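(* Assume Hypotheses (H1) and (H2) below, and let all objects be as defined in the context. Then there are constants $\eta, C, L_0>0$ such that, for every $L\geq L_0$ and every $\lambda\in\bar\Omega$, the boundary-value problems (BVP$^+_j$), $j=1,\ldots,r$, and (BVP$^-_j$), $j=1,\ldots,n-r$, defined below each have a unique solution, the matrices $\tilde C^\pm_L(\lambda)$ are uniquely determined, and \[ |\mathcal{E}(\lambda)-\tilde{\mathcal{E}}_L(\lambda)| + |\mathcal{C}_L(\lambda)-\tilde{\mathcal{C}}_L(\lambda)| \leq C\mathrm{e}^{-\eta L} \quad\text{and}\quad |E_L(\lambda)-\tilde E_L(\lambda)|\leq C\mathrm{e}^{-\eta L} \] for all $L\geq L_0$, uniformly in $\lambda\in\bar\Omega$. Furthermore, for each $L\geq L_0$, $\tilde E_L(\lambda)$ is analytic in $\lambda\in\Omega$.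
   Context: Consider the linear system $U_x=A(x,\lambda)U$, $U\in\mathbb{C}^n$, $x\in\mathbb{R}$. (H1): There are an open, bounded, simply connected set $\Omega\subset\mathbb{C}$, a continuous map $A:\mathbb{R}\times\bar\Omega\to\mathbb{C}^{n\times n}$ and continuous maps $A_\pm:\bar\Omega\to\mathbb{C}^{n\times n}$ such that (i) $A(x,\lambda)$ and $A_\pm(\lambda)$ are analytic in $\lambda\in\Omega$; (ii) $A(x,\lambda)\to A_\pm(\lambda)$ exponentially as $x\to\pm\infty$; (iii) $A_\pm(\lambda)$ are hyperbolic for $\lambda\in\bar\Omega$ and each has exactly $r$ eigenvalues, counted with multiplicity, with negative real part. (H2): The eigenvalues of $A_\pm(\lambda)$ are simple for all $\lambda\in\bar\Omega$. Notation: $\langle U,V\rangle:=U^*V$ with ${}^*$ the conjugate transpose; $\mathbb{I}$ is the identity. $P^s_\pm(\lambda)$ is the spectral projection of $A_\pm(\lambda)$ onto the eigenspace of eigenvalues with negative real part and $P^u_\pm(\lambda)=\mathbb{I}-P^s_\pm(\lambda)$. Let $\nu^+_1(\lambda),\ldots,\nu^+_n(\lambda)$ be the eigenvalues of $A_+(\lambda)$, ordered by increasing real part (so $\mathrm{Re}\,\nu^+_j<0$ iff $j\le r$), varying continuously in $\lambda\in\bar\Omega$, with continuously varying eigenvectors $V^+_j(\lambda)$ of $A_+(\lambda)$ for $\nu^+_j(\lambda)$ and $W^+_j(\lambda)$ of $A_+(\lambda)^*$ for $\overline{\nu^+_j(\lambda)}$. Likewise $\nu^-_1(\lambda),\ldots,\nu^-_n(\lambda)$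 are the eigenvalues of $A_-(\lambda)$ ordered by decreasing real part (so $\mathrm{Re}\,\nu^-_j>0$ iff $j\le n-r$), with continuously varying eigenvectors $V^-_j(\lambda)$ of $A_-(\lambda)$ and $W^-_j(\lambda)$ of $A_-(\lambda)^*$ (for $\overline{\nu^-_j(\lambda)}$). Exact Evans function: $E^s_+(y,\lambda)$ is the set of $U_0\in\mathbb{C}^n$ such that the solution with $U(y)=U_0$ tends to $0$ as $x\to\infty$; $E^u_-(y,\lambda)$ is defined analogously with $x\to-\infty$. Let $Z^+_1(\lambda),\ldots,Z^+_r(\lambda)$ be a basis of $\mathrm{Rg}\,P^s_+(\lambda)$ and $Z^-_1(\lambda),\ldots,Z^-_{n-r}(\lambda)$ a basis of $\mathrm{Rg}\,P^u_-(\lambda)$, analytic in $\lambda\in\Omega$ and continuous on $\bar\Omega$; $Z^\pm(\lambda)$ denote the matrices with these columns. For $L$ large, let $Z^+_j(L,\lambda)$ be the projection of $Z^+_j(\lambda)$ onto $E^s_+(L,\lambda)$ along $\mathrm{Rg}\,P^u_+(\lambda)$, and $Z^+_j(x,\lambda)$ the solution of $U_x=A(x,\lambda)U$ with this value at $x=L$; define $Z^-_j(-L,\lambda)$, $Z^-_j(x,\lambda)$ analogously using $E^u_-(-L,\lambda)$ and $\mathrm{Rg}\,P^s_-(\lambda)$. Set $E_L(\lambda):=\det(Z^-_1(0,\lambda),\ldots,Z^-_{n-r}(0,\lambda),Z^+_1(0,\lambda),\ldots,Z^+_r(0,\lambda))\,\mathrm{e}^{-\mathrm{tr}(A_-(\lambda)P^u_-(\lambda))L}\mathrm{e}^{\mathrm{tr}(A_+(\lambda)P^s_+(\lambda))L}$.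 Alternative formulation: for $j=1,\ldots,r$ let $V^+_j(x,\lambda)$, $x\ge0$, be a solution of $V_x=(A(x,\lambda)-\nu^+_j(\lambda)\mathbb{I})V$ depending continuously on $\lambda\in\bar\Omega$ with $V^+_j(x,\lambda)\to V^+_j(\lambda)$ as $x\to\infty$; for $j=1,\ldots,n-r$ let $V^-_j(x,\lambda)$, $x\le0$, be a solution of $V_x=(A(x,\lambda)-\nu^-_j(\lambda)\mathbb{I})V$ continuous in $\lambda$ with $V^-_j(x,\lambda)\to V^-_j(\lambda)$ as $x\to-\infty$. Let $V^\pm(x,\lambda)$ be the matrices with these columns. Define $\mathcal{E}(\lambda):=\det(V^-(0,\lambda),V^+(0,\lambda))$; let $C^+_L(\lambda)\in\mathbb{C}^{r\times r}$ and $C^-_L(\lambda)\in\mathbb{C}^{(n-r)\times(n-r)}$ be the unique matrices with $V^+(L,\lambda)C^+_L(\lambda)=(Z^+_1(L,\lambda),\ldots,Z^+_r(L,\lambda))$ and $V^-(-L,\lambda)C^-_L(\lambda)=(Z^-_1(-L,\lambda),\ldots,Z^-_{n-r}(-L,\lambda))$, and $\mathcal{C}_L(\lambda):=\det C^+_L(\lambda)\det C^-_L(\lambda)$. Algorithm: Fix $L$ and $\lambda\in\bar\Omega$. For $j=1,\ldots,r$ successively, (BVP$^+_j$) asks for $V=V^+_{L,j}(\cdot,\lambda)$ on $[0,L]$ with $V_x=(A(x,\lambda)-\nu^+_j(\lambda)\mathbb{I})V$ on $0<x<L$; $\langle V^+_{L,k}(0,\lambda),V(0)\rangle=0$ for $k=1,\ldots,j-1$;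 $\langle W^+_j(\lambda),V(L)\rangle=\langle W^+_j(\lambda),V^+_j(\lambda)\rangle$; $\langle W^+_k(\lambda),V(L)\rangle=0$ for $k=j+1,\ldots,n$. For $j=1,\ldots,n-r$ successively, (BVP$^-_j$) asks for $V=V^-_{L,j}(\cdot,\lambda)$ on $[-L,0]$ with $V_x=(A(x,\lambda)-\nu^-_j(\lambda)\mathbb{I})V$ on $-L<x<0$; $\langle V^-_{L,k}(0,\lambda),V(0)\rangle=0$ for $k<j$; $\langle W^-_j(\lambda),V(-L)\rangle=\langle W^-_j(\lambda),V^-_j(\lambda)\rangle$; $\langle W^-_k(\lambda),V(-L)\rangle=0$ for $k=j+1,\ldots,n$. Let $V^\pm_L(x,\lambda)$ be the matrices with columns $V^\pm_{L,j}(x,\lambda)$, and let $\tilde C^+_L(\lambda)$, $\tilde C^-_L(\lambda)$ solve $V^+_L(L,\lambda)\tilde C^+_L(\lambda)=Z^+(\lambda)$ and $V^-_L(-L,\lambda)\tilde C^-_L(\lambda)=Z^-(\lambda)$. Set $\tilde{\mathcal{E}}_L(\lambda):=\det(V^-_L(0,\lambda),V^+_L(0,\lambda))$, $\tilde{\mathcal{C}}_L(\lambda):=\det\tilde C^-_L(\lambda)\det\tilde C^+_L(\lambda)$ and $\tilde E_L(\lambda):=\tilde{\mathcal{E}}_L(\lambda)\tilde{\mathcal{C}}_L(\lambda)$. *)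

theory Defs
  imports "HOL-Analysis.Analysis"
    "Jordan_Normal_Form.Schur_Decomposition"
    "Jordan_Normal_Form.Char_Poly"
begin

text \<open>Vectors in C^n are represented by Jordan_Normal_Form vectors of dimension n,
  n x n matrices by JNF matrices in carrier_mat n n.  Indices are 0-based.\<close>

definition cinner :: "complex vec \<Rightarrow> complex vec \<Rightarrow> complex" where
  "cinner u v = conjugate u \<bullet> v"

definition mtrace :: "complex mat \<Rightarrow> complex" where
  "mtrace M = (\<Sum>i<dim_row M. M $$ (i,i))"

definition vec_lim :: "nat \<Rightarrow> ('b \<Rightarrow> complex vec) \<Rightarrow> complex vec \<Rightarrow> 'b filter \<Rightarrow> bool" where
  "vec_lim n U l F \<longleftrightarrow> (\<forall>i<n. ((\<lambda>x. U x $ i) \<longlongrightarrow> l $ i) F)"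

definition ode_sol :: "nat \<Rightarrow> (real \<Rightarrow> complex mat) \<Rightarrow> real set \<Rightarrow> (real \<Rightarrow> complex vec) \<Rightarrow> bool" where
  "ode_sol n M I U \<longleftrightarrow> (\<forall>x\<in>I. U x \<in> carrier_vec n \<and>
      (\<forall>i<n. ((\<lambda>t. U t $ i) has_vector_derivative (M x *\<^sub>v U x) $ i) (at x within I)))"

definition bvp_ode :: "nat \<Rightarrow> (real \<Rightarrow> complex mat) \<Rightarrow> real \<Rightarrow> real \<Rightarrow> (real \<Rightarrow> complex vec) \<Rightarrow> bool" where
  "bvp_ode n M a b V \<longleftrightarrow> (\<forall>x\<in>{a..b}. V x \<in> carrier_vec n) \<and>
      (\<forall>i<n. continuous_on {a..b} (\<lambda>x. V x $ i)) \<and> ode_sol n M {a<..<b} V"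

definition ode_flow :: "nat \<Rightarrow> (real \<Rightarrow> complex mat) \<Rightarrow> real \<Rightarrow> complex vec \<Rightarrow> real \<Rightarrow> complex vec" where
  "ode_flow n M s v t = (THE U. ode_sol n M UNIV U \<and> U s = v) t"

definition stable_set :: "nat \<Rightarrow> (real \<Rightarrow> complex mat) \<Rightarrow> real \<Rightarrow> complex vec set" where
  "stable_set n M y = {u \<in> carrier_vec n. \<exists>U. ode_sol n M UNIV U \<and> U y = u \<and> vec_lim n U (0\<^sub>v n) at_top}"

definition unstable_set :: "nat \<Rightarrow> (real \<Rightarrow> complex mat) \<Rightarrow> real \<Rightarrow> complex vec set" where
  "unstable_set n M y = {u \<in> carrier_vec n. \<exists>U. ode_sol n M UNIV U \<and> U y = u \<and> vec_lim n U (0\<^sub>v n) at_bot}"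

definition mrange :: "nat \<Rightarrow> complex mat \<Rightarrow> complex vec set" where
  "mrange n P = {P *\<^sub>v v | v. v \<in> carrier_vec n}"

definition proj_along :: "complex vec set \<Rightarrow> complex vec set \<Rightarrow> complex vec \<Rightarrow> complex vec" where
  "proj_along S T v = (THE w. w \<in> S \<and> v - w \<in> T)"

text \<open>Spectral projection onto the (generalised) eigenspace of the eigenvalues with negative
  real part: the idempotent commuting with A such that A restricted to its range has only
  eigenvalues with negative real part and A restricted to its kernel has only eigenvalues
  with nonnegative real part.\<close>
definition is_stable_spec_proj :: "complex mat \<Rightarrow> complex mat \<Rightarrow> bool" where
  "is_stable_spec_proj A P \<longleftrightarrow> P \<in> carrier_mat (dim_row A) (dim_row A) \<and> P * P = P \<and> A * P = P * A \<and>
     (\<forall>v k. eigenvector A v k \<and> P *\<^sub>v v = v \<longrightarrow> Re k < 0) \<and>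
     (\<forall>v k. eigenvector A v k \<and> P *\<^sub>v v = 0\<^sub>v (dim_row A) \<longrightarrow> Re k \<ge> 0)"

definition Ps :: "complex mat \<Rightarrow> complex mat" where
  "Ps A = (THE P. is_stable_spec_proj A P)"

definition Pu :: "complex mat \<Rightarrow> complex mat" where
  "Pu A = 1\<^sub>m (dim_row A) - Ps A"

definition n_stable_eigs :: "complex mat \<Rightarrow> nat" where
  "n_stable_eigs A = (\<Sum>k\<in>{k. eigenvalue A k \<and> Re k < 0}. Polynomial.order k (char_poly A))"

definition hyperbolic :: "complex mat \<Rightarrow> bool" where
  "hyperbolic A \<longleftrightarrow> (\<forall>k. eigenvalue A k \<longrightarrow> Re k \<noteq> 0)"

definition simple_eigs :: "complex mat \<Rightarrow> bool" where
  "simple_eigs A \<longleftrightarrow> (\<forall>k. eigenvalue A k \<longrightarrow> Polynomial.order k (char_poly A) = 1)"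

definition cols_basis :: "nat \<Rightarrow> nat \<Rightarrow> complex mat \<Rightarrow> complex vec set \<Rightarrow> bool" where
  "cols_basis n k Z S \<longleftrightarrow> Z \<in> carrier_mat n k \<and>
     (\<forall>c\<in>carrier_vec k. Z *\<^sub>v c \<in> S) \<and> (\<forall>v\<in>S. \<exists>c\<in>carrier_vec k. v = Z *\<^sub>v c) \<and>
     (\<forall>c\<in>carrier_vec k. Z *\<^sub>v c = 0\<^sub>v n \<longrightarrow> c = 0\<^sub>v k)"

definition ZpL :: "nat \<Rightarrow> (real \<Rightarrow> complex mat) \<Rightarrow> complex mat \<Rightarrow> complex mat \<Rightarrow> real \<Rightarrow> nat \<Rightarrow> complex vec" where
  "ZpL n A Apl Z L j = proj_along (stable_set n A L) (mrange n (Pu Apl)) (col Z j)"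

definition ZmL :: "nat \<Rightarrow> (real \<Rightarrow> complex mat) \<Rightarrow> complex mat \<Rightarrow> complex mat \<Rightarrow> real \<Rightarrow> nat \<Rightarrow> complex vec" where
  "ZmL n A Aml Z L j = proj_along (unstable_set n A (-L)) (mrange n (Ps Aml)) (col Z j)"

definition evans_L :: "nat \<Rightarrow> nat \<Rightarrow> (real \<Rightarrow> complex mat) \<Rightarrow> complex mat \<Rightarrow> complex mat \<Rightarrow>
    complex mat \<Rightarrow> complex mat \<Rightarrow> real \<Rightarrow> complex" where
  "evans_L n r A Apl Aml Zpl Zml L =
     Determinant.det (mat_of_cols n
        (map (\<lambda>j. ode_flow n A (-L) (ZmL n A Aml Zml L j) 0) [0..<n-r] @
         map (\<lambda>j. ode_flow n A L (ZpL n A Apl Zpl L j) 0) [0..<r]))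
     * exp (- complex_of_real L * mtrace (Aml * Pu Aml))
     * exp (complex_of_real L * mtrace (Apl * Ps Apl))"

definition det_cols :: "nat \<Rightarrow> nat \<Rightarrow> (nat \<Rightarrow> complex vec) \<Rightarrow> (nat \<Rightarrow> complex vec) \<Rightarrow> complex" where
  "det_cols n r Vm Vp = Determinant.det (mat_of_cols n (map Vm [0..<n-r] @ map Vp [0..<r]))"

definition coef_mat :: "nat \<Rightarrow> nat \<Rightarrow> (nat \<Rightarrow> complex vec) \<Rightarrow> complex mat \<Rightarrow> complex mat" where
  "coef_mat n k V Z = (THE C. C \<in> carrier_mat k k \<and> mat_of_cols n (map V [0..<k]) * C = Z)"

definition calC_L :: "nat \<Rightarrow> nat \<Rightarrow> (real \<Rightarrow> complex mat) \<Rightarrow> complex mat \<Rightarrow> complex mat \<Rightarrow>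
    complex mat \<Rightarrow> complex mat \<Rightarrow> (nat \<Rightarrow> real \<Rightarrow> complex vec) \<Rightarrow> (nat \<Rightarrow> real \<Rightarrow> complex vec) \<Rightarrow> real \<Rightarrow> complex" where
  "calC_L n r A Apl Aml Zpl Zml Vp Vm L =
     Determinant.det (coef_mat n r (\<lambda>j. Vp j L) (mat_of_cols n (map (ZpL n A Apl Zpl L) [0..<r])))
   * Determinant.det (coef_mat n (n-r) (\<lambda>j. Vm j (-L)) (mat_of_cols n (map (ZmL n A Aml Zml L) [0..<n-r])))"

text \<open>(BVP^+_j): M = A(.,\<lambda>), nu = \<nu>^+_.(\<lambda>), W = W^+_.(\<lambda>), Vinf = V^+_.(\<lambda>),
  prev k = V^+_{L,k}(.,\<lambda>) for k < j.\<close>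
definition bvp_plus :: "nat \<Rightarrow> (real \<Rightarrow> complex mat) \<Rightarrow> (nat \<Rightarrow> complex) \<Rightarrow> (nat \<Rightarrow> complex vec) \<Rightarrow>
    (nat \<Rightarrow> complex vec) \<Rightarrow> real \<Rightarrow> (nat \<Rightarrow> real \<Rightarrow> complex vec) \<Rightarrow> nat \<Rightarrow> (real \<Rightarrow> complex vec) \<Rightarrow> bool" where
  "bvp_plus n M nu W Vinf L prev j V \<longleftrightarrow>
     bvp_ode n (\<lambda>x. M x - nu j \<cdot>\<^sub>m 1\<^sub>m n) 0 L V \<and>
     (\<forall>k<j. cinner (prev k 0) (V 0) = 0) \<and>
     cinner (W j) (V L) = cinner (W j) (Vinf j) \<and>
     (\<forall>k. j < k \<and> k < n \<longrightarrow> cinner (W k) (V L) = 0)"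

definition bvp_minus :: "nat \<Rightarrow> (real \<Rightarrow> complex mat) \<Rightarrow> (nat \<Rightarrow> complex) \<Rightarrow> (nat \<Rightarrow> complex vec) \<Rightarrow>
    (nat \<Rightarrow> complex vec) \<Rightarrow> real \<Rightarrow> (nat \<Rightarrow> real \<Rightarrow> complex vec) \<Rightarrow> nat \<Rightarrow> (real \<Rightarrow> complex vec) \<Rightarrow> bool" where
  "bvp_minus n M nu W Vinf L prev j V \<longleftrightarrow>
     bvp_ode n (\<lambda>x. M x - nu j \<cdot>\<^sub>m 1\<^sub>m n) (-L) 0 V \<and>
     (\<forall>k<j. cinner (prev k 0) (V 0) = 0) \<and>
     cinner (W j) (V (-L)) = cinner (W j) (Vinf j) \<and>
     (\<forall>k. j < k \<and> k < n \<longrightarrow> cinner (W k) (V (-L)) = 0)"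

end

theory Submission
  imports Defs "HOL-Complex_Analysis.Complex_Analysis"
begin

text \<open>
  Eigenvalues on the same side of the imaginary axis may have equal or arbitrarily close real parts,
  so single solutions of the boundary-value problems cannot be compared with the exact ones
  uniformly in \<open>\<lambda>\<close>. Their minors can: if the solutions for the stable eigenvalues, rescaled by their exponents, are
  completed by constant eigenvectors for the unstable eigenvalues, then no minor grows while \<open>x\<close>
  moves from \<open>L\<close> to \<open>0\<close>. Perturbations of order \<open>exp (- \<alpha> L)\<close> at \<open>L\<close> therefore stay of
  this order at \<open>0\<close>.

  The solution of the \<open>j\<close>-th boundary-value problem is the solution \<open>Y\<^sub>j\<close> with value \<open>V\<^sub>j\<close> at \<open>L\<close> plus a
  combination of the \<open>Y\<^sub>k\<close> with \<open>k < j\<close>, rescaled to the \<open>j\<close>-th exponent, and the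
  orthogonality conditions at \<open>0\<close> are those of Gram and Schmidt. The change of basis is unipotent, hence
  the determinants of the algorithm are those of the solutions \<open>Y\<^sub>j\<close>.

  The exact quantities satisfy \<open>E\<^sub>L = \<E> \<C>\<^sub>L\<close>, so the estimate for \<open>E\<^sub>L\<close> follows from those
  for \<open>\<E>\<close> and \<open>\<C>\<^sub>L\<close>. The numerical one is \<open>exp (L (\<Sum> \<nu>\<^sup>+ - \<Sum> \<nu>\<^sup>-))\<close> times the determinant at \<open>0\<close> of the
  solutions with values \<open>Z\<^sup>\<plusminus>\<close> at \<open>\<plusminus>L\<close>, which is analytic because simple eigenvalues and the flow
  are. The half-line \<open>x \<le> 0\<close> is reduced to \<open>x \<ge> 0\<close> by reflection.
\<close>

section \<open>Differential inequalities\<close>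

text \<open>The solutions \<open>Vpx\<close> and \<open>Vmx\<close> converge to the eigenvectors
  only pointwise in the parameter: multiples of faster solutions may be mixed in, and no gap between
  exponents on the same side controls the speed. Their limits are therefore used only to let an end
  point run to infinity in estimates whose constants do not see that speed. For minors a rate comes
  out: their exponents never amplify errors backwards, and the perturbation, of size
  \<open>exp (- \<alpha> * x)\<close>, is integrable. Hence \<eta> = \<alpha>. The gap \<delta>
  between stable and unstable real parts, obtained from compactness, is needed as a quantity only to
  identify the stable subspace at \<open>L\<close>.

  The two blocks of columns of the determinant at 0 are exchanged one after the other. Once the
  right block is exchanged, its columns are known only through bounded minors. The left block must
  therefore be exchanged by an estimate that sees the right block only through minors: with a full
  set of rescaled columns the determinant obeys Liouville's scalar equation with an integrable
  coefficient, and this equation carries the error from \<open>- L\<close> to 0.\<close>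

definition deriv_on :: "real \<Rightarrow> real \<Rightarrow> (real \<Rightarrow> complex) \<Rightarrow> (real \<Rightarrow> complex) \<Rightarrow> bool" where
  "deriv_on a b f f' \<longleftrightarrow> continuous_on {a..b} f \<and>
     (\<forall>x\<in>{a<..<b}. (f has_vector_derivative f' x) (at x))"

lemma deriv_on_cong:
  assumes "deriv_on a b f f'" "\<And>x. a < x \<Longrightarrow> x < b \<Longrightarrow> f' x = g' x"
  shows "deriv_on a b f g'"
  using assms by (simp add: deriv_on_def)

lemma deriv_on_const: "deriv_on a b (\<lambda>x. c) (\<lambda>x. 0)"
  by (simp add: deriv_on_def)

lemma deriv_on_diff:
  "deriv_on a b f f' \<Longrightarrow> deriv_on a b g g' \<Longrightarrow> deriv_on a b (\<lambda>x. f x - g x) (\<lambda>x. f' x - g' x)"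
  unfolding deriv_on_def by (auto intro: continuous_intros has_vector_derivative_diff)

lemma deriv_on_mult:
  "deriv_on a b f f' \<Longrightarrow> deriv_on a b g g' \<Longrightarrow>
   deriv_on a b (\<lambda>x. f x * g x) (\<lambda>x. f x * g' x + f' x * g x)"
  unfolding deriv_on_def by (auto intro!: continuous_intros has_vector_derivative_mult)

lemma deriv_on_sum:
  assumes "\<And>i. i \<in> I \<Longrightarrow> deriv_on a b (f i) (f' i)"
  shows "deriv_on a b (\<lambda>x. \<Sum>i\<in>I. f i x) (\<lambda>x. \<Sum>i\<in>I. f' i x)"
  using assms unfolding deriv_on_def
  by (auto intro!: continuous_intros has_vector_derivative_sum)

lemma has_vector_derivative_cexp_linear:
  "((\<lambda>x. exp (c * complex_of_real (x - s))) has_vector_derivative c * exp (c * of_real (x - s))) (at x within S)"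
proof -
  have "((\<lambda>z. exp (c * (z - of_real s))) has_field_derivative c * exp (c * (of_real x - of_real s)))
          (at (of_real x) within of_real ` S)"
    by (auto intro!: derivative_eq_intros)
  then have "((\<lambda>z. exp (c * (z - of_real s))) \<circ> of_real has_vector_derivative
      (1 * (c * exp (c * (of_real x - of_real s))))) (at x within S)"
    by (intro field_vector_diff_chain_within) (auto intro!: derivative_eq_intros)
  then show ?thesis by (simp add: o_def)
qed

lemma deriv_on_exp:
  "deriv_on a b (\<lambda>x. exp (c * complex_of_real (x - s))) (\<lambda>x. c * exp (c * of_real (x - s)))"
  unfolding deriv_on_def using has_vector_derivative_cexp_linear
  by (auto intro!: continuous_intros)

lemma deriv_on_subset:
  assumes "deriv_on a b f f'" "a \<le> c" "d \<le> b"
  shows "deriv_on c d f f'"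
  using assms unfolding deriv_on_def by (auto intro: continuous_on_subset)

lemma deriv_on_reflect:
  assumes "deriv_on a b f f'"
  shows "deriv_on (- b) (- a) (\<lambda>x. f (- x)) (\<lambda>x. - f' (- x))"
  unfolding deriv_on_def
proof (intro conjI ballI)
  show "continuous_on {- b..- a} (\<lambda>x. f (- x))"
    by (rule continuous_on_compose2[where f = uminus and g = f and t = "{a..b}"])
       (use assms in \<open>auto simp: deriv_on_def intro!: continuous_intros\<close>)
  fix x assume "x \<in> {- b<..<- a}"
  then have "(f has_vector_derivative f' (- x)) (at (- x))"
    using assms by (auto simp: deriv_on_def)
  moreover have "((\<lambda>x::real. - x) has_vector_derivative - 1) (at x)"
    by (auto intro!: derivative_eq_intros)
  ultimately have "(f \<circ> (\<lambda>x. - x) has_vector_derivative (- 1) *\<^sub>R f' (- x)) (at x)"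
    by (intro vector_diff_chain_at) auto
  then show "((\<lambda>x. f (- x)) has_vector_derivative - f' (- x)) (at x)"
    by (simp add: o_def)
qed

lemma deriv_on_within:
  assumes "\<And>x. x \<in> I \<Longrightarrow> (f has_vector_derivative f' x) (at x within I)" "{a..b} \<subseteq> I"
  shows "deriv_on a b f f'"
  unfolding deriv_on_def
proof (intro conjI ballI)
  show "continuous_on {a..b} f"
    using assms by (meson continuous_on_subset has_vector_derivative_continuous continuous_on_eq_continuous_within)
  fix x assume x: "x \<in> {a<..<b}"
  have "{a<..<b} \<subseteq> I" using assms(2) by auto
  then have "x \<in> interior I" using x by (meson interior_maximal open_greaterThanLessThan subset_iff)
  then show "(f has_vector_derivative f' x) (at x)"
    using assms(1)[of x] interior_subset by (metis at_within_interior subset_iff)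
qed

lemma has_real_derivative_cmod_power2:
  assumes "(w has_vector_derivative w') (at x)"
  shows "((\<lambda>t. (cmod (w t))\<^sup>2) has_real_derivative 2 * Re (cnj (w x) * w')) (at x)"
proof -
  have 1: "((\<lambda>t. Re (w t)) has_real_derivative Re w') (at x)"
    using bounded_linear.has_vector_derivative[OF bounded_linear_Re assms]
    by (simp add: has_real_derivative_iff_has_vector_derivative)
  have 2: "((\<lambda>t. Im (w t)) has_real_derivative Im w') (at x)"
    using bounded_linear.has_vector_derivative[OF bounded_linear_Im assms]
    by (simp add: has_real_derivative_iff_has_vector_derivative)
  show ?thesis unfolding cmod_power2
    by (rule derivative_eq_intros 1 2 | simp)+
qed

text \<open>Integrating factor: under the lower bound on \<open>E'\<close> the product of
  \<open>E\<close> with \<open>exp (c * \<Lambda>)\<close> has a nonnegative derivative.\<close>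

lemma weighted_mono:
  fixes E E' \<Lambda> \<kappa> :: "real \<Rightarrow> real"
  assumes ab: "a \<le> b" and "continuous_on {a..b} E" "continuous_on {a..b} \<Lambda>"
    and E: "\<And>x. a < x \<Longrightarrow> x < b \<Longrightarrow> (E has_real_derivative E' x) (at x)"
    and L: "\<And>x. a < x \<Longrightarrow> x < b \<Longrightarrow> (\<Lambda> has_real_derivative \<kappa> x) (at x)"
    and le: "\<And>x. a < x \<Longrightarrow> x < b \<Longrightarrow> E' x \<ge> - (c * \<kappa> x * E x)"
  shows "E a * exp (c * \<Lambda> a) \<le> E b * exp (c * \<Lambda> b)"
proof (cases "a = b")
  case False
  then have "a < b" using ab by simp
  then show ?thesis
  proof (rule DERIV_nonneg_imp_increasing_open[where f = "\<lambda>x. E x * exp (c * \<Lambda> x)", OF less_imp_le])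
    fix x assume x: "a < x" "x < b"
    have "((\<lambda>x. E x * exp (c * \<Lambda> x)) has_real_derivative
        (E' x + c * \<kappa> x * E x) * exp (c * \<Lambda> x)) (at x)"
      by (rule derivative_eq_intros E[OF x] L[OF x] | simp add: algebra_simps)+
    moreover have "(E' x + c * \<kappa> x * E x) * exp (c * \<Lambda> x) \<ge> 0"
      using le[OF x] by simp
    ultimately show "\<exists>y. ((\<lambda>x. E x * exp (c * \<Lambda> x)) has_real_derivative y) (at x) \<and> 0 \<le> y" by blast
  qed (intro continuous_intros assms)
qed simp

text \<open>In the derivative of the sum of squares the diagonal part is nonnegative, and
  Cauchy-Schwarz bounds the coupling from below by \<open>- 2 * card G * \<kappa>\<close> times the
  energy. The alternative \<open>w g x = 0\<close> admits indices whose exponent has the wrong sign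
  but whose component vanishes, such as minors with a repeated column.\<close>

lemma backward_energy:
  fixes w h :: "'g \<Rightarrow> real \<Rightarrow> complex" and \<Lambda> \<kappa> :: "real \<Rightarrow> real"
  assumes fin: "finite G" and ab: "a \<le> b"
    and der: "\<And>g. g \<in> G \<Longrightarrow> deriv_on a b (w g) (\<lambda>x. \<mu> g * w g x + h g x)"
    and pos: "\<And>g x. g \<in> G \<Longrightarrow> a < x \<Longrightarrow> x < b \<Longrightarrow> Re (\<mu> g) \<ge> 0 \<or> w g x = 0"
    and h: "\<And>g x. g \<in> G \<Longrightarrow> a < x \<Longrightarrow> x < b \<Longrightarrow> cmod (h g x) \<le> \<kappa> x * (\<Sum>g\<in>G. cmod (w g x))"
    and L: "\<And>x. a < x \<Longrightarrow> x < b \<Longrightarrow> (\<Lambda> has_real_derivative \<kappa> x) (at x)" "continuous_on {a..b} \<Lambda>"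
    and \<kappa>: "\<And>x. a < x \<Longrightarrow> x < b \<Longrightarrow> \<kappa> x \<ge> 0"
  shows "(\<Sum>g\<in>G. (cmod (w g a))\<^sup>2) * exp (2 * card G * \<Lambda> a) \<le> (\<Sum>g\<in>G. (cmod (w g b))\<^sup>2) * exp (2 * card G * \<Lambda> b)"
proof (rule weighted_mono[OF ab _ L(2) _ L(1),
      where E = "\<lambda>x. \<Sum>g\<in>G. (cmod (w g x))\<^sup>2" and c = "2 * card G"
      and E' = "\<lambda>x. \<Sum>g\<in>G. 2 * Re (cnj (w g x) * (\<mu> g * w g x + h g x))"])
  show "continuous_on {a..b} (\<lambda>x. \<Sum>g\<in>G. (cmod (w g x))\<^sup>2)"
    using der by (auto intro!: continuous_intros simp: deriv_on_def)
  fix x assume x: "a < x" "x < b"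
  show "((\<lambda>x. \<Sum>g\<in>G. (cmod (w g x))\<^sup>2) has_real_derivative
      (\<Sum>g\<in>G. 2 * Re (cnj (w g x) * (\<mu> g * w g x + h g x)))) (at x)"
    using der x by (intro DERIV_sum has_real_derivative_cmod_power2) (auto simp: deriv_on_def)
  let ?S = "\<Sum>g\<in>G. cmod (w g x)"
  have "- (2 * \<kappa> x * ?S * cmod (w g x)) \<le> 2 * Re (cnj (w g x) * (\<mu> g * w g x + h g x))"
    if g: "g \<in> G" for g
  proof -
    have "Re (cnj (w g x) * (\<mu> g * w g x)) = (cmod (w g x))\<^sup>2 * Re (\<mu> g)"
      unfolding cmod_power2 by (simp add: power2_eq_square algebra_simps)
    moreover have "(cmod (w g x))\<^sup>2 * Re (\<mu> g) \<ge> 0" using pos[OF g x] by auto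
    moreover have "cmod (cnj (w g x) * h g x) \<le> cmod (w g x) * (\<kappa> x * ?S)"
      unfolding norm_mult using h[OF g x] by (simp add: mult_left_mono)
    moreover have "- cmod (cnj (w g x) * h g x) \<le> Re (cnj (w g x) * h g x)"
      using abs_Re_le_cmod[of "cnj (w g x) * h g x"] by linarith
    moreover have "Re (cnj (w g x) * (\<mu> g * w g x + h g x))
        = Re (cnj (w g x) * (\<mu> g * w g x)) + Re (cnj (w g x) * h g x)"
      by (simp only: distrib_left plus_complex.sel)
    moreover have "cmod (w g x) * (\<kappa> x * ?S) = \<kappa> x * ?S * cmod (w g x)" by (simp only: mult_ac)
    ultimately show ?thesis by linarith
  qed
  then have "(\<Sum>g\<in>G. - (2 * \<kappa> x * ?S * cmod (w g x))) \<le> (\<Sum>g\<in>G. 2 * Re (cnj (w g x) * (\<mu> g * w g x + h g x)))"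
    by (rule sum_mono)
  moreover have "(\<Sum>g\<in>G. - (2 * \<kappa> x * ?S * cmod (w g x))) = - (2 * \<kappa> x * ?S\<^sup>2)"
    by (simp add: sum_negf sum_distrib_left[symmetric] power2_eq_square)
  moreover have "2 * \<kappa> x * ?S\<^sup>2 \<le> 2 * \<kappa> x * ((\<Sum>g\<in>G. (cmod (w g x))\<^sup>2) * card G)"
    using \<kappa>[OF x] sum_squared_le_sum_of_squares[of "\<lambda>g. cmod (w g x)" G] by (intro mult_left_mono) auto
  ultimately show "(\<Sum>g\<in>G. 2 * Re (cnj (w g x) * (\<mu> g * w g x + h g x)))
      \<ge> - (2 * card G * \<kappa> x * (\<Sum>g\<in>G. (cmod (w g x))\<^sup>2))"
    by (simp add: algebra_simps)
qed

text \<open>Square root of \<open>backward_energy\<close>; passing between the Euclidean norm and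
  the sum of moduli costs at most the factor \<open>card G\<close>.\<close>

lemma backward_bound:
  fixes w h :: "'g \<Rightarrow> real \<Rightarrow> complex" and \<Lambda> \<kappa> :: "real \<Rightarrow> real" and B :: real
  assumes fin: "finite G" and ab: "a \<le> b"
    and der: "\<And>g. g \<in> G \<Longrightarrow> deriv_on a b (w g) (\<lambda>x. \<mu> g * w g x + h g x)"
    and pos: "\<And>g x. g \<in> G \<Longrightarrow> a < x \<Longrightarrow> x < b \<Longrightarrow> Re (\<mu> g) \<ge> 0 \<or> w g x = 0"
    and h: "\<And>g x. g \<in> G \<Longrightarrow> a < x \<Longrightarrow> x < b \<Longrightarrow> cmod (h g x) \<le> \<kappa> x * (\<Sum>g\<in>G. cmod (w g x))"
    and L: "\<And>x. a < x \<Longrightarrow> x < b \<Longrightarrow> (\<Lambda> has_real_derivative \<kappa> x) (at x)" "continuous_on {a..b} \<Lambda>"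
    and \<kappa>: "\<And>x. a < x \<Longrightarrow> x < b \<Longrightarrow> \<kappa> x \<ge> 0"
    and B: "\<Lambda> b - \<Lambda> a \<le> B"
  shows "(\<Sum>g\<in>G. cmod (w g a)) \<le> card G * exp (card G * B) * (\<Sum>g\<in>G. cmod (w g b))"
proof (cases "G = {}")
  case False
  then have G1: "real (card G) \<ge> 1" using fin by (simp add: Suc_leI card_gt_0_iff)
  let ?Q = "\<lambda>x. \<Sum>g\<in>G. (cmod (w g x))\<^sup>2" and ?S = "\<lambda>x. \<Sum>g\<in>G. cmod (w g x)"
  have S0: "?S x \<ge> 0" for x by (simp add: sum_nonneg)
  have "?Q a * exp (2 * card G * \<Lambda> a) \<le> ?Q b * exp (2 * card G * \<Lambda> b)"
    by (rule backward_energy[OF fin ab der pos h L \<kappa>])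
  then have "?Q a \<le> ?Q b * exp (2 * card G * (\<Lambda> b - \<Lambda> a))"
    by (simp add: right_diff_distrib exp_diff pos_le_divide_eq)
  also have "\<dots> \<le> ?Q b * exp (2 * card G * B)"
    using mult_left_mono[OF B, of "real (card G)"] by (intro mult_left_mono) (auto simp: sum_nonneg)
  also have "?Q b \<le> (?S b)\<^sup>2"
    using fin by (induction G rule: finite_induct) (auto simp: power2_sum sum_nonneg add_increasing2)
  finally have Qa: "?Q a \<le> (?S b)\<^sup>2 * exp (2 * card G * B)" by (simp add: mult_right_mono)
  have "(?S a)\<^sup>2 \<le> ?Q a * card G" by (rule sum_squared_le_sum_of_squares)
  also have "\<dots> \<le> (?S b)\<^sup>2 * exp (2 * card G * B) * card G"
    using Qa by (simp add: mult_right_mono)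
  \<comment> \<open>One more factor \<open>card G\<close> makes the bound a perfect square.\<close>
  also have "\<dots> \<le> (?S b)\<^sup>2 * exp (2 * card G * B) * (card G)\<^sup>2"
    using G1 by (intro mult_left_mono) (auto simp: power2_eq_square)
  also have "\<dots> = (card G * exp (card G * B) * ?S b)\<^sup>2"
    by (simp add: power_mult_distrib flip: exp_double)
  finally show ?thesis using S0 by (auto dest!: power2_le_imp_le)
qed simp

text \<open>The forcing \<open>h\<close> is not controlled by \<open>d\<close> itself, so a sum
  replaces the exponential factor: multiplied by \<open>exp (- \<mu> * (x - a))\<close>, which has
  modulus at most one, \<open>d\<close> changes by no more than the integral of \<kappa>.\<close>

lemma backward_difference:
  fixes d h :: "real \<Rightarrow> complex" and \<Lambda> \<kappa> :: "real \<Rightarrow> real"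
  assumes ab: "a \<le> b"
    and der: "deriv_on a b d (\<lambda>x. \<mu> * d x + h x)"
    and pos: "Re \<mu> \<ge> 0"
    and h: "\<And>x. a < x \<Longrightarrow> x < b \<Longrightarrow> cmod (h x) \<le> \<kappa> x"
    and L: "\<And>x. a < x \<Longrightarrow> x < b \<Longrightarrow> (\<Lambda> has_real_derivative \<kappa> x) (at x)" "continuous_on {a..b} \<Lambda>"
  shows "cmod (d a) \<le> cmod (d b) + (\<Lambda> b - \<Lambda> a)"
proof (cases "a = b")
  case False
  then have ab: "a < b" using ab by simp
  define f where "f = (\<lambda>x. exp (- \<mu> * of_real (x - a)) * d x)"
  have df: "deriv_on a b f (\<lambda>x. exp (- \<mu> * of_real (x - a)) * h x)"
    unfolding f_def
    by (rule deriv_on_cong[OF deriv_on_mult[OF deriv_on_exp der]]) (simp add: algebra_simps)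
  have e1: "cmod (exp (- \<mu> * of_real (x - a))) \<le> 1" if "x \<ge> a" for x
    using that pos by simp
  have "norm (f b - f a) \<le> \<Lambda> b - \<Lambda> a"
  proof (rule differentiable_bound_general[OF ab])
    show "continuous_on {a..b} f" using df by (simp add: deriv_on_def)
    fix x assume x: "a < x" "x < b"
    show "(f has_vector_derivative exp (- \<mu> * of_real (x - a)) * h x) (at x)"
      using df x by (simp add: deriv_on_def)
    show "(\<Lambda> has_vector_derivative \<kappa> x) (at x)"
      using L(1)[OF x] by (simp add: has_real_derivative_iff_has_vector_derivative)
    show "norm (exp (- \<mu> * of_real (x - a)) * h x) \<le> \<kappa> x"
      unfolding norm_mult using mult_mono[OF e1[of x] h[OF x]] x by simp
  qed (rule L(2))
  moreover have "f a = d a" by (simp add: f_def)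
  moreover have "cmod (f b) \<le> cmod (d b)"
    unfolding f_def norm_mult using mult_right_mono[OF e1[of b], of "cmod (d b)"] ab by simp
  ultimately show ?thesis using norm_triangle_sub[of "d a" "f b"] by (simp add: norm_minus_commute)
qed simp

section \<open>Linear systems of differential equations\<close>

definition mv :: "nat \<Rightarrow> (nat \<Rightarrow> nat \<Rightarrow> complex) \<Rightarrow> (nat \<Rightarrow> complex) \<Rightarrow> nat \<Rightarrow> complex" where
  "mv n M u i = (\<Sum>k<n. M i k * u k)"

lemma mv_diff: "mv n M (\<lambda>i. u i - v i) i = mv n M u i - mv n M v i"
  by (simp add: mv_def algebra_simps sum_subtractf)

lemma mv_scale: "mv n M (\<lambda>i. c * u i) i = c * mv n M u i"
  by (simp add: mv_def algebra_simps sum_distrib_left)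

lemma mv_sum: "mv n M (\<lambda>i. \<Sum>j\<in>S. u j i) i = (\<Sum>j\<in>S. mv n M (u j) i)"
  unfolding mv_def by (subst sum.swap) (simp add: sum_distrib_left)

lemma mv_cong: "(\<And>k. k < n \<Longrightarrow> u k = v k) \<Longrightarrow> mv n M u i = mv n M v i"
  by (simp add: mv_def)

lemma mv_uminus: "mv n (\<lambda>i k. - M i k) u i = - mv n M u i"
  by (simp add: mv_def sum_negf)

text \<open>The equation \<open>u' = (A - c) u\<close> is only required in the interior of \<open>[a, b]\<close>, with continuity
  up to the boundary.\<close>
definition sol :: "nat \<Rightarrow> (real \<Rightarrow> nat \<Rightarrow> nat \<Rightarrow> complex) \<Rightarrow> complex \<Rightarrow> real \<Rightarrow> real \<Rightarrow>
    (real \<Rightarrow> nat \<Rightarrow> complex) \<Rightarrow> bool" where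
  "sol n A c a b u \<longleftrightarrow> (\<forall>i<n. deriv_on a b (\<lambda>x. u x i) (\<lambda>x. mv n (A x) (u x) i - c * u x i))"

lemma sol_subset: "sol n A c a b u \<Longrightarrow> a \<le> a' \<Longrightarrow> b' \<le> b \<Longrightarrow> sol n A c a' b' u"
  unfolding sol_def using deriv_on_subset by blast

lemma sol_sum:
  assumes "\<And>j. j \<in> S \<Longrightarrow> sol n A c a b (u j)"
  shows "sol n A c a b (\<lambda>x i. \<Sum>j\<in>S. k j * u j x i)"
  unfolding sol_def
proof (intro allI impI)
  fix i assume i: "i < n"
  have 1: "deriv_on a b (\<lambda>x. \<Sum>j\<in>S. k j * u j x i)
      (\<lambda>x. \<Sum>j\<in>S. k j * (mv n (A x) (u j x) i - c * u j x i) + 0 * u j x i)"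
    using assms i by (intro deriv_on_sum deriv_on_mult deriv_on_const) (auto simp: sol_def)
  show "deriv_on a b (\<lambda>x. \<Sum>j\<in>S. k j * u j x i)
      (\<lambda>x. mv n (A x) (\<lambda>i. \<Sum>j\<in>S. k j * u j x i) i - c * (\<Sum>j\<in>S. k j * u j x i))"
    by (rule deriv_on_cong[OF 1])
       (simp add: mv_sum mv_scale right_diff_distrib sum_subtractf sum_distrib_left mult.left_commute)
qed

lemma sol_diff:
  assumes "sol n A c a b u" "sol n A c a b v"
  shows "sol n A c a b (\<lambda>x i. u x i - v x i)"
  unfolding sol_def
proof (intro allI impI)
  fix i assume i: "i < n"
  have 1: "deriv_on a b (\<lambda>x. u x i - v x i)
      (\<lambda>x. (mv n (A x) (u x) i - c * u x i) - (mv n (A x) (v x) i - c * v x i))"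
    using assms i by (intro deriv_on_diff) (auto simp: sol_def)
  show "deriv_on a b (\<lambda>x. u x i - v x i)
      (\<lambda>x. mv n (A x) (\<lambda>i. u x i - v x i) i - c * (u x i - v x i))"
    by (rule deriv_on_cong[OF 1]) (simp add: mv_diff algebra_simps)
qed

text \<open>The exponential factor is normalised to one at \<open>s\<close>, so data prescribed
  there survive the change of exponent.\<close>

lemma sol_shift:
  assumes "sol n A c a b u"
  shows "sol n A d a b (\<lambda>x i. exp ((c - d) * of_real (x - s)) * u x i)"
  unfolding sol_def
proof (intro allI impI)
  fix i assume i: "i < n"
  have 1: "deriv_on a b (\<lambda>x. exp ((c - d) * of_real (x - s)) * u x i)
      (\<lambda>x. exp ((c - d) * of_real (x - s)) * (mv n (A x) (u x) i - c * u x i)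
         + ((c - d) * exp ((c - d) * of_real (x - s))) * u x i)"
    using assms i by (intro deriv_on_mult deriv_on_exp) (auto simp: sol_def)
  show "deriv_on a b (\<lambda>x. exp ((c - d) * of_real (x - s)) * u x i)
      (\<lambda>x. mv n (A x) (\<lambda>i. exp ((c - d) * of_real (x - s)) * u x i) i
         - d * (exp ((c - d) * of_real (x - s)) * u x i))"
    by (rule deriv_on_cong[OF 1], subst mv_scale) (simp add: algebra_simps)
qed

lemma sol_reflect:
  assumes "sol n A c a b u"
  shows "sol n (\<lambda>x i k. - A (- x) i k) (- c) (- b) (- a) (\<lambda>x. u (- x))"
  unfolding sol_def
proof (intro allI impI)
  fix i assume i: "i < n"
  have 1: "deriv_on (- b) (- a) (\<lambda>x. u (- x) i) (\<lambda>x. - (mv n (A (- x)) (u (- x)) i - c * u (- x) i))"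
    using assms i deriv_on_reflect by (fastforce simp: sol_def)
  show "deriv_on (- b) (- a) (\<lambda>x. u (- x) i)
      (\<lambda>x. mv n (\<lambda>i k. - A (- x) i k) (u (- x)) i - - c * u (- x) i)"
    by (rule deriv_on_cong[OF 1]) (simp add: mv_uminus)
qed

text \<open>With \<open>\<mu> = 0\<close> the whole right-hand side counts as perturbation. It is
  bounded on the compact interval, and the energy that vanishes at \<open>b\<close> then vanishes at
  \<open>a\<close>.\<close>

lemma sol_zero_before:
  assumes u: "sol n A c a b u" and ab: "a \<le> b"
    and A: "\<And>i k. i < n \<Longrightarrow> k < n \<Longrightarrow> continuous_on {a..b} (\<lambda>x. A x i k)"
    and z: "\<And>i. i < n \<Longrightarrow> u b i = 0" and i: "i < n"
  shows "u a i = 0"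
proof -
  have "\<exists>K. \<forall>x\<in>{a..b}. (\<Sum>i<n. \<Sum>k<n. cmod (A x i k)) \<le> K"
  proof -
    have "continuous_on {a..b} (\<lambda>x. \<Sum>i<n. \<Sum>k<n. cmod (A x i k))"
      using A by (auto intro!: continuous_intros)
    then have "bounded ((\<lambda>x. \<Sum>i<n. \<Sum>k<n. cmod (A x i k)) ` {a..b})"
      by (intro compact_imp_bounded compact_continuous_image) auto
    then obtain K where "\<forall>y\<in>(\<lambda>x. \<Sum>i<n. \<Sum>k<n. cmod (A x i k)) ` {a..b}. norm y \<le> K"
      unfolding bounded_iff by blast
    then have "\<forall>x\<in>{a..b}. (\<Sum>i<n. \<Sum>k<n. cmod (A x i k)) \<le> K"
      by (metis (no_types, lifting) abs_ge_self image_eqI order_trans real_norm_def)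
    then show ?thesis by blast
  qed
  then obtain K where K: "\<And>x. x \<in> {a..b} \<Longrightarrow> (\<Sum>i<n. \<Sum>k<n. cmod (A x i k)) \<le> K" by blast
  have Kik: "cmod (A x i k) \<le> K" if "x \<in> {a..b}" "i < n" "k < n" for x i k
  proof -
    have "cmod (A x i k) \<le> (\<Sum>k<n. cmod (A x i k))"
      using that by (intro member_le_sum) auto
    also have "\<dots> \<le> (\<Sum>i<n. \<Sum>k<n. cmod (A x i k))"
      using that by (intro member_le_sum[of i "{..<n}" "\<lambda>i. \<Sum>k<n. cmod (A x i k)"]) (auto intro: sum_nonneg)
    finally show ?thesis using K[OF that(1)] by linarith
  qed
  have K0: "K \<ge> 0" using Kik[of a i i] ab i by (meson atLeastAtMost_iff norm_ge_zero order_refl order_trans)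
  define K' where "K' = K + cmod c"
  have "(\<Sum>g<n. (cmod (u a g))\<^sup>2) * exp (2 * card {..<n} * (K' * a))
      \<le> (\<Sum>g<n. (cmod (u b g))\<^sup>2) * exp (2 * card {..<n} * (K' * b))"
  proof (rule backward_energy[where \<mu> = "\<lambda>_. 0" and h = "\<lambda>g x. mv n (A x) (u x) g - c * u x g"
        and \<Lambda> = "\<lambda>x. K' * x" and \<kappa> = "\<lambda>x. K'"])
    fix g x assume g: "g \<in> {..<n}" and x: "a < x" "x < b"
    have "cmod (mv n (A x) (u x) g) \<le> (\<Sum>k<n. K * cmod (u x k))"
      unfolding mv_def using g x
      by (intro order_trans[OF norm_sum] sum_mono) (auto simp: norm_mult intro!: mult_right_mono Kik)
    also have "\<dots> = K * (\<Sum>k<n. cmod (u x k))" by (simp add: sum_distrib_left)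
    finally have "cmod (mv n (A x) (u x) g) \<le> K * (\<Sum>k<n. cmod (u x k))" .
    moreover have "cmod (c * u x g) \<le> cmod c * (\<Sum>k<n. cmod (u x k))"
      unfolding norm_mult using g by (intro mult_left_mono member_le_sum) auto
    ultimately show "cmod (mv n (A x) (u x) g - c * u x g) \<le> K' * (\<Sum>g<n. cmod (u x g))"
      unfolding K'_def distrib_right by (intro order_trans[OF norm_triangle_ineq4] add_mono)
  next
    fix x :: real show "((*) K' has_real_derivative K') (at x)"
      by (auto intro!: derivative_eq_intros)
  qed (use ab u K0 in \<open>auto simp: sol_def K'_def intro!: continuous_intros\<close>)
  also have "\<dots> = 0" using z by simp
  finally have "(\<Sum>g<n. (cmod (u a g))\<^sup>2) \<le> 0"
    by (simp add: mult_le_0_iff)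
  then have "(\<Sum>g<n. (cmod (u a g))\<^sup>2) = 0" by (intro antisym) (auto simp: sum_nonneg)
  then show ?thesis using i by (subst (asm) sum_nonneg_eq_0_iff) auto
qed

text \<open>The difference vanishes at \<open>s\<close>. To the left of \<open>s\<close> this is
  \<open>sol_zero_before\<close>, to the right it is the same after reflection.\<close>

lemma sol_unique:
  assumes u: "sol n A c a b u" and v: "sol n A c a b v"
    and A: "\<And>i k. i < n \<Longrightarrow> k < n \<Longrightarrow> continuous_on {a..b} (\<lambda>x. A x i k)"
    and s: "s \<in> {a..b}" "\<And>i. i < n \<Longrightarrow> u s i = v s i" and x: "x \<in> {a..b}" and i: "i < n"
  shows "u x i = v x i"
proof -
  define d where "d = (\<lambda>x i. u x i - v x i)"
  have d: "sol n A c a b d" unfolding d_def by (rule sol_diff[OF u v])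
  have "d x i = 0"
  proof (cases "x \<le> s")
    case True
    show ?thesis
    proof (rule sol_zero_before[OF sol_subset[OF d] True])
      fix i k assume "i < n" "k < n"
      then show "continuous_on {x..s} (\<lambda>x. A x i k)"
        using s x by (intro continuous_on_subset[OF A]) auto
    qed (use s x i d_def in auto)
  next
    case False
    have "(\<lambda>x. d (- x)) (- x) i = 0"
    proof (rule sol_zero_before[OF sol_reflect[OF sol_subset[OF d, of s x]], where i = i])
      fix i k assume "i < n" "k < n"
      then have "continuous_on {s..x} (\<lambda>x. A x i k)"
        using s x by (intro continuous_on_subset[OF A]) auto
      then show "continuous_on {- x..- s} (\<lambda>x. - A (- x) i k)"
        by (intro continuous_on_minus,
            rule continuous_on_compose2[where f = uminus and g = "\<lambda>x. A x i k" and t = "{s..x}"])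
           (auto intro!: continuous_intros)
    qed (use s x i d_def False in auto)
    then show ?thesis by simp
  qed
  then show ?thesis by (simp add: d_def)
qed

section \<open>Determinants of families of columns\<close>

text \<open>The column index comes first: \<open>c j\<close> is the \<open>j\<close>-th column, so
  that \<open>c(j := v)\<close> replaces a column. Functions instead of matrices make families of
  columns easy to cut, join and update.\<close>

definition D :: "nat \<Rightarrow> (nat \<Rightarrow> nat \<Rightarrow> complex) \<Rightarrow> complex" where
  "D n c = Determinant.det (Matrix.mat n n (\<lambda>(i,j). c j i))"

lemma D_cong:
  assumes "\<And>i j. i < n \<Longrightarrow> j < n \<Longrightarrow> c j i = c' j i"
  shows "D n c = D n c'"
  unfolding D_def by (rule arg_cong[where f = Determinant.det], rule eq_matI) (use assms in auto)

lemma D_expand: "D n c = (\<Sum>p | p permutes {0..<n}. of_int (sign p) * (\<Prod>j<n. c j (p j)))"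
  unfolding D_def
  by (subst det_col[where n = n], simp, intro sum.cong refl arg_cong2[where f = "(*)"] prod.cong)
     (auto dest: permutes_in_image)

definition minor_cofactor :: "nat \<Rightarrow> (nat \<Rightarrow> nat \<Rightarrow> complex) \<Rightarrow> nat \<Rightarrow> nat \<Rightarrow> complex" where
  "minor_cofactor n c j i = Determinant.cofactor (Matrix.mat n n (\<lambda>(i,j). c j i)) i j"

lemma minor_cofactor_upd: "j < n \<Longrightarrow> i < n \<Longrightarrow> minor_cofactor n (c(j := v)) j i = minor_cofactor n c j i"
  unfolding minor_cofactor_def Determinant.cofactor_def
  by (intro arg_cong2[where f = "(*)"] refl arg_cong[where f = Determinant.det] eq_matI)
     (auto simp: mat_delete_def)

text \<open>Laplace expansion along column \<open>j\<close>, whose cofactors do not see that column.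
  Linearity in each column is read off from this form.\<close>

lemma D_upd: "j < n \<Longrightarrow> D n (c(j := v)) = (\<Sum>i<n. v i * minor_cofactor n c j i)"
proof -
  assume j: "j < n"
  have "D n (c(j := v)) = (\<Sum>i<n. (c(j := v)) j i * minor_cofactor n (c(j := v)) j i)"
    unfolding D_def minor_cofactor_def
    by (subst laplace_expansion_column[where n = n and j = j]) (use j in auto)
  then show ?thesis using j by (simp add: minor_cofactor_upd)
qed

lemma D_upd_sum:
  assumes "j < n" "\<And>i. i < n \<Longrightarrow> u i = (\<Sum>l\<in>S. a l * v l i)"
  shows "D n (c(j := u)) = (\<Sum>l\<in>S. a l * D n (c(j := v l)))"
proof -
  have "D n (c(j := u)) = (\<Sum>i<n. \<Sum>l\<in>S. a l * v l i * minor_cofactor n c j i)"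
    using assms by (simp add: D_upd sum_distrib_right)
  also have "\<dots> = (\<Sum>l\<in>S. a l * D n (c(j := v l)))"
    by (subst sum.swap) (simp add: D_upd assms(1) sum_distrib_left mult.assoc)
  finally show ?thesis .
qed

lemma D_equal_columns:
  assumes "j < n" "k < n" "j \<noteq> k" "\<And>i. i < n \<Longrightarrow> c j i = c k i"
  shows "D n c = 0"
  unfolding D_def
  by (rule det_identical_columns[of _ n j k]) (use assms in \<open>auto intro!: eq_vecI\<close>)

text \<open>Cramer's rule: every other summand repeats a column.\<close>

lemma D_replace:
  assumes k: "k < n" and u: "\<And>i. i < n \<Longrightarrow> u i = (\<Sum>l<n. a l * c l i)"
  shows "D n (c(k := u)) = a k * D n c"
proof -
  have "D n (c(k := u)) = (\<Sum>l<n. a l * D n (c(k := c l)))" by (rule D_upd_sum[OF k u])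
  also have "\<dots> = (\<Sum>l<n. if l = k then a k * D n c else 0)"
  proof (intro sum.cong refl)
    fix l assume "l \<in> {..<n}"
    then show "a l * D n (c(k := c l)) = (if l = k then a k * D n c else 0)"
      using D_equal_columns[of l n k "c(k := c l)"] k by auto
  qed
  finally show ?thesis using k by (simp add: sum.delta)
qed

lemma D_scale: "D n (\<lambda>j i. s j * c j i) = (\<Prod>j<n. s j) * D n c"
  unfolding D_expand by (simp add: prod.distrib sum_distrib_left mult_ac)

text \<open>Algebraic core of Liouville's formula. The cofactor sums over \<open>j\<close> form the
  product of the matrix with its adjugate, which is \<open>D n c\<close> times the identity, so only
  the diagonal of \<open>M\<close> survives.\<close>

lemma D_trace:
  "(\<Sum>j<n. D n (c(j := mv n M (c j)))) = (\<Sum>i<n. M i i) * D n c"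
proof -
  let ?A = "Matrix.mat n n (\<lambda>(i,j). c j i)"
  have A: "?A \<in> carrier_mat n n" by simp
  have *: "(\<Sum>j<n. c j k * minor_cofactor n c j i) = (if k = i then D n c else 0)" if "k < n" "i < n" for k i
  proof -
    have "(?A * adj_mat ?A) $$ (k, i) = (if k = i then D n c else 0)"
      using that unfolding adj_mat(2)[OF A] D_def by simp
    then show ?thesis using that
      by (simp add: adj_mat_def scalar_prod_def minor_cofactor_def atLeast0LessThan)
  qed
  have "(\<Sum>j<n. D n (c(j := mv n M (c j)))) = (\<Sum>j<n. \<Sum>i<n. \<Sum>k<n. M i k * (c j k * minor_cofactor n c j i))"
    by (simp add: D_upd mv_def sum_distrib_right mult.assoc)
  also have "\<dots> = (\<Sum>i<n. \<Sum>j<n. \<Sum>k<n. M i k * (c j k * minor_cofactor n c j i))"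
    by (rule sum.swap)
  also have "\<dots> = (\<Sum>i<n. \<Sum>k<n. \<Sum>j<n. M i k * (c j k * minor_cofactor n c j i))"
    by (intro sum.cong refl sum.swap)
  also have "\<dots> = (\<Sum>i<n. \<Sum>k<n. M i k * (if k = i then D n c else 0))"
    by (simp add: sum_distrib_left[symmetric] *)
  also have "\<dots> = (\<Sum>i<n. M i i) * D n c"
    by (simp add: sum_distrib_right if_distrib sum.delta cong: if_cong)
  finally show ?thesis .
qed

lemma deriv_on_prod:
  assumes "finite S" "\<And>j. j \<in> S \<Longrightarrow> deriv_on a b (f j) (f' j)"
  shows "deriv_on a b (\<lambda>x. \<Prod>j\<in>S. f j x) (\<lambda>x. \<Sum>j\<in>S. f' j x * (\<Prod>k\<in>S - {j}. f k x))"
  using assms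
proof (induction S rule: finite_induct)
  case empty
  then show ?case by (simp add: deriv_on_const)
next
  case (insert s S)
  have 1: "deriv_on a b (\<lambda>x. f s x * (\<Prod>j\<in>S. f j x))
      (\<lambda>x. f s x * (\<Sum>j\<in>S. f' j x * (\<Prod>k\<in>S - {j}. f k x)) + f' s x * (\<Prod>j\<in>S. f j x))"
    by (intro deriv_on_mult insert) (use insert in auto)
  have 2: "(\<Prod>k\<in>insert s S - {j}. f k x) = f s x * (\<Prod>k\<in>S - {j}. f k x)" if "j \<in> S" for j x
  proof -
    have "insert s S - {j} = insert s (S - {j})" using insert that by auto
    then show ?thesis using insert by simp
  qed
  show ?case using insert
    by (simp, intro deriv_on_cong[OF 1]) (simp add: 2 sum_distrib_left algebra_simps)
qed

lemma deriv_on_D: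
  assumes c: "\<And>j i. j < n \<Longrightarrow> i < n \<Longrightarrow> deriv_on a b (\<lambda>x. c x j i) (\<lambda>x. c' x j i)"
  shows "deriv_on a b (\<lambda>x. D n (c x)) (\<lambda>x. \<Sum>j<n. D n ((c x)(j := c' x j)))"
proof -
  have 1: "deriv_on a b (\<lambda>x. D n (c x)) (\<lambda>x. \<Sum>p | p permutes {0..<n}. of_int (sign p) *
      (\<Sum>j<n. c' x j (p j) * (\<Prod>k\<in>{..<n} - {j}. c x k (p k))) + 0 * (\<Prod>j<n. c x j (p j)))"
    unfolding D_expand
    by (intro deriv_on_sum deriv_on_mult deriv_on_const deriv_on_prod c)
       (auto dest: permutes_in_image)
  have 2: "(\<Prod>k<n. ((c x)(j := c' x j)) k (p k)) = c' x j (p j) * (\<Prod>k\<in>{..<n} - {j}. c x k (p k))"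
    if "j < n" for x j p
    using that by (subst prod.remove[of _ j]) (auto intro!: prod.cong)
  show ?thesis
    by (rule deriv_on_cong[OF 1], unfold D_expand, subst sum.swap)
       (simp add: 2 sum_distrib_left del: fun_upd_apply)
qed

text \<open>Only the columns in \<open>J\<close> are expanded. Each summand is indexed by the
  function \<open>g\<close> that picks a basis vector for every such column; these summands later
  become the functions \<open>w\<close>.\<close>

lemma D_multilinear:
  assumes J: "J \<subseteq> {..<n}" and u: "\<And>j i. j \<in> J \<Longrightarrow> i < n \<Longrightarrow> u j i = (\<Sum>l<n. a j l * V l i)"
  shows "D n (\<lambda>j. if j \<in> J then u j else y j) =
    (\<Sum>g\<in>PiE J (\<lambda>_. {..<n}). (\<Prod>j\<in>J. a j (g j)) * D n (\<lambda>j. if j \<in> J then V (g j) else y j))"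
proof -
  have fJ: "finite J" using J finite_subset by blast
  have split: "(\<Prod>j<n. (if j \<in> J then f j else y j) (p j)) = (\<Prod>j\<in>J. f j (p j)) * (\<Prod>j\<in>{..<n} - J. y j (p j))"
    for f :: "nat \<Rightarrow> nat \<Rightarrow> complex" and p
    by (subst prod.subset_diff[OF J]) (simp_all add: mult.commute)
  have "D n (\<lambda>j. if j \<in> J then u j else y j) = (\<Sum>p | p permutes {0..<n}. of_int (sign p) *
      ((\<Prod>j\<in>J. \<Sum>l<n. a j l * V l (p j)) * (\<Prod>j\<in>{..<n} - J. y j (p j))))"
    unfolding D_expand split
  proof (intro sum.cong refl arg_cong2[where f = "(*)"] prod.cong)
    fix p j assume p: "p \<in> {p. p permutes {0..<n}}" and j: "j \<in> J"
    have "p j < n" using permutes_in_image[of p "{0..<n}" j] p j J by auto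
    then show "u j (p j) = (\<Sum>l<n. a j l * V l (p j))" by (rule u[OF j])
  qed
  also have "\<dots> = (\<Sum>p | p permutes {0..<n}. \<Sum>g\<in>PiE J (\<lambda>_. {..<n}). (\<Prod>j\<in>J. a j (g j)) *
      (of_int (sign p) * ((\<Prod>j\<in>J. V (g j) (p j)) * (\<Prod>j\<in>{..<n} - J. y j (p j)))))"
    by (subst prod_sum_PiE[OF fJ]) (simp_all add: sum_distrib_left sum_distrib_right prod.distrib mult_ac)
  also have "\<dots> = (\<Sum>g\<in>PiE J (\<lambda>_. {..<n}). (\<Prod>j\<in>J. a j (g j)) * D n (\<lambda>j. if j \<in> J then V (g j) else y j))"
    unfolding D_expand split by (subst sum.swap) (simp add: sum_distrib_left)
  finally show ?thesis .
qed

lemma D_matmul: "D n (\<lambda>j i. \<Sum>k<n. M j k * c k i) = D n c * D n M"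
proof -
  let ?A = "Matrix.mat n n (\<lambda>(i,j). c j i)" and ?B = "Matrix.mat n n (\<lambda>(i,j). M j i)"
  have "D n (\<lambda>j i. \<Sum>k<n. M j k * c k i) = Determinant.det (?A * ?B)"
    unfolding D_def
    by (rule arg_cong[where f = Determinant.det], rule eq_matI)
       (auto simp: scalar_prod_def atLeast0LessThan mult.commute)
  also have "\<dots> = D n c * D n M" unfolding D_def by (rule det_mult) auto
  finally show ?thesis .
qed

lemma D_block_identity:
  assumes r: "r \<le> n"
  shows "D n (\<lambda>j k. if j < r then (if k < r then C k j else 0) else if k = j then 1 else 0)
      = D r (\<lambda>j k. C k j)"
proof -
  have "Matrix.mat n n (\<lambda>(i,j). if j < r then (if i < r then C i j else 0) else if i = j then 1 else 0)
    = four_block_mat (Matrix.mat r r (\<lambda>(i,j). C i j)) (0\<^sub>m r (n - r)) (0\<^sub>m (n - r) r) (1\<^sub>m (n - r))"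
    by (rule eq_matI) (use r in auto)
  then show ?thesis unfolding D_def
    by (simp add: det_four_block_mat_lower_left_zero[of _ r _ "n - r"])
qed

text \<open>Keeping the columns from \<open>r\<close> on amounts to a block diagonal coefficient
  matrix with blocks \<open>C\<close> and the identity.\<close>

lemma D_block_mult:
  assumes r: "r \<le> n" and B': "\<And>j i. j < r \<Longrightarrow> i < n \<Longrightarrow> B' j i = (\<Sum>k<r. C k j * B k i)"
  shows "D n (\<lambda>j. if j < r then B' j else c j) = D n (\<lambda>j. if j < r then B j else c j) * D r (\<lambda>j k. C k j)"
proof -
  define M where "M = (\<lambda>j k. if j < r then (if k < r then C k j else 0) else if k = j then 1 else (0::complex))"
  define b where "b = (\<lambda>j. if j < r then B j else c j)"
  have "D n (\<lambda>j. if j < r then B' j else c j) = D n (\<lambda>j i. \<Sum>k<n. M j k * b k i)"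
  proof (rule D_cong)
    fix i j assume ij: "i < n" "j < n"
    show "(if j < r then B' j else c j) i = (\<Sum>k<n. M j k * b k i)"
    proof (cases "j < r")
      case True
      have "(\<Sum>k<n. M j k * b k i) = (\<Sum>k<r. M j k * b k i)"
        by (rule sum.mono_neutral_right) (use r True in \<open>auto simp: M_def\<close>)
      then show ?thesis using True B' ij by (simp add: M_def b_def)
    next
      case False
      have "(\<Sum>k<n. M j k * b k i) = (\<Sum>k<n. if k = j then b j i else 0)"
        by (intro sum.cong refl) (use False in \<open>auto simp: M_def\<close>)
      then show ?thesis using False ij by (simp add: b_def)
    qed
  qed
  also have "\<dots> = D n b * D n M" by (rule D_matmul)
  also have "D n M = D r (\<lambda>j k. C k j)" unfolding M_def by (rule D_block_identity[OF r])
  finally show ?thesis unfolding b_def .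
qed

lemma D_triangular:
  assumes "\<And>j k. j < n \<Longrightarrow> k < n \<Longrightarrow> j < k \<Longrightarrow> T j k = 0" "\<And>j. j < n \<Longrightarrow> T j j = 1"
  shows "D n T = 1"
proof -
  let ?A = "Matrix.mat n n (\<lambda>(i,j). T j i)"
  have "Determinant.det ?A = prod_list (diag_mat ?A)"
    by (rule det_upper_triangular) (use assms in auto)
  also have "diag_mat ?A = map (\<lambda>_. 1) [0..<n]"
    unfolding diag_mat_def by (rule map_cong) (use assms in auto)
  also have "prod_list \<dots> = (1::complex)" by (simp add: map_replicate_const prod_list_replicate)
  finally show ?thesis by (simp add: D_def)
qed

text \<open>The coefficient matrix is triangular with unit diagonal. This is why orthogonalisation
  is invisible in the determinants.\<close>

lemma D_unipotent:
  assumes r: "r \<le> n" and B': "\<And>j i. j < r \<Longrightarrow> i < n \<Longrightarrow> B' j i = B j i + (\<Sum>k<j. T k j * B k i)"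
  shows "D n (\<lambda>j. if j < r then B' j else c j) = D n (\<lambda>j. if j < r then B j else c j)"
proof -
  define C where "C = (\<lambda>k j. if k < j then T k j else if k = j then 1 else 0)"
  have "D n (\<lambda>j. if j < r then B' j else c j) = D n (\<lambda>j. if j < r then B j else c j) * D r (\<lambda>j k. C k j)"
  proof (rule D_block_mult[OF r])
    fix j i assume j: "j < r" and i: "i < n"
    have "(\<Sum>k<r. C k j * B k i) = (\<Sum>k<Suc j. C k j * B k i)"
      by (rule sum.mono_neutral_right) (use j in \<open>auto simp: C_def\<close>)
    also have "\<dots> = (\<Sum>k<j. T k j * B k i) + B j i" by (simp add: C_def)
    finally show "B' j i = (\<Sum>k<r. C k j * B k i)" using B' j i by simp
  qed
  also have "D r (\<lambda>j k. C k j) = 1" by (rule D_triangular) (auto simp: C_def)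
  finally show ?thesis by simp
qed

text \<open>The sign depends on the block sizes alone, hence an estimate for one order of the blocks
  serves the other.\<close>

lemma D_swap_blocks:
  "D (m + r) (\<lambda>j. if j < m then P j else Q (j - m)) =
   (-1) ^ (m * r) * D (m + r) (\<lambda>j. if j < r then Q j else P (j - r))"
proof -
  let ?A = "Matrix.mat (m + r) (m + r) (\<lambda>(i,j). (if j < m then P j else Q (j - m)) i)"
  have "D (m + r) (\<lambda>j. if j < m then P j else Q (j - m)) = (-1) ^ (r * m) *
     Determinant.det (Matrix.mat (r + m) (r + m) (\<lambda> (i,j). ?A $$ (i,(if j < r then j + m else j - r))))"
    unfolding D_def by (subst det_swap_cols[of _ r m]) (auto simp: add.commute)
  also have "Matrix.mat (r + m) (r + m) (\<lambda> (i,j). ?A $$ (i,(if j < r then j + m else j - r)))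
     = Matrix.mat (m + r) (m + r) (\<lambda>(i,j). (if j < r then Q j else P (j - r)) i)"
    by (rule eq_matI) auto
  finally show ?thesis unfolding D_def by (simp add: mult.commute)
qed

lemma D_independent:
  assumes "D n c \<noteq> 0" "\<And>i. i < n \<Longrightarrow> (\<Sum>l<n. a l * c l i) = 0" "k < n"
  shows "a k = 0"
proof -
  have "D n (c(k := \<lambda>_. 0)) = a k * D n c" by (rule D_replace) (use assms in auto)
  moreover have "D n (c(k := \<lambda>_. 0)) = 0" using assms(3) by (simp add: D_upd)
  ultimately show ?thesis using assms(1) by simp
qed

lemma D_nonzero:
  assumes "\<And>a k. (\<And>i. i < n \<Longrightarrow> (\<Sum>l<n. a l * c l i) = 0) \<Longrightarrow> k < n \<Longrightarrow> a k = 0"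
  shows "D n c \<noteq> 0"
proof
  let ?A = "Matrix.mat n n (\<lambda>(i,j). c j i)"
  assume "D n c = 0"
  then obtain v where v: "v \<in> carrier_vec n" "v \<noteq> 0\<^sub>v n" "?A *\<^sub>v v = 0\<^sub>v n"
    unfolding D_def using det_0_iff_vec_prod_zero[of ?A n] by auto
  have "v $ k = 0" if k: "k < n" for k
  proof (rule assms[OF _ k, where a = "\<lambda>l. v $ l"])
    fix i assume i: "i < n"
    have "(?A *\<^sub>v v) $ i = 0" using v(3) i by simp
    then show "(\<Sum>l<n. v $ l * c l i) = 0"
      using i v(1) by (simp add: scalar_prod_def atLeast0LessThan mult.commute)
  qed
  then have "v = 0\<^sub>v n" using v(1) by (intro eq_vecI) auto
  then show False using v(2) by simp
qed

section \<open>The flow of a linear system and its dependence on a parameter\<close>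

text \<open>The integral of \<open>f\<close> from \<open>s\<close> to \<open>x\<close>, rescaled to
  the unit interval: one formula for both orders of \<open>s\<close> and \<open>x\<close>, and a
  fixed domain when the integrand depends on a parameter.\<close>

definition oint :: "(real \<Rightarrow> complex) \<Rightarrow> real \<Rightarrow> real \<Rightarrow> complex" where
  "oint f s x = (x - s) *\<^sub>R integral {0..1} (\<lambda>\<theta>. f (s + \<theta> * (x - s)))"

lemma oint_same [simp]: "oint f s s = 0"
  by (simp add: oint_def)

lemma oint_antiderivative:
  assumes F: "\<And>t. t \<in> {-M..M} \<Longrightarrow> (F has_vector_derivative f t) (at t within {-M..M})"
    and s: "s \<in> {-M..M}" and x: "x \<in> {-M..M}"
  shows "oint f s x = F x - F s"
proof -
  have conv: "s + \<theta> * (x - s) \<in> {-M..M}" if "\<theta> \<in> {0..1}" for \<theta>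
  proof -
    have "s + \<theta> * (x - s) = (1 - \<theta>) * s + \<theta> * x" by (simp add: algebra_simps)
    moreover have "(1 - \<theta>) *\<^sub>R s + \<theta> *\<^sub>R x \<in> {-M..M}"
      using s x that by (intro convexD[OF convex_real_interval(5)]) auto
    ultimately show ?thesis by simp
  qed
  have "((\<lambda>\<theta>. (x - s) *\<^sub>R f (s + \<theta> * (x - s))) has_integral
      (F \<circ> (\<lambda>\<theta>. s + \<theta> * (x - s))) 1 - (F \<circ> (\<lambda>\<theta>. s + \<theta> * (x - s))) 0) {0..1}"
  proof (rule fundamental_theorem_of_calculus)
    fix \<theta> :: real assume \<theta>: "\<theta> \<in> {0..1}"
    have "((\<lambda>\<theta>. s + \<theta> * (x - s)) has_vector_derivative (x - s)) (at \<theta> within {0..1})"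
      by (auto intro!: derivative_eq_intros)
    then show "(F \<circ> (\<lambda>\<theta>. s + \<theta> * (x - s)) has_vector_derivative (x - s) *\<^sub>R f (s + \<theta> * (x - s)))
        (at \<theta> within {0..1})"
      by (rule vector_diff_chain_within)
         (rule has_vector_derivative_within_subset[OF F[OF conv[OF \<theta>]]], use conv in auto)
  qed simp
  from integral_unique[OF this] show ?thesis by (simp add: o_def oint_def)
qed

lemma oint_deriv:
  assumes f: "continuous_on UNIV f"
  shows "(oint f s has_vector_derivative f x) (at x)"
proof -
  define M where "M = \<bar>x\<bar> + \<bar>s\<bar> + 1"
  define F where "F = (\<lambda>y. integral {-M..y} f)"
  have F: "(F has_vector_derivative f t) (at t within {-M..M})" if "t \<in> {-M..M}" for t
    unfolding F_def using that f continuous_on_subset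
    by (intro integral_has_vector_derivative) auto
  have xM: "x \<in> {-M<..<M}" and sM: "s \<in> {-M..M}" by (auto simp: M_def)
  have "(F has_vector_derivative f x) (at x)"
    using F[of x] xM at_within_interior[of x "{-M..M}"] by auto
  then have "((\<lambda>y. F y - F s) has_vector_derivative f x) (at x)"
    by (auto intro!: derivative_eq_intros)
  then show ?thesis
  proof (rule has_vector_derivative_transform_within_open)
    show "F y - F s = oint f s y" if "y \<in> {-M<..<M}" for y
      using oint_antiderivative[where f = f, OF F sM, of y] that by auto
  qed (use xM in auto)
qed

text \<open>Integration gains the factor \<open>1 / l\<close> against the weight
  \<open>exp (l * \<bar>t - s\<bar>)\<close>. This makes the series of Picard terms geometric on
  intervals of any length.\<close>

lemma oint_exp_bound:
  assumes f: "continuous_on UNIV f" and l: "l > 0"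
    and le: "\<And>t. \<bar>t - s\<bar> \<le> M \<Longrightarrow> cmod (f t) \<le> c * exp (l * \<bar>t - s\<bar>)" and x: "\<bar>x - s\<bar> \<le> M"
  shows "cmod (oint f s x) \<le> c / l * exp (l * \<bar>x - s\<bar>)"
proof -
  have d: "(oint f s has_vector_derivative f t) (at t)" for t by (rule oint_deriv[OF f])
  have cont: "continuous_on S (oint f s)" for S
    using d by (meson continuous_at_imp_continuous_on has_vector_derivative_continuous)
  have "cmod (f s) \<le> c" using le[of s] x by simp
  then have c0: "c \<ge> 0" using norm_ge_zero order_trans by blast
  consider "x = s" | "s < x" | "x < s" by linarith
  then show ?thesis
  proof cases
    case 1
    then show ?thesis using c0 l by simp
  next
    case 2
    have fle: "cmod (f t) \<le> c * exp (l * (t - s))" if "s < t" "t < x" for t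
      using le[of t] that x by simp
    have "norm (oint f s x - oint f s s) \<le> c / l * exp (l * (x - s)) - c / l * exp (l * (s - s))"
      by (rule differentiable_bound_general[OF 2, where f' = f and \<phi>' = "\<lambda>t. c * exp (l * (t - s))"])
         (use l d cont fle in \<open>auto intro!: continuous_intros derivative_eq_intros
            simp: has_real_derivative_iff_has_vector_derivative[symmetric]\<close>)
    moreover have "c / l \<ge> 0" using c0 l by simp
    ultimately show ?thesis using 2 by simp
  next
    case 3
    have fle: "cmod (f t) \<le> c * exp (l * (s - t))" if "x < t" "t < s" for t
      using le[of t] that x by simp
    have "norm (oint f s s - oint f s x) \<le> - c / l * exp (l * (s - s)) - (- c / l * exp (l * (s - x)))"
      by (rule differentiable_bound_general[OF 3, where f' = f and \<phi>' = "\<lambda>t. c * exp (l * (s - t))"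
            and \<phi> = "\<lambda>t. - c / l * exp (l * (s - t))"])
         (use l d cont fle in \<open>auto intro!: continuous_intros derivative_eq_intros
            simp: has_real_derivative_iff_has_vector_derivative[symmetric]\<close>)
    moreover have "c / l \<ge> 0" using c0 l by simp
    ultimately show ?thesis using 3 by simp
  qed
qed

text \<open>The terms of the Peano-Baker series applied to \<open>v\<close>, not the successive
  approximations. An explicit series lets analyticity in a parameter pass from the terms to the
  sum.\<close>

primrec picard :: "nat \<Rightarrow> (real \<Rightarrow> nat \<Rightarrow> nat \<Rightarrow> complex) \<Rightarrow> real \<Rightarrow> (nat \<Rightarrow> complex) \<Rightarrow>
    nat \<Rightarrow> real \<Rightarrow> nat \<Rightarrow> complex" where
  "picard n A s v 0 x i = v i"
| "picard n A s v (Suc k) x i = oint (\<lambda>t. mv n (A t) (picard n A s v k t) i) s x"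

definition phi :: "nat \<Rightarrow> (real \<Rightarrow> nat \<Rightarrow> nat \<Rightarrow> complex) \<Rightarrow> real \<Rightarrow> (nat \<Rightarrow> complex) \<Rightarrow>
    real \<Rightarrow> nat \<Rightarrow> complex" where
  "phi n A s v x i = (\<Sum>k. picard n A s v k x i)"

lemma picard_cont:
  assumes A: "\<And>i k. i < n \<Longrightarrow> k < n \<Longrightarrow> continuous_on UNIV (\<lambda>x. A x i k)" and i: "i < n"
  shows "continuous_on UNIV (\<lambda>x. picard n A s v k x i)"
  using i
proof (induction k arbitrary: i)
  case (Suc k)
  then have "continuous_on UNIV (\<lambda>t. mv n (A t) (picard n A s v k t) i)"
    unfolding mv_def by (auto intro!: continuous_intros A)
  then show ?case
    using oint_deriv by (auto intro!: continuous_at_imp_continuous_on has_vector_derivative_continuous)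
qed simp

text \<open>Bielecki's weight: applying the matrix costs the factor \<open>n * a\<close>,
  integration against the weight with \<open>l = 2 * n * a\<close> gains its inverse and another
  factor 1/2.\<close>

lemma picard_bound:
  assumes A: "\<And>i k. i < n \<Longrightarrow> k < n \<Longrightarrow> continuous_on UNIV (\<lambda>x. A x i k)" and i: "i < n"
    and a: "\<And>i k t. i < n \<Longrightarrow> k < n \<Longrightarrow> \<bar>t - s\<bar> \<le> M \<Longrightarrow> cmod (A t i k) \<le> a" "a > 0"
    and v: "\<And>i. i < n \<Longrightarrow> cmod (v i) \<le> B" and x: "\<bar>x - s\<bar> \<le> M"
  shows "cmod (picard n A s v k x i) \<le> B * (1/2) ^ k * exp (2 * real n * a * \<bar>x - s\<bar>)"
  using i x
proof (induction k arbitrary: i x)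
  case 0
  have "B \<ge> 0" using v[OF 0(1)] norm_ge_zero order_trans by blast
  then have "B * 1 \<le> B * exp (2 * real n * a * \<bar>x - s\<bar>)" using a(2) by (intro mult_left_mono) auto
  then show ?case using v[OF 0(1)] by simp
next
  case (Suc k)
  have n: "n > 0" using Suc.prems by simp
  have "cmod (oint (\<lambda>t. mv n (A t) (picard n A s v k t) i) s x)
     \<le> (n * a * (B * (1/2) ^ k)) / (2 * real n * a) * exp ((2 * real n * a) * \<bar>x - s\<bar>)"
  proof (rule oint_exp_bound[OF _ _ _ Suc.prems(2)])
    show "continuous_on UNIV (\<lambda>t. mv n (A t) (picard n A s v k t) i)"
      unfolding mv_def using Suc.prems picard_cont[OF A] A by (auto intro!: continuous_intros)
    show "0 < 2 * real n * a" using n a by simp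
    fix t assume t: "\<bar>t - s\<bar> \<le> M"
    have "cmod (mv n (A t) (picard n A s v k t) i)
       \<le> (\<Sum>j<n. a * (B * (1/2) ^ k * exp (2 * real n * a * \<bar>t - s\<bar>)))"
      unfolding mv_def using Suc.prems t a
      by (intro order_trans[OF norm_sum] sum_mono) (auto simp: norm_mult intro!: mult_mono Suc.IH)
    then show "cmod (mv n (A t) (picard n A s v k t) i)
       \<le> n * a * (B * (1/2) ^ k) * exp (2 * real n * a * \<bar>t - s\<bar>)"
      by (simp add: mult_ac)
  qed
  also have "(n * a * (B * (1/2) ^ k)) / (2 * real n * a) = B * (1/2) ^ Suc k" using n a by simp
  finally show ?case by simp
qed

lemma matrix_bounded:
  fixes A :: "'a::topological_space \<Rightarrow> nat \<Rightarrow> nat \<Rightarrow> complex"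
  assumes "\<And>i k. i < n \<Longrightarrow> k < n \<Longrightarrow> continuous_on S (\<lambda>x. A x i k)" "compact S"
  obtains a where "a > 0" "\<And>x i k. x \<in> S \<Longrightarrow> i < n \<Longrightarrow> k < n \<Longrightarrow> cmod (A x i k) \<le> a"
proof -
  have "compact ((\<lambda>x. \<Sum>i<n. \<Sum>k<n. cmod (A x i k)) ` S)"
    using assms by (intro compact_continuous_image) (auto intro!: continuous_intros)
  from compact_imp_bounded[OF this] obtain a where a: "a > 0"
    "\<And>x. x \<in> S \<Longrightarrow> norm (\<Sum>i<n. \<Sum>k<n. cmod (A x i k)) \<le> a"
    unfolding bounded_pos by blast
  have "cmod (A x i k) \<le> a" if "x \<in> S" "i < n" "k < n" for x i k
  proof -
    have "cmod (A x i k) \<le> (\<Sum>k<n. cmod (A x i k))"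
      using that by (intro member_le_sum) auto
    also have "\<dots> \<le> (\<Sum>i<n. \<Sum>k<n. cmod (A x i k))"
      using that by (intro member_le_sum[of i "{..<n}" "\<lambda>i. \<Sum>k<n. cmod (A x i k)"]) (auto intro: sum_nonneg)
    finally show ?thesis using a(2)[OF that(1)] by simp
  qed
  then show ?thesis using that a(1) by blast
qed

lemma phi_init: "phi n A s v s i = v i"
proof -
  have "(\<lambda>k. picard n A s v k s i) = (\<lambda>k. if k = 0 then v i else 0)"
    by (rule ext, case_tac k) auto
  then show ?thesis unfolding phi_def by (simp only:) (subst suminf_finite[of "{0}"], auto)
qed

text \<open>Termwise differentiation: the derivative of a term is \<open>A\<close> applied to the
  preceding term, and the geometric bound makes the differentiated series converge uniformly around
  \<open>s\<close> up to a distance beyond \<open>x\<close>.\<close>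

lemma phi_deriv:
  assumes A: "\<And>i k. i < n \<Longrightarrow> k < n \<Longrightarrow> continuous_on UNIV (\<lambda>x. A x i k)" and i: "i < n"
  shows "((\<lambda>x. phi n A s v x i) has_vector_derivative mv n (A x) (phi n A s v x) i) (at x)"
proof -
  define M where "M = \<bar>x - s\<bar> + 1"
  obtain a where a: "a > 0" "\<And>t i k. t \<in> {s - M..s + M} \<Longrightarrow> i < n \<Longrightarrow> k < n \<Longrightarrow> cmod (A t i k) \<le> a"
    by (rule matrix_bounded[of n "{s - M..s + M}" A]) (use A continuous_on_subset in blast)+
  have a': "cmod (A t i k) \<le> a" if "i < n" "k < n" "\<bar>t - s\<bar> \<le> M" for i k t
    using a(2) that by (simp add: abs_le_iff)
  define B where "B = (\<Sum>i<n. cmod (v i))"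
  have vB: "cmod (v i) \<le> B" if "i < n" for i
    unfolding B_def using that by (intro member_le_sum) auto
  define E where "E = exp (2 * real n * a * M)"
  have B0: "B \<ge> 0" unfolding B_def by (simp add: sum_nonneg)
  have pb: "cmod (picard n A s v k t j) \<le> B * E * (1/2) ^ k" if "\<bar>t - s\<bar> \<le> M" "j < n" for t k j
  proof -
    have "cmod (picard n A s v k t j) \<le> B * (1/2) ^ k * exp (2 * real n * a * \<bar>t - s\<bar>)"
      by (rule picard_bound[where M = M]) (use that A a' a(1) vB in auto)
    also have "\<dots> \<le> B * (1/2) ^ k * E"
      unfolding E_def using that a B0 by (intro mult_left_mono) (auto intro!: mult_left_mono)
    finally show ?thesis by (simp add: mult_ac)
  qed
  have summ: "summable (\<lambda>k. B * E * (1/2) ^ k)" by (intro summable_mult summable_geometric) simp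
  have sp: "summable (\<lambda>k. picard n A s v k t j)" if "\<bar>t - s\<bar> \<le> M" "j < n" for t j
    by (rule summable_comparison_test'[OF summ, of 0]) (use pb that in auto)
  \<comment> \<open>Derivatives of the terms. The zeroth term is constant, so the index is shifted
    by one.\<close>
  define g where "g = (\<lambda>k t. case k of 0 \<Rightarrow> 0 | Suc k \<Rightarrow> mv n (A t) (picard n A s v k t) i)"
  let ?T = "{s - M<..<s + M}"
  have gsum: "(\<lambda>k. g k t) sums mv n (A t) (phi n A s v t) i" if t: "\<bar>t - s\<bar> \<le> M" for t
  proof -
    have "(\<lambda>k. mv n (A t) (picard n A s v k t) i) sums mv n (A t) (phi n A s v t) i"
      unfolding mv_def phi_def
      by (intro sums_sum sums_mult summable_sums sp t) auto
    then have "(\<lambda>k. g (Suc k) t) sums mv n (A t) (phi n A s v t) i" by (simp add: g_def)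
    moreover have "g 0 t = 0" by (simp add: g_def)
    ultimately show ?thesis using sums_Suc_iff[of "\<lambda>k. g k t"] by simp
  qed
  \<comment> \<open>The factor 2 pays for the shifted index.\<close>
  have gb: "cmod (g k t) \<le> n * a * (B * E * (2 * (1/2) ^ k))" if t: "\<bar>t - s\<bar> \<le> M" for k t
  proof (cases k)
    case 0
    then show ?thesis using a B0 by (simp add: g_def E_def)
  next
    case (Suc l)
    have "cmod (mv n (A t) (picard n A s v l t) i) \<le> (\<Sum>j<n. a * (B * E * (1/2) ^ l))"
      unfolding mv_def using i t a
      by (intro order_trans[OF norm_sum] sum_mono) (auto simp: norm_mult intro!: mult_mono pb a')
    then show ?thesis using Suc by (simp add: g_def mult_ac)
  qed
  have "uniform_limit ?T (\<lambda>N t. \<Sum>k<N. g k t) (\<lambda>t. \<Sum>k. g k t) sequentially"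
  proof (rule Weierstrass_m_test)
    show "summable (\<lambda>k. n * a * (B * E * (2 * (1/2::real) ^ k)))"
      by (intro summable_mult summable_geometric) simp
  qed (use gb in auto)
  then have ul: "uniform_limit ?T (\<lambda>N t. \<Sum>k<N. g k t) (\<lambda>t. mv n (A t) (phi n A s v t) i) sequentially"
    using sums_unique[OF gsum] by (simp add: uniform_limit_iff abs_le_iff)
  have xT: "x \<in> ?T" unfolding M_def by auto
  have "\<exists>G. \<forall>t\<in>?T. (\<lambda>k. picard n A s v k t i) sums G t \<and>
      (G has_derivative (\<lambda>h. h *\<^sub>R mv n (A t) (phi n A s v t) i)) (at t within ?T)"
  proof (rule has_derivative_series[where f' = "\<lambda>k t h. h *\<^sub>R g k t" and x = s])
    show "convex ?T" by simp
    show "s \<in> ?T" by (auto simp: M_def)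
    show "(\<lambda>k. picard n A s v k s i) sums phi n A s v s i"
      unfolding phi_def by (rule summable_sums[OF sp]) (use i in \<open>auto simp: M_def\<close>)
    fix k t assume t: "t \<in> ?T"
    have "((\<lambda>t. picard n A s v k t i) has_vector_derivative g k t) (at t)"
    proof (cases k)
      case (Suc l)
      have "continuous_on UNIV (\<lambda>t. mv n (A t) (picard n A s v l t) i)"
        unfolding mv_def using i picard_cont[OF A] A by (auto intro!: continuous_intros)
      then show ?thesis using oint_deriv Suc by (simp add: g_def)
    qed (simp add: g_def)
    then show "((\<lambda>t. picard n A s v k t i) has_derivative (\<lambda>h. h *\<^sub>R g k t)) (at t within ?T)"
      by (simp add: has_vector_derivative_def has_derivative_at_withinI)
  next
    fix e :: real assume e: "e > 0"
    have "\<forall>\<^sub>F N in sequentially. \<forall>t\<in>?T. dist (\<Sum>k<N. g k t) (mv n (A t) (phi n A s v t) i) < e"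
      using ul e by (rule uniform_limitD)
    then show "\<forall>\<^sub>F N in sequentially. \<forall>t\<in>?T. \<forall>h.
        norm ((\<Sum>k<N. h *\<^sub>R g k t) - h *\<^sub>R mv n (A t) (phi n A s v t) i) \<le> e * norm h"
    proof (rule eventually_mono, intro ballI allI)
      fix N t h assume *: "\<forall>t\<in>?T. dist (\<Sum>k<N. g k t) (mv n (A t) (phi n A s v t) i) < e" and t: "t \<in> ?T"
      have "norm ((\<Sum>k<N. h *\<^sub>R g k t) - h *\<^sub>R mv n (A t) (phi n A s v t) i)
          = \<bar>h\<bar> * dist (\<Sum>k<N. g k t) (mv n (A t) (phi n A s v t) i)"
        by (simp add: dist_norm scaleR_sum_right[symmetric] scaleR_diff_right[symmetric])
      also have "\<dots> \<le> \<bar>h\<bar> * e" using * t by (intro mult_left_mono) (auto intro: less_imp_le)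
      finally show "norm ((\<Sum>k<N. h *\<^sub>R g k t) - h *\<^sub>R mv n (A t) (phi n A s v t) i) \<le> e * norm h"
        by (simp add: mult.commute)
    qed
  qed
  then obtain G where G': "\<forall>t\<in>?T. (\<lambda>k. picard n A s v k t i) sums G t \<and>
      (G has_derivative (\<lambda>h. h *\<^sub>R mv n (A t) (phi n A s v t) i)) (at t within ?T)" by blast
  then have G: "\<And>t. t \<in> ?T \<Longrightarrow> (\<lambda>k. picard n A s v k t i) sums G t"
    "\<And>t. t \<in> ?T \<Longrightarrow> (G has_vector_derivative mv n (A t) (phi n A s v t) i) (at t within ?T)"
    by (simp_all add: has_vector_derivative_def)
  have "(G has_vector_derivative mv n (A x) (phi n A s v x) i) (at x)"
    using G(2)[OF xT] at_within_open[OF xT] by simp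
  then show ?thesis
    by (rule has_vector_derivative_transform_within_open[OF _ _ xT])
       (use sums_unique[OF G(1)] in \<open>auto simp: phi_def\<close>)
qed

lemma phi_sol:
  assumes A: "\<And>i k. i < n \<Longrightarrow> k < n \<Longrightarrow> continuous_on UNIV (\<lambda>x. A x i k)"
  shows "sol n A 0 a b (phi n A s v)"
  unfolding sol_def
  by (intro allI impI deriv_on_within[where I = UNIV]) (use phi_deriv[OF A] in auto)

lemma phi_linear:
  assumes A: "\<And>i k. i < n \<Longrightarrow> k < n \<Longrightarrow> continuous_on UNIV (\<lambda>x. A x i k)" and i: "i < n"
    and v: "\<And>i. i < n \<Longrightarrow> v i = (\<Sum>j\<in>S. c j * w j i)"
  shows "phi n A s v x i = (\<Sum>j\<in>S. c j * phi n A s (w j) x i)"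
proof (rule sol_unique[where a = "min s x" and b = "max s x" and s = s and A = A and c = 0
      and u = "phi n A s v" and v = "\<lambda>x i. \<Sum>j\<in>S. c j * phi n A s (w j) x i"])
  show "continuous_on {min s x..max s x} (\<lambda>x. A x i k)" if "i < n" "k < n" for i k
    by (rule continuous_on_subset[OF A[OF that]]) simp
  show "sol n A 0 (min s x) (max s x) (phi n A s v)" by (rule phi_sol[OF A])
  show "sol n A 0 (min s x) (max s x) (\<lambda>x i. \<Sum>j\<in>S. c j * phi n A s (w j) x i)"
    by (rule sol_sum[OF phi_sol[OF A]])
qed (use v i in \<open>auto simp: phi_init\<close>)

lemma phi_unique:
  assumes A: "\<And>i k. i < n \<Longrightarrow> k < n \<Longrightarrow> continuous_on UNIV (\<lambda>x. A x i k)" and i: "i < n"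
    and u: "sol n A 0 (min s x) (max s x) u" "\<And>i. i < n \<Longrightarrow> u s i = v i"
  shows "u x i = phi n A s v x i"
proof (rule sol_unique[where a = "min s x" and b = "max s x" and s = s, OF u(1) phi_sol[OF A]])
  show "continuous_on {min s x..max s x} (\<lambda>x. A x i k)" if "i < n" "k < n" for i k
    by (rule continuous_on_subset[OF A[OF that]]) simp
qed (use u i in \<open>auto simp: phi_init\<close>)

text \<open>Riemann sums are holomorphic in \<open>z\<close> and converge locally uniformly, because
  \<open>f\<close> is uniformly continuous on the unit interval times a closed disc.\<close>

lemma holomorphic_integral:
  fixes f :: "real \<Rightarrow> complex \<Rightarrow> complex"
  assumes S: "open S" and c: "continuous_on ({0..1} \<times> S) (\<lambda>(t,z). f t z)"
    and h: "\<And>t. t \<in> {0..1} \<Longrightarrow> f t holomorphic_on S"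
  shows "(\<lambda>z. integral {0..1} (\<lambda>t. f t z)) holomorphic_on S"
proof (rule holomorphic_uniform_sequence[OF S,
    where f = "\<lambda>N z. \<Sum>k<Suc N. (1 / real (Suc N)) *\<^sub>R f (real k / real (Suc N)) z"])
  fix N
  have "(\<lambda>z. \<Sum>k<Suc N. complex_of_real (1 / real (Suc N)) * f (real k / real (Suc N)) z) holomorphic_on S"
    by (intro holomorphic_on_sum holomorphic_on_mult holomorphic_on_const h) auto
  then show "(\<lambda>z. \<Sum>k<Suc N. (1 / real (Suc N)) *\<^sub>R f (real k / real (Suc N)) z) holomorphic_on S"
    by (simp add: scaleR_conv_of_real)
next
  fix x assume x: "x \<in> S"
  then obtain d where d: "d > 0" "cball x d \<subseteq> S" using S open_contains_cball by blast
  have cs: "continuous_on {0..1} (\<lambda>t. f t z)" if "z \<in> S" for z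
  proof -
    have "continuous_on {0..1} (\<lambda>t. case (t, z) of (t, z) \<Rightarrow> f t z)"
      by (rule continuous_on_compose2[OF c]) (use that in \<open>auto intro!: continuous_intros\<close>)
    then show ?thesis by simp
  qed
  have "uniform_limit (cball x d) (\<lambda>N z. \<Sum>k<Suc N. (1 / real (Suc N)) *\<^sub>R f (real k / real (Suc N)) z)
      (\<lambda>z. integral {0..1} (\<lambda>t. f t z)) sequentially"
  proof (rule uniform_limitI)
    fix e :: real assume e: "e > 0"
    have "uniformly_continuous_on ({0..1} \<times> cball x d) (\<lambda>(t,z). f t z)"
      using d by (intro compact_uniformly_continuous continuous_on_subset[OF c] compact_Times) auto
    then obtain \<delta> where \<delta>: "\<delta> > 0" "\<And>p q. p \<in> {0..1} \<times> cball x d \<Longrightarrow> q \<in> {0..1} \<times> cball x d \<Longrightarrow>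
        dist q p < \<delta> \<Longrightarrow> dist (case q of (t,z) \<Rightarrow> f t z) (case p of (t,z) \<Rightarrow> f t z) < e / 2"
      unfolding uniformly_continuous_on_def using e by (meson half_gt_zero)
    obtain N0 :: nat where N0: "1 / \<delta> < real N0" using reals_Archimedean2 by blast
    have "\<forall>z\<in>cball x d. dist (\<Sum>k<Suc N. (1 / real (Suc N)) *\<^sub>R f (real k / real (Suc N)) z)
        (integral {0..1} (\<lambda>t. f t z)) < e" if N: "N \<ge> N0" for N
    proof
      fix z assume z: "z \<in> cball x d"
      define m where "m = real (Suc N)"
      have m0: "1 / \<delta> < m" using N N0 by (simp add: m_def)
      have m: "m > 0" "1 / m < \<delta>"
        using m0 \<delta>(1) by (auto simp: m_def field_simps)
      define G where "G = (\<lambda>y. integral {0..y} (\<lambda>t. f t z))"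
      have G: "(G has_vector_derivative f t z) (at t within {0..1})" if "t \<in> {0..1}" for t
        unfolding G_def using cs z d that by (intro integral_has_vector_derivative) auto
      \<comment> \<open>On one cell the integral differs from the Riemann summand by at most the
        length times the oscillation bound \<open>e / 2\<close>: mean value inequality for
        \<open>G t - t *\<^sub>R f ?a z\<close>.\<close>
      have step: "norm (G (real (Suc k) / m) - G (real k / m) - (1 / m) *\<^sub>R f (real k / m) z) \<le> e / 2 * (1 / m)"
        if k: "k < Suc N" for k
      proof -
        let ?a = "real k / m" and ?b = "real (Suc k) / m"
        have ab: "?a < ?b" "0 \<le> ?a" "?b \<le> 1" "?b - ?a = 1 / m"
          using k m by (auto simp: m_def field_simps)
        have G': "((\<lambda>t. G t - t *\<^sub>R f ?a z) has_vector_derivative f t z - f ?a z) (at t within {0..1})"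
          if "t \<in> {0..1}" for t
          using G[OF that] by (auto intro!: derivative_eq_intros)
        have "norm ((G ?b - ?b *\<^sub>R f ?a z) - (G ?a - ?a *\<^sub>R f ?a z)) \<le> e / 2 * ?b - e / 2 * ?a"
        proof (rule differentiable_bound_general[OF ab(1), where f' = "\<lambda>t. f t z - f ?a z" and \<phi>' = "\<lambda>_. e / 2"])
          show "continuous_on {?a..?b} (\<lambda>t. G t - t *\<^sub>R f ?a z)"
            by (rule continuous_on_subset[of "{0..1}"])
               (use G' ab has_vector_derivative_continuous continuous_on_eq_continuous_within in \<open>blast, auto\<close>)
          show "continuous_on {?a..?b} ((*) (e / 2))" by (intro continuous_intros)
          fix t assume t: "?a < t" "t < ?b"
          then have t01: "t \<in> {0<..<1}" using ab by auto
          show "((*) (e / 2) has_vector_derivative e / 2) (at t)"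
            by (auto intro!: derivative_eq_intros simp: has_real_derivative_iff_has_vector_derivative[symmetric])
          show "((\<lambda>t. G t - t *\<^sub>R f ?a z) has_vector_derivative f t z - f ?a z) (at t)"
            using G'[of t] t01 at_within_interior[of t "{0..1}"] by auto
          have "dist (t, z) (?a, z) < \<delta>" using t ab m by (simp add: dist_Pair_Pair dist_real_def)
          then show "norm (f t z - f ?a z) \<le> e / 2"
            using \<delta>(2)[of "(?a, z)" "(t, z)"] t01 ab z by (auto simp: dist_norm)
        qed
        moreover have "(G ?b - ?b *\<^sub>R f ?a z) - (G ?a - ?a *\<^sub>R f ?a z) = G ?b - G ?a - (?b - ?a) *\<^sub>R f ?a z"
          by (simp add: algebra_simps)
        moreover have "e / 2 * ?b - e / 2 * ?a = e / 2 * (?b - ?a)" by (simp only: right_diff_distrib)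
        ultimately show ?thesis by (simp only: ab(4))
      qed
      have "(\<Sum>k<Suc N. G (real (Suc k) / m) - G (real k / m)) = G (real (Suc N) / m) - G (real 0 / m)"
        by (rule sum_lessThan_telescope)
      also have "\<dots> = integral {0..1} (\<lambda>t. f t z)"
        using m unfolding G_def by (simp add: m_def)
      finally have "integral {0..1} (\<lambda>t. f t z) - (\<Sum>k<Suc N. (1 / m) *\<^sub>R f (real k / m) z)
          = (\<Sum>k<Suc N. G (real (Suc k) / m) - G (real k / m) - (1 / m) *\<^sub>R f (real k / m) z)"
        by (simp only: sum_subtractf)
      also have "norm \<dots> \<le> (\<Sum>k<Suc N. e / 2 * (1 / m))"
        by (rule sum_norm_le) (use step in auto)
      also have "\<dots> = e / 2" 
        by (simp only: sum_constant card_lessThan m_def[symmetric]) (use m in simp)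
      also have "\<dots> < e" using e by simp
      finally show "dist (\<Sum>k<Suc N. (1 / real (Suc N)) *\<^sub>R f (real k / real (Suc N)) z)
        (integral {0..1} (\<lambda>t. f t z)) < e"
        unfolding m_def by (simp add: dist_norm norm_minus_commute)
    qed
    then show "\<forall>\<^sub>F N in sequentially. \<forall>z\<in>cball x d.
        dist (\<Sum>k<Suc N. (1 / real (Suc N)) *\<^sub>R f (real k / real (Suc N)) z) (integral {0..1} (\<lambda>t. f t z)) < e"
      by (auto simp: eventually_sequentially)
  qed
  then show "\<exists>d>0. cball x d \<subseteq> S \<and> uniform_limit (cball x d)
      (\<lambda>N z. \<Sum>k<Suc N. (1 / real (Suc N)) *\<^sub>R f (real k / real (Suc N)) z)
      (\<lambda>z. integral {0..1} (\<lambda>t. f t z)) sequentially"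
    using d by blast
qed

text \<open>Joint continuity is carried through the induction because
  \<open>holomorphic_integral\<close> requires it of the integrand.\<close>

lemma picard_holomorphic:
  fixes A :: "complex \<Rightarrow> real \<Rightarrow> nat \<Rightarrow> nat \<Rightarrow> complex"
  assumes S: "open S"
    and A: "\<And>i k. i < n \<Longrightarrow> k < n \<Longrightarrow> continuous_on (UNIV \<times> S) (\<lambda>(x,z). A z x i k)"
    and Ah: "\<And>i k x. i < n \<Longrightarrow> k < n \<Longrightarrow> (\<lambda>z. A z x i k) holomorphic_on S"
    and v: "\<And>i. i < n \<Longrightarrow> (\<lambda>z. v z i) holomorphic_on S"
    and i: "i < n"
  shows "continuous_on (UNIV \<times> S) (\<lambda>(x,z). picard n (A z) s (v z) k x i) \<and>
    (\<forall>x. (\<lambda>z. picard n (A z) s (v z) k x i) holomorphic_on S)"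
  using i
proof (induction k arbitrary: i)
  case 0
  have "continuous_on (UNIV \<times> S) (\<lambda>p. v (snd p) i)"
    by (rule continuous_on_compose2[OF holomorphic_on_imp_continuous_on[OF v[OF 0]]])
       (auto intro!: continuous_intros)
  then show ?case using v[OF 0] by (simp add: case_prod_unfold)
next
  case (Suc k)
  define f where "f = (\<lambda>t z. mv n (A z t) (picard n (A z) s (v z) k t) i)"
  have fc: "continuous_on (UNIV \<times> S) (\<lambda>p. f (fst p) (snd p))"
    unfolding f_def mv_def using A Suc by (auto intro!: continuous_intros simp: case_prod_unfold)
  have fh: "f t holomorphic_on S" for t
    unfolding f_def mv_def using Ah Suc by (auto intro!: holomorphic_intros)
  have fc': "continuous_on ((UNIV \<times> S) \<times> cbox 0 1) (\<lambda>(p,\<theta>). f (s + \<theta> * (fst p - s)) (snd p))"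
    unfolding case_prod_unfold
    by (rule continuous_on_compose2[OF fc, where f = "\<lambda>q. (s + snd q * (fst (fst q) - s), snd (fst q))",
          unfolded fst_conv snd_conv])
       (auto intro!: continuous_intros)
  have "continuous_on (UNIV \<times> S) (\<lambda>p. integral (cbox 0 1) (\<lambda>\<theta>. f (s + \<theta> * (fst p - s)) (snd p)))"
    by (rule integral_continuous_on_param[OF fc'])
  then have "continuous_on (UNIV \<times> S) (\<lambda>p. (fst p - s) *\<^sub>R integral {0..1} (\<lambda>\<theta>. f (s + \<theta> * (fst p - s)) (snd p)))"
    by (auto intro!: continuous_intros)
  moreover have "(\<lambda>z. oint (\<lambda>t. f t z) s x) holomorphic_on S" for x
  proof -
    have "(\<lambda>z. integral {0..1} (\<lambda>\<theta>. f (s + \<theta> * (x - s)) z)) holomorphic_on S"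
    proof (rule holomorphic_integral[OF S])
      show "continuous_on ({0..1} \<times> S) (\<lambda>(\<theta>, z). f (s + \<theta> * (x - s)) z)"
        unfolding case_prod_unfold
        by (rule continuous_on_compose2[OF fc, where f = "\<lambda>q. (s + fst q * (x - s), snd q)",
              unfolded fst_conv snd_conv])
           (auto intro!: continuous_intros)
    qed (rule fh)
    then show ?thesis unfolding oint_def scaleR_conv_of_real by (intro holomorphic_intros)
  qed
  ultimately show ?case by (simp add: f_def oint_def case_prod_unfold)
qed

text \<open>On a closed disc one bound \<open>a\<close> serves all matrices and one \<open>B\<close>
  all initial values, so the partial sums converge uniformly by the M-test.\<close>

lemma phi_holomorphic:
  fixes A :: "complex \<Rightarrow> real \<Rightarrow> nat \<Rightarrow> nat \<Rightarrow> complex"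
  assumes S: "open S"
    and A: "\<And>i k. i < n \<Longrightarrow> k < n \<Longrightarrow> continuous_on (UNIV \<times> S) (\<lambda>(x,z). A z x i k)"
    and Ah: "\<And>i k x. i < n \<Longrightarrow> k < n \<Longrightarrow> (\<lambda>z. A z x i k) holomorphic_on S"
    and v: "\<And>i. i < n \<Longrightarrow> (\<lambda>z. v z i) holomorphic_on S"
    and i: "i < n"
  shows "(\<lambda>z. phi n (A z) s (v z) x i) holomorphic_on S"
  unfolding phi_def
proof (rule holomorphic_uniform_sequence[OF S, where f = "\<lambda>N z. \<Sum>k<N. picard n (A z) s (v z) k x i"])
  show "(\<lambda>z. \<Sum>k<N. picard n (A z) s (v z) k x i) holomorphic_on S" for N
    using picard_holomorphic[OF S A Ah v i] by (intro holomorphic_on_sum) auto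
  fix z0 assume "z0 \<in> S"
  then obtain d where d: "d > 0" "cball z0 d \<subseteq> S" using S open_contains_cball by blast
  define M where "M = \<bar>x - s\<bar>"
  let ?K = "{s - M..s + M} \<times> cball z0 d"
  obtain a where a: "a > 0" "\<And>p i k. p \<in> ?K \<Longrightarrow> i < n \<Longrightarrow> k < n \<Longrightarrow> cmod (A (snd p) (fst p) i k) \<le> a"
  proof (rule matrix_bounded[of n ?K "\<lambda>p. A (snd p) (fst p)"])
    show "continuous_on ?K (\<lambda>p. A (snd p) (fst p) i k)" if "i < n" "k < n" for i k
      using d by (intro continuous_on_subset[OF A[OF that, unfolded case_prod_unfold]]) auto
  qed (auto intro: compact_Times)
  obtain B where B: "B > 0" "\<And>z i k. z \<in> cball z0 d \<Longrightarrow> i < n \<Longrightarrow> k < n \<Longrightarrow> cmod (v z i) \<le> B"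
    by (rule matrix_bounded[of n "cball z0 d" "\<lambda>z i k. v z i"])
       (use d v holomorphic_on_imp_continuous_on continuous_on_subset in \<open>blast, auto\<close>)
  have "cmod (picard n (A z) s (v z) k x i) \<le> B * exp (2 * real n * a * M) * (1/2) ^ k"
    if z: "z \<in> cball z0 d" for k z
  proof -
    have Az: "continuous_on UNIV (\<lambda>x. A z x i k)" if "i < n" "k < n" for i k
      by (rule continuous_on_compose2[OF A[OF that], where f = "\<lambda>x. (x, z)", unfolded prod.case])
         (use z d in \<open>auto intro!: continuous_intros\<close>)
    have "cmod (picard n (A z) s (v z) k x i) \<le> B * (1/2) ^ k * exp (2 * real n * a * \<bar>x - s\<bar>)"
    proof (rule picard_bound[OF Az i, where M = M])
      show "cmod (A z t i k) \<le> a" if "i < n" "k < n" "\<bar>t - s\<bar> \<le> M" for i k t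
        using a(2)[of "(t, z)" i k] that z by (simp add: abs_le_iff)
    qed (use a B z i in \<open>auto simp: M_def\<close>)
    then show ?thesis by (simp add: M_def mult_ac)
  qed
  moreover have "summable (\<lambda>k. B * exp (2 * real n * a * M) * (1/2) ^ k)"
    by (intro summable_mult summable_geometric) simp
  ultimately have "uniform_limit (cball z0 d) (\<lambda>N z. \<Sum>k<N. picard n (A z) s (v z) k x i)
      (\<lambda>z. \<Sum>k. picard n (A z) s (v z) k x i) sequentially"
    by (rule Weierstrass_m_test)
  then show "\<exists>d>0. cball z0 d \<subseteq> S \<and> uniform_limit (cball z0 d)
      (\<lambda>N z. \<Sum>k<N. picard n (A z) s (v z) k x i) (\<lambda>z. \<Sum>k. picard n (A z) s (v z) k x i) sequentially"
    using d by blast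
qed

section \<open>Coordinates with respect to a basis\<close>

lemma minor_cofactor_right_inverse:
  assumes "k < n" "i < n"
  shows "(\<Sum>j<n. c j k * minor_cofactor n c j i) = (if k = i then D n c else 0)"
proof -
  let ?A = "Matrix.mat n n (\<lambda>(i,j). c j i)"
  have A: "?A \<in> carrier_mat n n" by simp
  have "(?A * adj_mat ?A) $$ (k, i) = (if k = i then D n c else 0)"
    using assms unfolding adj_mat(2)[OF A] D_def by simp
  then show ?thesis using assms
    by (simp add: adj_mat_def scalar_prod_def minor_cofactor_def atLeast0LessThan)
qed

text \<open>Coordinates by Cramer's rule: the quotients of cofactors are the entries of the inverse
  matrix. The explicit formula is linear in \<open>u\<close> and continuous in \<open>u\<close> and
  \<open>V\<close> where \<open>D n V\<close> is nonzero.\<close>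

definition crd :: "nat \<Rightarrow> (nat \<Rightarrow> nat \<Rightarrow> complex) \<Rightarrow> (nat \<Rightarrow> complex) \<Rightarrow> nat \<Rightarrow> complex" where
  "crd n V u l = (\<Sum>i<n. minor_cofactor n V l i / D n V * u i)"

lemma crd_expand:
  assumes "D n V \<noteq> 0" "i < n"
  shows "u i = (\<Sum>l<n. crd n V u l * V l i)"
proof -
  have "(\<Sum>l<n. crd n V u l * V l i) = (\<Sum>l<n. \<Sum>k<n. u k / D n V * (V l i * minor_cofactor n V l k))"
    by (simp add: crd_def sum_distrib_left sum_distrib_right mult_ac)
  also have "\<dots> = (\<Sum>k<n. u k / D n V * (\<Sum>l<n. V l i * minor_cofactor n V l k))"
    by (subst sum.swap) (simp add: sum_distrib_left)
  also have "\<dots> = u i" using assms by (simp add: minor_cofactor_right_inverse if_distrib sum.delta cong: if_cong)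
  finally show ?thesis ..
qed

lemma crd_unique:
  assumes "D n V \<noteq> 0" "\<And>i. i < n \<Longrightarrow> u i = (\<Sum>l<n. a l * V l i)" "k < n"
  shows "crd n V u k = a k"
proof -
  have "(\<Sum>l<n. (crd n V u l - a l) * V l i) = 0" if "i < n" for i
    using crd_expand[OF assms(1) that, of u] assms(2)[OF that]
    by (simp add: left_diff_distrib sum_subtractf)
  from D_independent[OF assms(1) this assms(3)] show ?thesis by simp
qed

lemma crd_basis:
  assumes "D n V \<noteq> 0" "k < n" "j < n"
  shows "crd n V (V j) k = (if k = j then 1 else 0)"
proof (rule crd_unique[OF assms(1) _ assms(2)])
  fix i
  have "(\<Sum>l<n. (if l = j then 1 else 0) * V l i) = (\<Sum>l<n. if l = j then V l i else 0)"
    by (intro sum.cong) auto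
  then show "V j i = (\<Sum>l<n. (if l = j then 1 else 0) * V l i)" using assms(3) by simp
qed

lemma crd_cong: "(\<And>i. i < n \<Longrightarrow> u i = v i) \<Longrightarrow> crd n V u k = crd n V v k"
  by (simp add: crd_def)

lemma crd_sum: "crd n V (\<lambda>i. \<Sum>j\<in>S. a j * u j i) k = (\<Sum>j\<in>S. a j * crd n V (u j) k)"
  unfolding crd_def sum_distrib_left by (subst sum.swap) (simp add: mult_ac)

lemma crd_diff: "crd n V (\<lambda>i. u i - v i) k = crd n V u k - crd n V v k"
  by (simp add: crd_def right_diff_distrib sum_subtractf)

lemma crd_scale: "crd n V (\<lambda>i. a * u i) k = a * crd n V u k"
  by (simp add: crd_def sum_distrib_left mult_ac)

lemma deriv_on_crd:
  assumes "\<And>i. i < n \<Longrightarrow> deriv_on a b (\<lambda>x. u x i) (\<lambda>x. u' x i)"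
  shows "deriv_on a b (\<lambda>x. crd n V (u x) k) (\<lambda>x. crd n V (u' x) k)"
proof -
  have 1: "deriv_on a b (\<lambda>x. crd n V (u x) k)
      (\<lambda>x. \<Sum>i<n. minor_cofactor n V k i / D n V * u' x i + 0 * u x i)"
    unfolding crd_def using assms by (intro deriv_on_sum deriv_on_mult deriv_on_const) auto
  show ?thesis by (rule deriv_on_cong[OF 1]) (simp add: crd_def)
qed

lemma tendsto_crd:
  assumes "\<And>i. i < n \<Longrightarrow> ((\<lambda>x. u x i) \<longlongrightarrow> v i) F"
  shows "((\<lambda>x. crd n V (u x) k) \<longlongrightarrow> crd n V v k) F"
  unfolding crd_def using assms by (intro tendsto_intros) auto

lemma tendsto_D:
  assumes "\<And>i j. i < n \<Longrightarrow> j < n \<Longrightarrow> ((\<lambda>x. c x j i) \<longlongrightarrow> c' j i) F"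
  shows "((\<lambda>x. D n (c x)) \<longlongrightarrow> D n c') F"
  unfolding D_expand
  by (intro tendsto_intros assms) (auto dest: permutes_in_image)

section \<open>Scalar equations\<close>

lemma deriv_on_increment:
  fixes \<Lambda> \<kappa> :: "real \<Rightarrow> real"
  assumes ab: "a \<le> b" and f: "deriv_on a b f f'"
    and le: "\<And>x. a < x \<Longrightarrow> x < b \<Longrightarrow> cmod (f' x) \<le> \<kappa> x"
    and L: "\<And>x. a < x \<Longrightarrow> x < b \<Longrightarrow> (\<Lambda> has_real_derivative \<kappa> x) (at x)" "continuous_on {a..b} \<Lambda>"
  shows "cmod (f b - f a) \<le> \<Lambda> b - \<Lambda> a"
proof (cases "a = b")
  case False
  then have "a < b" using ab by simp
  then show ?thesis
    by (rule differentiable_bound_general[where f' = f' and \<phi>' = \<kappa>])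
       (use f L le in \<open>auto simp: deriv_on_def has_real_derivative_iff_has_vector_derivative\<close>)
qed simp

text \<open>Gronwall's inequality as the case of a one-point index set, with
  \<open>\<mu> = 0\<close> and the whole coefficient as perturbation.\<close>

lemma scalar_backward_bound:
  fixes \<Lambda> \<kappa> :: "real \<Rightarrow> real"
  assumes ab: "a \<le> b" and f: "deriv_on a b f (\<lambda>x. c x * f x)"
    and le: "\<And>x. a < x \<Longrightarrow> x < b \<Longrightarrow> cmod (c x) \<le> \<kappa> x"
    and L: "\<And>x. a < x \<Longrightarrow> x < b \<Longrightarrow> (\<Lambda> has_real_derivative \<kappa> x) (at x)" "continuous_on {a..b} \<Lambda>"
    and B: "\<Lambda> b - \<Lambda> a \<le> B"
  shows "cmod (f a) \<le> exp B * cmod (f b)"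
proof -
  have "(\<Sum>g\<in>{()}. cmod (f a)) \<le> card {()} * exp (card {()} * B) * (\<Sum>g\<in>{()}. cmod (f b))"
  proof (rule backward_bound[where w = "\<lambda>_. f" and h = "\<lambda>_ x. c x * f x" and \<mu> = "\<lambda>_. 0" and \<kappa> = \<kappa> and \<Lambda> = \<Lambda>])
    fix x assume x: "a < x" "x < b"
    show "0 \<le> \<kappa> x" using le[OF x] norm_ge_zero order_trans by blast
    show "cmod (c x * f x) \<le> \<kappa> x * (\<Sum>g\<in>{()}. cmod (f x))"
      using le[OF x] by (simp add: norm_mult mult_right_mono)
  qed (use ab f L B in auto)
  then show ?thesis by simp
qed

text \<open>No sign condition on the coefficient is involved, so reflection turns the backward bound
  into a forward one.\<close>

lemma scalar_forward_bound:
  fixes \<Lambda> \<kappa> :: "real \<Rightarrow> real"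
  assumes ab: "a \<le> b" and f: "deriv_on a b f (\<lambda>x. c x * f x)"
    and le: "\<And>x. a < x \<Longrightarrow> x < b \<Longrightarrow> cmod (c x) \<le> \<kappa> x"
    and L: "\<And>x. a < x \<Longrightarrow> x < b \<Longrightarrow> (\<Lambda> has_real_derivative \<kappa> x) (at x)" "continuous_on {a..b} \<Lambda>"
    and B: "\<Lambda> b - \<Lambda> a \<le> B"
  shows "cmod (f b) \<le> exp B * cmod (f a)"
proof -
  have "cmod (f (- (- b))) \<le> exp B * cmod (f (- (- a)))"
  proof (rule scalar_backward_bound[where f = "\<lambda>x. f (- x)" and c = "\<lambda>x. - c (- x)"
      and \<kappa> = "\<lambda>x. \<kappa> (- x)" and \<Lambda> = "\<lambda>x. - \<Lambda> (- x)"])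
    show "deriv_on (- b) (- a) (\<lambda>x. f (- x)) (\<lambda>x. - c (- x) * f (- x))"
      using deriv_on_reflect[OF f] by simp
    show "continuous_on {- b..- a} (\<lambda>x. - \<Lambda> (- x))"
      by (intro continuous_on_minus, rule continuous_on_compose2[where f = uminus, OF L(2)])
         (auto intro!: continuous_intros)
    fix x assume x: "- b < x" "x < - a"
    have "(\<Lambda> has_real_derivative \<kappa> (- x)) (at (- x))" using x by (intro L) auto
    then have "((\<lambda>x. \<Lambda> (- x)) has_real_derivative \<kappa> (- x) * - 1) (at x)"
      by (rule DERIV_chain2) (auto intro!: derivative_eq_intros)
    then show "((\<lambda>x. - \<Lambda> (- x)) has_real_derivative \<kappa> (- x)) (at x)"
      by (auto intro!: derivative_eq_intros)
    show "cmod (- c (- x)) \<le> \<kappa> (- x)" using le[of "- x"] x by simp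
  qed (use ab B in auto)
  then show ?thesis by simp
qed

section \<open>Minors of solution matrices\<close>

text \<open>The columns in the positions \<open>J\<close> are basis vectors that belong to exponents with positive
  real part. The other columns evolve, rescaled by the remaining exponents, so that no minor
  can grow when \<open>x\<close> decreases.\<close>
locale frame =
  fixes n :: nat and J :: "nat set" and V :: "nat \<Rightarrow> nat \<Rightarrow> complex" and nu :: "nat \<Rightarrow> complex"
    and A :: "real \<Rightarrow> nat \<Rightarrow> nat \<Rightarrow> complex" and rho :: "real \<Rightarrow> nat \<Rightarrow> nat \<Rightarrow> complex"
    and T :: "real set" and \<kappa> \<Lambda> :: "real \<Rightarrow> real" and BL :: real
  assumes J: "J \<subseteq> {..<n}"
    and detV: "D n V \<noteq> 0"
    and pos: "\<And>l. l \<in> J \<Longrightarrow> Re (nu l) > 0"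
    and neg: "\<And>l. l < n \<Longrightarrow> l \<notin> J \<Longrightarrow> Re (nu l) < 0"
    and AV: "\<And>x l i. x \<in> T \<Longrightarrow> l < n \<Longrightarrow> i < n \<Longrightarrow>
        mv n (A x) (V l) i = nu l * V l i + (\<Sum>k<n. rho x k l * V k i)"
    and rho: "\<And>x k l. x \<in> T \<Longrightarrow> k < n \<Longrightarrow> l < n \<Longrightarrow> cmod (rho x k l) \<le> \<kappa> x"
    and \<kappa>: "\<And>x. x \<in> T \<Longrightarrow> \<kappa> x \<ge> 0"
    and \<Lambda>: "\<And>x. x \<in> T \<Longrightarrow> (\<Lambda> has_real_derivative \<kappa> x) (at x)"
    and BL: "\<And>a b. a \<in> T \<Longrightarrow> b \<in> T \<Longrightarrow> \<Lambda> b - \<Lambda> a \<le> BL"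
    and T: "\<And>a b. a \<in> T \<Longrightarrow> b \<in> T \<Longrightarrow> {a..b} \<subseteq> T"
begin

lemma finJ: "finite J" using J finite_subset by blast

text \<open>Non-injective maps are included so that the set is closed under the updates
  \<open>g(j := k)\<close> that occur in \<open>hw\<close>; their minors vanish.\<close>

definition "G = PiE J (\<lambda>_. {..<n})"

text \<open>For injective \<open>g\<close>, and up to sign and the factor \<open>D n V\<close>, \<open>w Y g\<close> is the minor of the
  coordinates of \<open>Y\<close> in the rows outside \<open>g ` J\<close>. It satisfies \<open>w' = mu g * w + hw\<close>, where
  \<open>Re (mu g) \<ge> 0\<close> because \<open>J\<close> collects all exponents with positive real part.\<close>
definition "w Y g = D n (\<lambda>j. if j \<in> J then V (g j) else Y j)"

text \<open>Every basis vector stays in its own position: the exponent is zero, and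
  \<open>w Y idg\<close> is \<open>D n V\<close> times the minor of \<open>Y\<close> in the
  coordinates outside \<open>J\<close>.\<close>

definition "idg = restrict id J"

definition "mu g = (\<Sum>j\<in>J. nu j) - (\<Sum>j\<in>J. nu (g j))"

definition "trr x = (\<Sum>k<n. rho x k k)"

definition "hw x f g = trr x * f g - (\<Sum>j\<in>J. \<Sum>k<n. rho x k (g j) * f (g(j := k)))"

text \<open>There are \<open>n\<close> summands in \<open>trr\<close> and at most
  \<open>n * n\<close> in the double sum of \<open>hw\<close>, each with a factor bounded by
  \<kappa>.\<close>

definition "c0 = real n + real n * real n"

text \<open>The constant of \<open>backward_bound\<close> when \<open>c0 * \<kappa>\<close> takes
  the place of \<kappa>; its integral is at most \<open>c0 * BL\<close>.\<close>

definition "CW = card G * exp (card G * (c0 * BL))"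

lemma finG: "finite G" unfolding G_def using finJ by (intro finite_PiE) auto

lemma idg_G: "idg \<in> G" using J by (auto simp: idg_def G_def)

lemma w_idg: "w Y idg = D n (\<lambda>j. if j \<in> J then V j else Y j)"
  unfolding w_def by (rule D_cong) (auto simp: idg_def)

lemma w_V_idg: "w V idg = D n V"
  unfolding w_idg by (rule D_cong) auto

lemma mu_idg: "mu idg = 0"
  unfolding mu_def idg_def by simp

lemma upd_G: "g \<in> G \<Longrightarrow> j \<in> J \<Longrightarrow> k < n \<Longrightarrow> g(j := k) \<in> G"
  by (auto simp: G_def PiE_def extensional_def)

lemma G_less: "g \<in> G \<Longrightarrow> j \<in> J \<Longrightarrow> g j < n"
  by (auto simp: G_def)

text \<open>The trace is read off in the basis \<open>V\<close>: by \<open>D_trace\<close>, letting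
  \<open>A x\<close> act on one column of \<open>V\<close> at a time produces the diagonal
  coefficients \<open>nu l + rho x l l\<close>.\<close>

lemma trace_A:
  assumes x: "x \<in> T"
  shows "(\<Sum>i<n. A x i i) = (\<Sum>l<n. nu l) + trr x"
proof -
  have *: "D n (V(l := mv n (A x) (V l))) = (nu l + rho x l l) * D n V" if l: "l < n" for l
  proof -
    have "D n (V(l := mv n (A x) (V l))) = ((if l = l then nu l else 0) + rho x l l) * D n V"
    proof (rule D_replace[OF l, where a = "\<lambda>k. (if k = l then nu l else 0) + rho x k l"])
      fix i assume i: "i < n"
      have "(\<Sum>k<n. (if k = l then nu l else 0) * V k i) = (\<Sum>k<n. if k = l then nu l * V l i else 0)"
        by (intro sum.cong) auto
      then show "mv n (A x) (V l) i = (\<Sum>k<n. ((if k = l then nu l else 0) + rho x k l) * V k i)"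
        using l by (simp add: AV[OF x l i] distrib_right sum.distrib)
    qed
    then show ?thesis by simp
  qed
  have "(\<Sum>i<n. A x i i) * D n V = (\<Sum>l<n. (nu l + rho x l l) * D n V)"
    unfolding D_trace[symmetric] using * by (intro sum.cong) auto
  then show ?thesis using detV by (simp add: sum.distrib trr_def sum_distrib_right[symmetric])
qed

text \<open>Liouville's formula. With a full set of exponents the shifts by \<open>nu j\<close>
  cancel the constant part of the trace; only \<open>trr\<close>, bounded by multiples of \<kappa>,
  remains.\<close>

lemma deriv_D_columns:
  assumes T': "{a..b} \<subseteq> T"
    and Y: "\<And>j. j < n \<Longrightarrow> sol n A (nu j) a b (\<lambda>x. Y x j)"
  shows "deriv_on a b (\<lambda>x. D n (Y x)) (\<lambda>x. trr x * D n (Y x))"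
proof -
  have d: "deriv_on a b (\<lambda>x. D n (Y x))
     (\<lambda>x. \<Sum>j<n. D n ((Y x)(j := (\<lambda>i. mv n (A x) (Y x j) i - nu j * Y x j i))))"
    by (rule deriv_on_D[where c' = "\<lambda>x j i. mv n (A x) (Y x j) i - nu j * Y x j i"])
       (use Y in \<open>auto simp: sol_def\<close>)
  show ?thesis
  proof (rule deriv_on_cong[OF d])
    fix x assume x: "a < x" "x < b"
    then have xT: "x \<in> T" using T' by auto
    have "(\<Sum>j<n. D n ((Y x)(j := (\<lambda>i. mv n (A x) (Y x j) i - nu j * Y x j i))))
        = (\<Sum>j<n. D n ((Y x)(j := mv n (A x) (Y x j))) - nu j * D n (Y x))"
    proof (intro sum.cong refl)
      fix j assume j: "j \<in> {..<n}"
      have "D n ((Y x)(j := (\<lambda>i. mv n (A x) (Y x j) i - nu j * Y x j i)))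
         = D n ((Y x)(j := mv n (A x) (Y x j))) - nu j * D n ((Y x)(j := Y x j))"
        using j by (simp only: D_upd lessThan_iff) (simp add: left_diff_distrib sum_subtractf sum_distrib_left mult.assoc)
      then show "D n ((Y x)(j := (\<lambda>i. mv n (A x) (Y x j) i - nu j * Y x j i)))
         = D n ((Y x)(j := mv n (A x) (Y x j))) - nu j * D n (Y x)" by simp
    qed
    also have "\<dots> = trr x * D n (Y x)"
      unfolding sum_subtractf D_trace trace_A[OF xT] by (simp add: sum_distrib_right algebra_simps)
    finally show "(\<Sum>j<n. D n ((Y x)(j := (\<lambda>i. mv n (A x) (Y x j) i - nu j * Y x j i)))) = trr x * D n (Y x)" .
  qed
qed

text \<open>The columns in \<open>J\<close> are constant, so the derivative acts outside
  \<open>J\<close> only. This action is the trace minus the action of \<open>A\<close> on the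
  columns in \<open>J\<close>, and there \<open>AV\<close> yields exponents and updates of
  \<open>g\<close>.\<close>

lemma deriv_w:
  assumes T': "{a..b} \<subseteq> T" and g: "g \<in> G"
    and Y: "\<And>j. j < n \<Longrightarrow> j \<notin> J \<Longrightarrow> sol n A (nu j) a b (\<lambda>x. Y x j)"
  shows "deriv_on a b (\<lambda>x. w (Y x) g) (\<lambda>x. mu g * w (Y x) g + hw x (w (Y x)) g)"
proof -
  define c where "c = (\<lambda>x j. if j \<in> J then V (g j) else Y x j)"
  define c' where "c' = (\<lambda>x j i. if j \<in> J then 0 else mv n (A x) (Y x j) i - nu j * Y x j i)"
  have wc: "w (Y x) g = D n (c x)" for x by (simp add: w_def c_def)
  have d: "deriv_on a b (\<lambda>x. D n (c x)) (\<lambda>x. \<Sum>j<n. D n ((c x)(j := c' x j)))"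
  proof (rule deriv_on_D)
    fix j i assume "j < n" "i < n"
    then show "deriv_on a b (\<lambda>x. c x j i) (\<lambda>x. c' x j i)"
      using Y by (cases "j \<in> J") (auto simp: c_def c'_def deriv_on_const sol_def)
  qed
  show ?thesis unfolding wc
  proof (rule deriv_on_cong[OF d])
    fix x assume x: "a < x" "x < b"
    then have xT: "x \<in> T" using T' by auto
    have j1: "D n ((c x)(j := c' x j)) = D n ((c x)(j := mv n (A x) (c x j))) - nu j * D n (c x)"
      if j: "j < n" "j \<notin> J" for j
    proof -
      have "D n ((c x)(j := c' x j)) = D n ((c x)(j := mv n (A x) (c x j))) - nu j * D n ((c x)(j := c x j))"
        using j by (simp only: D_upd)
          (simp add: c'_def c_def left_diff_distrib sum_subtractf sum_distrib_left mult.assoc)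
      then show ?thesis by simp
    qed
    have j2: "D n ((c x)(j := mv n (A x) (c x j))) - nu (g j) * D n (c x)
        = (\<Sum>k<n. rho x k (g j) * w (Y x) (g(j := k)))" if j: "j \<in> J" for j
    proof -
      have jn: "j < n" using j J by auto
      have gj: "g j < n" by (rule G_less[OF g j])
      have "D n ((c x)(j := mv n (A x) (c x j)))
         = (\<Sum>i<n. (nu (g j) * V (g j) i + (\<Sum>k<n. rho x k (g j) * V k i)) * minor_cofactor n (c x) j i)"
        using j by (simp add: D_upd[OF jn] c_def AV[OF xT gj])
      also have "\<dots> = nu (g j) * (\<Sum>i<n. V (g j) i * minor_cofactor n (c x) j i)
         + (\<Sum>i<n. \<Sum>k<n. rho x k (g j) * (V k i * minor_cofactor n (c x) j i))"
        by (simp add: distrib_right sum.distrib sum_distrib_left sum_distrib_right mult.assoc)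
      also have "(\<Sum>i<n. \<Sum>k<n. rho x k (g j) * (V k i * minor_cofactor n (c x) j i))
         = (\<Sum>k<n. rho x k (g j) * D n ((c x)(j := V k)))"
        by (subst sum.swap) (simp add: D_upd[OF jn] sum_distrib_left)
      also have "(\<Sum>i<n. V (g j) i * minor_cofactor n (c x) j i) = D n (c x)"
        using D_upd[OF jn, of "c x" "V (g j)"] j by (simp add: c_def fun_upd_idem)
      also have "(\<lambda>k. D n ((c x)(j := V k))) = (\<lambda>k. w (Y x) (g(j := k)))"
        unfolding w_def c_def using j by (intro ext D_cong) auto
      finally show ?thesis by (simp del: fun_upd_apply)
    qed
    have "(\<Sum>j<n. D n ((c x)(j := c' x j)))
        = (\<Sum>j\<in>{..<n} - J. D n ((c x)(j := c' x j))) + (\<Sum>j\<in>J. D n ((c x)(j := c' x j)))"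
      by (rule sum.subset_diff[OF J]) simp
    also have "(\<Sum>j\<in>J. D n ((c x)(j := c' x j))) = 0"
      by (rule sum.neutral) (use J in \<open>auto simp: D_upd c'_def\<close>)
    also have "(\<Sum>j\<in>{..<n} - J. D n ((c x)(j := c' x j)))
        = (\<Sum>j\<in>{..<n} - J. D n ((c x)(j := mv n (A x) (c x j)))) - (\<Sum>j\<in>{..<n} - J. nu j) * D n (c x)"
      by (simp add: j1 sum_subtractf sum_distrib_right)
    also have "(\<Sum>j\<in>{..<n} - J. D n ((c x)(j := mv n (A x) (c x j))))
        = (\<Sum>i<n. A x i i) * D n (c x) - (\<Sum>j\<in>J. D n ((c x)(j := mv n (A x) (c x j))))"
      unfolding D_trace[symmetric] by (subst sum.subset_diff[OF J]) simp_all
    also have "(\<Sum>j\<in>J. D n ((c x)(j := mv n (A x) (c x j))))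
        = (\<Sum>j\<in>J. nu (g j)) * D n (c x) + (\<Sum>j\<in>J. \<Sum>k<n. rho x k (g j) * w (Y x) (g(j := k)))"
      by (simp add: j2[symmetric] sum_subtractf sum_distrib_right)
    also have "(\<Sum>i<n. A x i i) = (\<Sum>j\<in>{..<n} - J. nu j) + (\<Sum>j\<in>J. nu j) + trr x"
      unfolding trace_A[OF xT] by (subst sum.subset_diff[OF J]) simp_all
    finally show "(\<Sum>j<n. D n ((c x)(j := c' x j))) = mu g * D n (c x) + hw x (w (Y x)) g"
      unfolding hw_def wc mu_def by (simp add: algebra_simps del: fun_upd_apply)
  qed
qed

lemma w_noninj:
  assumes "\<not> inj_on g J"
  shows "w Y g = 0"
proof -
  obtain i j where "i \<in> J" "j \<in> J" "i \<noteq> j" "g i = g j" using assms by (auto simp: inj_on_def)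
  then show ?thesis unfolding w_def using J by (intro D_equal_columns[of i n j]) auto
qed

lemma mu_pos:
  assumes g: "g \<in> G"
  shows "Re (mu g) \<ge> 0 \<or> w Y g = 0"
proof (cases "inj_on g J")
  case True
  have gJ: "g ` J \<subseteq> {..<n}" using G_less[OF g] by auto
  have "(\<Sum>j\<in>J. Re (nu (g j))) = (\<Sum>l\<in>g ` J. Re (nu l))"
    using True by (simp add: sum.reindex)
  also have "\<dots> = (\<Sum>l\<in>g ` J \<inter> J. Re (nu l)) + (\<Sum>l\<in>g ` J - J. Re (nu l))"
    using finJ by (subst sum.Int_Diff[of _ _ J]) auto
  also have "(\<Sum>l\<in>g ` J - J. Re (nu l)) \<le> 0"
    using gJ neg by (intro sum_nonpos) (auto intro: less_imp_le)
  also have "(\<Sum>l\<in>g ` J \<inter> J. Re (nu l)) \<le> (\<Sum>l\<in>J. Re (nu l))"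
    using finJ pos by (intro sum_mono2) (auto intro: less_imp_le)
  finally show ?thesis by (simp add: mu_def)
qed (simp add: w_noninj)

text \<open>If \<open>g\<close> permutes \<open>J\<close>, its exponent is zero; otherwise a column
  is repeated. Hence \<open>w V\<close> is stationary for the unperturbed equation, which is what
  \<open>w_rate\<close> subtracts.\<close>

lemma mu_w_V:
  assumes g: "g \<in> G"
  shows "mu g * w V g = 0"
proof (cases "inj_on g J \<and> g ` J \<subseteq> J")
  case True
  then have "g ` J = J" using finJ by (simp add: endo_inj_surj)
  then have "(\<Sum>j\<in>J. nu (g j)) = (\<Sum>l\<in>J. nu l)"
    using True sum.reindex[of g J nu] by simp
  then show ?thesis by (simp add: mu_def)
next
  case False
  show ?thesis
  proof (cases "inj_on g J")
    case True
    then obtain j where j: "j \<in> J" "g j \<notin> J" using False by auto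
    then have "w V g = 0" unfolding w_def
      using J G_less[OF g j(1)] by (intro D_equal_columns[of j n "g j"]) auto
    then show ?thesis by simp
  qed (simp add: w_noninj)
qed

lemma hw_bound:
  assumes x: "x \<in> T" and g: "g \<in> G"
  shows "cmod (hw x f g) \<le> c0 * \<kappa> x * (\<Sum>g\<in>G. cmod (f g))"
proof -
  let ?S = "\<Sum>g\<in>G. cmod (f g)"
  have fS: "cmod (f g) \<le> ?S" if "g \<in> G" for g using that finG by (intro member_le_sum) auto
  have S0: "?S \<ge> 0" by (simp add: sum_nonneg)
  have tr: "cmod (trr x) \<le> n * \<kappa> x"
    unfolding trr_def using sum_norm_bound[of "{..<n}" "\<lambda>k. rho x k k" "\<kappa> x"] rho[OF x] by auto
  have "cmod (\<Sum>k<n. rho x k (g j) * f (g(j := k))) \<le> n * (\<kappa> x * ?S)" if j: "j \<in> J" for j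
  proof -
    have "cmod (rho x k (g j) * f (g(j := k))) \<le> \<kappa> x * ?S" if "k < n" for k
      unfolding norm_mult using that j g x \<kappa>[OF x]
      by (intro mult_mono rho fS upd_G[OF g] G_less[OF g]) auto
    then show ?thesis using sum_norm_bound[of "{..<n}" "\<lambda>k. rho x k (g j) * f (g(j := k))" "\<kappa> x * ?S"] by simp
  qed
  then have "cmod (\<Sum>j\<in>J. \<Sum>k<n. rho x k (g j) * f (g(j := k))) \<le> card J * (n * (\<kappa> x * ?S))"
    using sum_norm_bound[of J "\<lambda>j. \<Sum>k<n. rho x k (g j) * f (g(j := k))" "n * (\<kappa> x * ?S)"] by simp
  also have "\<dots> \<le> n * (n * (\<kappa> x * ?S))"
    using card_mono[OF _ J] \<kappa>[OF x] S0 by (intro mult_right_mono) auto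
  finally have 1: "cmod (\<Sum>j\<in>J. \<Sum>k<n. rho x k (g j) * f (g(j := k))) \<le> n * (n * (\<kappa> x * ?S))" .
  have 2: "cmod (trr x * f g) \<le> n * \<kappa> x * ?S"
    unfolding norm_mult using tr fS[OF g] \<kappa>[OF x] by (intro mult_mono) auto
  have "cmod (hw x f g) \<le> n * \<kappa> x * ?S + n * (n * (\<kappa> x * ?S))"
    unfolding hw_def by (rule order_trans[OF norm_triangle_ineq4 add_mono[OF 2 1]])
  then show ?thesis by (simp add: c0_def algebra_simps)
qed

lemma c0_nonneg: "c0 \<ge> 0" by (simp add: c0_def)

lemma cont_\<Lambda>: "{a..b} \<subseteq> T \<Longrightarrow> continuous_on {a..b} \<Lambda>"
  using \<Lambda> by (meson DERIV_isCont continuous_at_imp_continuous_on subsetD)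

lemma CW_nonneg: "CW \<ge> 0" by (simp add: CW_def)

text \<open>\<open>w\<close> is not additive in its columns, but the minors of \<open>Y\<close> and
  of \<open>Z\<close> solve the same linear system, so their difference falls under
  \<open>backward_bound\<close> as well.\<close>

lemma w_diff_bound:
  assumes ab: "a \<le> b" "a \<in> T" "b \<in> T"
    and Y: "\<And>j. j < n \<Longrightarrow> j \<notin> J \<Longrightarrow> sol n A (nu j) a b (\<lambda>x. Y x j)"
    and Z: "\<And>j. j < n \<Longrightarrow> j \<notin> J \<Longrightarrow> sol n A (nu j) a b (\<lambda>x. Z x j)"
  shows "(\<Sum>g\<in>G. cmod (w (Y a) g - w (Z a) g)) \<le> CW * (\<Sum>g\<in>G. cmod (w (Y b) g - w (Z b) g))"
proof -
  have T': "{a..b} \<subseteq> T" using T ab by simp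
  show ?thesis unfolding CW_def
  proof (rule backward_bound[where w = "\<lambda>g x. w (Y x) g - w (Z x) g" and \<mu> = mu
        and h = "\<lambda>g x. hw x (\<lambda>g. w (Y x) g - w (Z x) g) g"
        and \<Lambda> = "\<lambda>x. c0 * \<Lambda> x" and \<kappa> = "\<lambda>x. c0 * \<kappa> x"])
    fix g assume g: "g \<in> G"
    have lin: "hw x (\<lambda>g. w (Y x) g - w (Z x) g) g = hw x (w (Y x)) g - hw x (w (Z x)) g" for x
      by (simp add: hw_def right_diff_distrib sum_subtractf)
    show "deriv_on a b (\<lambda>x. w (Y x) g - w (Z x) g)
        (\<lambda>x. mu g * (w (Y x) g - w (Z x) g) + hw x (\<lambda>g. w (Y x) g - w (Z x) g) g)"
      by (rule deriv_on_cong[OF deriv_on_diff[OF deriv_w[OF T' g Y] deriv_w[OF T' g Z]]])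
         (auto simp: lin algebra_simps)
    fix x assume x: "a < x" "x < b"
    show "0 \<le> Re (mu g) \<or> w (Y x) g - w (Z x) g = 0"
      using mu_pos[OF g, of "Y x"] mu_pos[OF g, of "Z x"] by auto
    show "cmod (hw x (\<lambda>g. w (Y x) g - w (Z x) g) g) \<le> c0 * \<kappa> x * (\<Sum>g\<in>G. cmod (w (Y x) g - w (Z x) g))"
      using x T' by (intro hw_bound g) auto
  next
    fix x assume x: "a < x" "x < b"
    then have xT: "x \<in> T" using T' by auto
    show "((\<lambda>x. c0 * \<Lambda> x) has_real_derivative c0 * \<kappa> x) (at x)"
      using \<Lambda>[OF xT] by (auto intro!: derivative_eq_intros)
    show "0 \<le> c0 * \<kappa> x" using \<kappa>[OF xT] c0_nonneg by simp
  next
    show "c0 * \<Lambda> b - c0 * \<Lambda> a \<le> c0 * BL"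
      using mult_left_mono[OF BL[OF ab(2,3)] c0_nonneg] by (simp add: right_diff_distrib)
  qed (use finG ab cont_\<Lambda>[OF T'] in \<open>auto intro!: continuous_intros\<close>)
qed

lemma w_bound:
  assumes ab: "a \<le> b" "a \<in> T" "b \<in> T"
    and Y: "\<And>j. j < n \<Longrightarrow> j \<notin> J \<Longrightarrow> sol n A (nu j) a b (\<lambda>x. Y x j)"
  shows "(\<Sum>g\<in>G. cmod (w (Y a) g)) \<le> CW * (\<Sum>g\<in>G. cmod (w (Y b) g))"
proof -
  have T': "{a..b} \<subseteq> T" using T ab by simp
  show ?thesis unfolding CW_def
  proof (rule backward_bound[where w = "\<lambda>g x. w (Y x) g" and \<mu> = mu
        and h = "\<lambda>g x. hw x (w (Y x)) g"
        and \<Lambda> = "\<lambda>x. c0 * \<Lambda> x" and \<kappa> = "\<lambda>x. c0 * \<kappa> x"])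
    fix g assume g: "g \<in> G"
    show "deriv_on a b (\<lambda>x. w (Y x) g) (\<lambda>x. mu g * w (Y x) g + hw x (w (Y x)) g)"
      by (rule deriv_w[OF T' g Y])
    fix x assume x: "a < x" "x < b"
    show "0 \<le> Re (mu g) \<or> w (Y x) g = 0" by (rule mu_pos[OF g])
    show "cmod (hw x (w (Y x)) g) \<le> c0 * \<kappa> x * (\<Sum>g\<in>G. cmod (w (Y x) g))"
      using x T' by (intro hw_bound g) auto
  next
    fix x assume x: "a < x" "x < b"
    then have xT: "x \<in> T" using T' by auto
    show "((\<lambda>x. c0 * \<Lambda> x) has_real_derivative c0 * \<kappa> x) (at x)"
      using \<Lambda>[OF xT] by (auto intro!: derivative_eq_intros)
    show "0 \<le> c0 * \<kappa> x" using \<kappa>[OF xT] c0_nonneg by simp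
  next
    show "c0 * \<Lambda> b - c0 * \<Lambda> a \<le> c0 * BL"
      using mult_left_mono[OF BL[OF ab(2,3)] c0_nonneg] by (simp add: right_diff_distrib)
  qed (use finG ab cont_\<Lambda>[OF T'] in \<open>auto intro!: continuous_intros\<close>)
qed

text \<open>Since \<open>w V\<close> is stationary without perturbation, going backwards adds to the
  difference at most the integral of \<open>hw\<close>, that is \<open>c0 * N\<close> times the
  integral of \<kappa>.\<close>

lemma w_rate:
  assumes ab: "a \<le> b" "a \<in> T" "b \<in> T" and g: "g \<in> G"
    and Y: "\<And>j. j < n \<Longrightarrow> j \<notin> J \<Longrightarrow> sol n A (nu j) a b (\<lambda>x. Y x j)"
    and N: "\<And>x. a < x \<Longrightarrow> x < b \<Longrightarrow> (\<Sum>g\<in>G. cmod (w (Y x) g)) \<le> N"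
  shows "cmod (w (Y a) g - w V g) \<le> cmod (w (Y b) g - w V g) + c0 * N * (\<Lambda> b - \<Lambda> a)"
proof (cases "Re (mu g) \<ge> 0")
  case True
  have T': "{a..b} \<subseteq> T" using T ab by simp
  have "cmod (w (Y a) g - w V g) \<le> cmod (w (Y b) g - w V g) + (c0 * N * \<Lambda> b - c0 * N * \<Lambda> a)"
  proof (rule backward_difference[OF ab(1) _ True])
    show "deriv_on a b (\<lambda>x. w (Y x) g - w V g) (\<lambda>x. mu g * (w (Y x) g - w V g) + hw x (w (Y x)) g)"
      by (rule deriv_on_cong[OF deriv_on_diff[OF deriv_w[OF T' g Y] deriv_on_const]])
         (auto simp: right_diff_distrib mu_w_V[OF g])
    fix x assume x: "a < x" "x < b"
    then have xT: "x \<in> T" using T' by auto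
    have "cmod (hw x (w (Y x)) g) \<le> c0 * \<kappa> x * (\<Sum>g\<in>G. cmod (w (Y x) g))" by (rule hw_bound[OF xT g])
    also have "\<dots> \<le> c0 * \<kappa> x * N" using N[OF x] c0_nonneg \<kappa>[OF xT] by (intro mult_left_mono) auto
    finally show "cmod (hw x (w (Y x)) g) \<le> c0 * N * \<kappa> x" by (simp add: mult_ac)
    show "((\<lambda>x. c0 * N * \<Lambda> x) has_real_derivative c0 * N * \<kappa> x) (at x)"
      using \<Lambda>[OF xT] by (auto intro!: derivative_eq_intros)
  qed (use cont_\<Lambda>[OF T'] in \<open>auto intro!: continuous_intros\<close>)
  then show ?thesis by (simp add: right_diff_distrib)
next
  case False
  \<comment> \<open>An exponent with negative real part belongs to a non-injective \<open>g\<close>,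
    for which both minors vanish.\<close>
  then have z: "w (Y x) g = 0" for x using mu_pos[OF g] by blast
  have "w V g = 0" using False mu_pos[OF g] by blast
  moreover have "0 \<le> c0 * N * (\<Lambda> b - \<Lambda> a)"
  proof (cases "a = b")
    case False
    then have "a < b" using ab by simp
    then obtain x where x: "a < x" "x < b" using dense by blast
    have "N \<ge> 0" using order_trans[OF sum_nonneg N[OF x]] by simp
    moreover have "\<Lambda> a \<le> \<Lambda> b"
      using T[OF ab(2,3)] \<Lambda> \<kappa> ab(1) by (intro DERIV_nonneg_imp_nondecreasing[of a b \<Lambda>]) fastforce+
    ultimately show ?thesis using c0_nonneg by simp
  qed simp
  ultimately show ?thesis using z by simp
qed

end

section \<open>Frames on the two half-lines\<close>

locale exponents =
  fixes n :: nat and J :: "nat set" and V :: "nat \<Rightarrow> nat \<Rightarrow> complex" and nu :: "nat \<Rightarrow> complex"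
    and A :: "real \<Rightarrow> nat \<Rightarrow> nat \<Rightarrow> complex" and rho :: "real \<Rightarrow> nat \<Rightarrow> nat \<Rightarrow> complex"
    and K \<alpha> :: real
  assumes J0: "J \<subseteq> {..<n}"
    and detV0: "D n V \<noteq> 0"
    and pos0: "\<And>l. l \<in> J \<Longrightarrow> Re (nu l) > 0"
    and neg0: "\<And>l. l < n \<Longrightarrow> l \<notin> J \<Longrightarrow> Re (nu l) < 0"
    and K: "K \<ge> 0" and \<alpha>: "\<alpha> > 0"

locale right_frame = exponents +
  assumes AV0: "\<And>x l i. x \<ge> 0 \<Longrightarrow> l < n \<Longrightarrow> i < n \<Longrightarrow>
        mv n (A x) (V l) i = nu l * V l i + (\<Sum>k<n. rho x k l * V k i)"
    and rho0: "\<And>x k l. x \<ge> 0 \<Longrightarrow> k < n \<Longrightarrow> l < n \<Longrightarrow> cmod (rho x k l) \<le> K * exp (- \<alpha> * x)"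

text \<open>The primitive is the one that vanishes at infinity, and the perturbation has total mass
  \<open>K / \<alpha>\<close> on the half-line.\<close>

sublocale right_frame \<subseteq> frame n J V nu A rho "{0..}" "\<lambda>x. K * exp (- \<alpha> * x)"
    "\<lambda>x. - (K / \<alpha> * exp (- \<alpha> * x))" "K / \<alpha>"
proof
  fix x :: real
  show "((\<lambda>x. - (K / \<alpha> * exp (- \<alpha> * x))) has_real_derivative K * exp (- \<alpha> * x)) (at x)"
    using \<alpha> by (auto intro!: derivative_eq_intros)
next
  fix a b :: real assume ab: "a \<in> {0..}" "b \<in> {0..}"
  have "K / \<alpha> * exp (- \<alpha> * a) \<le> K / \<alpha> * 1" using ab K \<alpha> by (intro mult_left_mono) auto
  moreover have "0 \<le> K / \<alpha> * exp (- \<alpha> * b)" using K \<alpha> by auto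
  ultimately show "- (K / \<alpha> * exp (- \<alpha> * b)) - - (K / \<alpha> * exp (- \<alpha> * a)) \<le> K / \<alpha>" by linarith
qed (use J0 detV0 pos0 neg0 K \<alpha> AV0 rho0 in auto)

locale left_frame = exponents +
  assumes AV0: "\<And>x l i. x \<le> 0 \<Longrightarrow> l < n \<Longrightarrow> i < n \<Longrightarrow>
        mv n (A x) (V l) i = nu l * V l i + (\<Sum>k<n. rho x k l * V k i)"
    and rho0: "\<And>x k l. x \<le> 0 \<Longrightarrow> k < n \<Longrightarrow> l < n \<Longrightarrow> cmod (rho x k l) \<le> K * exp (\<alpha> * x)"

sublocale left_frame \<subseteq> frame n J V nu A rho "{..0}" "\<lambda>x. K * exp (\<alpha> * x)"
    "\<lambda>x. K / \<alpha> * exp (\<alpha> * x)" "K / \<alpha>"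
proof
  fix x :: real
  show "((\<lambda>x. K / \<alpha> * exp (\<alpha> * x)) has_real_derivative K * exp (\<alpha> * x)) (at x)"
    using \<alpha> by (auto intro!: derivative_eq_intros)
next
  fix a b :: real assume ab: "a \<in> {..0}" "b \<in> {..0}"
  have "K / \<alpha> * exp (\<alpha> * b) \<le> K / \<alpha> * 1"
    using ab K \<alpha> by (intro mult_left_mono) (auto simp: mult_le_0_iff)
  moreover have "0 \<le> K / \<alpha> * exp (\<alpha> * a)" using K \<alpha> by auto
  ultimately show "K / \<alpha> * exp (\<alpha> * b) - K / \<alpha> * exp (\<alpha> * a) \<le> K / \<alpha>" by linarith
qed (use J0 detV0 pos0 neg0 K \<alpha> AV0 rho0 in auto)

lemma (in frame) tendsto_w:
  assumes "\<And>j i. j < n \<Longrightarrow> j \<notin> J \<Longrightarrow> i < n \<Longrightarrow> ((\<lambda>x. X x j i) \<longlongrightarrow> Z j i) F"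
  shows "((\<lambda>x. w (X x) g) \<longlongrightarrow> w Z g) F"
  unfolding w_def by (rule tendsto_D) (use assms in auto)

lemma (in frame) w_cong:
  "(\<And>j i. j < n \<Longrightarrow> j \<notin> J \<Longrightarrow> i < n \<Longrightarrow> Y j i = Z j i) \<Longrightarrow> w Y g = w Z g"
  unfolding w_def by (rule D_cong) auto

section \<open>Minors of exact and of transported columns on the right half-line\<close>

context right_frame
begin

definition "NV = (\<Sum>g\<in>G. cmod (w V g))"

definition "CR = c0 * (CW * NV) * (K / \<alpha>)"

context
  fixes X :: "real \<Rightarrow> nat \<Rightarrow> nat \<Rightarrow> complex"
  assumes X: "\<And>j b. j < n \<Longrightarrow> j \<notin> J \<Longrightarrow> sol n A (nu j) 0 b (\<lambda>x. X x j)"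
    and X_lim: "\<And>j i. j < n \<Longrightarrow> j \<notin> J \<Longrightarrow> i < n \<Longrightarrow> ((\<lambda>x. X x j i) \<longlongrightarrow> V j i) at_top"
begin

lemma X_sol: "j < n \<Longrightarrow> j \<notin> J \<Longrightarrow> a \<ge> 0 \<Longrightarrow> sol n A (nu j) a b (\<lambda>x. X x j)"
  using X sol_subset by blast

text \<open>\<open>w_bound\<close> on \<open>[x, b]\<close> with \<open>b\<close> tending to
  infinity: the limit of \<open>X\<close> enters, its speed does not.\<close>

lemma X_minor_bound:
  assumes x: "x \<ge> 0"
  shows "(\<Sum>g\<in>G. cmod (w (X x) g)) \<le> CW * NV"
proof (rule tendsto_lowerbound)
  show "((\<lambda>b. CW * (\<Sum>g\<in>G. cmod (w (X b) g))) \<longlongrightarrow> CW * NV) at_top"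
    unfolding NV_def by (intro tendsto_intros tendsto_w X_lim)
  show "\<forall>\<^sub>F b in at_top. (\<Sum>g\<in>G. cmod (w (X x) g)) \<le> CW * (\<Sum>g\<in>G. cmod (w (X b) g))"
    using eventually_ge_at_top[of x]
    by eventually_elim (use x in \<open>auto intro!: w_bound X_sol\<close>)
qed simp

text \<open>\<open>w_rate\<close> on \<open>[x, b]\<close>: the difference at \<open>b\<close>
  disappears in the limit, and the tail of the perturbation beyond \<open>x\<close> remains.\<close>

lemma X_minor_rate:
  assumes x: "x \<ge> 0" and g: "g \<in> G"
  shows "cmod (w (X x) g - w V g) \<le> CR * exp (- \<alpha> * x)"
proof (rule tendsto_lowerbound)
  have "((\<lambda>b. cmod (w (X b) g - w V g)) \<longlongrightarrow> cmod (w V g - w V g)) at_top"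
    by (intro tendsto_intros tendsto_w X_lim)
  then show "((\<lambda>b. cmod (w (X b) g - w V g) + CR * exp (- \<alpha> * x)) \<longlongrightarrow> CR * exp (- \<alpha> * x)) at_top"
    using tendsto_add[OF _ tendsto_const, of _ 0 at_top "CR * exp (- \<alpha> * x)"] by simp
  show "\<forall>\<^sub>F b in at_top. cmod (w (X x) g - w V g) \<le> cmod (w (X b) g - w V g) + CR * exp (- \<alpha> * x)"
    using eventually_ge_at_top[of x]
  proof eventually_elim
    fix b assume b: "x \<le> b"
    have "cmod (w (X x) g - w V g) \<le> cmod (w (X b) g - w V g)
        + c0 * (CW * NV) * (- (K / \<alpha> * exp (- \<alpha> * b)) - - (K / \<alpha> * exp (- \<alpha> * x)))"
      using x b by (intro w_rate X_sol X_minor_bound g) auto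
    also have "\<dots> \<le> cmod (w (X b) g - w V g) + c0 * (CW * NV) * (K / \<alpha> * exp (- \<alpha> * x))"
    proof (intro add_left_mono mult_left_mono)
      show "- (K / \<alpha> * exp (- \<alpha> * b)) - - (K / \<alpha> * exp (- \<alpha> * x)) \<le> K / \<alpha> * exp (- \<alpha> * x)"
        using K \<alpha> by simp
      show "0 \<le> c0 * (CW * NV)" using c0_nonneg CW_nonneg by (simp add: NV_def sum_nonneg)
    qed
    finally show "cmod (w (X x) g - w V g) \<le> cmod (w (X b) g - w V g) + CR * exp (- \<alpha> * x)"
      by (simp add: CR_def mult_ac)
  qed
qed simp

lemma transported_minor_bound:
  assumes L: "L \<ge> 0" and Y: "\<And>j. j < n \<Longrightarrow> j \<notin> J \<Longrightarrow> sol n A (nu j) 0 L (\<lambda>x. Y x j)"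
    and YL: "\<And>j i. j < n \<Longrightarrow> j \<notin> J \<Longrightarrow> i < n \<Longrightarrow> Y L j i = V j i"
  shows "(\<Sum>g\<in>G. cmod (w (Y 0) g)) \<le> CW * NV"
proof -
  have "(\<Sum>g\<in>G. cmod (w (Y 0) g)) \<le> CW * (\<Sum>g\<in>G. cmod (w (Y L) g))"
    by (rule w_bound) (use L Y in auto)
  also have "w (Y L) = w V" by (intro ext w_cong) (use YL in auto)
  finally show ?thesis by (simp add: NV_def)
qed

text \<open>The transported columns equal \<open>V\<close> at \<open>L\<close>, so
  \<open>X_minor_rate\<close> gives the error there; \<open>w_diff_bound\<close> carries it back to
  0 at the price of \<open>CW\<close>.\<close>

lemma transported_minor_difference:
  assumes L: "L \<ge> 0" and Y: "\<And>j. j < n \<Longrightarrow> j \<notin> J \<Longrightarrow> sol n A (nu j) 0 L (\<lambda>x. Y x j)"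
    and YL: "\<And>j i. j < n \<Longrightarrow> j \<notin> J \<Longrightarrow> i < n \<Longrightarrow> Y L j i = V j i"
  shows "(\<Sum>g\<in>G. cmod (w (X 0) g - w (Y 0) g)) \<le> CW * (card G * CR) * exp (- \<alpha> * L)"
proof -
  have "(\<Sum>g\<in>G. cmod (w (X 0) g - w (Y 0) g)) \<le> CW * (\<Sum>g\<in>G. cmod (w (X L) g - w (Y L) g))"
    by (rule w_diff_bound) (use L X Y in auto)
  also have "w (Y L) = w V" by (intro ext w_cong) (use YL in auto)
  finally have "(\<Sum>g\<in>G. cmod (w (X 0) g - w (Y 0) g)) \<le> CW * (\<Sum>g\<in>G. cmod (w (X L) g - w V g))" .
  also have "\<dots> \<le> CW * (\<Sum>g\<in>G. CR * exp (- \<alpha> * L))"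
    using CW_nonneg by (intro mult_left_mono sum_mono X_minor_rate L)
  finally show ?thesis by (simp add: mult_ac)
qed

end

lemma deriv_on_coordinates:
  assumes u: "sol n A 0 a b u" and a: "a \<ge> 0" and l: "l < n"
  shows "deriv_on a b (\<lambda>x. crd n V (u x) l)
    (\<lambda>x. nu l * crd n V (u x) l + (\<Sum>k<n. rho x l k * crd n V (u x) k))"
proof -
  have 1: "deriv_on a b (\<lambda>x. crd n V (u x) l) (\<lambda>x. crd n V (\<lambda>i. mv n (A x) (u x) i) l)"
    using u by (intro deriv_on_crd) (simp add: sol_def)
  show ?thesis
  proof (rule deriv_on_cong[OF 1], rule crd_unique[OF detV _ l])
    fix x i assume x: "a < x" "x < b" and i: "i < n"
    let ?c = "crd n V (u x)"
    have "mv n (A x) (u x) i = mv n (A x) (\<lambda>i. \<Sum>k<n. ?c k * V k i) i"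
      by (rule mv_cong) (rule crd_expand[OF detV])
    also have "\<dots> = (\<Sum>k<n. ?c k * (nu k * V k i + (\<Sum>l<n. rho x l k * V l i)))"
      using x a i by (simp add: mv_sum mv_scale AV0)
    also have "\<dots> = (\<Sum>k<n. nu k * ?c k * V k i) + (\<Sum>k<n. \<Sum>l<n. rho x l k * ?c k * V l i)"
      by (simp add: distrib_left sum.distrib sum_distrib_left mult_ac)
    also have "(\<Sum>k<n. \<Sum>l<n. rho x l k * ?c k * V l i) = (\<Sum>l<n. (\<Sum>k<n. rho x l k * ?c k) * V l i)"
      by (subst sum.swap) (simp add: sum_distrib_right)
    finally show "mv n (A x) (u x) i = (\<Sum>l<n. (nu l * ?c l + (\<Sum>k<n. rho x l k * ?c k)) * V l i)"
      by (simp add: distrib_right sum.distrib)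
  qed
qed

text \<open>The difference of the squared norms of the unstable and of the stable coordinates does not
  decrease along solutions, so it is nonpositive for decaying ones.\<close>
lemma decaying_solution_zero:
  assumes u: "\<And>b. sol n A 0 L b u" and lim: "\<And>i. i < n \<Longrightarrow> ((\<lambda>x. u x i) \<longlongrightarrow> 0) at_top"
    and \<delta>: "\<And>l. l \<in> J \<Longrightarrow> Re (nu l) \<ge> \<delta>" "\<And>l. l < n \<Longrightarrow> l \<notin> J \<Longrightarrow> Re (nu l) \<le> - \<delta>"
    and L: "L \<ge> 0" "n * (K * exp (- \<alpha> * L)) \<le> \<delta>"
    and uL: "\<And>l. l < n \<Longrightarrow> l \<notin> J \<Longrightarrow> crd n V (u L) l = 0" and i: "i < n"
  shows "u L i = 0"
proof -
  define c where "c = (\<lambda>x l. crd n V (u x) l)"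
  define s where "s = (\<lambda>l. if l \<in> J then 1 else - 1 :: real)"
  define E where "E = (\<lambda>x. \<Sum>l<n. s l * (cmod (c x l))\<^sup>2)"
  define f where "f = (\<lambda>x l. \<Sum>k<n. rho x l k * c x k)"
  have mono: "E L \<le> E b" if b: "b \<ge> L" for b
  proof -
    have dc: "deriv_on L b (\<lambda>x. c x l) (\<lambda>x. nu l * c x l + f x l)" if "l < n" for l
      unfolding c_def f_def by (rule deriv_on_coordinates[OF u L(1) that])
    \<comment> \<open>The weight is constant: \<open>weighted_mono\<close> serves as plain
      monotonicity.\<close>
    have "E L * exp (0 * 0) \<le> E b * exp (0 * 0)"
    proof (rule weighted_mono[OF b, where \<Lambda> = "\<lambda>_. 0" and \<kappa> = "\<lambda>_. 0" and E = E
          and E' = "\<lambda>x. \<Sum>l<n. s l * (2 * Re (cnj (c x l) * (nu l * c x l + f x l)))"])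
      show "continuous_on {L..b} E"
        unfolding E_def using dc by (auto intro!: continuous_intros simp: deriv_on_def)
      fix x assume x: "L < x" "x < b"
      show "(E has_real_derivative (\<Sum>l<n. s l * (2 * Re (cnj (c x l) * (nu l * c x l + f x l))))) (at x)"
        unfolding E_def
      proof (intro DERIV_sum DERIV_cmult has_real_derivative_cmod_power2)
        fix l assume "l \<in> {..<n}"
        then show "((\<lambda>t. c t l) has_vector_derivative nu l * c x l + f x l) (at x)"
          using dc[of l] x by (simp add: deriv_on_def)
      qed
      define S where "S = (\<Sum>k<n. cmod (c x k))"
      define Q where "Q = (\<Sum>k<n. (cmod (c x k))\<^sup>2)"
      define k where "k = K * exp (- \<alpha> * x)"
      have k0: "k \<ge> 0" using K by (simp add: k_def)
      have "k \<le> K * exp (- \<alpha> * L)" unfolding k_def using x K \<alpha> by (intro mult_left_mono) auto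
      \<comment> \<open>Beyond \<open>L\<close> the gap dominates the coupling. Together with
        Cauchy-Schwarz for \<open>S\<close> this makes the derivative of \<open>E\<close>
        nonnegative.\<close>
      then have kd: "n * k \<le> \<delta>" using L(2) mult_left_mono[of k "K * exp (- \<alpha> * L)" "real n"] by linarith
      have summand: "2 * (\<delta> * (cmod (c x l))\<^sup>2) - 2 * (cmod (c x l) * (k * S))
          \<le> s l * (2 * Re (cnj (c x l) * (nu l * c x l + f x l)))" if l: "l < n" for l
      proof -
        have "cmod (f x l) \<le> (\<Sum>j<n. k * cmod (c x j))"
          unfolding f_def using l x L(1) rho0[of x l] k_def
          by (intro order_trans[OF norm_sum] sum_mono) (auto simp: norm_mult intro!: mult_right_mono)
        then have "cmod (f x l) \<le> k * S" by (simp add: S_def sum_distrib_left)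
        then have "cmod (cnj (c x l) * f x l) \<le> cmod (c x l) * (k * S)"
          by (simp add: norm_mult mult_left_mono)
        moreover have "\<bar>s l * Re (cnj (c x l) * f x l)\<bar> \<le> cmod (cnj (c x l) * f x l)"
          using abs_Re_le_cmod[of "cnj (c x l) * f x l"] by (auto simp: s_def)
        moreover have "s l * Re (cnj (c x l) * (nu l * c x l)) = s l * Re (nu l) * (cmod (c x l))\<^sup>2"
          unfolding cmod_power2 by (simp add: power2_eq_square algebra_simps)
        moreover have "\<delta> * (cmod (c x l))\<^sup>2 \<le> s l * Re (nu l) * (cmod (c x l))\<^sup>2"
          using \<delta>(1)[of l] \<delta>(2)[OF l] by (intro mult_right_mono) (auto simp: s_def)
        moreover have "s l * (2 * Re (cnj (c x l) * (nu l * c x l + f x l)))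
           = 2 * (s l * Re (cnj (c x l) * (nu l * c x l))) + 2 * (s l * Re (cnj (c x l) * f x l))"
          by (simp only: distrib_left plus_complex.sel mult_ac)
        ultimately show ?thesis by linarith
      qed
      have "S\<^sup>2 \<le> Q * n"
        unfolding S_def Q_def using sum_squared_le_sum_of_squares[of "\<lambda>k. cmod (c x k)" "{..<n}"] by simp
      then have "k * S\<^sup>2 \<le> k * (Q * n)" using k0 by (rule mult_left_mono)
      also have "\<dots> \<le> \<delta> * Q"
        using mult_right_mono[OF kd, of Q] by (simp add: Q_def sum_nonneg mult_ac)
      finally have "0 \<le> 2 * (\<delta> * Q) - 2 * (k * S\<^sup>2)" by simp
      also have "\<dots> = (\<Sum>l<n. 2 * (\<delta> * (cmod (c x l))\<^sup>2) - 2 * (cmod (c x l) * (k * S)))"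
        by (simp add: sum_subtractf sum_distrib_left[symmetric] sum_distrib_right[symmetric] Q_def
            S_def[symmetric] power2_eq_square)
      also have "\<dots> \<le> (\<Sum>l<n. s l * (2 * Re (cnj (c x l) * (nu l * c x l + f x l))))"
        using summand by (intro sum_mono) auto
      finally show "- (0 * 0 * E x) \<le> (\<Sum>l<n. s l * (2 * Re (cnj (c x l) * (nu l * c x l + f x l))))" by simp
    qed auto
    then show ?thesis by simp
  qed
  have "(E \<longlongrightarrow> (\<Sum>l<n. s l * (cmod (crd n V (\<lambda>_. 0) l))\<^sup>2)) at_top"
    unfolding E_def c_def by (intro tendsto_intros tendsto_crd lim)
  then have "(E \<longlongrightarrow> 0) at_top" by (simp add: crd_def)
  then have "E L \<le> 0"
    by (rule tendsto_lowerbound) (use mono in \<open>auto simp: eventually_at_top_linorder\<close>)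
  \<comment> \<open>The coordinates with sign -1 vanish at \<open>L\<close>, so only nonnegative
    terms are left.\<close>
  moreover have "E L = (\<Sum>l<n. (cmod (c L l))\<^sup>2)"
    unfolding E_def using uL by (intro sum.cong) (auto simp: s_def c_def)
  ultimately have "(\<Sum>l<n. (cmod (c L l))\<^sup>2) = 0"
    by (intro antisym) (auto simp: sum_nonneg)
  then have "c L l = 0" if "l < n" for l
    using that by (subst (asm) sum_nonneg_eq_0_iff) auto
  then show ?thesis using crd_expand[OF detV i, of "u L"] by (simp add: c_def)
qed

end

section \<open>Full determinants on the left half-line\<close>

context left_frame
begin

context
  fixes Y :: "real \<Rightarrow> nat \<Rightarrow> nat \<Rightarrow> complex"
  assumes Y: "\<And>j a. j < n \<Longrightarrow> j \<notin> J \<Longrightarrow> sol n A (nu j) a 0 (\<lambda>x. Y x j)"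
begin

definition "N0 = (\<Sum>g\<in>G. cmod (w (Y 0) g))"

lemma Y_sol: "j < n \<Longrightarrow> j \<notin> J \<Longrightarrow> b \<le> 0 \<Longrightarrow> sol n A (nu j) a b (\<lambda>x. Y x j)"
  using Y sol_subset by blast

lemma Y_minor_bound:
  assumes "x \<le> 0"
  shows "(\<Sum>g\<in>G. cmod (w (Y x) g)) \<le> CW * N0"
  unfolding N0_def by (rule w_bound) (use assms Y in auto)

context
  fixes X :: "real \<Rightarrow> nat \<Rightarrow> nat \<Rightarrow> complex"
  assumes X: "\<And>j a. j \<in> J \<Longrightarrow> sol n A (nu j) a 0 (\<lambda>x. X x j)"
    and X_lim: "\<And>j i. j \<in> J \<Longrightarrow> i < n \<Longrightarrow> ((\<lambda>x. X x j i) \<longlongrightarrow> V j i) at_bot"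
begin

text \<open>A full set of rescaled solutions: the columns in \<open>J\<close> tend to
  \<open>V\<close> at minus infinity, the others are only required to solve their equations.\<close>

definition "F x = D n (\<lambda>j. if j \<in> J then X x j else Y x j)"

definition "EB = exp (n * (K / \<alpha>))"

lemma EB_nonneg: "EB \<ge> 0" by (simp add: EB_def)

lemma trr_bound: "x \<le> 0 \<Longrightarrow> cmod (trr x) \<le> n * (K * exp (\<alpha> * x))"
  unfolding trr_def using sum_norm_bound[of "{..<n}" "\<lambda>k. rho x k k" "K * exp (\<alpha> * x)"] rho0 by auto

lemma deriv_F: "b \<le> 0 \<Longrightarrow> deriv_on a b F (\<lambda>x. trr x * F x)"
  unfolding F_def
proof (rule deriv_D_columns)
  fix j assume b: "b \<le> 0" and j: "j < n"
  show "sol n A (nu j) a b (\<lambda>x. if j \<in> J then X x j else Y x j)"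
    using b j sol_subset[OF X[of j a], of a b] Y_sol[of j b a] by (cases "j \<in> J") auto
qed auto

lemma n\<Lambda>_deriv: "((\<lambda>x. n * (K / \<alpha> * exp (\<alpha> * x))) has_real_derivative n * (K * exp (\<alpha> * x))) (at x)"
  using \<Lambda>[of "min x 0"] \<alpha> by (auto intro!: derivative_eq_intros)

lemma n\<Lambda>_le:
  assumes "a \<le> 0" "b \<le> 0"
  shows "n * (K / \<alpha> * exp (\<alpha> * b)) - n * (K / \<alpha> * exp (\<alpha> * a)) \<le> n * (K / \<alpha>)"
  using mult_left_mono[OF BL[of a b], of "real n"] assms by (simp add: right_diff_distrib)

text \<open>Expanding the columns in \<open>J\<close> over \<open>V\<close> writes both terms
  through the same minors of \<open>Y\<close>. These stay bounded, while the coefficients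
  converge.\<close>

lemma F_minus_w_tendsto: "((\<lambda>x. F x - w (Y x) idg) \<longlongrightarrow> 0) at_bot"
proof -
  \<comment> \<open>The coefficient of the minor for \<open>g\<close> in that expansion; for
    \<open>Z = V\<close> it singles out \<open>idg\<close>.\<close>
  define p where "p = (\<lambda>(Z :: nat \<Rightarrow> nat \<Rightarrow> complex) g. \<Prod>j\<in>J. crd n V (Z j) (g j))"
  have ex: "D n (\<lambda>j. if j \<in> J then Z j else Y x j) = (\<Sum>g\<in>G. p Z g * w (Y x) g)" for Z x
    unfolding p_def G_def w_def by (rule D_multilinear[OF J crd_expand[OF detV]])
  have "((\<lambda>x. \<Sum>g\<in>G. cmod (p (X x) g - p V g) * (CW * N0)) \<longlongrightarrow>
      (\<Sum>g\<in>G. cmod (p V g - p V g) * (CW * N0))) at_bot"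
    unfolding p_def by (intro tendsto_intros tendsto_crd X_lim)
  then have lim: "((\<lambda>x. \<Sum>g\<in>G. cmod (p (X x) g - p V g) * (CW * N0)) \<longlongrightarrow> 0) at_bot" by simp
  show ?thesis
  proof (rule Lim_null_comparison[OF _ lim])
    show "\<forall>\<^sub>F x in at_bot. norm (F x - w (Y x) idg) \<le> (\<Sum>g\<in>G. cmod (p (X x) g - p V g) * (CW * N0))"
      using eventually_le_at_bot[of 0]
    proof eventually_elim
      fix x :: real assume x: "x \<le> 0"
      have "F x - w (Y x) idg = (\<Sum>g\<in>G. (p (X x) g - p V g) * w (Y x) g)"
        unfolding F_def w_idg ex by (simp add: left_diff_distrib sum_subtractf)
      also have "cmod \<dots> \<le> (\<Sum>g\<in>G. cmod (p (X x) g - p V g) * (CW * N0))"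
      proof (intro sum_norm_le)
        fix g assume g: "g \<in> G"
        have "cmod (w (Y x) g) \<le> (\<Sum>g\<in>G. cmod (w (Y x) g))"
          using g finG by (intro member_le_sum) auto
        also have "\<dots> \<le> CW * N0" by (rule Y_minor_bound[OF x])
        finally show "cmod ((p (X x) g - p V g) * w (Y x) g) \<le> cmod (p (X x) g - p V g) * (CW * N0)"
          by (simp add: norm_mult mult_left_mono)
      qed
      finally show "norm (F x - w (Y x) idg) \<le> (\<Sum>g\<in>G. cmod (p (X x) g - p V g) * (CW * N0))" .
    qed
  qed
qed

lemma w_idg_bound: "x \<le> 0 \<Longrightarrow> cmod (w (Y x) idg) \<le> CW * N0"
  using member_le_sum[of idg G "\<lambda>g. cmod (w (Y x) g)"] finG idg_G Y_minor_bound[of x] by simp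

text \<open>Liouville's equation is followed forward from \<open>y\<close> to \<open>x\<close>. As
  \<open>y\<close> tends to minus infinity, \<open>F y\<close> approaches the minor
  \<open>w (Y y) idg\<close>, which is bounded.\<close>

lemma F_bound:
  assumes x: "x \<le> 0"
  shows "cmod (F x) \<le> EB * (CW * N0)"
proof (rule tendsto_lowerbound)
  have "((\<lambda>y. EB * (cmod (F y - w (Y y) idg) + CW * N0)) \<longlongrightarrow> EB * (cmod 0 + CW * N0)) at_bot"
    by (intro tendsto_intros F_minus_w_tendsto)
  then show "((\<lambda>y. EB * (cmod (F y - w (Y y) idg) + CW * N0)) \<longlongrightarrow> EB * (CW * N0)) at_bot" by simp
  show "\<forall>\<^sub>F y in at_bot. cmod (F x) \<le> EB * (cmod (F y - w (Y y) idg) + CW * N0)"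
    using eventually_le_at_bot[of x]
  proof eventually_elim
    fix y assume y: "y \<le> x"
    have "cmod (F x) \<le> EB * cmod (F y)"
      unfolding EB_def
      by (rule scalar_forward_bound[OF y deriv_F[OF x] trr_bound n\<Lambda>_deriv _ n\<Lambda>_le])
         (use x y \<alpha> in \<open>auto intro!: continuous_intros\<close>)
    also have "cmod (F y) \<le> cmod (F y - w (Y y) idg) + cmod (w (Y y) idg)"
      using norm_triangle_ineq[of "F y - w (Y y) idg" "w (Y y) idg"] by simp
    also have "cmod (w (Y y) idg) \<le> CW * N0" using x y by (intro w_idg_bound) auto
    finally show "cmod (F x) \<le> EB * (cmod (F y - w (Y y) idg) + CW * N0)"
      using EB_nonneg by (simp add: mult_left_mono)
  qed
qed simp

text \<open>Because \<open>mu idg = 0\<close>, both functions change only at a rate of order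
  \<open>exp (\<alpha> * x)\<close>; their difference vanishes at minus infinity, and integration
  from there gives the bound. The term \<open>n * EB\<close> stems from \<open>F\<close>, the term
  \<open>c0\<close> from the minor.\<close>

lemma F_rate:
  assumes x: "x \<le> 0"
  shows "cmod (F x - w (Y x) idg) \<le> (n * EB + c0) * (CW * N0) * (K / \<alpha>) * exp (\<alpha> * x)"
proof (rule tendsto_lowerbound)
  define C where "C = (n * EB + c0) * (CW * N0)"
  have N0: "N0 \<ge> 0" by (simp add: N0_def sum_nonneg)
  then have C0: "C \<ge> 0" unfolding C_def using EB_nonneg c0_nonneg CW_nonneg by simp
  have "((\<lambda>y. cmod (F y - w (Y y) idg) + C * (K / \<alpha>) * exp (\<alpha> * x)) \<longlongrightarrow> cmod 0 + C * (K / \<alpha>) * exp (\<alpha> * x)) at_bot"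
    by (intro tendsto_intros F_minus_w_tendsto)
  then show "((\<lambda>y. cmod (F y - w (Y y) idg) + (n * EB + c0) * (CW * N0) * (K / \<alpha>) * exp (\<alpha> * x)) \<longlongrightarrow>
      (n * EB + c0) * (CW * N0) * (K / \<alpha>) * exp (\<alpha> * x)) at_bot" by (simp add: C_def)
  show "\<forall>\<^sub>F y in at_bot. cmod (F x - w (Y x) idg) \<le>
      cmod (F y - w (Y y) idg) + (n * EB + c0) * (CW * N0) * (K / \<alpha>) * exp (\<alpha> * x)"
    using eventually_le_at_bot[of x]
  proof eventually_elim
    fix y assume y: "y \<le> x"
    have "cmod ((F x - w (Y x) idg) - (F y - w (Y y) idg))
        \<le> C * (K / \<alpha> * exp (\<alpha> * x)) - C * (K / \<alpha> * exp (\<alpha> * y))"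
    proof (rule deriv_on_increment[OF y, where \<kappa> = "\<lambda>x. C * (K * exp (\<alpha> * x))"
          and \<Lambda> = "\<lambda>x. C * (K / \<alpha> * exp (\<alpha> * x))"])
      show "deriv_on y x (\<lambda>x. F x - w (Y x) idg)
          (\<lambda>x. trr x * F x - (mu idg * w (Y x) idg + hw x (w (Y x)) idg))"
        using x y by (intro deriv_on_diff deriv_F deriv_w idg_G Y_sol) auto
      fix z assume "y < z" "z < x"
      then have z: "z \<le> 0" using x by simp
      have "cmod (hw z (w (Y z)) idg) \<le> c0 * (K * exp (\<alpha> * z)) * (CW * N0)"
        using hw_bound[of z idg "w (Y z)"] idg_G z K c0_nonneg Y_minor_bound[OF z]
        by (meson atMost_iff mult_left_mono mult_nonneg_nonneg exp_ge_zero order_trans)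
      moreover have "cmod (trr z * F z) \<le> n * (K * exp (\<alpha> * z)) * (EB * (CW * N0))"
        unfolding norm_mult using trr_bound[OF z] F_bound[OF z] K by (intro mult_mono) auto
      ultimately have "cmod (trr z * F z - hw z (w (Y z)) idg)
          \<le> n * (K * exp (\<alpha> * z)) * (EB * (CW * N0)) + c0 * (K * exp (\<alpha> * z)) * (CW * N0)"
        by (intro order_trans[OF norm_triangle_ineq4 add_mono])
      then show "cmod (trr z * F z - (mu idg * w (Y z) idg + hw z (w (Y z)) idg)) \<le> C * (K * exp (\<alpha> * z))"
        by (simp add: mu_idg C_def algebra_simps)
      show "((\<lambda>x. C * (K / \<alpha> * exp (\<alpha> * x))) has_real_derivative C * (K * exp (\<alpha> * z))) (at z)"
        using \<alpha> by (auto intro!: derivative_eq_intros)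
    qed (use \<alpha> in \<open>auto intro!: continuous_intros\<close>)
    moreover have "C * (K / \<alpha> * exp (\<alpha> * y)) \<ge> 0" using C0 K \<alpha> by auto
    ultimately have "cmod ((F x - w (Y x) idg) - (F y - w (Y y) idg)) \<le> C * (K / \<alpha>) * exp (\<alpha> * x)"
      by (simp add: mult.assoc)
    then show "cmod (F x - w (Y x) idg) \<le>
      cmod (F y - w (Y y) idg) + (n * EB + c0) * (CW * N0) * (K / \<alpha>) * exp (\<alpha> * x)"
      using norm_triangle_sub[of "F x - w (Y x) idg" "F y - w (Y y) idg"] unfolding C_def by linarith
  qed
qed simp

text \<open>\<open>F\<close> and the determinant of the transported columns obey the same scalar
  equation, so their difference at \<open>- L\<close> reaches 0 enlarged by at most
  \<open>EB\<close>. At \<open>- L\<close> the transported columns are \<open>V\<close>, and the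
  difference is the one of \<open>F_rate\<close>.\<close>

lemma transported_determinant_difference:
  assumes L: "L \<ge> 0" and S: "\<And>j. j \<in> J \<Longrightarrow> sol n A (nu j) (- L) 0 (\<lambda>x. S x j)"
    and SL: "\<And>j i. j \<in> J \<Longrightarrow> i < n \<Longrightarrow> S (- L) j i = V j i"
  shows "cmod (F 0 - D n (\<lambda>j. if j \<in> J then S 0 j else Y 0 j))
     \<le> EB * ((n * EB + c0) * (CW * N0) * (K / \<alpha>)) * exp (- \<alpha> * L)"
proof -
  define H where "H = (\<lambda>x. D n (\<lambda>j. if j \<in> J then S x j else Y x j))"
  have dH: "deriv_on (- L) 0 H (\<lambda>x. trr x * H x)"
    unfolding H_def
  proof (rule deriv_D_columns)
    fix j assume "j < n"
    then show "sol n A (nu j) (- L) 0 (\<lambda>x. if j \<in> J then S x j else Y x j)"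
      using S Y by (cases "j \<in> J") auto
  qed auto
  have "cmod (F 0 - H 0) \<le> EB * cmod (F (- L) - H (- L))"
    unfolding EB_def
  proof (rule scalar_forward_bound[where c = trr, OF _ _ trr_bound n\<Lambda>_deriv _ n\<Lambda>_le])
    show "deriv_on (- L) 0 (\<lambda>x. F x - H x) (\<lambda>x. trr x * (F x - H x))"
      by (rule deriv_on_cong[OF deriv_on_diff[OF deriv_F dH]]) (auto simp: right_diff_distrib)
  qed (use L \<alpha> in \<open>auto intro!: continuous_intros\<close>)
  also have "H (- L) = w (Y (- L)) idg"
    unfolding H_def w_idg by (rule D_cong) (use SL in auto)
  also have "cmod (F (- L) - w (Y (- L)) idg)
      \<le> (n * EB + c0) * (CW * N0) * (K / \<alpha>) * exp (\<alpha> * (- L))"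
    by (rule F_rate) (use L in simp)
  finally show ?thesis using EB_nonneg unfolding H_def by (simp add: mult_left_mono mult.assoc)
qed

end
end
end

section \<open>Gram-Schmidt orthogonalisation of transported vectors\<close>

definition ip :: "nat \<Rightarrow> (nat \<Rightarrow> complex) \<Rightarrow> (nat \<Rightarrow> complex) \<Rightarrow> complex" where
  "ip n u v = (\<Sum>i<n. cnj (u i) * v i)"

lemma ip_cnj: "cnj (ip n u v) = ip n v u"
  by (simp add: ip_def mult.commute)

lemma ip_scale_left: "ip n (\<lambda>i. a * u i) v = cnj a * ip n u v"
  by (simp add: ip_def sum_distrib_left mult.assoc)

lemma ip_scale_right: "ip n u (\<lambda>i. a * v i) = a * ip n u v"
  by (simp add: ip_def sum_distrib_left mult_ac)

lemma ip_diff_right: "ip n u (\<lambda>i. v i - w i) = ip n u v - ip n u w"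
  by (simp add: ip_def right_diff_distrib sum_subtractf)

lemma ip_sum_right: "ip n u (\<lambda>i. \<Sum>k\<in>S. a k * v k i) = (\<Sum>k\<in>S. a k * ip n u (v k))"
  unfolding ip_def sum_distrib_left by (subst sum.swap) (simp add: mult_ac)

lemma ip_cong: "(\<And>i. i < n \<Longrightarrow> u i = u' i) \<Longrightarrow> (\<And>i. i < n \<Longrightarrow> v i = v' i) \<Longrightarrow> ip n u v = ip n u' v'"
  by (simp add: ip_def)

lemma ip_self_zero:
  assumes "ip n u u = 0" "i < n"
  shows "u i = 0"
proof -
  have "ip n u u = of_real (\<Sum>i<n. (cmod (u i))\<^sup>2)"
    by (simp add: ip_def complex_norm_square mult.commute del: of_real_power)
  then have "(\<Sum>i<n. (cmod (u i))\<^sup>2) = 0" using assms(1) by (metis of_real_eq_0_iff)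
  then show ?thesis using assms(2) by (subst (asm) sum_nonneg_eq_0_iff) auto
qed

text \<open>\<open>\<Phi>\<close> stands for the flow from \<open>L\<close> to 0. Orthogonality is
  demanded at 0 and coordinates are prescribed at \<open>L\<close>, so vectors at \<open>L\<close>
  are orthogonalised with respect to the inner product of their images.\<close>

locale transport =
  fixes n :: nat and V :: "nat \<Rightarrow> nat \<Rightarrow> complex" and \<Phi> :: "(nat \<Rightarrow> complex) \<Rightarrow> nat \<Rightarrow> complex"
  assumes detV: "D n V \<noteq> 0"
    and lin: "\<And>u (S :: nat set) a v i. i < n \<Longrightarrow> (\<And>i. i < n \<Longrightarrow> u i = (\<Sum>j\<in>S. a j * v j i)) \<Longrightarrow>
        \<Phi> u i = (\<Sum>j\<in>S. a j * \<Phi> (v j) i)"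
    and inj: "\<And>u i. (\<And>i. i < n \<Longrightarrow> \<Phi> u i = 0) \<Longrightarrow> i < n \<Longrightarrow> u i = 0"
begin

text \<open>No normalisation: the coordinate along \<open>V j\<close> has to stay 1, as the
  condition with \<open>W j\<close> at \<open>L\<close> demands.\<close>

function gs :: "nat \<Rightarrow> nat \<Rightarrow> complex" where
  "gs j = (\<lambda>i. V j i - (\<Sum>k<j. ip n (\<Phi> (gs k)) (\<Phi> (V j)) / ip n (\<Phi> (gs k)) (\<Phi> (gs k)) * gs k i))"
  by auto
termination by (relation "Wellfounded.measure id") auto

declare gs.simps [simp del]

definition "q k j = ip n (\<Phi> (gs k)) (\<Phi> (V j)) / ip n (\<Phi> (gs k)) (\<Phi> (gs k))"

lemma gs_eq: "gs j i = V j i - (\<Sum>k<j. q k j * gs k i)"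
  by (subst gs.simps) (simp add: q_def)

lemma gs_triangular: "\<exists>t. \<forall>i. gs j i = V j i + (\<Sum>k<j. t k * V k i)"
proof (induction j rule: less_induct)
  case (less j)
  then obtain t where t: "\<And>k i. k < j \<Longrightarrow> gs k i = V k i + (\<Sum>l<k. t k l * V l i)"
    by metis
  define t' where "t' = (\<lambda>k l. if l < k then t k l else if l = k then 1 else 0)"
  have "gs k i = (\<Sum>l<j. t' k l * V l i)" if k: "k < j" for k i
  proof -
    have "(\<Sum>l<j. t' k l * V l i) = (\<Sum>l<Suc k. t' k l * V l i)"
      by (rule sum.mono_neutral_right) (use k in \<open>auto simp: t'_def\<close>)
    then show ?thesis using t[OF k] by (simp add: t'_def)
  qed
  then have "gs j i = V j i - (\<Sum>k<j. q k j * (\<Sum>l<j. t' k l * V l i))" for i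
    by (simp add: gs_eq[of j])
  moreover have "(\<Sum>k<j. q k j * (\<Sum>l<j. t' k l * V l i)) = (\<Sum>l<j. (\<Sum>k<j. q k j * t' k l) * V l i)" for i
    unfolding sum_distrib_left sum_distrib_right by (subst sum.swap) (simp add: mult.assoc)
  ultimately have "gs j i = V j i + (\<Sum>l<j. - (\<Sum>k<j. q k j * t' k l) * V l i)" for i
    by (simp add: sum_negf)
  then show ?case by (intro exI[of _ "\<lambda>l. - (\<Sum>k<j. q k j * t' k l)"]) blast
qed

text \<open>Triangularity in coordinates; these are the conditions that the \<open>j\<close>-th
  boundary-value problem imposes at \<open>L\<close>.\<close>

lemma crd_gs:
  assumes "j < n" "l < n" "j \<le> l"
  shows "crd n V (gs j) l = (if l = j then 1 else 0)"
proof -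
  obtain t where t: "\<And>i. gs j i = V j i + (\<Sum>k<j. t k * V k i)" using gs_triangular by blast
  have "crd n V (gs j) l = (if l < j then t l else if l = j then 1 else 0)"
  proof (rule crd_unique[OF detV _ assms(2)])
    fix i
    have "(\<Sum>l<n. (if l < j then t l else if l = j then 1 else 0) * V l i)
      = (\<Sum>l<Suc j. (if l < j then t l else if l = j then 1 else 0) * V l i)"
      by (rule sum.mono_neutral_right) (use assms in auto)
    then show "gs j i = (\<Sum>l<n. (if l < j then t l else if l = j then 1 else 0) * V l i)" using t by simp
  qed
  then show ?thesis using assms by simp
qed

lemma \<Phi>_gs: "i < n \<Longrightarrow> \<Phi> (gs j) i = \<Phi> (V j) i - (\<Sum>k<j. q k j * \<Phi> (gs k) i)"
proof -
  assume i: "i < n"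
  have "\<Phi> (V j) i = (\<Sum>k\<in>{..<Suc j}. (if k < j then q k j else 1) * \<Phi> (gs k) i)"
    by (rule lin[OF i]) (simp add: gs_eq[of j])
  then show ?thesis by simp
qed

text \<open>By injectivity of \<open>\<Phi>\<close> a vanishing norm would force
  \<open>gs j = 0\<close>, against its \<open>j\<close>-th coordinate 1. The quotients in
  \<open>gs\<close> are thus genuine.\<close>

lemma gs_nonzero:
  assumes "j < n"
  shows "ip n (\<Phi> (gs j)) (\<Phi> (gs j)) \<noteq> 0"
proof
  assume "ip n (\<Phi> (gs j)) (\<Phi> (gs j)) = 0"
  then have "gs j i = 0" if "i < n" for i
    using inj[OF _ that] ip_self_zero by blast
  then have "crd n V (gs j) j = 0" by (simp add: crd_def)
  then show False using crd_gs[of j j] assms by simp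
qed

lemma gs_orthogonal:
  assumes "j < n" "k < j"
  shows "ip n (\<Phi> (gs k)) (\<Phi> (gs j)) = 0"
  using assms
proof (induction j arbitrary: k rule: less_induct)
  case (less j)
  have orth: "ip n (\<Phi> (gs k)) (\<Phi> (gs l)) = 0" if "l < j" "k \<noteq> l" for l
  proof (cases "k < l")
    case True
    then show ?thesis using less that by auto
  next
    case False
    then have "ip n (\<Phi> (gs l)) (\<Phi> (gs k)) = 0" using less that by auto
    then show ?thesis using ip_cnj by (metis complex_cnj_zero)
  qed
  have "ip n (\<Phi> (gs k)) (\<Phi> (gs j)) = ip n (\<Phi> (gs k)) (\<lambda>i. \<Phi> (V j) i - (\<Sum>l<j. q l j * \<Phi> (gs l) i))"
    by (rule ip_cong) (simp_all add: \<Phi>_gs[of _ j])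
  also have "\<dots> = ip n (\<Phi> (gs k)) (\<Phi> (V j)) - (\<Sum>l<j. q l j * ip n (\<Phi> (gs k)) (\<Phi> (gs l)))"
    by (simp add: ip_diff_right ip_sum_right)
  also have "(\<Sum>l<j. q l j * ip n (\<Phi> (gs k)) (\<Phi> (gs l)))
      = (\<Sum>l<j. if l = k then q k j * ip n (\<Phi> (gs k)) (\<Phi> (gs k)) else 0)"
    by (intro sum.cong) (use orth in auto)
  also have "\<dots> = ip n (\<Phi> (gs k)) (\<Phi> (V j))"
    using less gs_nonzero[of k] by (simp add: q_def)
  finally show ?case by simp
qed

text \<open>\<open>u\<close> lies in the span of the \<open>V l\<close> with \<open>l < j\<close>,
  whose images are combinations of the \<open>\<Phi> (gs k)\<close>; hence \<open>\<Phi> u\<close>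
  is orthogonal to itself. Uniqueness for the boundary-value problems rests on this.\<close>

lemma orthogonal_zero:
  assumes j: "j \<le> n" and u: "\<And>l. j \<le> l \<Longrightarrow> l < n \<Longrightarrow> crd n V u l = 0"
    and o: "\<And>k. k < j \<Longrightarrow> ip n (\<Phi> (gs k)) (\<Phi> u) = 0" and i: "i < n"
  shows "u i = 0"
proof -
  have VO: "ip n (\<Phi> u) (\<Phi> (V l)) = 0" if l: "l < j" for l
  proof -
    have o': "ip n (\<Phi> u) (\<Phi> (gs k)) = 0" if "k < j" for k
      using o[OF that] ip_cnj by (metis complex_cnj_zero)
    have "ip n (\<Phi> u) (\<Phi> (V l)) = ip n (\<Phi> u) (\<lambda>i. \<Sum>k\<in>{..<Suc l}. (if k < l then q k l else 1) * \<Phi> (gs k) i)"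
      by (rule ip_cong) (auto simp: \<Phi>_gs[of _ l])
    also have "\<dots> = (\<Sum>k\<in>{..<Suc l}. (if k < l then q k l else 1) * ip n (\<Phi> u) (\<Phi> (gs k)))"
      by (rule ip_sum_right)
    also have "\<dots> = 0" by (rule sum.neutral) (use o' l in auto)
    finally show ?thesis .
  qed
  have ui: "u i = (\<Sum>l<j. crd n V u l * V l i)" if "i < n" for i
  proof -
    have "(\<Sum>l<n. crd n V u l * V l i) = (\<Sum>l<j. crd n V u l * V l i)"
      by (rule sum.mono_neutral_right) (use u j in auto)
    then show ?thesis using crd_expand[OF detV that, of u] by simp
  qed
  have "ip n (\<Phi> u) (\<Phi> u) = ip n (\<Phi> u) (\<lambda>i. \<Sum>l<j. crd n V u l * \<Phi> (V l) i)"
    by (rule ip_cong) (auto intro: lin ui)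
  also have "\<dots> = 0" unfolding ip_sum_right by (rule sum.neutral) (use VO in auto)
  finally show ?thesis using inj[OF _ i] ip_self_zero by blast
qed

end

section \<open>The boundary-value problems\<close>

locale bvp =
  fixes n r :: nat and V :: "nat \<Rightarrow> nat \<Rightarrow> complex" and nu :: "nat \<Rightarrow> complex"
    and A :: "real \<Rightarrow> nat \<Rightarrow> nat \<Rightarrow> complex" and L :: real
  assumes r: "r \<le> n" and detV: "D n V \<noteq> 0" and L: "L \<ge> 0"
    and A_cont: "\<And>i k. i < n \<Longrightarrow> k < n \<Longrightarrow> continuous_on UNIV (\<lambda>x. A x i k)"
begin

lemma A_cont': "i < n \<Longrightarrow> k < n \<Longrightarrow> continuous_on S (\<lambda>x. A x i k)"
  using A_cont continuous_on_subset by blast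

lemma phi_sol': "sol n A 0 a b (phi n A s v)"
  by (rule phi_sol) (rule A_cont)

lemma phi_linear':
  assumes "i < n" "\<And>i. i < n \<Longrightarrow> v i = (\<Sum>j\<in>S. c j * y j i)"
  shows "phi n A s v x i = (\<Sum>j\<in>S. c j * phi n A s (y j) x i)"
  by (rule phi_linear[OF _ assms]) (rule A_cont)

sublocale transport n V "\<lambda>u. phi n A L u 0"
proof
  fix u i assume z: "\<And>i. i < n \<Longrightarrow> phi n A L u 0 i = 0" and i: "i < n"
  have "phi n A L u L i = (\<lambda>x i. 0) L i"
    by (rule sol_unique[OF phi_sol', where a = 0 and b = L and s = 0])
       (use z i L A_cont' in \<open>auto simp: sol_def mv_def deriv_on_const\<close>)
  then show "u i = 0" by (simp add: phi_init)
next
  fix u :: "nat \<Rightarrow> complex" and S :: "nat set" and a v i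
  assume "i < n" "\<And>i. i < n \<Longrightarrow> u i = (\<Sum>j\<in>S. a j * v j i)"
  then show "phi n A L u 0 i = (\<Sum>j\<in>S. a j * phi n A L (v j) 0 i)" by (rule phi_linear')
qed (rule detV)

text \<open>The rescaling is normalised at \<open>L\<close>, so that the values there are the
  vectors \<open>gs j\<close> themselves.\<close>

definition "S j x i = exp ((0 - nu j) * of_real (x - L)) * phi n A L (gs j) x i"

definition "Y j x i = exp ((0 - nu j) * of_real (x - L)) * phi n A L (V j) x i"

text \<open>Coordinates replace the inner products with \<open>W\<close> at \<open>L\<close>: every
  adjoint eigenvector annihilates all eigenvectors but its own, as \<open>ip_W\<close>
  shows.\<close>

definition "fbvp prev j v \<longleftrightarrow> sol n A (nu j) 0 L v \<and> (\<forall>k<j. ip n (prev k 0) (v 0) = 0) \<and>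
   crd n V (v L) j = 1 \<and> (\<forall>k. j < k \<and> k < n \<longrightarrow> crd n V (v L) k = 0)"

lemma S_sol: "sol n A (nu j) a b (S j)"
  unfolding S_def by (rule sol_shift[OF phi_sol'])

lemma Y_sol: "sol n A (nu j) a b (Y j)"
  unfolding Y_def by (rule sol_shift[OF phi_sol'])

lemma S_0: "S j 0 = (\<lambda>i. exp (nu j * of_real L) * phi n A L (gs j) 0 i)"
  by (auto simp: S_def)

lemma Y_0: "Y j 0 = (\<lambda>i. exp (nu j * of_real L) * phi n A L (V j) 0 i)"
  by (auto simp: Y_def)

lemma S_L: "S j L = gs j"
  by (auto simp: S_def phi_init)

lemma Y_L: "Y j L = V j"
  by (auto simp: Y_def phi_init)

lemma S_bvp:
  assumes "j < n"
  shows "fbvp S j (S j)"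
  unfolding fbvp_def
proof (intro conjI allI impI)
  fix k assume "k < j"
  then show "ip n (S k 0) (S j 0) = 0"
    using gs_orthogonal[OF assms] unfolding S_0 ip_scale_left ip_scale_right by simp
next
  show "crd n V (S j L) j = 1" using crd_gs[OF assms assms] by (simp add: S_L)
  show "crd n V (S j L) k = 0" if "j < k \<and> k < n" for k
    using crd_gs[OF assms, of k] that by (simp add: S_L)
qed (rule S_sol)

text \<open>At \<open>L\<close> the difference of two solutions has no coordinates from
  \<open>j\<close> on, and at 0 it is orthogonal to the earlier solutions. The exponential factors
  are nonzero and do not disturb orthogonality, so \<open>orthogonal_zero\<close> applies.\<close>

lemma S_unique:
  assumes j: "j < n" and v: "fbvp S j v" and x: "x \<in> {0..L}" and i: "i < n"
  shows "v x i = S j x i"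
proof -
  define d where "d = (\<lambda>x i. v x i - S j x i)"
  have d: "sol n A (nu j) 0 L d"
    unfolding d_def by (rule sol_diff) (use v S_sol in \<open>auto simp: fbvp_def\<close>)
  have d0: "d 0 i = exp ((0 - nu j) * of_real (0 - L)) * phi n A L (d L) 0 i" if "i < n" for i
    by (rule sol_unique[OF d sol_shift[OF phi_sol'], where s = L])
       (use that L A_cont' in \<open>auto simp: phi_init\<close>)
  have "d L i = 0" if "i < n" for i
  proof (rule orthogonal_zero[OF _ _ _ that, of j])
    show "crd n V (d L) l = 0" if "j \<le> l" "l < n" for l
      using v S_bvp[OF j] that unfolding d_def crd_diff fbvp_def by (cases "l = j") auto
    fix k assume k: "k < j"
    have "ip n (S k 0) (d 0) = 0"
      using v S_bvp[OF j] k unfolding d_def ip_diff_right fbvp_def by auto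
    moreover have "ip n (S k 0) (d 0) = ip n (\<lambda>i. exp ((0 - nu k) * of_real (0 - L)) * phi n A L (gs k) 0 i)
        (\<lambda>i. exp ((0 - nu j) * of_real (0 - L)) * phi n A L (d L) 0 i)"
      by (rule ip_cong) (auto simp: S_def d0)
    ultimately show "ip n (phi n A L (gs k) 0) (phi n A L (d L) 0) = 0"
      by (simp add: ip_scale_left ip_scale_right)
  qed (use j in auto)
  then have dL: "d L i = 0" if "i < n" for i using that by blast
  have "d x i = (\<lambda>x i. 0) x i"
    by (rule sol_unique[OF d, of "\<lambda>x i. 0", where s = L])
       (use x i L A_cont' dL in \<open>auto simp: sol_def mv_def deriv_on_const\<close>)
  then show ?thesis by (simp add: d_def)
qed

text \<open>Rescaling by different exponents multiplies the triangular coefficients by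
  \<open>e j / e k\<close>, which leaves the unit diagonal in place.\<close>

lemma S_minor:
  "D n (\<lambda>j. if j < r then S j 0 else c j) = D n (\<lambda>j. if j < r then Y j 0 else c j)"
proof -
  obtain t where t: "\<And>j i. gs j i = V j i + (\<Sum>k<j. t j k * V k i)" using gs_triangular by metis
  define e where "e = (\<lambda>j. exp (nu j * of_real L))"
  show ?thesis
  proof (rule D_unipotent[OF r, where T = "\<lambda>k j. t j k * e j / e k"])
    fix j i assume i: "i < n"
    have "phi n A L (gs j) 0 i = (\<Sum>k\<in>{..<Suc j}. (if k < j then t j k else 1) * phi n A L (V k) 0 i)"
      by (rule lin[OF i]) (simp add: t)
    then have "S j 0 i = Y j 0 i + (\<Sum>k<j. e j * (t j k * phi n A L (V k) 0 i))"
      unfolding S_0 Y_0 e_def by (simp add: distrib_left sum_distrib_left)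
    moreover have "e j * (t j k * phi n A L (V k) 0 i) = t j k * e j / e k * Y k 0 i" for k
      unfolding Y_0 e_def by simp
    ultimately show "S j 0 i = Y j 0 i + (\<Sum>k<j. t j k * e j / e k * Y k 0 i)" by simp
  qed
qed

lemma gs_minor: "D n (\<lambda>j. if j < r then gs j else c j) = D n (\<lambda>j. if j < r then V j else c j)"
proof -
  obtain t where t: "\<And>j i. gs j i = V j i + (\<Sum>k<j. t j k * V k i)" using gs_triangular by metis
  show ?thesis by (rule D_unipotent[OF r, where T = "\<lambda>k j. t j k"]) (use t in auto)
qed

end

section \<open>Coordinate determinants\<close>

text \<open>With \<open>V\<close> in the last columns the coefficient matrix is block triangular,
  and only the first \<open>r\<close> coordinates count.\<close>

lemma D_coordinates:
  assumes r: "r \<le> n" and V: "D n V \<noteq> 0"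
  shows "D n (\<lambda>j. if j < r then u j else V j) = D n V * D r (\<lambda>j k. crd n V (u j) k)"
proof -
  define M where "M = (\<lambda>j k. if j < r then crd n V (u j) k else if k = j then 1 else (0::complex))"
  have "D n (\<lambda>j. if j < r then u j else V j) = D n (\<lambda>j i. \<Sum>k<n. M j k * V k i)"
  proof (rule D_cong)
    fix i j assume ij: "i < n" "j < n"
    show "(if j < r then u j else V j) i = (\<Sum>k<n. M j k * V k i)"
    proof (cases "j < r")
      case True
      then show ?thesis using crd_expand[OF V ij(1), of "u j"] by (simp add: M_def)
    next
      case False
      have "(\<Sum>k<n. M j k * V k i) = (\<Sum>k<n. if k = j then V j i else 0)"
        by (intro sum.cong refl) (use False in \<open>auto simp: M_def\<close>)
      then show ?thesis using False ij by simp
    qed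
  qed
  also have "\<dots> = D n V * D n M" by (rule D_matmul)
  also have "D n M = D r (\<lambda>j k. crd n V (u j) k)"
  proof -
    have "Matrix.mat n n (\<lambda>(i,j). M j i) = four_block_mat (Matrix.mat r r (\<lambda>(k,j). crd n V (u j) k))
        (0\<^sub>m r (n - r)) (Matrix.mat (n - r) r (\<lambda>(k,j). crd n V (u j) (k + r))) (1\<^sub>m (n - r))"
      by (rule eq_matI) (use r in \<open>auto simp: M_def\<close>)
    then show ?thesis unfolding D_def
      by (simp add: det_four_block_mat_upper_right_zero[of _ r _ "n - r"])
  qed
  finally show ?thesis .
qed

lemma coefficient_det:
  assumes r: "r \<le> n" and V: "D n V \<noteq> 0"
    and C: "\<And>j i. j < r \<Longrightarrow> i < n \<Longrightarrow> Z j i = (\<Sum>k<r. C k j * B k i)"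
  shows "D r (\<lambda>j k. crd n V (Z j) k) = D r (\<lambda>j k. crd n V (B j) k) * D r (\<lambda>j k. C k j)"
proof -
  have "D n (\<lambda>j. if j < r then Z j else V j) = D n (\<lambda>j. if j < r then B j else V j) * D r (\<lambda>j k. C k j)"
    by (rule D_block_mult[OF r C])
  then show ?thesis unfolding D_coordinates[OF r V] using V by simp
qed

lemma coefficient_unique:
  assumes r: "r \<le> n" and B: "D n (\<lambda>j. if j < r then B j else c j) \<noteq> 0"
    and eq: "\<And>i. i < n \<Longrightarrow> (\<Sum>k<r. a k * B k i) = (\<Sum>k<r. b k * B k i)" and k: "k < r"
  shows "a k = b k"
proof -
  have "(if k < r then a k - b k else 0) = 0"
  proof (rule D_independent[OF B, where a = "\<lambda>k. if k < r then a k - b k else 0"])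
    fix i assume i: "i < n"
    have "(\<Sum>l<n. (if l < r then a l - b l else 0) * (if l < r then B l else c l) i)
       = (\<Sum>l<r. (a l - b l) * B l i)"
      by (rule sum.mono_neutral_cong_right) (use r in auto)
    also have "\<dots> = 0" using eq[OF i] by (simp add: left_diff_distrib sum_subtractf)
    finally show "(\<Sum>l<n. (if l < r then a l - b l else 0) * (if l < r then B l else c l) i) = 0" .
  qed (use k r in auto)
  then show ?thesis using k by simp
qed

text \<open>The recursion \<open>gs_eq\<close>, solved for \<open>V l\<close>, inverts the
  triangular change of basis.\<close>

lemma (in bvp) gs_spans:
  assumes u: "\<And>l. r \<le> l \<Longrightarrow> l < n \<Longrightarrow> crd n V u l = 0"
  shows "\<exists>a. \<forall>i<n. u i = (\<Sum>k<r. a k * gs k i)"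
proof -
  define q' where "q' = (\<lambda>l k. if k < l then q k l else if k = l then 1 else 0)"
  have V: "V l i = (\<Sum>k<r. q' l k * gs k i)" if "l < r" for l i
  proof -
    have "(\<Sum>k<r. q' l k * gs k i) = (\<Sum>k<Suc l. q' l k * gs k i)"
      by (rule sum.mono_neutral_right) (use that in \<open>auto simp: q'_def\<close>)
    then show ?thesis using gs_eq[of l i] by (simp add: q'_def)
  qed
  have "u i = (\<Sum>k<r. (\<Sum>l<r. crd n V u l * q' l k) * gs k i)" if i: "i < n" for i
  proof -
    have "u i = (\<Sum>l<n. crd n V u l * V l i)" by (rule crd_expand[OF detV i])
    also have "\<dots> = (\<Sum>l<r. crd n V u l * V l i)"
      by (rule sum.mono_neutral_right) (use u r in auto)
    also have "\<dots> = (\<Sum>l<r. \<Sum>k<r. crd n V u l * q' l k * gs k i)"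
      by (simp add: V sum_distrib_left mult.assoc)
    also have "\<dots> = (\<Sum>k<r. (\<Sum>l<r. crd n V u l * q' l k) * gs k i)"
      by (subst sum.swap) (simp add: sum_distrib_right)
    finally show ?thesis .
  qed
  then show ?thesis by (intro exI[of _ "\<lambda>k. \<Sum>l<r. crd n V u l * q' l k"]) simp
qed

section \<open>The stable subspace\<close>

text \<open>One half-line at a fixed \<open>L\<close>, in a form that fits both sides after
  reflection. The second condition on \<open>L\<close> lets the gap \<delta> dominate the
  perturbation beyond \<open>L\<close>; \<open>XL\<close> says that the exact solutions at
  \<open>L\<close> have independent stable coordinates.\<close>

locale stable_frame = right_frame n "{r..<n}" V nu A rho K \<alpha>
  for n r V nu A rho K \<alpha> +
  fixes X :: "nat \<Rightarrow> real \<Rightarrow> nat \<Rightarrow> complex" and \<delta> L :: real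
  assumes r: "r \<le> n"
    and A_cont: "\<And>i k. i < n \<Longrightarrow> k < n \<Longrightarrow> continuous_on UNIV (\<lambda>x. A x i k)"
    and X: "\<And>j b. j < r \<Longrightarrow> sol n A (nu j) 0 b (X j)"
    and X_lim: "\<And>j i. j < r \<Longrightarrow> i < n \<Longrightarrow> ((\<lambda>x. X j x i) \<longlongrightarrow> V j i) at_top"
    and \<delta>_pos: "\<And>l. r \<le> l \<Longrightarrow> l < n \<Longrightarrow> Re (nu l) \<ge> \<delta>"
    and \<delta>_neg: "\<And>l. l < r \<Longrightarrow> Re (nu l) \<le> - \<delta>" and \<delta>: "\<delta> > 0"
    and L: "L \<ge> 0" "n * (K * exp (- \<alpha> * L)) \<le> \<delta>"
    and XL: "D r (\<lambda>j k. crd n V (X j L) k) \<noteq> 0"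
begin

lemma phi_sol': "sol n A 0 a b (phi n A s v)"
  by (rule phi_sol) (rule A_cont)

lemma phi_linear':
  assumes "i < n" "\<And>i. i < n \<Longrightarrow> v i = (\<Sum>j\<in>S. c j * y j i)"
  shows "phi n A s v x i = (\<Sum>j\<in>S. c j * phi n A s (y j) x i)"
  by (rule phi_linear[OF _ assms]) (rule A_cont)

lemma phi_unique':
  assumes "i < n" "sol n A 0 (min s x) (max s x) u" "\<And>i. i < n \<Longrightarrow> u s i = v i"
  shows "u x i = phi n A s v x i"
  by (rule phi_unique[OF _ assms]) (rule A_cont)

definition "decays u \<longleftrightarrow> (\<forall>i<n. ((\<lambda>x. phi n A L u x i) \<longlongrightarrow> 0) at_top)"

lemma phi_sum: "i < n \<Longrightarrow> phi n A L (\<lambda>i. \<Sum>k\<in>S. a k * v k i) x i = (\<Sum>k\<in>S. a k * phi n A L (v k) x i)"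
  by (rule phi_linear') auto

lemma decays_sum:
  assumes "\<And>k. k \<in> S \<Longrightarrow> decays (v k)"
  shows "decays (\<lambda>i. \<Sum>k\<in>S. a k * v k i)"
  unfolding decays_def
proof (intro allI impI)
  fix i assume i: "i < n"
  have "((\<lambda>x. \<Sum>k\<in>S. a k * phi n A L (v k) x i) \<longlongrightarrow> (\<Sum>k\<in>S. a k * 0)) at_top"
    using assms i by (intro tendsto_intros) (auto simp: decays_def)
  then show "((\<lambda>x. phi n A L (\<lambda>i. \<Sum>k\<in>S. a k * v k i) x i) \<longlongrightarrow> 0) at_top"
    using i by (simp add: phi_sum)
qed

lemma decays_diff:
  assumes "decays u" "decays v"
  shows "decays (\<lambda>i. u i - v i)"
proof -
  have "decays (\<lambda>i. \<Sum>k<2::nat. (if k = 0 then 1 else - 1) * (if k = 0 then u else v) i)"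
    by (rule decays_sum) (use assms in auto)
  then show ?thesis by (simp add: numeral_2_eq_2)
qed

lemma phi_X:
  assumes j: "j < r" and i: "i < n" and x: "x \<ge> 0"
  shows "phi n A L (X j L) x i = exp (nu j * of_real (x - L)) * X j x i"
proof -
  have "exp ((nu j - 0) * of_real (x - L)) * X j x i = phi n A L (X j L) x i"
    by (rule phi_unique'[OF i sol_shift[OF sol_subset[OF X[OF j, of "max L x"]]]]) (use x L in auto)
  then show ?thesis by simp
qed

lemma decays_X:
  assumes j: "j < r"
  shows "decays (X j L)"
  unfolding decays_def
proof (intro allI impI)
  fix i assume i: "i < n"
  have "((\<lambda>x. exp (Re (nu j) * (x - L))) \<longlongrightarrow> 0) at_top"
  proof -
    have "filterlim (\<lambda>x. (- Re (nu j)) * (x - L)) at_top at_top"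
      using \<delta>_neg[OF j] \<delta>
      by (intro filterlim_tendsto_pos_mult_at_top[OF tendsto_const])
         (auto intro!: filterlim_at_top_mono[OF filterlim_tendsto_add_at_top[OF tendsto_const filterlim_ident, of "- L"]])
    then have "filterlim (\<lambda>x. Re (nu j) * (x - L)) at_bot at_top"
      by (simp add: filterlim_uminus_at_bot)
    then show ?thesis by (rule filterlim_compose[OF exp_at_bot])
  qed
  then have "((\<lambda>x. exp (nu j * of_real (x - L))) \<longlongrightarrow> 0) at_top"
    by (subst tendsto_norm_zero_iff[symmetric]) (simp add: norm_exp_eq_Re)
  from tendsto_mult[OF this X_lim[OF j i]]
  have "((\<lambda>x. exp (nu j * of_real (x - L)) * X j x i) \<longlongrightarrow> 0) at_top" by simp
  then show "((\<lambda>x. phi n A L (X j L) x i) \<longlongrightarrow> 0) at_top"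
    by (rule Lim_transform_eventually)
       (use eventually_ge_at_top[of 0] in \<open>eventually_elim, simp add: phi_X[OF j i]\<close>)
qed

text \<open>The stable subspace at \<open>L\<close> meets the unstable eigenspace only in 0, by
  \<open>decaying_solution_zero\<close>. This takes the place of a dimension count.\<close>

lemma decays_zero:
  assumes u: "decays u" and z: "\<And>l. l < r \<Longrightarrow> crd n V u l = 0" and i: "i < n"
  shows "u i = 0"
proof -
  have "phi n A L u L i = 0"
  proof (rule decaying_solution_zero[OF phi_sol'])
    show "crd n V (phi n A L u L) l = 0" if "l < n" "l \<notin> {r..<n}" for l
      using z[of l] that by (simp add: phi_init cong: crd_cong)
  qed (use u i \<delta>_pos \<delta>_neg L in \<open>auto simp: decays_def\<close>)
  then show ?thesis by (simp add: phi_init)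
qed

lemma X_top_coordinates: "\<exists>a. \<forall>l<r. crd n V (\<lambda>i. \<Sum>k<r. a k * X k L i) l = c l"
proof -
  define a where "a = crd r (\<lambda>j k. crd n V (X j L) k) c"
  have "crd n V (\<lambda>i. \<Sum>k<r. a k * X k L i) l = c l" if "l < r" for l
    unfolding crd_sum a_def using crd_expand[OF XL that, of c] by simp
  then show ?thesis by (intro exI[of _ a]) simp
qed

text \<open>By \<open>XL\<close> some combination of the \<open>X k L\<close> has the same stable
  coordinates as \<open>u\<close>; the remainder decays without stable coordinates and therefore
  vanishes.\<close>

lemma decays_iff: "decays u \<Longrightarrow> \<exists>a. \<forall>i<n. u i = (\<Sum>k<r. a k * X k L i)"
proof -
  assume u: "decays u"
  obtain a where a: "\<And>l. l < r \<Longrightarrow> crd n V (\<lambda>i. \<Sum>k<r. a k * X k L i) l = crd n V u l"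
    using X_top_coordinates by blast
  have "u i - (\<Sum>k<r. a k * X k L i) = 0" if "i < n" for i
    by (rule decays_zero[OF decays_diff[OF u decays_sum[OF decays_X]]])
       (use a that in \<open>auto simp: crd_diff\<close>)
  then show ?thesis by (intro exI[of _ a]) auto
qed

lemma projection_exists:
  "\<exists>a. decays (\<lambda>i. \<Sum>k<r. a k * X k L i) \<and> (\<forall>l<r. crd n V (\<lambda>i. z i - (\<Sum>k<r. a k * X k L i)) l = 0)"
proof -
  obtain a where a: "\<And>l. l < r \<Longrightarrow> crd n V (\<lambda>i. \<Sum>k<r. a k * X k L i) l = crd n V z l"
    using X_top_coordinates by blast
  then show ?thesis
    by (intro exI[of _ a]) (auto simp: crd_diff intro: decays_sum decays_X)
qed

lemma projection_unique:
  assumes "decays u" "decays v" "\<And>l. l < r \<Longrightarrow> crd n V (\<lambda>i. z i - u i) l = 0"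
    "\<And>l. l < r \<Longrightarrow> crd n V (\<lambda>i. z i - v i) l = 0" "i < n"
  shows "u i = v i"
proof -
  have "u i - v i = 0"
    by (rule decays_zero[OF decays_diff[OF assms(1,2)]])
       (use assms in \<open>auto simp: crd_diff\<close>)
  then show ?thesis by simp
qed

end

section \<open>Coordinates of vectors and matrices\<close>

definition mf :: "complex mat \<Rightarrow> nat \<Rightarrow> nat \<Rightarrow> complex" where
  "mf M i k = M $$ (i, k)"

lemma mult_mat_vec_mv:
  "M \<in> carrier_mat n n \<Longrightarrow> v \<in> carrier_vec n \<Longrightarrow> i < n \<Longrightarrow> (M *\<^sub>v v) $ i = mv n (mf M) (vec_index v) i"
  by (simp add: scalar_prod_def mv_def mf_def atLeast0LessThan)

lemma cinner_ip: "u \<in> carrier_vec n \<Longrightarrow> v \<in> carrier_vec n \<Longrightarrow> cinner u v = ip n (vec_index u) (vec_index v)"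
  by (simp add: cinner_def ip_def scalar_prod_def atLeast0LessThan conjugate_complex_def)

lemma shifted_mult_mat_vec:
  assumes "M \<in> carrier_mat n n" "v \<in> carrier_vec n" "i < n"
  shows "((M - c \<cdot>\<^sub>m 1\<^sub>m n) *\<^sub>v v) $ i = mv n (mf M) (vec_index v) i - c * v $ i"
proof -
  have "((M - c \<cdot>\<^sub>m 1\<^sub>m n) *\<^sub>v v) $ i = (\<Sum>k<n. (M $$ (i,k) - c * (if i = k then 1 else 0)) * v $ k)"
    using assms by (simp add: scalar_prod_def atLeast0LessThan)
  also have "\<dots> = (\<Sum>k<n. M $$ (i,k) * v $ k - (if k = i then c * v $ i else 0))"
    by (intro sum.cong) (auto simp: algebra_simps)
  also have "\<dots> = mv n (mf M) (vec_index v) i - c * v $ i"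
    using assms(3) by (simp add: sum_subtractf mv_def mf_def)
  finally show ?thesis .
qed

lemma ode_sol_sol:
  assumes M: "\<And>x. M x \<in> carrier_mat n n" and U: "ode_sol n (\<lambda>x. M x - c \<cdot>\<^sub>m 1\<^sub>m n) I U"
    and I: "{a..b} \<subseteq> I"
  shows "sol n (\<lambda>x. mf (M x)) c a b (\<lambda>x. vec_index (U x))"
  unfolding sol_def
proof (intro allI impI, rule deriv_on_within[OF _ I])
  fix i x assume i: "i < n" and x: "x \<in> I"
  then have "U x \<in> carrier_vec n"
    "((\<lambda>t. U t $ i) has_vector_derivative ((M x - c \<cdot>\<^sub>m 1\<^sub>m n) *\<^sub>v U x) $ i) (at x within I)"
    using U by (auto simp: ode_sol_def)
  then show "((\<lambda>x. U x $ i) has_vector_derivative mv n (mf (M x)) (vec_index (U x)) i - c * U x $ i) (at x within I)"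
    using shifted_mult_mat_vec[OF M _ i] by simp
qed

lemma ode_sol_UNIV_sol:
  assumes M: "\<And>x. M x \<in> carrier_mat n n" and U: "ode_sol n M UNIV U"
  shows "sol n (\<lambda>x. mf (M x)) 0 a b (\<lambda>x. vec_index (U x))"
  unfolding sol_def
proof (intro allI impI, rule deriv_on_within[where I = UNIV])
  fix i x assume i: "i < n"
  then have "U x \<in> carrier_vec n" "((\<lambda>t. U t $ i) has_vector_derivative (M x *\<^sub>v U x) $ i) (at x)"
    using U by (auto simp: ode_sol_def)
  then show "((\<lambda>x. U x $ i) has_vector_derivative mv n (mf (M x)) (vec_index (U x)) i - 0 * U x $ i) (at x within UNIV)"
    using mult_mat_vec_mv[OF M _ i] by simp
qed simp

lemma bvp_ode_iff:
  assumes M: "\<And>x. M x \<in> carrier_mat n n"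
  shows "bvp_ode n (\<lambda>x. M x - c \<cdot>\<^sub>m 1\<^sub>m n) a b U \<longleftrightarrow>
    (\<forall>x\<in>{a..b}. U x \<in> carrier_vec n) \<and> sol n (\<lambda>x. mf (M x)) c a b (\<lambda>x. vec_index (U x))"
proof -
  have "((\<lambda>t. U t $ i) has_vector_derivative ((M x - c \<cdot>\<^sub>m 1\<^sub>m n) *\<^sub>v U x) $ i) (at x within {a<..<b}) \<longleftrightarrow>
     ((\<lambda>t. U t $ i) has_vector_derivative mv n (mf (M x)) (vec_index (U x)) i - c * U x $ i) (at x)"
    if "x \<in> {a<..<b}" "U x \<in> carrier_vec n" "i < n" for x i
    using that shifted_mult_mat_vec[OF M that(2,3)] at_within_open[of x "{a<..<b}"] by simp
  then show ?thesis
    unfolding bvp_ode_def ode_sol_def sol_def deriv_on_def by fastforce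
qed

lemma ode_sol_phi:
  assumes M: "\<And>x. M x \<in> carrier_mat n n"
    and c: "\<And>i k. i < n \<Longrightarrow> k < n \<Longrightarrow> continuous_on UNIV (\<lambda>x. mf (M x) i k)"
  shows "ode_sol n M UNIV (\<lambda>x. Matrix.vec n (phi n (\<lambda>x. mf (M x)) s u x))"
  unfolding ode_sol_def
proof (intro ballI conjI allI impI)
  fix x i assume i: "i < n"
  have "(M x *\<^sub>v Matrix.vec n (phi n (\<lambda>x. mf (M x)) s u x)) $ i
      = mv n (mf (M x)) (phi n (\<lambda>x. mf (M x)) s u x) i"
    unfolding mult_mat_vec_mv[OF M vec_carrier i] by (rule mv_cong) simp
  then show "((\<lambda>t. Matrix.vec n (phi n (\<lambda>x. mf (M x)) s u t) $ i) has_vector_derivative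
      (M x *\<^sub>v Matrix.vec n (phi n (\<lambda>x. mf (M x)) s u x)) $ i) (at x)"
    using phi_deriv[where n = n and A = "\<lambda>x. mf (M x)" and s = s and v = u, OF c i] i by simp
qed auto

lemma ode_sol_unique:
  assumes M: "\<And>x. M x \<in> carrier_mat n n"
    and c: "\<And>i k. i < n \<Longrightarrow> k < n \<Longrightarrow> continuous_on UNIV (\<lambda>x. mf (M x) i k)"
    and U: "ode_sol n M UNIV U"
  shows "U x = Matrix.vec n (phi n (\<lambda>x. mf (M x)) s (vec_index (U s)) x)"
proof (rule eq_vecI)
  fix i assume "i < dim_vec (Matrix.vec n (phi n (\<lambda>x. mf (M x)) s (vec_index (U s)) x))"
  then have i: "i < n" by simp
  have "U x $ i = phi n (\<lambda>x. mf (M x)) s (vec_index (U s)) x i"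
    by (rule phi_unique[OF _ i ode_sol_UNIV_sol[OF M U]]) (use c in auto)
  then show "U x $ i = Matrix.vec n (phi n (\<lambda>x. mf (M x)) s (vec_index (U s)) x) $ i" using i by simp
next
  have "U x \<in> carrier_vec n" using U by (auto simp: ode_sol_def)
  then show "dim_vec (U x) = dim_vec (Matrix.vec n (phi n (\<lambda>x. mf (M x)) s (vec_index (U s)) x))" by simp
qed

lemma ode_flow_phi:
  assumes M: "\<And>x. M x \<in> carrier_mat n n"
    and c: "\<And>i k. i < n \<Longrightarrow> k < n \<Longrightarrow> continuous_on UNIV (\<lambda>x. mf (M x) i k)"
    and v: "v \<in> carrier_vec n"
  shows "ode_flow n M s v t = Matrix.vec n (phi n (\<lambda>x. mf (M x)) s (vec_index v) t)"
proof -
  have "(THE U. ode_sol n M UNIV U \<and> U s = v) = (\<lambda>x. Matrix.vec n (phi n (\<lambda>x. mf (M x)) s (vec_index v) x))"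
  proof (rule the_equality)
    show "ode_sol n M UNIV (\<lambda>x. Matrix.vec n (phi n (\<lambda>x. mf (M x)) s (vec_index v) x)) \<and>
        Matrix.vec n (phi n (\<lambda>x. mf (M x)) s (vec_index v) s) = v"
      using ode_sol_phi[OF M c] v by (auto simp: phi_init)
    fix U assume "ode_sol n M UNIV U \<and> U s = v"
    then show "U = (\<lambda>x. Matrix.vec n (phi n (\<lambda>x. mf (M x)) s (vec_index v) x))"
      using ode_sol_unique[OF M c, where U = U and s = s] by auto
  qed
  then show ?thesis by (simp add: ode_flow_def)
qed

lemma solution_set_phi:
  assumes M: "\<And>x. M x \<in> carrier_mat n n"
    and c: "\<And>i k. i < n \<Longrightarrow> k < n \<Longrightarrow> continuous_on UNIV (\<lambda>x. mf (M x) i k)"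
    and u: "u \<in> carrier_vec n"
  shows "(\<exists>U. ode_sol n M UNIV U \<and> U s = u \<and> vec_lim n U (0\<^sub>v n) F) \<longleftrightarrow>
     (\<forall>i<n. ((\<lambda>x. phi n (\<lambda>x. mf (M x)) s (vec_index u) x i) \<longlongrightarrow> 0) F)"
proof
  assume "\<exists>U. ode_sol n M UNIV U \<and> U s = u \<and> vec_lim n U (0\<^sub>v n) F"
  then obtain U where U: "ode_sol n M UNIV U" "U s = u" "vec_lim n U (0\<^sub>v n) F" by blast
  have "U x $ i = phi n (\<lambda>x. mf (M x)) s (vec_index u) x i" if "i < n" for x i
    using ode_sol_unique[OF M c U(1), of x s] U(2) that by simp
  then show "\<forall>i<n. ((\<lambda>x. phi n (\<lambda>x. mf (M x)) s (vec_index u) x i) \<longlongrightarrow> 0) F"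
    using U(3) by (simp add: vec_lim_def)
next
  assume *: "\<forall>i<n. ((\<lambda>x. phi n (\<lambda>x. mf (M x)) s (vec_index u) x i) \<longlongrightarrow> 0) F"
  show "\<exists>U. ode_sol n M UNIV U \<and> U s = u \<and> vec_lim n U (0\<^sub>v n) F"
    by (rule exI[of _ "\<lambda>x. Matrix.vec n (phi n (\<lambda>x. mf (M x)) s (vec_index u) x)"])
       (use ode_sol_phi[OF M c] u * in \<open>auto simp: phi_init vec_lim_def\<close>)
qed

lemma det_mat_of_cols: "length vs = n \<Longrightarrow> Determinant.det (mat_of_cols n vs) = D n (\<lambda>j. vec_index (vs ! j))"
  unfolding D_def
  by (rule arg_cong[where f = Determinant.det], rule eq_matI) (auto simp: mat_of_cols_index)

lemma det_cols_D:
  assumes "r \<le> n"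
  shows "det_cols n r Vm Vp = D n (\<lambda>j. if j < n - r then vec_index (Vm j) else vec_index (Vp (j - (n - r))))"
proof -
  have "length (map Vm [0..<n - r] @ map Vp [0..<r]) = n" using assms by simp
  from det_mat_of_cols[OF this] show ?thesis
    unfolding det_cols_def using assms by (simp only:) (rule D_cong, simp add: nth_append)
qed

text \<open>Independence of the columns, completed by some \<open>c\<close> to a basis, makes the
  coefficient matrix unique, so the definite description in \<open>coef_mat\<close> denotes
  \<open>C\<close>.\<close>

lemma coef_mat_det:
  fixes S :: "nat \<Rightarrow> complex vec"
  assumes k: "k \<le> n" and Z: "Z \<in> carrier_mat n k"
    and S: "D n (\<lambda>j. if j < k then vec_index (S j) else c j) \<noteq> 0"
    and C: "\<And>j i. j < k \<Longrightarrow> i < n \<Longrightarrow> Z $$ (i,j) = (\<Sum>l<k. C l j * S l $ i)"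
  shows "\<exists>!Q. Q \<in> carrier_mat k k \<and> mat_of_cols n (map S [0..<k]) * Q = Z"
    and "Determinant.det (coef_mat n k S Z) = D k (\<lambda>j l. C l j)"
proof -
  let ?Q = "Matrix.mat k k (\<lambda>(l,j). C l j)"
  have prod: "(mat_of_cols n (map S [0..<k]) * Q) $$ (i,j) = (\<Sum>l<k. Q $$ (l,j) * S l $ i)"
    if "Q \<in> carrier_mat k k" "i < n" "j < k" for Q i j
    using that by (auto simp: scalar_prod_def atLeast0LessThan mat_of_cols_index mult.commute intro!: sum.cong)
  have 1: "?Q \<in> carrier_mat k k \<and> mat_of_cols n (map S [0..<k]) * ?Q = Z"
  proof
    show "mat_of_cols n (map S [0..<k]) * ?Q = Z"
    proof (rule eq_matI)
      fix i j assume "i < dim_row Z" "j < dim_col Z"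
      then have ij: "i < n" "j < k" using Z by auto
      show "(mat_of_cols n (map S [0..<k]) * ?Q) $$ (i,j) = Z $$ (i,j)"
        using ij C by (subst prod) auto
    qed (use Z in auto)
  qed simp
  have 2: "Q = ?Q" if Q: "Q \<in> carrier_mat k k \<and> mat_of_cols n (map S [0..<k]) * Q = Z" for Q
  proof (rule eq_matI)
    fix l j assume "l < dim_row ?Q" "j < dim_col ?Q"
    then have lj: "l < k" "j < k" by auto
    have "Q $$ (l,j) = ?Q $$ (l,j)"
    proof (rule coefficient_unique[OF k S _ lj(1), where a = "\<lambda>l. Q $$ (l,j)" and b = "\<lambda>l. ?Q $$ (l,j)"])
      fix i assume "i < n"
      then show "(\<Sum>l<k. Q $$ (l, j) * S l $ i) = (\<Sum>l<k. ?Q $$ (l, j) * S l $ i)"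
        using prod[of Q i j] prod[of ?Q i j] Q 1 lj by simp
    qed
    then show "Q $$ (l,j) = ?Q $$ (l,j)" .
  qed (use Q in auto)
  show "\<exists>!Q. Q \<in> carrier_mat k k \<and> mat_of_cols n (map S [0..<k]) * Q = Z"
    using 1 2 by blast
  have "coef_mat n k S Z = ?Q"
    unfolding coef_mat_def by (rule the_equality) (use 1 2 in blast)+
  then show "Determinant.det (coef_mat n k S Z) = D k (\<lambda>j l. C l j)" by (simp add: D_def)
qed

section \<open>Matrices with simple spectrum\<close>

lemma mat_adjoint_index:
  assumes "M \<in> carrier_mat n n" "i < n" "k < n"
  shows "mf (mat_adjoint M) i k = cnj (mf M k i)"
  using assms by (simp add: mf_def mat_adjoint_def mat_of_rows_index conjugate_complex_def)

locale eigenbasis =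
  fixes n :: nat and M :: "complex mat" and nu :: "nat \<Rightarrow> complex" and V W :: "nat \<Rightarrow> complex vec"
  assumes M: "M \<in> carrier_mat n n"
    and eigV: "\<And>j. j < n \<Longrightarrow> eigenvector M (V j) (nu j)"
    and eigW: "\<And>j. j < n \<Longrightarrow> eigenvector (mat_adjoint M) (W j) (cnj (nu j))"
    and distinct: "inj_on nu {..<n}"
begin

abbreviation "Vf j \<equiv> vec_index (V j)"

lemma V_carrier: "j < n \<Longrightarrow> V j \<in> carrier_vec n"
  using eigV M by (auto simp: eigenvector_def)

lemma W_carrier: "j < n \<Longrightarrow> W j \<in> carrier_vec n"
  using eigW[of j] M by (auto simp: eigenvector_def mat_adjoint_def)

lemma mv_V: "j < n \<Longrightarrow> i < n \<Longrightarrow> mv n (mf M) (Vf j) i = nu j * Vf j i"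
  using mult_mat_vec_mv[OF M V_carrier, of j i] eigV[of j] V_carrier[of j] by (simp add: eigenvector_def)

lemma mv_W: "j < n \<Longrightarrow> i < n \<Longrightarrow> (\<Sum>k<n. cnj (mf M k i) * vec_index (W j) k) = cnj (nu j) * vec_index (W j) i"
proof -
  assume j: "j < n" and i: "i < n"
  have Ma: "mat_adjoint M \<in> carrier_mat n n" using M by (auto simp: mat_adjoint_def)
  have "mv n (mf (mat_adjoint M)) (vec_index (W j)) i = cnj (nu j) * vec_index (W j) i"
    using mult_mat_vec_mv[OF Ma W_carrier[OF j] i] eigW[OF j] W_carrier[OF j] i by (simp add: eigenvector_def)
  then show ?thesis using mat_adjoint_index[OF M i] by (simp add: mv_def)
qed

lemma V_nonzero: "j < n \<Longrightarrow> \<exists>i<n. Vf j i \<noteq> 0"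
proof (rule ccontr)
  assume j: "j < n" and "\<not> (\<exists>i<n. Vf j i \<noteq> 0)"
  then have "V j = 0\<^sub>v n" using V_carrier[OF j] by (intro eq_vecI) auto
  then show False using eigV[OF j] M by (simp add: eigenvector_def)
qed

lemma independent:
  assumes "N \<le> n" "\<And>i. i < n \<Longrightarrow> (\<Sum>l<N. a l * Vf l i) = 0" "k < N"
  shows "a k = 0"
  using assms
proof (induction N arbitrary: a k)
  case (Suc N)
  have N: "N < n" using Suc.prems(1) by simp
  \<comment> \<open>Applying \<open>M - nu N\<close> removes the last eigenvector and multiplies the
    others by nonzero factors.\<close>
  have "(\<Sum>l<N. (a l * (nu l - nu N)) * Vf l i) = 0" if i: "i < n" for i
  proof -
    have "mv n (mf M) (\<lambda>i. \<Sum>l<Suc N. a l * Vf l i) i = 0"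
      unfolding mv_def by (rule sum.neutral) (simp add: Suc.prems(2) del: sum.lessThan_Suc)
    then have "(\<Sum>l<Suc N. a l * (nu l * Vf l i)) = 0"
      unfolding mv_sum mv_scale using mv_V i N by simp
    moreover have "nu N * (\<Sum>l<Suc N. a l * Vf l i) = 0" using Suc.prems(2) i by simp
    ultimately have "(\<Sum>l<Suc N. a l * (nu l * Vf l i)) - nu N * (\<Sum>l<Suc N. a l * Vf l i) = 0" by simp
    then show ?thesis by (simp add: algebra_simps sum_distrib_left sum_subtractf)
  qed
  then have "a l * (nu l - nu N) = 0" if "l < N" for l
    using Suc.IH[of "\<lambda>l. a l * (nu l - nu N)" l] that N by simp
  moreover have "nu l \<noteq> nu N" if "l < N" for l
    using distinct that N by (auto simp: inj_on_def)
  ultimately have z: "a l = 0" if "l < N" for l using that by fastforce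
  obtain i where i: "i < n" "Vf N i \<noteq> 0" using V_nonzero[OF N] by blast
  have "a N = 0" using Suc.prems(2)[OF i(1)] i(2) z by simp
  then show ?case using z Suc.prems(3) less_Suc_eq by auto
qed simp

lemma detV: "D n Vf \<noteq> 0"
  by (rule D_nonzero) (rule independent, auto)

text \<open>Moving \<open>M\<close> across the inner product shows that \<open>nu l\<close> and
  \<open>nu k\<close> act alike on it, and they differ.\<close>

lemma ip_W_V: "k < n \<Longrightarrow> l < n \<Longrightarrow> k \<noteq> l \<Longrightarrow> ip n (vec_index (W k)) (Vf l) = 0"
proof -
  assume k: "k < n" and l: "l < n" and kl: "k \<noteq> l"
  have "nu l * ip n (vec_index (W k)) (Vf l) = ip n (vec_index (W k)) (mv n (mf M) (Vf l))"
    unfolding ip_def using mv_V[OF l] by (simp add: sum_distrib_left mult_ac)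
  also have "\<dots> = (\<Sum>i<n. \<Sum>j<n. cnj (vec_index (W k) i) * (mf M i j * Vf l j))"
    by (simp add: ip_def mv_def sum_distrib_left)
  also have "\<dots> = (\<Sum>j<n. cnj (\<Sum>i<n. cnj (mf M i j) * vec_index (W k) i) * Vf l j)"
    by (subst sum.swap) (simp add: sum_distrib_right mult_ac sum_distrib_left)
  also have "\<dots> = nu k * ip n (vec_index (W k)) (Vf l)"
    using mv_W[OF k] by (simp add: ip_def sum_distrib_left mult_ac)
  finally have "(nu l - nu k) * ip n (vec_index (W k)) (Vf l) = 0" by (simp add: algebra_simps)
  moreover have "nu l \<noteq> nu k" using distinct k l kl by (auto simp: inj_on_def)
  ultimately show ?thesis by simp
qed

text \<open>Biorthogonality leaves one term of the expansion of \<open>u\<close>. Together with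
  \<open>ip_W_V_nonzero\<close> this translates conditions with \<open>W k\<close> into conditions
  on coordinates.\<close>

lemma ip_W:
  assumes k: "k < n"
  shows "ip n (vec_index (W k)) u = crd n Vf u k * ip n (vec_index (W k)) (Vf k)"
proof -
  have "ip n (vec_index (W k)) u = ip n (vec_index (W k)) (\<lambda>i. \<Sum>l<n. crd n Vf u l * Vf l i)"
    by (rule ip_cong) (auto intro: crd_expand[OF detV])
  also have "\<dots> = (\<Sum>l<n. crd n Vf u l * ip n (vec_index (W k)) (Vf l))" by (rule ip_sum_right)
  also have "\<dots> = (\<Sum>l<n. if l = k then crd n Vf u k * ip n (vec_index (W k)) (Vf k) else 0)"
    by (intro sum.cong) (use ip_W_V k in auto)
  finally show ?thesis using k by simp
qed

text \<open>Otherwise \<open>W k\<close> would pair to zero with every vector, itself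
  included.\<close>

lemma ip_W_V_nonzero: "k < n \<Longrightarrow> ip n (vec_index (W k)) (Vf k) \<noteq> 0"
proof
  assume k: "k < n" and z: "ip n (vec_index (W k)) (Vf k) = 0"
  then have "ip n (vec_index (W k)) (vec_index (W k)) = 0" using ip_W[OF k, of "vec_index (W k)"] by simp
  then have "vec_index (W k) i = 0" if "i < n" for i using ip_self_zero that by blast
  then have "W k = 0\<^sub>v n" using W_carrier[OF k] by (intro eq_vecI) auto
  then show False using eigW[OF k] M by (simp add: eigenvector_def mat_adjoint_def)
qed

lemma crd_mv:
  assumes k: "k < n"
  shows "crd n Vf (mv n (mf M) u) k = nu k * crd n Vf u k"
proof (rule crd_unique[OF detV _ k])
  fix i assume i: "i < n"
  have "mv n (mf M) u i = mv n (mf M) (\<lambda>i. \<Sum>l<n. crd n Vf u l * Vf l i) i"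
    by (rule mv_cong) (rule crd_expand[OF detV])
  then show "mv n (mf M) u i = (\<Sum>l<n. nu l * crd n Vf u l * Vf l i)"
    unfolding mv_sum mv_scale using mv_V i by (simp add: mult_ac)
qed

text \<open>Spectral projection onto the eigenvectors with index in \<open>I\<close>: each summand
  is \<open>V l\<close> times the \<open>l\<close>-th row of the inverse basis matrix.\<close>

definition "pr I = Matrix.mat n n (\<lambda>(i,a). \<Sum>l\<in>I. minor_cofactor n Vf l a / D n Vf * Vf l i)"

lemma pr_carrier: "pr I \<in> carrier_mat n n" by (simp add: pr_def)

lemma pr_mult:
  assumes "u \<in> carrier_vec n" "i < n"
  shows "(pr I *\<^sub>v u) $ i = (\<Sum>l\<in>I. crd n Vf (vec_index u) l * Vf l i)"
proof -
  have "(pr I *\<^sub>v u) $ i = (\<Sum>a<n. \<Sum>l\<in>I. minor_cofactor n Vf l a / D n Vf * Vf l i * u $ a)"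
    using assms by (simp add: pr_def scalar_prod_def atLeast0LessThan sum_distrib_right)
  also have "\<dots> = (\<Sum>l\<in>I. crd n Vf (vec_index u) l * Vf l i)"
    by (subst sum.swap) (simp add: crd_def sum_distrib_right sum_distrib_left mult_ac)
  finally show ?thesis .
qed

lemma crd_pr:
  assumes I: "I \<subseteq> {..<n}" and u: "u \<in> carrier_vec n" and k: "k < n"
  shows "crd n Vf (vec_index (pr I *\<^sub>v u)) k = (if k \<in> I then crd n Vf (vec_index u) k else 0)"
proof (rule crd_unique[OF detV _ k])
  fix i assume i: "i < n"
  have "(\<Sum>l<n. (if l \<in> I then crd n Vf (vec_index u) l else 0) * Vf l i) = (\<Sum>l\<in>I. crd n Vf (vec_index u) l * Vf l i)"
    by (rule sum.mono_neutral_cong_right) (use I in auto)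
  then show "vec_index (pr I *\<^sub>v u) i = (\<Sum>l<n. (if l \<in> I then crd n Vf (vec_index u) l else 0) * Vf l i)"
    using pr_mult[OF u i] by simp
qed

lemma vec_eqI_crd:
  assumes "u \<in> carrier_vec n" "v \<in> carrier_vec n"
    "\<And>k. k < n \<Longrightarrow> crd n Vf (vec_index u) k = crd n Vf (vec_index v) k"
  shows "u = v"
proof (rule eq_vecI)
  fix i assume "i < dim_vec v"
  then have i: "i < n" using assms by simp
  have "u $ i = (\<Sum>l<n. crd n Vf (vec_index u) l * Vf l i)" by (rule crd_expand[OF detV i])
  also have "\<dots> = (\<Sum>l<n. crd n Vf (vec_index v) l * Vf l i)" using assms(3) by simp
  also have "\<dots> = v $ i" by (rule crd_expand[OF detV i, symmetric])
  finally show "u $ i = v $ i" .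
qed (use assms in auto)

lemma mat_eqI_crd:
  assumes P: "P \<in> carrier_mat n n" and Q: "Q \<in> carrier_mat n n"
    and eq: "\<And>k l. k < n \<Longrightarrow> l < n \<Longrightarrow> crd n Vf (vec_index (P *\<^sub>v V l)) k = crd n Vf (vec_index (Q *\<^sub>v V l)) k"
  shows "P = Q"
proof (rule eq_matI)
  fix i j assume "i < dim_row Q" "j < dim_col Q"
  then have ij: "i < n" "j < n" using Q by auto
  have PQ: "mv n (mf P) (Vf l) i = mv n (mf Q) (Vf l) i" if "l < n" for l
  proof -
    have "P *\<^sub>v V l = Q *\<^sub>v V l"
      by (rule vec_eqI_crd) (use P Q V_carrier[OF that] eq[OF _ that] in auto)
    then show ?thesis
      using mult_mat_vec_mv[OF P V_carrier[OF that] ij(1)] mult_mat_vec_mv[OF Q V_carrier[OF that] ij(1)]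
      by simp
  qed
  define e where "e = (\<lambda>k. if k = j then 1 else (0::complex))"
  have "mv n (mf R) e i = (\<Sum>l<n. crd n Vf e l * mv n (mf R) (Vf l) i)" for R
  proof -
    have "mv n (mf R) e i = mv n (mf R) (\<lambda>i. \<Sum>l<n. crd n Vf e l * Vf l i) i"
      by (rule mv_cong) (rule crd_expand[OF detV])
    then show ?thesis by (simp add: mv_sum mv_scale)
  qed
  moreover have "mv n (mf R) e i = R $$ (i,j)" for R
  proof -
    have "mv n (mf R) e i = (\<Sum>k<n. if k = j then R $$ (i,j) else 0)"
      unfolding mv_def e_def mf_def by (intro sum.cong) auto
    then show ?thesis using ij by simp
  qed
  ultimately show "P $$ (i,j) = Q $$ (i,j)" using PQ by (metis (mono_tags, lifting) lessThan_iff sum.cong)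
qed (use P Q in auto)

lemma vec_index_mult: "P \<in> carrier_mat n n \<Longrightarrow> u \<in> carrier_vec n \<Longrightarrow>
    crd n Vf (vec_index (P *\<^sub>v u)) k = crd n Vf (mv n (mf P) (vec_index u)) k"
  by (rule crd_cong) (rule mult_mat_vec_mv)

definition "St = {l. l < n \<and> Re (nu l) < 0}"

lemma St: "St \<subseteq> {..<n}" by (auto simp: St_def)

text \<open>An eigenvector for \<open>k\<close> can have a nonzero \<open>l\<close>-th coordinate
  only if \<open>nu l = k\<close>. This turns the sign conditions on eigenvectors into membership of
  indices in \<open>St\<close>.\<close>

lemma is_stable_spec_proj_pr: "is_stable_spec_proj M (pr St)"
proof -
  have dim: "dim_row M = n" using M by simp
  have eig: "k = nu l" if "eigenvector M v k" "l < n" "crd n Vf (vec_index v) l \<noteq> 0" for v k l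
  proof -
    have v: "v \<in> carrier_vec n" "M *\<^sub>v v = k \<cdot>\<^sub>v v" using that(1) M by (auto simp: eigenvector_def)
    have "nu l * crd n Vf (vec_index v) l = crd n Vf (vec_index (k \<cdot>\<^sub>v v)) l"
      using vec_index_mult[OF M v(1), of l] crd_mv[OF that(2)] v(2) by simp
    also have "\<dots> = crd n Vf (\<lambda>i. k * vec_index v i) l" by (rule crd_cong) (use v in auto)
    finally show ?thesis using that(3) by (simp add: crd_scale)
  qed
  have nz: "\<exists>l<n. crd n Vf (vec_index v) l \<noteq> 0" if "eigenvector M v k" for v k
  proof (rule ccontr)
    assume z: "\<not> ?thesis"
    have v: "v \<in> carrier_vec n" "v \<noteq> 0\<^sub>v n" using that M by (auto simp: eigenvector_def)
    have "v = 0\<^sub>v n"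
    proof (rule vec_eqI_crd[OF v(1)])
      fix k assume k: "k < n"
      have "crd n Vf (vec_index (0\<^sub>v n)) k = crd n Vf (\<lambda>_. 0) k" by (rule crd_cong) simp
      also have "\<dots> = 0" by (simp add: crd_def)
      finally show "crd n Vf (vec_index v) k = crd n Vf (vec_index (0\<^sub>v n)) k" using z k by simp
    qed simp
    then show False using v(2) by simp
  qed
  show ?thesis
    unfolding is_stable_spec_proj_def dim
  proof (intro conjI allI impI)
    show "pr St \<in> carrier_mat n n" by (rule pr_carrier)
    show "pr St * pr St = pr St"
    proof (rule mat_eqI_crd)
      fix k l assume kl: "k < n" "l < n"
      have "(pr St * pr St) *\<^sub>v V l = pr St *\<^sub>v (pr St *\<^sub>v V l)"
        using pr_carrier V_carrier[OF kl(2)] by (rule assoc_mult_mat_vec[OF pr_carrier])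
      then show "crd n Vf (vec_index ((pr St * pr St) *\<^sub>v V l)) k = crd n Vf (vec_index (pr St *\<^sub>v V l)) k"
        using crd_pr[OF St V_carrier[OF kl(2)] kl(1)]
          crd_pr[OF St mult_mat_vec_carrier[OF pr_carrier V_carrier[OF kl(2)]] kl(1)] by simp
    qed (auto simp: pr_def)
    show "M * pr St = pr St * M"
    proof (rule mat_eqI_crd)
      fix k l assume kl: "k < n" "l < n"
      have c: "pr St *\<^sub>v V l \<in> carrier_vec n" "M *\<^sub>v V l \<in> carrier_vec n"
        using pr_carrier M V_carrier[OF kl(2)] mult_mat_vec_carrier by blast+
      have "(M * pr St) *\<^sub>v V l = M *\<^sub>v (pr St *\<^sub>v V l)" "(pr St * M) *\<^sub>v V l = pr St *\<^sub>v (M *\<^sub>v V l)"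
        using M pr_carrier V_carrier[OF kl(2)] by (auto intro: assoc_mult_mat_vec)
      then show "crd n Vf (vec_index ((M * pr St) *\<^sub>v V l)) k = crd n Vf (vec_index ((pr St * M) *\<^sub>v V l)) k"
        using vec_index_mult[OF M c(1)] vec_index_mult[OF M V_carrier[OF kl(2)]]
          crd_mv[OF kl(1)] crd_pr[OF St V_carrier[OF kl(2)] kl(1)] crd_pr[OF St c(2) kl(1)]
        by simp
    qed (use M pr_carrier in \<open>auto intro: mult_carrier_mat\<close>)
  next
    fix v k assume v: "eigenvector M v k \<and> pr St *\<^sub>v v = v"
    then obtain l where l: "l < n" "crd n Vf (vec_index v) l \<noteq> 0" using nz by blast
    have "v \<in> carrier_vec n" using v M by (auto simp: eigenvector_def)
    then have "l \<in> St" using crd_pr[OF St _ l(1), of v] l v by (auto split: if_splits)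
    then show "Re k < 0" using eig[of v k l] v l by (auto simp: St_def)
  next
    fix v k assume v: "eigenvector M v k \<and> pr St *\<^sub>v v = 0\<^sub>v n"
    then obtain l where l: "l < n" "crd n Vf (vec_index v) l \<noteq> 0" using nz by blast
    have vc: "v \<in> carrier_vec n" using v M by (auto simp: eigenvector_def)
    have "crd n Vf (vec_index (0\<^sub>v n)) l = crd n Vf (\<lambda>_. 0) l" by (rule crd_cong) simp
    then have "crd n Vf (vec_index (0\<^sub>v n)) l = 0" by (simp add: crd_def)
    then have "l \<notin> St" using crd_pr[OF St vc l(1)] l v by (auto split: if_splits)
    then show "Re k \<ge> 0" using eig[of v k l] v l by (auto simp: St_def)
  qed
qed

text \<open>Commuting with \<open>M\<close>, whose eigenvalues are distinct, forces a candidate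
  \<open>P\<close> to be diagonal in the basis \<open>V\<close>. Idempotence leaves 0 or 1 on the
  diagonal, and the sign conditions decide between them.\<close>

lemma Ps_eq: "Ps M = pr St"
  unfolding Ps_def
proof (rule the_equality, rule is_stable_spec_proj_pr)
  fix P assume P0: "is_stable_spec_proj M P"
  have dim: "dim_row M = n" using M by simp
  have P: "P \<in> carrier_mat n n" "P * P = P" "M * P = P * M"
    "\<And>v k. eigenvector M v k \<Longrightarrow> P *\<^sub>v v = v \<Longrightarrow> Re k < 0"
    "\<And>v k. eigenvector M v k \<Longrightarrow> P *\<^sub>v v = 0\<^sub>v n \<Longrightarrow> Re k \<ge> 0"
    using P0 unfolding is_stable_spec_proj_def dim by auto
  show "P = pr St"
  proof (rule mat_eqI_crd[OF P(1) pr_carrier])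
    fix k l assume kl: "k < n" "l < n"
    have Vl: "V l \<in> carrier_vec n" by (rule V_carrier[OF kl(2)])
    define p where "p = P *\<^sub>v V l"
    have p: "p \<in> carrier_vec n" unfolding p_def using P(1) Vl by simp
    have Mp: "M *\<^sub>v p = nu l \<cdot>\<^sub>v p"
    proof -
      have "M *\<^sub>v p = P *\<^sub>v (M *\<^sub>v V l)"
        unfolding p_def using P(1,3) M Vl assoc_mult_mat_vec by metis
      also have "\<dots> = P *\<^sub>v (nu l \<cdot>\<^sub>v V l)" using eigV[OF kl(2)] by (simp add: eigenvector_def)
      also have "\<dots> = nu l \<cdot>\<^sub>v p" unfolding p_def using P(1) Vl by (simp add: mult_mat_vec)
      finally show ?thesis .
    qed
    have pc: "crd n Vf (vec_index p) j = 0" if j: "j < n" "j \<noteq> l" for j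
    proof -
      have "nu j * crd n Vf (vec_index p) j = crd n Vf (vec_index (nu l \<cdot>\<^sub>v p)) j"
        using vec_index_mult[OF M p, of j] crd_mv[OF j(1)] Mp by simp
      also have "\<dots> = crd n Vf (\<lambda>i. nu l * vec_index p i) j" by (rule crd_cong) (use p in auto)
      finally have "(nu j - nu l) * crd n Vf (vec_index p) j = 0" by (simp add: crd_scale algebra_simps)
      moreover have "nu j \<noteq> nu l" using distinct j kl by (auto simp: inj_on_def)
      ultimately show ?thesis by simp
    qed
    define c where "c = crd n Vf (vec_index p) l"
    have pV: "p = c \<cdot>\<^sub>v V l"
    proof (rule vec_eqI_crd[OF p])
      fix j assume j: "j < n"
      have "crd n Vf (vec_index (c \<cdot>\<^sub>v V l)) j = crd n Vf (\<lambda>i. c * Vf l i) j"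
        by (rule crd_cong) (use Vl in auto)
      also have "\<dots> = (if j = l then c else 0)" using crd_basis[OF detV j kl(2)] by (simp add: crd_scale)
      finally show "crd n Vf (vec_index p) j = crd n Vf (vec_index (c \<cdot>\<^sub>v V l)) j"
        using pc[OF j] by (simp add: c_def)
    qed (use Vl in simp)
    have "P *\<^sub>v p = p" unfolding p_def using P(1,2) Vl assoc_mult_mat_vec by metis
    then have "c \<cdot>\<^sub>v (c \<cdot>\<^sub>v V l) = c \<cdot>\<^sub>v V l"
      using pV P(1) Vl mult_mat_vec[OF P(1) Vl, of c] p_def by metis
    then have "c * c * Vf l i = c * Vf l i" if "i < n" for i
      using that Vl by (metis carrier_vecD index_smult_vec(1) mult.assoc smult_carrier_vec)
    moreover obtain i where "i < n" "Vf l i \<noteq> 0" using V_nonzero[OF kl(2)] by blast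
    ultimately have "c * c = c" by (metis mult_right_cancel)
    then have c01: "c = 0 \<or> c = 1" by simp
    have cSt: "c = (if l \<in> St then 1 else 0)"
    proof (cases "c = 1")
      case True
      then have "P *\<^sub>v V l = V l" using pV Vl unfolding p_def by simp
      then have "Re (nu l) < 0" using P(4) eigV[OF kl(2)] by blast
      then show ?thesis using True kl by (simp add: St_def)
    next
      case False
      then have c0: "c = 0" using c01 by simp
      then have "P *\<^sub>v V l = 0\<^sub>v n" using pV Vl unfolding p_def by auto
      then have "Re (nu l) \<ge> 0" using P(5) eigV[OF kl(2)] by blast
      then show ?thesis using c0 by (simp add: St_def)
    qed
    show "crd n Vf (vec_index (P *\<^sub>v V l)) k = crd n Vf (vec_index (pr St *\<^sub>v V l)) k"
      unfolding crd_pr[OF St Vl kl(1)] crd_basis[OF detV kl] p_def[symmetric]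
      using pc[OF kl(1)] cSt by (cases "k = l") (auto simp: c_def)
  qed
qed

lemma Pu_eq: "Pu M = pr ({..<n} - St)"
proof -
  have dim: "dim_row M = n" using M by simp
  show ?thesis unfolding Pu_def Ps_eq dim
  proof (rule mat_eqI_crd)
    fix k l assume kl: "k < n" "l < n"
    have Vl: "V l \<in> carrier_vec n" by (rule V_carrier[OF kl(2)])
    have "(1\<^sub>m n - pr St) *\<^sub>v V l = V l - pr St *\<^sub>v V l"
      using minus_mult_distrib_mat_vec[OF one_carrier_mat pr_carrier Vl] Vl by simp
    then have "crd n Vf (vec_index ((1\<^sub>m n - pr St) *\<^sub>v V l)) k
        = crd n Vf (\<lambda>i. Vf l i - vec_index (pr St *\<^sub>v V l) i) k"
      using pr_carrier[of St] by (intro crd_cong) (auto simp: pr_def)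
    then show "crd n Vf (vec_index ((1\<^sub>m n - pr St) *\<^sub>v V l)) k = crd n Vf (vec_index (pr ({..<n} - St) *\<^sub>v V l)) k"
      using kl by (simp add: crd_diff crd_pr[OF St Vl kl(1)] crd_pr[OF _ Vl kl(1), of "{..<n} - St"])
  qed (auto simp: pr_def)
qed

lemma mrange_pr:
  assumes I: "I \<subseteq> {..<n}"
  shows "u \<in> mrange n (pr I) \<longleftrightarrow> u \<in> carrier_vec n \<and> (\<forall>l<n. l \<notin> I \<longrightarrow> crd n Vf (vec_index u) l = 0)"
proof
  assume "u \<in> mrange n (pr I)"
  then obtain v where "v \<in> carrier_vec n" "u = pr I *\<^sub>v v" by (auto simp: mrange_def)
  then show "u \<in> carrier_vec n \<and> (\<forall>l<n. l \<notin> I \<longrightarrow> crd n Vf (vec_index u) l = 0)"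
    using crd_pr[OF I] pr_carrier[of I] by auto
next
  assume u: "u \<in> carrier_vec n \<and> (\<forall>l<n. l \<notin> I \<longrightarrow> crd n Vf (vec_index u) l = 0)"
  have "u = pr I *\<^sub>v u"
    by (rule vec_eqI_crd) (use u crd_pr[OF I] pr_carrier[of I] in auto)
  then show "u \<in> mrange n (pr I)" using u by (auto simp: mrange_def)
qed

text \<open>After exchanging the sums, \<open>M\<close> acts on \<open>V l\<close> as
  \<open>nu l\<close>, and what is left is the \<open>l\<close>-th coordinate of \<open>V l\<close>,
  that is 1.\<close>

lemma mtrace_pr:
  assumes I: "I \<subseteq> {..<n}"
  shows "mtrace (M * pr I) = (\<Sum>l\<in>I. nu l)"
proof -
  have "mtrace (M * pr I) = (\<Sum>i<n. \<Sum>a<n. mf M i a * (\<Sum>l\<in>I. minor_cofactor n Vf l i / D n Vf * Vf l a))"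
    unfolding mtrace_def using M
    by (intro sum.cong) (auto simp: pr_def scalar_prod_def atLeast0LessThan mf_def)
  also have "\<dots> = (\<Sum>i<n. \<Sum>l\<in>I. minor_cofactor n Vf l i / D n Vf * mv n (mf M) (Vf l) i)"
    unfolding sum_distrib_left mv_def by (subst (2) sum.swap) (simp add: mult_ac)
  also have "\<dots> = (\<Sum>l\<in>I. nu l * crd n Vf (Vf l) l)"
    unfolding crd_def sum_distrib_left
    by (subst sum.swap, intro sum.cong refl) (use I mv_V in \<open>auto simp: mult_ac\<close>)
  also have "\<dots> = (\<Sum>l\<in>I. nu l)"
    by (intro sum.cong refl) (use I crd_basis[OF detV] in auto)
  finally show ?thesis .
qed

lemma n_stable_eigs_St:
  assumes e: "{k. eigenvalue M k} = nu ` {..<n}" and s: "simple_eigs M"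
  shows "n_stable_eigs M = card St"
proof -
  have "{k. eigenvalue M k \<and> Re k < 0} = nu ` St" using e by (auto simp: St_def)
  moreover have "inj_on nu St" using distinct by (rule inj_on_subset) (rule St)
  moreover have "Polynomial.order k (char_poly M) = 1" if "k \<in> nu ` St" for k
    using s that e St by (auto simp: simple_eigs_def)
  ultimately show ?thesis by (simp add: n_stable_eigs_def card_image)
qed

end

section \<open>Comparison of the two determinants\<close>

lemma D_bound:
  assumes "\<And>j i. j < n \<Longrightarrow> i < n \<Longrightarrow> cmod (c j i) \<le> B"
  shows "cmod (D n c) \<le> fact n * B ^ n"
proof -
  have "cmod (D n c) \<le> (\<Sum>p | p permutes {0..<n}. B ^ n)"
    unfolding D_expand
  proof (rule sum_norm_le)
    fix p assume p: "p \<in> {p. p permutes {0..<n}}"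
    have "cmod (\<Prod>j<n. c j (p j)) \<le> (\<Prod>j<n. B)"
      unfolding prod_norm[symmetric]
    proof (rule prod_mono)
      fix j assume j: "j \<in> {..<n}"
      then have "p j < n" using permutes_in_image[of p "{0..<n}" j] p by auto
      then show "0 \<le> cmod (c j (p j)) \<and> cmod (c j (p j)) \<le> B" using assms j by auto
    qed
    moreover have "cmod (of_int (sign p)) = 1" by (rule sign_cases[of p]) auto
    ultimately show "cmod (of_int (sign p) * (\<Prod>j<n. c j (p j))) \<le> B ^ n" by (simp add: norm_mult)
  qed
  also have "\<dots> = fact n * B ^ n"
    using card_permutations[of "{0..<n}" n] by simp
  finally show ?thesis .
qed

context frame
begin

lemma w_expand:
  "D n (\<lambda>j. if j \<in> J then u j else y j) = (\<Sum>g\<in>G. (\<Prod>j\<in>J. crd n V (u j) (g j)) * w y g)"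
  unfolding G_def w_def by (rule D_multilinear[OF J crd_expand[OF detV]])

lemma prod_crd_bound:
  assumes B: "B \<ge> 1" "\<And>j k. j \<in> J \<Longrightarrow> k < n \<Longrightarrow> cmod (crd n V (u j) k) \<le> B" and g: "g \<in> G"
  shows "cmod (\<Prod>j\<in>J. crd n V (u j) (g j)) \<le> B ^ n"
proof -
  have "cmod (\<Prod>j\<in>J. crd n V (u j) (g j)) \<le> (\<Prod>j\<in>J. B)"
    unfolding prod_norm[symmetric] by (rule prod_mono) (use B G_less[OF g] in auto)
  also have "\<dots> = B ^ card J" by simp
  also have "\<dots> \<le> B ^ n" using B(1) card_mono[OF _ J] by (intro power_increasing) auto
  finally show ?thesis .
qed

lemma D_w_bound:
  assumes B: "B \<ge> 1" "\<And>j k. j \<in> J \<Longrightarrow> k < n \<Longrightarrow> cmod (crd n V (u j) k) \<le> B"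
  shows "cmod (D n (\<lambda>j. if j \<in> J then u j else y j)) \<le> B ^ n * (\<Sum>g\<in>G. cmod (w y g))"
  unfolding w_expand sum_distrib_left
proof (rule sum_norm_le)
  fix g assume g: "g \<in> G"
  have "cmod (\<Prod>j\<in>J. crd n V (u j) (g j)) \<le> B ^ n"
    by (rule prod_crd_bound[OF B(1) _ g]) (rule B(2))
  then show "cmod ((\<Prod>j\<in>J. crd n V (u j) (g j)) * w y g) \<le> B ^ n * cmod (w y g)"
    by (simp add: norm_mult mult_right_mono)
qed

text \<open>The columns in \<open>J\<close> enter through bounded coordinates, so closeness of the
  minors suffices; \<open>y j\<close> and \<open>z j\<close> may be far apart.\<close>

lemma D_w_diff_bound:
  assumes B: "B \<ge> 1" "\<And>j k. j \<in> J \<Longrightarrow> k < n \<Longrightarrow> cmod (crd n V (u j) k) \<le> B"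
  shows "cmod (D n (\<lambda>j. if j \<in> J then u j else y j) - D n (\<lambda>j. if j \<in> J then u j else z j))
    \<le> B ^ n * (\<Sum>g\<in>G. cmod (w y g - w z g))"
  unfolding w_expand sum_subtractf[symmetric] right_diff_distrib[symmetric] sum_distrib_left
proof (rule sum_norm_le)
  fix g assume g: "g \<in> G"
  have "cmod (\<Prod>j\<in>J. crd n V (u j) (g j)) \<le> B ^ n"
    by (rule prod_crd_bound[OF B(1) _ g]) (rule B(2))
  then show "cmod ((\<Prod>j\<in>J. crd n V (u j) (g j)) * (w y g - w z g)) \<le> B ^ n * cmod (w y g - w z g)"
    by (simp add: norm_mult mult_right_mono)
qed

lemma card_G: "card G = n ^ card J"
  unfolding G_def using finJ by (simp add: card_PiE)

end

lemma (in right_frame) NV_bound: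
  fixes B :: real
  assumes "\<And>l i. l < n \<Longrightarrow> i < n \<Longrightarrow> cmod (V l i) \<le> B"
  shows "NV \<le> real (card G) * (fact n * B ^ n)"
  unfolding NV_def
  by (rule sum_bounded_above, unfold w_def, rule D_bound) (use assms G_less J in auto)

text \<open>Reflection negates the exponents, so the set of positive ones becomes its
  complement.\<close>

lemma left_frame_reflect:
  assumes "left_frame n {..<m} V nu A rho K \<alpha>" "m \<le> n"
  shows "right_frame n {m..<n} V (\<lambda>l. - nu l) (\<lambda>x i k. - A (- x) i k) (\<lambda>x k l. - rho (- x) k l) K \<alpha>"
proof -
  interpret left_frame n "{..<m}" V nu A rho K \<alpha> by fact
  show ?thesis
  proof
    fix x :: real and l i assume x: "x \<ge> 0" and l: "l < n" "i < n"
    show "mv n (\<lambda>i k. - A (- x) i k) (V l) i = - nu l * V l i + (\<Sum>k<n. - rho (- x) k l * V k i)"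
      using AV0[of "- x" l i] x l by (simp add: mv_uminus sum_negf)
  next
    fix x :: real and k l assume "x \<ge> 0" "k < n" "l < n"
    then show "cmod (- rho (- x) k l) \<le> K * exp (- \<alpha> * x)" using rho0[of "- x" k l] by simp
  qed (use detV0 pos0 neg0 K \<alpha> in auto)
qed

lemma D_swap_norm:
  "cmod (D (m + r) (\<lambda>j. if j < m then P j else Q (j - m))) = cmod (D (m + r) (\<lambda>j. if j < r then Q j else P (j - r)))"
  "cmod (D (m + r) (\<lambda>j. if j < m then P j else Q (j - m)) - D (m + r) (\<lambda>j. if j < m then P j else Q' (j - m)))
   = cmod (D (m + r) (\<lambda>j. if j < r then Q j else P (j - r)) - D (m + r) (\<lambda>j. if j < r then Q' j else P (j - r)))"
  unfolding D_swap_blocks right_diff_distrib[symmetric] by (simp_all add: norm_mult norm_power)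

text \<open>The first summand comes from exchanging the right columns, the second from exchanging
  the left ones; \<open>N\<close> bounds the minors of the transported right columns at 0. Written
  out to show that neither the parameter nor \<open>L\<close> enters.\<close>

definition diff_const :: "nat \<Rightarrow> nat \<Rightarrow> nat \<Rightarrow> real \<Rightarrow> real \<Rightarrow> real \<Rightarrow> real" where
  "diff_const n m r K \<alpha> B =
    (let Gp = real (n ^ card {r..<n}); Gm = real (n ^ card {..<m}); c = real n + real n * real n;
      Wp = Gp * exp (Gp * (c * (K / \<alpha>))); Wm = Gm * exp (Gm * (c * (K / \<alpha>)));
      N = Wp * (Gp * (fact n * B ^ n)); E = exp (n * (K / \<alpha>))
     in B ^ n * (Wp * (Gp * (c * N * (K / \<alpha>))))
        + E * ((n * E + c) * (Wm * (Gm * (B ^ n * N))) * (K / \<alpha>)))"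

text \<open>One block at a time. The right columns are exchanged beside the exact left columns,
  whose coordinates at 0 are bounded by \<open>B\<close>. The left columns are then exchanged beside
  the transported right columns, of which only the minors are under control.\<close>

lemma determinant_difference:
  assumes P: "right_frame n {r..<n} Vp nup A rhop K \<alpha>" and M: "left_frame n {..<m} Vm num A rhom K \<alpha>"
    and n: "n = m + r" and A_cont: "\<And>i k. i < n \<Longrightarrow> k < n \<Longrightarrow> continuous_on UNIV (\<lambda>x. A x i k)"
    and L: "L \<ge> 0"
    and Xp: "\<And>j b. j < r \<Longrightarrow> sol n A (nup j) 0 b (Xp j)"
      "\<And>j i. j < r \<Longrightarrow> i < n \<Longrightarrow> ((\<lambda>x. Xp j x i) \<longlongrightarrow> Vp j i) at_top"
    and Xm: "\<And>j a. j < m \<Longrightarrow> sol n A (num j) a 0 (Xm j)"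
      "\<And>j i. j < m \<Longrightarrow> i < n \<Longrightarrow> ((\<lambda>x. Xm j x i) \<longlongrightarrow> Vm j i) at_bot"
    and B: "B \<ge> 1" "\<And>l i. l < n \<Longrightarrow> i < n \<Longrightarrow> cmod (Vp l i) \<le> B"
      "\<And>l k. l < n \<Longrightarrow> k < n \<Longrightarrow> cmod (crd n Vp (Vm l) k) \<le> B"
      "\<And>j k. j < m \<Longrightarrow> k < n \<Longrightarrow> cmod (crd n Vp (Xm j 0) k) \<le> B"
  shows "cmod (D n (\<lambda>j. if j < m then Xm j 0 else Xp (j - m) 0)
      - D n (\<lambda>j. if j < m then bvp.S n Vm (\<lambda>l. - num l) (\<lambda>x i k. - A (- x) i k) L j 0
                 else bvp.S n Vp nup A L (j - m) 0)) \<le> diff_const n m r K \<alpha> B * exp (- \<alpha> * L)"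
proof -
  interpret P: right_frame n "{r..<n}" Vp nup A rhop K \<alpha> by fact
  interpret M: left_frame n "{..<m}" Vm num A rhom K \<alpha> by fact
  interpret SP: bvp n r Vp nup A L
    by unfold_locales (use n P.detV L A_cont in auto)
  have A_cont': "continuous_on UNIV (\<lambda>x. - A (- x) i k)" if "i < n" "k < n" for i k
    by (intro continuous_on_minus, rule continuous_on_compose2[where f = uminus, OF A_cont[OF that]])
       (auto intro!: continuous_intros)
  interpret SM: bvp n m Vm "\<lambda>l. - num l" "\<lambda>x i k. - A (- x) i k" L
    by unfold_locales (use n M.detV L A_cont' in auto)
  define Yp where "Yp = (\<lambda>j. SP.Y j 0)"
  define Ym where "Ym = (\<lambda>j. SM.Y j 0)"
  have swap: "D n (\<lambda>j. if j < m then Q j else R (j - m)) = (-1) ^ (m * r) * D n (\<lambda>j. if j < r then R j else Q (j - r))"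
    for Q R :: "nat \<Rightarrow> nat \<Rightarrow> complex" unfolding n by (rule D_swap_blocks)
  have "D n (\<lambda>j. if j < m then SM.S j 0 else SP.S (j - m) 0) = D n (\<lambda>j. if j < m then Ym j else SP.S (j - m) 0)"
    unfolding Ym_def by (rule SM.S_minor)
  also have "\<dots> = D n (\<lambda>j. if j < m then Ym j else Yp (j - m))"
    unfolding swap[of Ym "\<lambda>j. SP.S j 0"] swap[of Ym Yp] SP.S_minor[of "\<lambda>j. Ym (j - r)"] unfolding Yp_def ..
  finally have Et: "D n (\<lambda>j. if j < m then SM.S j 0 else SP.S (j - m) 0) = D n (\<lambda>j. if j < m then Ym j else Yp (j - m))" .
  define Gp where "Gp = real (n ^ card {r..<n})"
  define Gm where "Gm = real (n ^ card {..<m})"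
  define c where "c = real n + real n * real n"
  define Wp where "Wp = Gp * exp (Gp * (c * (K / \<alpha>)))"
  define Wm where "Wm = Gm * exp (Gm * (c * (K / \<alpha>)))"
  define N where "N = Wp * (Gp * (fact n * B ^ n))"
  define E where "E = exp (n * (K / \<alpha>))"
  have cG: "real (card P.G) = Gp" "real (card M.G) = Gm" by (simp_all add: P.card_G M.card_G Gp_def Gm_def)
  have cc: "P.c0 = c" "M.c0 = c" by (simp_all add: P.c0_def M.c0_def c_def)
  have cW: "P.CW = Wp" "M.CW = Wm" by (simp_all add: P.CW_def M.CW_def Wp_def Wm_def cG cc)
  have nonneg: "Wp \<ge> 0" "Wm \<ge> 0" "Gp \<ge> 0" "Gm \<ge> 0" "c \<ge> 0" "K / \<alpha> \<ge> 0" "E \<ge> 0" "B ^ n \<ge> 0"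
    using P.K P.\<alpha> B(1) by (auto simp: Wp_def Wm_def Gp_def Gm_def c_def E_def)
  have NVb: "P.CW * P.NV \<le> N"
    unfolding N_def cW using P.NV_bound[OF B(2)] nonneg cG by (intro mult_left_mono) auto
  let ?Xp = "\<lambda>x j. Xp j x" and ?Yp = "\<lambda>x j. SP.Y j x"
  have 1: "cmod (D n (\<lambda>j. if j < m then Xm j 0 else Xp (j - m) 0) - D n (\<lambda>j. if j < m then Xm j 0 else Yp (j - m)))
      \<le> B ^ n * (Wp * (Gp * (c * N * (K / \<alpha>)))) * exp (- \<alpha> * L)"
  proof -
    have "cmod (D n (\<lambda>j. if j < m then Xm j 0 else Xp (j - m) 0) - D n (\<lambda>j. if j < m then Xm j 0 else Yp (j - m)))
      = cmod (D n (\<lambda>j. if j < r then Xp j 0 else Xm (j - r) 0) - D n (\<lambda>j. if j < r then Yp j else Xm (j - r) 0))"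
      unfolding n by (rule D_swap_norm)
    also have "\<dots> = cmod (D n (\<lambda>j. if j \<in> {r..<n} then Xm (j - r) 0 else ?Xp 0 j)
        - D n (\<lambda>j. if j \<in> {r..<n} then Xm (j - r) 0 else ?Yp 0 j))"
      by (intro arg_cong[where f = cmod] arg_cong2[where f = "(-)"] D_cong) (auto simp: Yp_def)
    also have "\<dots> \<le> B ^ n * (\<Sum>g\<in>P.G. cmod (P.w (?Xp 0) g - P.w (?Yp 0) g))"
      by (rule P.D_w_diff_bound[OF B(1)]) (use B(4) n in auto)
    also have "\<dots> \<le> B ^ n * (P.CW * (card P.G * P.CR) * exp (- \<alpha> * L))"
      using nonneg
      by (intro mult_left_mono P.transported_minor_difference) (use Xp L SP.Y_sol SP.Y_L in auto)
    also have "\<dots> = B ^ n * (Wp * (Gp * (c * (P.CW * P.NV) * (K / \<alpha>)))) * exp (- \<alpha> * L)"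
      by (simp add: P.CR_def cG cc cW mult_ac)
    also have "\<dots> \<le> B ^ n * (Wp * (Gp * (c * N * (K / \<alpha>)))) * exp (- \<alpha> * L)"
      using nonneg NVb by (intro mult_right_mono mult_left_mono) auto
    finally show ?thesis .
  qed
  \<comment> \<open>The right columns continued to the left of 0: column \<open>j - m\<close> is
    rescaled by the exponent \<open>num j\<close>, as the left frame asks for the indices from
    \<open>m\<close> on.\<close>
  define Y where "Y = (\<lambda>x j i. exp ((0 - num j) * of_real (x - 0)) * phi n A 0 (Yp (j - m)) x i)"
  have Ysol: "sol n A (num j) a b (\<lambda>x. Y x j)" for j a b
    unfolding Y_def by (rule sol_shift) (rule phi_sol, rule A_cont)
  have Y0: "Y 0 j = Yp (j - m)" for j
    by (auto simp: Y_def phi_init)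
  let ?S = "\<lambda>x j. SM.Y j (- x)"
  have Ssol: "sol n A (num j) (- L) 0 (\<lambda>x. ?S x j)" for j
    using sol_reflect[OF SM.Y_sol[of j 0 L]] by simp
  \<comment> \<open>The minors of the left frame at 0 contain left eigenvectors; expanded in the
    right basis they reduce to the minors of \<open>transported_minor_bound\<close>.\<close>
  have N0: "M.N0 Y \<le> Gm * (B ^ n * N)"
  proof -
    have "cmod (M.w (Y 0) g) \<le> B ^ n * N" if g: "g \<in> M.G" for g
    proof -
      have "M.w (Y 0) g = D n (\<lambda>j. if j < m then Vm (g j) else Yp (j - m))"
        unfolding M.w_def Y0 by (rule D_cong) auto
      also have "cmod \<dots> = cmod (D n (\<lambda>j. if j < r then Yp j else Vm (g (j - r))))"
        unfolding n by (rule D_swap_norm)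
      also have "D n (\<lambda>j. if j < r then Yp j else Vm (g (j - r)))
          = D n (\<lambda>j. if j \<in> {r..<n} then Vm (g (j - r)) else ?Yp 0 j)"
        by (rule D_cong) (auto simp: Yp_def)
      also have "cmod \<dots> \<le> B ^ n * (\<Sum>g\<in>P.G. cmod (P.w (?Yp 0) g))"
        by (rule P.D_w_bound[OF B(1)]) (use B(3) M.G_less[OF g] n in auto)
      also have "\<dots> \<le> B ^ n * (P.CW * P.NV)"
        using nonneg
        by (intro mult_left_mono P.transported_minor_bound[of ?Xp L]) (use Xp L SP.Y_sol SP.Y_L in auto)
      also have "\<dots> \<le> B ^ n * N" using nonneg NVb by (intro mult_left_mono) auto
      finally show ?thesis .
    qed
    then have "(\<Sum>g\<in>M.G. cmod (M.w (Y 0) g)) \<le> card M.G * (B ^ n * N)"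
      by (rule sum_bounded_above)
    moreover have "M.N0 Y = (\<Sum>g\<in>M.G. cmod (M.w (Y 0) g))"
      by (rule M.N0_def) (rule Ysol)
    ultimately show ?thesis using cG by simp
  qed
  have 2: "cmod (D n (\<lambda>j. if j < m then Xm j 0 else Yp (j - m)) - D n (\<lambda>j. if j < m then Ym j else Yp (j - m)))
      \<le> E * ((n * E + c) * (Wm * (Gm * (B ^ n * N))) * (K / \<alpha>)) * exp (- \<alpha> * L)"
  proof -
    have "cmod (D n (\<lambda>j. if j < m then Xm j 0 else Yp (j - m)) - D n (\<lambda>j. if j < m then Ym j else Yp (j - m)))
      = cmod (M.F Y (\<lambda>x j. Xm j x) 0 - D n (\<lambda>j. if j \<in> {..<m} then ?S 0 j else Y 0 j))"
      by (subst M.F_def) (auto simp: Ysol Xm Y0 Ym_def intro!: arg_cong[where f = cmod] arg_cong2[where f = "(-)"] D_cong)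
    also have "\<dots> \<le> M.EB * ((n * M.EB + M.c0) * (M.CW * M.N0 Y) * (K / \<alpha>)) * exp (- \<alpha> * L)"
      by (rule M.transported_determinant_difference[where S = ?S])
         (use Ysol Xm L Ssol SM.Y_L in auto)
    also have "M.EB = E" by (subst M.EB_def[where Y = Y and X = "\<lambda>x j. Xm j x"]) (use Ysol Xm in \<open>auto simp: E_def\<close>)
    also have "E * ((n * E + M.c0) * (M.CW * M.N0 Y) * (K / \<alpha>)) * exp (- \<alpha> * L)
        \<le> E * ((n * E + c) * (Wm * (Gm * (B ^ n * N))) * (K / \<alpha>)) * exp (- \<alpha> * L)"
      unfolding cc cW using nonneg N0 by (intro mult_right_mono mult_left_mono) auto
    finally show ?thesis .
  qed
  have "cmod (D n (\<lambda>j. if j < m then Xm j 0 else Xp (j - m) 0) - D n (\<lambda>j. if j < m then Ym j else Yp (j - m)))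
      \<le> B ^ n * (Wp * (Gp * (c * N * (K / \<alpha>)))) * exp (- \<alpha> * L)
       + E * ((n * E + c) * (Wm * (Gm * (B ^ n * N))) * (K / \<alpha>)) * exp (- \<alpha> * L)"
    using norm_triangle_mono[OF 1 2] by simp
  also have "\<dots> = diff_const n m r K \<alpha> B * exp (- \<alpha> * L)"
    unfolding diff_const_def Let_def Gp_def[symmetric] Gm_def[symmetric] c_def[symmetric]
      Wp_def[symmetric] Wm_def[symmetric] N_def[symmetric] E_def[symmetric]
    by (simp only: distrib_right)
  finally show ?thesis unfolding Et .
qed

section \<open>Coefficient matrices on one half-line\<close>

context right_frame
begin

lemma top_minor:
  assumes "J = {r..<n}" "r \<le> n"
  shows "w Y idg = D n V * D r (\<lambda>j k. crd n V (Y j) k)"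
proof -
  have "w Y idg = D n (\<lambda>j. if j < r then Y j else V j)"
    unfolding w_idg by (rule D_cong) (use assms in auto)
  then show ?thesis unfolding D_coordinates[OF assms(2) detV] .
qed

text \<open>The minor for \<open>idg\<close> is \<open>D n V\<close> times the determinant of the
  stable coordinates, so this is \<open>X_minor_rate\<close> divided by
  \<open>D n V\<close>.\<close>

lemma top_minor_rate:
  fixes B :: real
  assumes J: "J = {r..<n}" "r \<le> n"
    and X: "\<And>j b. j < r \<Longrightarrow> sol n A (nu j) 0 b (\<lambda>x. X x j)"
    and X_lim: "\<And>j i. j < r \<Longrightarrow> i < n \<Longrightarrow> ((\<lambda>x. X x j i) \<longlongrightarrow> V j i) at_top"
    and x: "x \<ge> 0" and B: "B \<ge> 1" "cmod (1 / D n V) \<le> B" "\<And>l i. l < n \<Longrightarrow> i < n \<Longrightarrow> cmod (V l i) \<le> B"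
  shows "cmod (D r (\<lambda>j k. crd n V (X x j) k) - 1)
      \<le> B * (c0 * (CW * (card G * (fact n * B ^ n))) * (K / \<alpha>)) * exp (- \<alpha> * x)"
proof -
  have "cmod (w (X x) idg - w V idg) \<le> CR * exp (- \<alpha> * x)"
    by (rule X_minor_rate) (use J X X_lim x idg_G in auto)
  also have "CR \<le> c0 * (CW * (card G * (fact n * B ^ n))) * (K / \<alpha>)"
    unfolding CR_def using NV_bound[OF B(3)] c0_nonneg CW_nonneg K \<alpha>
    by (intro mult_right_mono mult_left_mono) auto
  finally have 1: "cmod (w (X x) idg - w V idg) \<le> c0 * (CW * (card G * (fact n * B ^ n))) * (K / \<alpha>) * exp (- \<alpha> * x)"
    by (simp add: mult_right_mono)
  have "w (X x) idg - w V idg = D n V * (D r (\<lambda>j k. crd n V (X x j) k) - 1)"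
    unfolding top_minor[OF J, of "X x"] w_V_idg by (simp add: right_diff_distrib)
  then have "D r (\<lambda>j k. crd n V (X x j) k) - 1 = 1 / D n V * (w (X x) idg - w V idg)"
    using detV by simp
  from arg_cong[OF this, where f = cmod] have "cmod (D r (\<lambda>j k. crd n V (X x j) k) - 1) = cmod (1 / D n V) * cmod (w (X x) idg - w V idg)"
    by (simp only: norm_mult)
  also have "\<dots> \<le> B * (c0 * (CW * (card G * (fact n * B ^ n))) * (K / \<alpha>) * exp (- \<alpha> * x))"
    using B 1 by (intro mult_mono) auto
  finally show ?thesis by (simp add: mult.assoc)
qed

end

sublocale stable_frame \<subseteq> bvp: bvp n r V nu A L
  by unfold_locales (use r detV L A_cont in auto)

context stable_frame
begin

text \<open>Passing from \<open>V\<close> to \<open>S\<close> at \<open>L\<close> is unipotent,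
  hence the coefficient determinant is that of the stable coordinates of \<open>z\<close>.\<close>

lemma tilde_coefficients:
  assumes z: "\<And>j l. j < r \<Longrightarrow> r \<le> l \<Longrightarrow> l < n \<Longrightarrow> crd n V (z j) l = 0"
  shows "\<exists>C. (\<forall>j<r. \<forall>i<n. z j i = (\<Sum>k<r. C k j * bvp.S k L i)) \<and>
      D r (\<lambda>j k. C k j) = D r (\<lambda>j k. crd n V (z j) k)"
    and "D n (\<lambda>j. if j < r then bvp.S j L else V j) \<noteq> 0"
proof -
  have SV: "D n (\<lambda>j. if j < r then bvp.S j L else V j) = D n V"
  proof -
    have "D n (\<lambda>j. if j < r then bvp.S j L else V j) = D n (\<lambda>j. if j < r then V j else V j)"
      unfolding bvp.S_L by (rule bvp.gs_minor)
    then show ?thesis by simp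
  qed
  then show "D n (\<lambda>j. if j < r then bvp.S j L else V j) \<noteq> 0" using detV by simp
  have "\<forall>j. \<exists>a. j < r \<longrightarrow> (\<forall>i<n. z j i = (\<Sum>k<r. a k * bvp.gs k i))"
    using bvp.gs_spans z by blast
  then obtain a where a: "\<And>j i. j < r \<Longrightarrow> i < n \<Longrightarrow> z j i = (\<Sum>k<r. a j k * bvp.gs k i)"
    by metis
  have C: "z j i = (\<Sum>k<r. a j k * bvp.S k L i)" if "j < r" "i < n" for j i
    using a that by (simp add: bvp.S_L)
  have "D r (\<lambda>j k. crd n V (bvp.S j L) k) = 1"
    using SV detV unfolding D_coordinates[OF r detV] by simp
  then have "D r (\<lambda>j k. crd n V (z j) k) = D r (\<lambda>j k. a j k)"
    using coefficient_det[OF r detV, of z "\<lambda>k j. a j k" "\<lambda>k. bvp.S k L"] C by simp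
  then show "\<exists>C. (\<forall>j<r. \<forall>i<n. z j i = (\<Sum>k<r. C k j * bvp.S k L i)) \<and>
      D r (\<lambda>j k. C k j) = D r (\<lambda>j k. crd n V (z j) k)"
    using C by (intro exI[of _ "\<lambda>k j. a j k"]) simp
qed

text \<open>Projection along the unstable eigenspace keeps stable coordinates, so the top minor of
  \<open>X\<close> at \<open>L\<close> times the determinant of \<open>C\<close> depends on
  \<open>z\<close> alone. By linearity of the flow the same coefficients serve at 0.\<close>

lemma X_coefficients:
  assumes zL: "\<And>j. j < r \<Longrightarrow> decays (zL j)"
    and zz: "\<And>j l. j < r \<Longrightarrow> l < r \<Longrightarrow> crd n V (\<lambda>i. z j i - zL j i) l = 0"
  obtains C where "\<And>j i. j < r \<Longrightarrow> i < n \<Longrightarrow> zL j i = (\<Sum>k<r. C k j * X k L i)"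
    "D r (\<lambda>j k. crd n V (X j L) k) * D r (\<lambda>j k. C k j) = D r (\<lambda>j k. crd n V (z j) k)"
    "\<And>j i. j < r \<Longrightarrow> i < n \<Longrightarrow> phi n A L (zL j) 0 i = (\<Sum>k<r. C k j * (exp (- nu k * of_real L) * X k 0 i))"
proof -
  have "\<forall>j. \<exists>a. j < r \<longrightarrow> (\<forall>i<n. zL j i = (\<Sum>k<r. a k * X k L i))"
    using decays_iff zL by blast
  then obtain a where a: "\<And>j i. j < r \<Longrightarrow> i < n \<Longrightarrow> zL j i = (\<Sum>k<r. a j k * X k L i)"
    by metis
  show ?thesis
  proof (rule that[of "\<lambda>k j. a j k"])
    show "zL j i = (\<Sum>k<r. a j k * X k L i)" if "j < r" "i < n" for j i by (rule a[OF that])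
    have "D r (\<lambda>j k. crd n V (zL j) k) = D r (\<lambda>j k. crd n V (z j) k)"
      by (rule D_cong) (use zz in \<open>auto simp: crd_diff\<close>)
    then show "D r (\<lambda>j k. crd n V (X j L) k) * D r a = D r (\<lambda>j k. crd n V (z j) k)"
      using coefficient_det[OF r detV, of zL "\<lambda>k j. a j k" "\<lambda>k. X k L"] a by simp
    fix j i assume j: "j < r" and i: "i < n"
    have "phi n A L (zL j) 0 i = (\<Sum>k<r. a j k * phi n A L (X k L) 0 i)"
      by (rule phi_linear'[OF i]) (rule a[OF j])
    then show "phi n A L (zL j) 0 i = (\<Sum>k<r. a j k * (exp (- nu k * of_real L) * X k 0 i))"
      using phi_X[OF _ i, of _ 0] by simp
  qed
qed

lemma X_columns_nonzero: "D n (\<lambda>j. if j < r then X j L else V j) \<noteq> 0"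
  unfolding D_coordinates[OF r detV] using detV XL by simp

lemma phi_Z:
  assumes z: "\<And>l. r \<le> l \<Longrightarrow> l < n \<Longrightarrow> crd n V z l = 0" and i: "i < n"
  shows "phi n A L z 0 i = (\<Sum>k<r. crd n V z k * (exp (- nu k * of_real L) * bvp.Y k 0 i))"
proof -
  have "phi n A L z 0 i = (\<Sum>k<r. crd n V z k * phi n A L (V k) 0 i)"
  proof (rule phi_linear'[OF i])
    fix i assume "i < n"
    then have "z i = (\<Sum>k<n. crd n V z k * V k i)" by (rule crd_expand[OF detV])
    also have "\<dots> = (\<Sum>k<r. crd n V z k * V k i)"
      by (rule sum.mono_neutral_right) (use z r in auto)
    finally show "z i = (\<Sum>k<r. crd n V z k * V k i)" .
  qed
  moreover have "exp (- nu k * of_real L) * bvp.Y k 0 i = phi n A L (V k) 0 i" for k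
    by (simp add: bvp.Y_0 exp_minus field_simps)
  ultimately show ?thesis by simp
qed

text \<open>\<open>projection_exists\<close> and \<open>projection_unique\<close> give the definite
  description in \<open>proj_along\<close> its value.\<close>

lemma proj_along_eq:
  assumes S: "\<And>u. u \<in> S \<longleftrightarrow> u \<in> carrier_vec n \<and> decays (vec_index u)"
    and T: "\<And>u. u \<in> T \<longleftrightarrow> u \<in> carrier_vec n \<and> (\<forall>l<r. crd n V (vec_index u) l = 0)"
    and v: "v \<in> carrier_vec n"
  shows "proj_along S T v \<in> carrier_vec n \<and> decays (vec_index (proj_along S T v)) \<and>
    (\<forall>l<r. crd n V (\<lambda>i. vec_index v i - vec_index (proj_along S T v) i) l = 0)"
proof -
  have cd: "decays (vec_index (Matrix.vec n f)) \<longleftrightarrow> decays f" for f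
  proof -
    have "phi n A L (vec_index (Matrix.vec n f)) x i = phi n A L f x i" if "i < n" for x i
      using phi_linear'[OF that, of "vec_index (Matrix.vec n f)" "\<lambda>_. 1" "\<lambda>_. f" "{()}" L x] by simp
    then show ?thesis by (simp add: decays_def)
  qed
  have cv: "crd n V (vec_index (v - u)) l = crd n V (\<lambda>i. vec_index v i - vec_index u i) l"
    if "u \<in> carrier_vec n" for u l
    by (rule crd_cong) (use v that in auto)
  obtain a where a: "decays (\<lambda>i. \<Sum>k<r. a k * X k L i)"
    "\<And>l. l < r \<Longrightarrow> crd n V (\<lambda>i. vec_index v i - (\<Sum>k<r. a k * X k L i)) l = 0"
    using projection_exists[of "vec_index v"] by blast
  define u where "u = Matrix.vec n (\<lambda>i. \<Sum>k<r. a k * X k L i)"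
  have uc: "u \<in> carrier_vec n" by (simp add: u_def)
  have ud: "decays (vec_index u)" using a(1) by (simp add: u_def cd)
  have uz: "crd n V (\<lambda>i. vec_index v i - vec_index u i) l = 0" if "l < r" for l
    using a(2)[OF that] by (subst crd_cong[where v = "\<lambda>i. vec_index v i - (\<Sum>k<r. a k * X k L i)"]) (auto simp: u_def)
  have "proj_along S T v = u"
    unfolding proj_along_def
  proof (rule the_equality)
    show "u \<in> S \<and> v - u \<in> T" using uc ud uz v cv[OF uc] by (simp add: S T)
    fix x assume x: "x \<in> S \<and> v - x \<in> T"
    then have xc: "x \<in> carrier_vec n" and xd: "decays (vec_index x)" by (auto simp: S)
    show "x = u"
    proof (rule eq_vecI)
      fix i assume "i < dim_vec u"
      then have i: "i < n" by (simp add: u_def)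
      show "x $ i = u $ i"
        by (rule projection_unique[OF xd ud _ uz i]) (use x xc cv[OF xc] in \<open>auto simp: T\<close>)
    qed (use xc uc in auto)
  qed
  then show ?thesis using uc ud uz by simp
qed

end

section \<open>The objects at a fixed parameter\<close>

text \<open>The scalars \<open>a k\<close> and \<open>b k\<close> stand for the exponentials between
  solutions and their rescalings; they leave both blocks together with the coefficient
  matrices.\<close>

lemma D_two_blocks:
  assumes n: "n = m + r"
    and P: "\<And>j i. j < m \<Longrightarrow> i < n \<Longrightarrow> P j i = (\<Sum>k<m. C k j * (a k * U k i))"
    and Q: "\<And>j i. j < r \<Longrightarrow> i < n \<Longrightarrow> Q j i = (\<Sum>k<r. C' k j * (b k * T k i))"
  shows "D n (\<lambda>j. if j < m then P j else Q (j - m)) =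
    (\<Prod>k<m. a k) * (\<Prod>k<r. b k) * D m (\<lambda>j k. C k j) * D r (\<lambda>j k. C' k j)
      * D n (\<lambda>j. if j < m then U j else T (j - m))"
proof -
  define aU where "aU = (\<lambda>k i. a k * U k i)"
  define bT where "bT = (\<lambda>k i. b k * T k i)"
  have swap: "D n (\<lambda>j. if j < m then Q j else R (j - m)) = (-1) ^ (m * r) * D n (\<lambda>j. if j < r then R j else Q (j - r))"
    for Q R :: "nat \<Rightarrow> nat \<Rightarrow> complex" unfolding n by (rule D_swap_blocks)
  have "D n (\<lambda>j. if j < m then P j else Q (j - m)) = D n (\<lambda>j. if j < m then aU j else Q (j - m)) * D m (\<lambda>j k. C k j)"
    by (rule D_block_mult) (use n P in \<open>auto simp: aU_def\<close>)
  also have "D n (\<lambda>j. if j < m then aU j else Q (j - m)) = D n (\<lambda>j. if j < m then aU j else bT (j - m)) * D r (\<lambda>j k. C' k j)"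
  proof -
    have "D n (\<lambda>j. if j < r then Q j else aU (j - r)) = D n (\<lambda>j. if j < r then bT j else aU (j - r)) * D r (\<lambda>j k. C' k j)"
      by (rule D_block_mult) (use n Q in \<open>auto simp: bT_def\<close>)
    then show ?thesis unfolding swap[of aU Q] swap[of aU bT] by simp
  qed
  also have "D n (\<lambda>j. if j < m then aU j else bT (j - m))
      = D n (\<lambda>j i. (if j < m then a j else b (j - m)) * (if j < m then U j else T (j - m)) i)"
    by (rule D_cong) (auto simp: aU_def bT_def)
  also have "\<dots> = (\<Prod>j<n. if j < m then a j else b (j - m)) * D n (\<lambda>j. if j < m then U j else T (j - m))"
    by (rule D_scale)
  also have "(\<Prod>j<n. if j < m then a j else b (j - m)) = (\<Prod>k<m. a k) * (\<Prod>k<r. b k)"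
  proof -
    have "(\<Prod>j<n. if j < m then a j else b (j - m)) = (\<Prod>j<m. a j) * (\<Prod>j\<in>{m..<m + r}. b (j - m))"
      unfolding n by (subst prod.atLeastLessThan_concat[of 0 m "m + r", symmetric, unfolded atLeast0LessThan])
        (auto intro!: arg_cong2[where f = "(*)"] prod.cong)
    also have "(\<Prod>j\<in>{m..<m + r}. b (j - m)) = (\<Prod>k<r. b k)"
      by (rule prod.reindex_bij_witness[where i = "\<lambda>k. k + m" and j = "\<lambda>j. j - m"]) auto
    finally show ?thesis .
  qed
  finally show ?thesis by (simp add: mult_ac)
qed

text \<open>The constant of \<open>top_minor_rate\<close>. Here \<open>k\<close> is the size of
  \<open>J\<close>, hence \<open>m\<close> on the right half-line and \<open>r\<close> on the left
  one.\<close>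

definition rate_const :: "nat \<Rightarrow> nat \<Rightarrow> real \<Rightarrow> real \<Rightarrow> real \<Rightarrow> real" where
  "rate_const n k K \<alpha> B = (let G = real (n ^ k); c = real n + real n * real n;
      W = G * exp (G * (c * (K / \<alpha>))) in B * (c * (W * (G * (fact n * B ^ n))) * (K / \<alpha>)))"

lemma col_mult_unit:
  fixes Z :: "complex mat"
  assumes "Z \<in> carrier_mat n k" "j < k"
  shows "Z *\<^sub>v unit_vec k j = col Z j"
  by (rule eq_vecI) (use assms scalar_prod_right_unit[of j k] in auto)

lemma (in eigenbasis) cinner_W:
  assumes u: "u \<in> carrier_vec n" and k: "k < n"
  shows "cinner (W k) u = crd n Vf (vec_index u) k * cinner (W k) (V k)"
  unfolding cinner_ip[OF W_carrier[OF k] u] cinner_ip[OF W_carrier[OF k] V_carrier[OF k]] by (rule ip_W[OF k])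

lemma (in eigenbasis) cinner_W_nonzero: "k < n \<Longrightarrow> cinner (W k) (V k) \<noteq> 0"
  using cinner_ip[OF W_carrier V_carrier] ip_W_V_nonzero by simp

lemma fbvp_cong:
  assumes "bvp.fbvp n V nu A L prev j v" "\<And>k. k < j \<Longrightarrow> \<forall>i<n. prev k 0 i = prev' k 0 i"
    "\<And>x i. i < n \<Longrightarrow> v x i = v' x i" "bvp n r' V A L"
  shows "bvp.fbvp n V nu A L prev' j v'"
proof -
  interpret bvp n r' V nu A L by fact
  have s: "sol n A (nu j) 0 L v'"
    unfolding sol_def
  proof (intro allI impI)
    fix i assume i: "i < n"
    have "deriv_on 0 L (\<lambda>x. v x i) (\<lambda>x. mv n (A x) (v x) i - nu j * v x i)"
      using assms(1) i by (simp add: fbvp_def sol_def)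
    moreover have "mv n (A x) (v x) i = mv n (A x) (v' x) i" for x by (rule mv_cong) (rule assms(3))
    ultimately show "deriv_on 0 L (\<lambda>x. v' x i) (\<lambda>x. mv n (A x) (v' x) i - nu j * v' x i)"
      by (simp add: assms(3)[OF i])
  qed
  have c: "crd n V (v' L) k = crd n V (v L) k" for k by (rule crd_cong) (simp add: assms(3))
  have i: "ip n (prev' k 0) (v' 0) = ip n (prev k 0) (v 0)" if "k < j" for k
    by (rule ip_cong) (use assms(2)[OF that] assms(3) in auto)
  show ?thesis using s c i assms(1) by (simp add: fbvp_def)
qed

text \<open>All objects at one parameter and one \<open>L\<close>, with constants that will be
  uniform in both. The last two conditions on \<open>L\<close> keep the top minors within 1/2 of 1,
  hence away from 0.\<close>

locale evans_point = P: eigenbasis n Ap nup Vp Wp + M: eigenbasis n Am num Vm Wm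
  for n :: nat and Ap Am :: "complex mat" and nup num :: "nat \<Rightarrow> complex" and Vp Wp Vm Wm :: "nat \<Rightarrow> complex vec" +
  fixes m r :: nat and A :: "real \<Rightarrow> complex mat" and Zp Zm :: "complex mat"
    and Vpx Vmx :: "nat \<Rightarrow> real \<Rightarrow> complex vec" and K \<alpha> \<delta> B L :: real
  assumes n: "n = m + r"
    and A: "\<And>x. A x \<in> carrier_mat n n"
    and A_cont: "\<And>i k. i < n \<Longrightarrow> k < n \<Longrightarrow> continuous_on UNIV (\<lambda>x. mf (A x) i k)"
    and K: "K \<ge> 0" and \<alpha>: "\<alpha> > 0" and \<delta>: "\<delta> > 0"
    and nup: "\<And>l. l < r \<Longrightarrow> Re (nup l) \<le> - \<delta>" "\<And>l. r \<le> l \<Longrightarrow> l < n \<Longrightarrow> Re (nup l) \<ge> \<delta>"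
    and num: "\<And>l. l < m \<Longrightarrow> Re (num l) \<ge> \<delta>" "\<And>l. m \<le> l \<Longrightarrow> l < n \<Longrightarrow> Re (num l) \<le> - \<delta>"
    and rhop: "\<And>x k l. x \<ge> 0 \<Longrightarrow> k < n \<Longrightarrow> l < n \<Longrightarrow>
      cmod (crd n P.Vf (mv n (\<lambda>i k. mf (A x) i k - mf Ap i k) (P.Vf l)) k) \<le> K * exp (- \<alpha> * x)"
    and rhom: "\<And>x k l. x \<le> 0 \<Longrightarrow> k < n \<Longrightarrow> l < n \<Longrightarrow>
      cmod (crd n M.Vf (mv n (\<lambda>i k. mf (A x) i k - mf Am i k) (M.Vf l)) k) \<le> K * exp (\<alpha> * x)"
    and Zp: "cols_basis n r Zp (mrange n (Ps Ap))" and Zm: "cols_basis n m Zm (mrange n (Pu Am))"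
    and Vpx: "\<And>j. j < r \<Longrightarrow> ode_sol n (\<lambda>x. A x - nup j \<cdot>\<^sub>m 1\<^sub>m n) {0..} (Vpx j) \<and> vec_lim n (Vpx j) (Vp j) at_top"
    and Vmx: "\<And>j. j < m \<Longrightarrow> ode_sol n (\<lambda>x. A x - num j \<cdot>\<^sub>m 1\<^sub>m n) {..0} (Vmx j) \<and> vec_lim n (Vmx j) (Vm j) at_bot"
    and B: "B \<ge> 1"
      "\<And>l i. l < n \<Longrightarrow> i < n \<Longrightarrow> cmod (P.Vf l i) \<le> B" "\<And>l i. l < n \<Longrightarrow> i < n \<Longrightarrow> cmod (M.Vf l i) \<le> B"
      "cmod (1 / D n P.Vf) \<le> B" "cmod (1 / D n M.Vf) \<le> B"
      "\<And>l k. l < n \<Longrightarrow> k < n \<Longrightarrow> cmod (crd n P.Vf (M.Vf l) k) \<le> B"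
      "\<And>j k. j < m \<Longrightarrow> k < n \<Longrightarrow> cmod (crd n P.Vf (vec_index (Vmx j 0)) k) \<le> B"
    and L: "L \<ge> 0" "n * (K * exp (- \<alpha> * L)) \<le> \<delta>"
      "rate_const n m K \<alpha> B * exp (- \<alpha> * L) \<le> 1 / 2" "rate_const n r K \<alpha> B * exp (- \<alpha> * L) \<le> 1 / 2"
begin

abbreviation "Af x \<equiv> mf (A x)"
abbreviation "Ar x i k \<equiv> - mf (A (- x)) i k"

definition "rp x k l = crd n P.Vf (mv n (\<lambda>i k. Af x i k - mf Ap i k) (P.Vf l)) k"
definition "rm x k l = crd n M.Vf (mv n (\<lambda>i k. Af x i k - mf Am i k) (M.Vf l)) k"

lemma mv_minus: "mv n (\<lambda>i k. X i k - Y i k) u i = mv n X u i - mv n Y u i"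
  by (simp add: mv_def left_diff_distrib sum_subtractf)

lemma r_le: "r \<le> n" and m_le: "m \<le> n" and nr: "n - r = m" using n by auto

lemma nup_neg: "l < r \<Longrightarrow> Re (nup l) < 0" using nup(1)[of l] \<delta> by linarith
lemma nup_pos: "r \<le> l \<Longrightarrow> l < n \<Longrightarrow> Re (nup l) > 0" using nup(2)[of l] \<delta> by linarith
lemma num_pos: "l < m \<Longrightarrow> Re (num l) > 0" using num(1)[of l] \<delta> by linarith
lemma num_minus: "m \<le> l \<Longrightarrow> l < n \<Longrightarrow> \<delta> \<le> - Re (num l)" using num(2)[of l] by linarith
lemma num_neg: "m \<le> l \<Longrightarrow> l < n \<Longrightarrow> Re (num l) < 0" using num(2)[of l] \<delta> by linarith

lemma plus_frame: "right_frame n {r..<n} P.Vf nup Af rp K \<alpha>"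
proof
  fix x :: real and l i assume "x \<ge> 0" "l < n" "i < n"
  then show "mv n (Af x) (P.Vf l) i = nup l * P.Vf l i + (\<Sum>k<n. rp x k l * P.Vf k i)"
    unfolding rp_def using crd_expand[OF P.detV, of i "mv n (\<lambda>i k. Af x i k - mf Ap i k) (P.Vf l)"] P.mv_V
    by (simp add: mv_minus diff_eq_eq add.commute)
qed (use P.detV nup_neg nup_pos K \<alpha> rhop in \<open>auto simp: rp_def\<close>)

lemma minus_frame: "left_frame n {..<m} M.Vf num Af rm K \<alpha>"
proof
  fix x :: real and l i assume "x \<le> 0" "l < n" "i < n"
  then show "mv n (Af x) (M.Vf l) i = num l * M.Vf l i + (\<Sum>k<n. rm x k l * M.Vf k i)"
    unfolding rm_def using crd_expand[OF M.detV, of i "mv n (\<lambda>i k. Af x i k - mf Am i k) (M.Vf l)"] M.mv_V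
    by (simp add: mv_minus diff_eq_eq add.commute)
qed (use m_le M.detV num_neg num_pos K \<alpha> rhom in \<open>auto simp: rm_def\<close>)

lemma minus_frame_reflected:
  "right_frame n {m..<n} M.Vf (\<lambda>l. - num l) Ar (\<lambda>x k l. - rm (- x) k l) K \<alpha>"
  using left_frame_reflect[OF minus_frame] n by simp

definition "Xp j x = vec_index (Vpx j x)"
definition "Xm j x = vec_index (Vmx j x)"

lemma Xp_sol: "j < r \<Longrightarrow> 0 \<le> a \<Longrightarrow> sol n Af (nup j) a b (Xp j)"
  unfolding Xp_def by (rule ode_sol_sol[OF A]) (use Vpx in auto)

lemma Xm_sol: "j < m \<Longrightarrow> b \<le> 0 \<Longrightarrow> sol n Af (num j) a b (Xm j)"
  unfolding Xm_def by (rule ode_sol_sol[OF A]) (use Vmx in auto)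

lemma Xp_lim: "j < r \<Longrightarrow> i < n \<Longrightarrow> ((\<lambda>x. Xp j x i) \<longlongrightarrow> P.Vf j i) at_top"
  using Vpx by (simp add: vec_lim_def Xp_def)

lemma Xm_lim: "j < m \<Longrightarrow> i < n \<Longrightarrow> ((\<lambda>x. Xm j x i) \<longlongrightarrow> M.Vf j i) at_bot"
  using Vmx by (simp add: vec_lim_def Xm_def)

definition "Xr j x = Xm j (- x)"

lemma Xr_sol: "j < m \<Longrightarrow> sol n Ar (- num j) 0 b (Xr j)"
  unfolding Xr_def using sol_reflect[OF Xm_sol[of j 0 "- b"]] by simp

lemma Xr_lim: "j < m \<Longrightarrow> i < n \<Longrightarrow> ((\<lambda>x. Xr j x i) \<longlongrightarrow> M.Vf j i) at_top"
  unfolding Xr_def using Xm_lim[of j i] by (simp add: filterlim_at_bot_mirror)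

text \<open>Top minor of the exact solutions at \<open>L\<close>. The product \<open>mp * mm\<close>
  is the factor between \<open>calC\<close> and its numerical counterpart.\<close>

definition "mp = D r (\<lambda>j k. crd n P.Vf (Xp j L) k)"
definition "mm = D m (\<lambda>j k. crd n M.Vf (Xr j L) k)"

lemma mp_rate: "cmod (mp - 1) \<le> rate_const n m K \<alpha> B * exp (- \<alpha> * L)"
proof -
  interpret F: right_frame n "{r..<n}" P.Vf nup Af rp K \<alpha> by (rule plus_frame)
  have "cmod (mp - 1) \<le> B * (F.c0 * (F.CW * (card F.G * (fact n * B ^ n))) * (K / \<alpha>)) * exp (- \<alpha> * L)"
    unfolding mp_def
    by (rule F.top_minor_rate[where X = "\<lambda>x j. Xp j x"]) (use n Xp_sol Xp_lim L B in auto)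
  then show ?thesis unfolding rate_const_def Let_def F.c0_def F.CW_def F.card_G using n by simp
qed

lemma mm_rate: "cmod (mm - 1) \<le> rate_const n r K \<alpha> B * exp (- \<alpha> * L)"
proof -
  interpret F: right_frame n "{m..<n}" M.Vf "\<lambda>l. - num l" Ar "\<lambda>x k l. - rm (- x) k l" K \<alpha>
    by (rule minus_frame_reflected)
  have "cmod (mm - 1) \<le> B * (F.c0 * (F.CW * (card F.G * (fact n * B ^ n))) * (K / \<alpha>)) * exp (- \<alpha> * L)"
    unfolding mm_def
    by (rule F.top_minor_rate[where X = "\<lambda>x j. Xr j x"]) (use n Xr_sol Xr_lim L B in auto)
  then show ?thesis unfolding rate_const_def Let_def F.c0_def F.CW_def F.card_G using n by simp
qed

lemma mp_nonzero: "mp \<noteq> 0"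
proof
  assume "mp = 0"
  then show False using order_trans[OF mp_rate L(3)] by simp
qed

lemma mm_nonzero: "mm \<noteq> 0"
proof
  assume "mm = 0"
  then show False using order_trans[OF mm_rate L(4)] by simp
qed

lemma Ar_cont: "i < n \<Longrightarrow> k < n \<Longrightarrow> continuous_on UNIV (\<lambda>x. Ar x i k)"
  by (rule continuous_on_minus, rule continuous_on_compose2[where f = uminus and t = UNIV, OF A_cont])
     (auto intro!: continuous_intros)

sublocale SP: stable_frame n r P.Vf nup Af rp K \<alpha> Xp \<delta> L
proof -
  interpret F: right_frame n "{r..<n}" P.Vf nup Af rp K \<alpha> by (rule plus_frame)
  show "stable_frame n r P.Vf nup Af rp K \<alpha> Xp \<delta> L"
    by unfold_locales (use r_le A_cont Xp_sol Xp_lim nup \<delta> L mp_nonzero[unfolded mp_def] in auto)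
qed

sublocale SM: stable_frame n m M.Vf "\<lambda>l. - num l" Ar "\<lambda>x k l. - rm (- x) k l" K \<alpha> Xr \<delta> L
proof -
  interpret F: right_frame n "{m..<n}" M.Vf "\<lambda>l. - num l" Ar "\<lambda>x k l. - rm (- x) k l" K \<alpha>
    by (rule minus_frame_reflected)
  show "stable_frame n m M.Vf (\<lambda>l. - num l) Ar (\<lambda>x k l. - rm (- x) k l) K \<alpha> Xr \<delta> L"
    by unfold_locales (use m_le Ar_cont Xr_sol Xr_lim num num_minus \<delta> L mm_nonzero[unfolded mm_def] in auto)
qed

definition "Sp j x = Matrix.vec n (SP.bvp.S j x)"
definition "Sm j x = Matrix.vec n (SM.bvp.S j (- x))"

text \<open>The conditions with \<open>Wp\<close> become conditions on coordinates after division by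
  the nonzero numbers \<open>cinner (Wp k) (Vp k)\<close>.\<close>

lemma bvp_plus_iff:
  assumes j: "j < n" and prev: "\<And>k. k < j \<Longrightarrow> prev k 0 \<in> carrier_vec n"
  shows "bvp_plus n A nup Wp Vp L prev j U \<longleftrightarrow> (\<forall>x\<in>{0..L}. U x \<in> carrier_vec n) \<and>
    SP.bvp.fbvp (\<lambda>k x. vec_index (prev k x)) j (\<lambda>x. vec_index (U x))"
proof (cases "\<forall>x\<in>{0..L}. U x \<in> carrier_vec n")
  case True
  then have U: "U 0 \<in> carrier_vec n" "U L \<in> carrier_vec n" using L by auto
  have "cinner (Wp j) (U L) = cinner (Wp j) (Vp j) \<longleftrightarrow> crd n P.Vf (vec_index (U L)) j = 1"
    using P.cinner_W[OF U(2) j] P.cinner_W_nonzero[OF j] by simp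
  moreover have "cinner (Wp k) (U L) = 0 \<longleftrightarrow> crd n P.Vf (vec_index (U L)) k = 0" if "k < n" for k
    using P.cinner_W[OF U(2) that] P.cinner_W_nonzero[OF that] by simp
  moreover have "cinner (prev k 0) (U 0) = ip n (vec_index (prev k 0)) (vec_index (U 0))" if "k < j" for k
    by (rule cinner_ip[OF prev[OF that] U(1)])
  ultimately show ?thesis
    unfolding bvp_plus_def bvp_ode_iff[OF A] SP.bvp.fbvp_def using True by auto
next
  case False
  then show ?thesis unfolding bvp_plus_def bvp_ode_iff[OF A] by auto
qed

lemma sol_reflect_iff:
  "sol n Af c (- L) 0 v \<longleftrightarrow> sol n Ar (- c) 0 L (\<lambda>x. v (- x))"
proof
  assume "sol n Af c (- L) 0 v"
  from sol_reflect[OF this] show "sol n Ar (- c) 0 L (\<lambda>x. v (- x))" by simp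
next
  assume "sol n Ar (- c) 0 L (\<lambda>x. v (- x))"
  from sol_reflect[OF this] show "sol n Af c (- L) 0 v" by simp
qed

lemma bvp_minus_iff:
  assumes j: "j < n" and prev: "\<And>k. k < j \<Longrightarrow> prev k 0 \<in> carrier_vec n"
  shows "bvp_minus n A num Wm Vm L prev j U \<longleftrightarrow> (\<forall>x\<in>{-L..0}. U x \<in> carrier_vec n) \<and>
    SM.bvp.fbvp (\<lambda>k x. vec_index (prev k (- x))) j (\<lambda>x. vec_index (U (- x)))"
proof (cases "\<forall>x\<in>{-L..0}. U x \<in> carrier_vec n")
  case True
  then have U: "U 0 \<in> carrier_vec n" "U (- L) \<in> carrier_vec n" using L by auto
  have "cinner (Wm j) (U (- L)) = cinner (Wm j) (Vm j) \<longleftrightarrow> crd n M.Vf (vec_index (U (- L))) j = 1"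
    using M.cinner_W[OF U(2) j] M.cinner_W_nonzero[OF j] by simp
  moreover have "cinner (Wm k) (U (- L)) = 0 \<longleftrightarrow> crd n M.Vf (vec_index (U (- L))) k = 0" if "k < n" for k
    using M.cinner_W[OF U(2) that] M.cinner_W_nonzero[OF that] by simp
  moreover have "cinner (prev k 0) (U 0) = ip n (vec_index (prev k 0)) (vec_index (U 0))" if "k < j" for k
    by (rule cinner_ip[OF prev[OF that] U(1)])
  ultimately show ?thesis
    unfolding bvp_minus_def bvp_ode_iff[OF A] SM.bvp.fbvp_def sol_reflect_iff using True by auto
next
  case False
  then show ?thesis unfolding bvp_minus_def bvp_ode_iff[OF A] by auto
qed

lemma bvp_plus_Sp:
  assumes j: "j < r"
  shows "bvp_plus n A nup Wp Vp L Sp j (Sp j)"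
    and "bvp_plus n A nup Wp Vp L Sp j U \<Longrightarrow> x \<in> {0..L} \<Longrightarrow> U x = Sp j x"
proof -
  have jn: "j < n" using j n by simp
  have carrier: "Sp k x \<in> carrier_vec n" for k x by (simp add: Sp_def)
  have bv: "bvp n r P.Vf Af L" by (rule SP.bvp.bvp_axioms)
  show "bvp_plus n A nup Wp Vp L Sp j (Sp j)"
    unfolding bvp_plus_iff[OF jn carrier] using carrier
    by (intro conjI ballI fbvp_cong[OF SP.bvp.S_bvp[OF jn] _ _ bv]) (auto simp: Sp_def)
  assume U: "bvp_plus n A nup Wp Vp L Sp j U" and x: "x \<in> {0..L}"
  then have Uc: "U x \<in> carrier_vec n" and "SP.bvp.fbvp (\<lambda>k x. vec_index (Sp k x)) j (\<lambda>x. vec_index (U x))"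
    using bvp_plus_iff[OF jn carrier] by auto
  then have "SP.bvp.fbvp SP.bvp.S j (\<lambda>x. vec_index (U x))"
    by (elim fbvp_cong[OF _ _ _ bv]) (auto simp: Sp_def)
  from SP.bvp.S_unique[OF jn this x] show "U x = Sp j x"
    using Uc by (intro eq_vecI) (auto simp: Sp_def)
qed

lemma bvp_minus_Sm:
  assumes j: "j < m"
  shows "bvp_minus n A num Wm Vm L Sm j (Sm j)"
    and "bvp_minus n A num Wm Vm L Sm j U \<Longrightarrow> x \<in> {-L..0} \<Longrightarrow> U x = Sm j x"
proof -
  have jn: "j < n" using j n by simp
  have carrier: "Sm k x \<in> carrier_vec n" for k x by (simp add: Sm_def)
  have bv: "bvp n m M.Vf Ar L" by (rule SM.bvp.bvp_axioms)
  show "bvp_minus n A num Wm Vm L Sm j (Sm j)"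
    unfolding bvp_minus_iff[OF jn carrier] using carrier
    by (intro conjI ballI fbvp_cong[OF SM.bvp.S_bvp[OF jn] _ _ bv]) (auto simp: Sm_def)
  assume U: "bvp_minus n A num Wm Vm L Sm j U" and x: "x \<in> {-L..0}"
  then have Uc: "U x \<in> carrier_vec n"
    and "SM.bvp.fbvp (\<lambda>k x. vec_index (Sm k (- x))) j (\<lambda>x. vec_index (U (- x)))"
    using bvp_minus_iff[OF jn carrier] by auto
  then have "SM.bvp.fbvp SM.bvp.S j (\<lambda>x. vec_index (U (- x)))"
    by (elim fbvp_cong[OF _ _ _ bv]) (auto simp: Sm_def)
  from SM.bvp.S_unique[OF jn this, of "- x"] show "U x = Sm j x"
    using Uc x by (intro eq_vecI) (auto simp: Sm_def)
qed

lemma St_plus: "P.St = {..<r}"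
proof (intro equalityI subsetI)
  fix l assume "l \<in> P.St"
  then have l: "l < n" "Re (nup l) < 0" by (auto simp: P.St_def)
  then show "l \<in> {..<r}" using nup_pos[of l] by (cases "l < r") auto
next
  fix l assume "l \<in> {..<r}"
  then show "l \<in> P.St" using nup_neg[of l] r_le by (simp add: P.St_def)
qed

lemma St_minus: "M.St = {m..<n}"
proof (intro equalityI subsetI)
  fix l assume "l \<in> M.St"
  then have l: "l < n" "Re (num l) < 0" by (auto simp: M.St_def)
  then show "l \<in> {m..<n}" using num_pos[of l] by (cases "l < m") auto
next
  fix l assume "l \<in> {m..<n}"
  then show "l \<in> M.St" using num_neg[of l] by (simp add: M.St_def)
qed

lemma Zp_carrier: "Zp \<in> carrier_mat n r" and Zm_carrier: "Zm \<in> carrier_mat n m"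
  using Zp Zm by (auto simp: cols_basis_def)

lemma crd_Zp: "j < r \<Longrightarrow> r \<le> l \<Longrightarrow> l < n \<Longrightarrow> crd n P.Vf (vec_index (col Zp j)) l = 0"
proof -
  assume j: "j < r" and l: "r \<le> l" "l < n"
  have "Zp *\<^sub>v unit_vec r j \<in> mrange n (Ps Ap)" using Zp by (auto simp: cols_basis_def)
  then have "col Zp j \<in> mrange n (P.pr P.St)"
    unfolding col_mult_unit[OF Zp_carrier j] P.Ps_eq .
  then show ?thesis using P.mrange_pr[OF P.St, of "col Zp j"] l by (auto simp: St_plus)
qed

lemma crd_Zm: "j < m \<Longrightarrow> m \<le> l \<Longrightarrow> l < n \<Longrightarrow> crd n M.Vf (vec_index (col Zm j)) l = 0"
proof -
  assume j: "j < m" and l: "m \<le> l" "l < n"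
  have I: "{..<n} - M.St \<subseteq> {..<n}" by auto
  have "Zm *\<^sub>v unit_vec m j \<in> mrange n (Pu Am)" using Zm by (auto simp: cols_basis_def)
  then have "col Zm j \<in> mrange n (M.pr ({..<n} - M.St))"
    unfolding col_mult_unit[OF Zm_carrier j] M.Pu_eq .
  then show ?thesis using M.mrange_pr[OF I, of "col Zm j"] l by (auto simp: St_minus)
qed

text \<open>A reflected solution solves the reflected system with the initial point moved from
  \<open>- L\<close> to \<open>L\<close>; uniqueness does the rest.\<close>

lemma phi_Ar: "i < n \<Longrightarrow> phi n Ar L u x i = phi n Af (- L) u (- x) i"
proof -
  assume i: "i < n"
  have "sol n Ar 0 (min L x) (max L x) (\<lambda>x. phi n Af (- L) u (- x))"
    using sol_reflect[OF SP.phi_sol'[of "- max L x" "- min L x" "- L" u]] by simp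
  from SM.phi_unique'[OF i this, of u] show ?thesis by (simp add: phi_init)
qed

lemma stable_set_iff: "u \<in> stable_set n A L \<longleftrightarrow> u \<in> carrier_vec n \<and> SP.decays (vec_index u)"
  unfolding stable_set_def SP.decays_def using solution_set_phi[OF A A_cont, of u L at_top] by auto

lemma unstable_set_iff: "u \<in> unstable_set n A (- L) \<longleftrightarrow> u \<in> carrier_vec n \<and> SM.decays (vec_index u)"
proof -
  have "((\<lambda>x. phi n Ar L (vec_index u) x i) \<longlongrightarrow> 0) at_top \<longleftrightarrow>
      ((\<lambda>x. phi n Af (- L) (vec_index u) x i) \<longlongrightarrow> 0) at_bot" if "i < n" for i
    unfolding phi_Ar[OF that] by (rule filterlim_at_bot_mirror[symmetric])
  then show ?thesis
    unfolding unstable_set_def SM.decays_def using solution_set_phi[OF A A_cont, of u "- L" at_bot] by auto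
qed

lemma ZpL: "j < r \<Longrightarrow> ZpL n A Ap Zp L j \<in> carrier_vec n \<and> SP.decays (vec_index (ZpL n A Ap Zp L j)) \<and>
    (\<forall>l<r. crd n P.Vf (\<lambda>i. vec_index (col Zp j) i - vec_index (ZpL n A Ap Zp L j) i) l = 0)"
  unfolding ZpL_def
proof (rule SP.proj_along_eq[OF stable_set_iff])
  fix u
  have I: "{..<n} - P.St \<subseteq> {..<n}" by auto
  show "u \<in> mrange n (Pu Ap) \<longleftrightarrow> u \<in> carrier_vec n \<and> (\<forall>l<r. crd n P.Vf (vec_index u) l = 0)"
    unfolding P.Pu_eq using P.mrange_pr[OF I, of u] r_le by (auto simp: St_plus)
qed (use Zp_carrier in auto)

lemma ZmL: "j < m \<Longrightarrow> ZmL n A Am Zm L j \<in> carrier_vec n \<and> SM.decays (vec_index (ZmL n A Am Zm L j)) \<and>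
    (\<forall>l<m. crd n M.Vf (\<lambda>i. vec_index (col Zm j) i - vec_index (ZmL n A Am Zm L j) i) l = 0)"
  unfolding ZmL_def
proof (rule SM.proj_along_eq[OF unstable_set_iff])
  fix u
  show "u \<in> mrange n (Ps Am) \<longleftrightarrow> u \<in> carrier_vec n \<and> (\<forall>l<m. crd n M.Vf (vec_index u) l = 0)"
    unfolding M.Ps_eq using M.mrange_pr[OF M.St, of u] m_le by (auto simp: St_minus)
qed (use Zm_carrier in auto)

definition "dzp = D r (\<lambda>j k. crd n P.Vf (vec_index (col Zp j)) k)"
definition "dzm = D m (\<lambda>j k. crd n M.Vf (vec_index (col Zm j)) k)"

lemma coefficients_plus:
  "\<exists>!Q. Q \<in> carrier_mat r r \<and> mat_of_cols n (map (\<lambda>j. Sp j L) [0..<r]) * Q = Zp"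
  "Determinant.det (coef_mat n r (\<lambda>j. Sp j L) Zp) = dzp"
proof -
  have "\<exists>C. (\<forall>j<r. \<forall>i<n. vec_index (col Zp j) i = (\<Sum>k<r. C k j * SP.bvp.S k L i)) \<and>
      D r (\<lambda>j k. C k j) = D r (\<lambda>j k. crd n P.Vf (vec_index (col Zp j)) k)"
    by (rule SP.tilde_coefficients(1)) (rule crd_Zp)
  then obtain C where C: "\<And>j i. j < r \<Longrightarrow> i < n \<Longrightarrow> vec_index (col Zp j) i = (\<Sum>k<r. C k j * SP.bvp.S k L i)"
    "D r (\<lambda>j k. C k j) = dzp"
    unfolding dzp_def by auto
  have C': "Zp $$ (i, j) = (\<Sum>l<r. C l j * vec_index (Sp l L) i)" if "j < r" "i < n" for j i
    using C(1)[OF that] that Zp_carrier by (simp add: Sp_def)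
  have nz0: "D n (\<lambda>j. if j < r then SP.bvp.S j L else P.Vf j) \<noteq> 0"
    by (rule SP.tilde_coefficients(2)[of "\<lambda>j. vec_index (col Zp j)"]) (rule crd_Zp)
  have nz: "D n (\<lambda>j. if j < r then vec_index (Sp j L) else P.Vf j) \<noteq> 0"
    using nz0
    by (subst D_cong[where c' = "\<lambda>j. if j < r then SP.bvp.S j L else P.Vf j"]) (auto simp: Sp_def)
  show "\<exists>!Q. Q \<in> carrier_mat r r \<and> mat_of_cols n (map (\<lambda>j. Sp j L) [0..<r]) * Q = Zp"
    by (rule coef_mat_det(1)[OF r_le Zp_carrier nz C'])
  show "Determinant.det (coef_mat n r (\<lambda>j. Sp j L) Zp) = dzp"
    using coef_mat_det(2)[OF r_le Zp_carrier nz C'] C(2) by simp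
qed

lemma coefficients_minus:
  "\<exists>!Q. Q \<in> carrier_mat m m \<and> mat_of_cols n (map (\<lambda>j. Sm j (- L)) [0..<m]) * Q = Zm"
  "Determinant.det (coef_mat n m (\<lambda>j. Sm j (- L)) Zm) = dzm"
proof -
  have "\<exists>C. (\<forall>j<m. \<forall>i<n. vec_index (col Zm j) i = (\<Sum>k<m. C k j * SM.bvp.S k L i)) \<and>
      D m (\<lambda>j k. C k j) = D m (\<lambda>j k. crd n M.Vf (vec_index (col Zm j)) k)"
    by (rule SM.tilde_coefficients(1)) (rule crd_Zm)
  then obtain C where C: "\<And>j i. j < m \<Longrightarrow> i < n \<Longrightarrow> vec_index (col Zm j) i = (\<Sum>k<m. C k j * SM.bvp.S k L i)"
    "D m (\<lambda>j k. C k j) = dzm"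
    unfolding dzm_def by auto
  have C': "Zm $$ (i, j) = (\<Sum>l<m. C l j * vec_index (Sm l (- L)) i)" if "j < m" "i < n" for j i
    using C(1)[OF that] that Zm_carrier by (simp add: Sm_def)
  have nz0: "D n (\<lambda>j. if j < m then SM.bvp.S j L else M.Vf j) \<noteq> 0"
    by (rule SM.tilde_coefficients(2)[of "\<lambda>j. vec_index (col Zm j)"]) (rule crd_Zm)
  have nz: "D n (\<lambda>j. if j < m then vec_index (Sm j (- L)) else M.Vf j) \<noteq> 0"
    using nz0
    by (subst D_cong[where c' = "\<lambda>j. if j < m then SM.bvp.S j L else M.Vf j"]) (auto simp: Sm_def)
  show "\<exists>!Q. Q \<in> carrier_mat m m \<and> mat_of_cols n (map (\<lambda>j. Sm j (- L)) [0..<m]) * Q = Zm"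
    by (rule coef_mat_det(1)[OF m_le Zm_carrier nz C'])
  show "Determinant.det (coef_mat n m (\<lambda>j. Sm j (- L)) Zm) = dzm"
    using coef_mat_det(2)[OF m_le Zm_carrier nz C'] C(2) by simp
qed

definition "Etilde = det_cols n r (\<lambda>j. Sm j 0) (\<lambda>j. Sp j 0)"
definition "Eexact = det_cols n r (\<lambda>j. Vmx j 0) (\<lambda>j. Vpx j 0)"

lemma Etilde_D: "Etilde = D n (\<lambda>j. if j < m then SM.bvp.S j 0 else SP.bvp.S (j - m) 0)"
  unfolding Etilde_def det_cols_D[OF r_le] nr by (rule D_cong) (auto simp: Sm_def Sp_def)

lemma Eexact_D: "Eexact = D n (\<lambda>j. if j < m then Xm j 0 else Xp (j - m) 0)"
  unfolding Eexact_def det_cols_D[OF r_le] nr by (rule D_cong) (auto simp: Xm_def Xp_def)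

lemma Eexact_Etilde: "cmod (Eexact - Etilde) \<le> diff_const n m r K \<alpha> B * exp (- \<alpha> * L)"
  unfolding Eexact_D Etilde_D
  by (rule determinant_difference[OF plus_frame minus_frame n A_cont L(1)])
     (use Xp_sol Xp_lim Xm_sol Xm_lim B(1-6) B(7)[folded Xm_def] in auto)

definition "calC = calC_L n r A Ap Am Zp Zm Vpx Vmx L"

definition "EL = evans_L n r A Ap Am Zp Zm L"

lemma prod_exp_num: "(\<Prod>k<m. exp (- (- num k) * of_real L)) = exp (of_real L * (\<Sum>k<m. num k))"
proof -
  have "(\<Prod>k<m. exp (- (- num k) * of_real L)) = exp (\<Sum>k<m. - (- num k) * of_real L)"
    by (rule exp_sum[symmetric]) simp
  also have "(\<Sum>k<m. - (- num k) * of_real L) = of_real L * (\<Sum>k<m. num k)"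
    unfolding sum_distrib_left by (rule sum.cong) simp_all
  finally show ?thesis .
qed

lemma prod_exp_nup: "(\<Prod>k<r. exp (- nup k * of_real L)) = exp (- of_real L * (\<Sum>k<r. nup k))"
proof -
  have "(\<Prod>k<r. exp (- nup k * of_real L)) = exp (\<Sum>k<r. - nup k * of_real L)"
    by (rule exp_sum[symmetric]) simp
  also have "(\<Sum>k<r. - nup k * of_real L) = - of_real L * (\<Sum>k<r. nup k)"
    unfolding sum_distrib_left by (rule sum.cong) simp_all
  finally show ?thesis .
qed

text \<open>The coefficients that express the projected bases at \<open>L\<close> and
  \<open>- L\<close> by the exact solutions also express their continuations at 0, up to
  exponentials of eigenvalues. These cancel against the traces in \<open>evans_L\<close>.\<close>

lemma calC_EL: "calC * (mp * mm) = dzp * dzm \<and> EL = Eexact * calC"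
proof -
  let ?zp = "\<lambda>j. vec_index (ZpL n A Ap Zp L j)" and ?zm = "\<lambda>j. vec_index (ZmL n A Am Zm L j)"
  obtain C where C: "\<And>j i. j < r \<Longrightarrow> i < n \<Longrightarrow> ?zp j i = (\<Sum>k<r. C k j * Xp k L i)"
    "mp * D r (\<lambda>j k. C k j) = dzp"
    "\<And>j i. j < r \<Longrightarrow> i < n \<Longrightarrow> phi n Af L (?zp j) 0 i = (\<Sum>k<r. C k j * (exp (- nup k * of_real L) * Xp k 0 i))"
    unfolding dzp_def mp_def
    by (rule SP.X_coefficients[of ?zp "\<lambda>j. vec_index (col Zp j)"]) (use ZpL in auto)
  obtain C' where C': "\<And>j i. j < m \<Longrightarrow> i < n \<Longrightarrow> ?zm j i = (\<Sum>k<m. C' k j * Xr k L i)"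
    "mm * D m (\<lambda>j k. C' k j) = dzm"
    "\<And>j i. j < m \<Longrightarrow> i < n \<Longrightarrow> phi n Ar L (?zm j) 0 i = (\<Sum>k<m. C' k j * (exp (- (- num k) * of_real L) * Xr k 0 i))"
    unfolding dzm_def mm_def
    by (rule SM.X_coefficients[of ?zm "\<lambda>j. vec_index (col Zm j)"]) (use ZmL in auto)
  have d1: "Determinant.det (coef_mat n r (\<lambda>j. Vpx j L) (mat_of_cols n (map (ZpL n A Ap Zp L) [0..<r])))
      = D r (\<lambda>j k. C k j)"
  proof (rule coef_mat_det(2)[OF r_le, where c = P.Vf])
    show "D n (\<lambda>j. if j < r then vec_index (Vpx j L) else P.Vf j) \<noteq> 0"
      using SP.X_columns_nonzero unfolding Xp_def .
    fix j i assume "j < r" "i < n"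
    then show "mat_of_cols n (map (ZpL n A Ap Zp L) [0..<r]) $$ (i, j) = (\<Sum>l<r. C l j * vec_index (Vpx l L) i)"
      using C(1) by (simp add: mat_of_cols_index Xp_def)
  qed (rule carrier_matI; simp)
  have d2: "Determinant.det (coef_mat n m (\<lambda>j. Vmx j (- L)) (mat_of_cols n (map (ZmL n A Am Zm L) [0..<m])))
      = D m (\<lambda>j k. C' k j)"
  proof (rule coef_mat_det(2)[OF m_le, where c = M.Vf])
    show "D n (\<lambda>j. if j < m then vec_index (Vmx j (- L)) else M.Vf j) \<noteq> 0"
      using SM.X_columns_nonzero unfolding Xr_def Xm_def .
    fix j i assume "j < m" "i < n"
    then show "mat_of_cols n (map (ZmL n A Am Zm L) [0..<m]) $$ (i, j) = (\<Sum>l<m. C' l j * vec_index (Vmx l (- L)) i)"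
      using C'(1) by (simp add: mat_of_cols_index Xr_def Xm_def)
  qed (rule carrier_matI; simp)
  have calC: "calC = D r (\<lambda>j k. C k j) * D m (\<lambda>j k. C' k j)"
    unfolding calC_def calC_L_def nr d1 d2 ..
  have fp: "vec_index (ode_flow n A L (ZpL n A Ap Zp L j) 0) i = phi n Af L (?zp j) 0 i" if "j < r" "i < n" for j i
    using ode_flow_phi[OF A A_cont, of "ZpL n A Ap Zp L j" L 0] ZpL[OF that(1)] that by simp
  have fm: "vec_index (ode_flow n A (- L) (ZmL n A Am Zm L j) 0) i = phi n Ar L (?zm j) 0 i" if "j < m" "i < n" for j i
    using ode_flow_phi[OF A A_cont, of "ZmL n A Am Zm L j" "- L" 0] ZmL[OF that(1)] that phi_Ar by simp
  have "Determinant.det (mat_of_cols n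
        (map (\<lambda>j. ode_flow n A (-L) (ZmL n A Am Zm L j) 0) [0..<m] @ map (\<lambda>j. ode_flow n A L (ZpL n A Ap Zp L j) 0) [0..<r]))
     = D n (\<lambda>j. if j < m then phi n Ar L (?zm j) 0 else phi n Af L (?zp (j - m)) 0)"
    by (subst det_mat_of_cols) (use n fp fm in \<open>auto intro!: D_cong simp: nth_append\<close>)
  also have "\<dots> = (\<Prod>k<m. exp (- (- num k) * of_real L)) * (\<Prod>k<r. exp (- nup k * of_real L))
      * D m (\<lambda>j k. C' k j) * D r (\<lambda>j k. C k j) * D n (\<lambda>j. if j < m then Xr j 0 else Xp (j - m) 0)"
    by (rule D_two_blocks[OF n C'(3) C(3)])
  also have "D n (\<lambda>j. if j < m then Xr j 0 else Xp (j - m) 0) = Eexact"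
    unfolding Eexact_D Xr_def minus_zero ..
  also have "(\<Prod>k<m. exp (- (- num k) * of_real L)) = exp (of_real L * (\<Sum>k<m. num k))"
    by (rule prod_exp_num)
  also have "(\<Prod>k<r. exp (- nup k * of_real L)) = exp (- of_real L * (\<Sum>k<r. nup k))"
    by (rule prod_exp_nup)
  finally have det: "Determinant.det (mat_of_cols n
        (map (\<lambda>j. ode_flow n A (-L) (ZmL n A Am Zm L j) 0) [0..<m] @ map (\<lambda>j. ode_flow n A L (ZpL n A Ap Zp L j) 0) [0..<r]))
     = exp (of_real L * (\<Sum>k<m. num k)) * exp (- of_real L * (\<Sum>k<r. nup k)) * calC * Eexact"
    unfolding calC by (simp add: mult_ac)
  have "{..<n} - M.St = {..<m}" unfolding St_minus using n by auto
  then have tm: "mtrace (Am * Pu Am) = (\<Sum>k<m. num k)"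
    unfolding M.Pu_eq using M.mtrace_pr[of "{..<m}"] m_le by simp
  have tp: "mtrace (Ap * Ps Ap) = (\<Sum>k<r. nup k)"
    unfolding P.Ps_eq using P.mtrace_pr[OF P.St] by (simp add: St_plus)
  have "EL = Eexact * calC"
    unfolding EL_def evans_L_def nr det tm tp
    by (simp add: exp_minus field_simps)
  moreover have "calC * (mp * mm) = dzp * dzm"
    unfolding calC C(2)[symmetric] C'(2)[symmetric] by (simp add: mult_ac)
  ultimately show ?thesis by blast
qed

text \<open>Eigenvectors and orthogonalisation disappear. What remains are eigenvalue sums, the
  bases \<open>Zp\<close> and \<open>Zm\<close> and the flow, so analyticity becomes accessible
  although the eigenvectors are only continuous in the parameter.\<close>

lemma Etilde_flow:
  "Etilde * (dzm * dzp) = exp (of_real L * ((\<Sum>k<r. nup k) - (\<Sum>k<m. num k))) *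
     D n (\<lambda>j. if j < m then phi n Af (- L) (vec_index (col Zm j)) 0 else phi n Af L (vec_index (col Zp (j - m))) 0)"
proof -
  have "D n (\<lambda>j. if j < m then SM.bvp.S j 0 else SP.bvp.S (j - m) 0)
      = D n (\<lambda>j. if j < m then SM.bvp.Y j 0 else SP.bvp.Y (j - m) 0)"
  proof -
    have swap: "D n (\<lambda>j. if j < m then Q j else R (j - m)) = (-1) ^ (m * r) * D n (\<lambda>j. if j < r then R j else Q (j - r))"
      for Q R :: "nat \<Rightarrow> nat \<Rightarrow> complex" unfolding n by (rule D_swap_blocks)
    show ?thesis
      unfolding SM.bvp.S_minor
        swap[of "\<lambda>j. SM.bvp.Y j 0" "\<lambda>j. SP.bvp.S j 0"] swap[of "\<lambda>j. SM.bvp.Y j 0" "\<lambda>j. SP.bvp.Y j 0"]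
        SP.bvp.S_minor ..
  qed
  then have E: "Etilde = D n (\<lambda>j. if j < m then SM.bvp.Y j 0 else SP.bvp.Y (j - m) 0)"
    unfolding Etilde_D .
  have "D n (\<lambda>j. if j < m then phi n Ar L (vec_index (col Zm j)) 0 else phi n Af L (vec_index (col Zp (j - m))) 0)
      = (\<Prod>k<m. exp (- (- num k) * of_real L)) * (\<Prod>k<r. exp (- nup k * of_real L))
      * D m (\<lambda>j k. crd n M.Vf (vec_index (col Zm j)) k) * D r (\<lambda>j k. crd n P.Vf (vec_index (col Zp j)) k)
      * D n (\<lambda>j. if j < m then SM.bvp.Y j 0 else SP.bvp.Y (j - m) 0)"
  proof (rule D_two_blocks[OF n])
    fix j i assume "j < m" "i < n"
    then show "phi n Ar L (vec_index (col Zm j)) 0 i = (\<Sum>k<m. crd n M.Vf (vec_index (col Zm j)) k *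
        (exp (- (- num k) * of_real L) * SM.bvp.Y k 0 i))"
      by (intro SM.phi_Z crd_Zm)
  next
    fix j i assume "j < r" "i < n"
    then show "phi n Af L (vec_index (col Zp j)) 0 i = (\<Sum>k<r. crd n P.Vf (vec_index (col Zp j)) k *
        (exp (- nup k * of_real L) * SP.bvp.Y k 0 i))"
      by (intro SP.phi_Z crd_Zp)
  qed
  also have "\<dots> = exp (of_real L * (\<Sum>k<m. num k)) * exp (- of_real L * (\<Sum>k<r. nup k)) * (dzm * dzp * Etilde)"
    unfolding E dzm_def dzp_def prod_exp_num prod_exp_nup by (simp only: mult_ac)
  finally have "D n (\<lambda>j. if j < m then phi n Ar L (vec_index (col Zm j)) 0 else phi n Af L (vec_index (col Zp (j - m))) 0)
      = exp (of_real L * (\<Sum>k<m. num k)) * exp (- of_real L * (\<Sum>k<r. nup k)) * (dzm * dzp * Etilde)" .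
  moreover have "D n (\<lambda>j. if j < m then phi n Ar L (vec_index (col Zm j)) 0 else phi n Af L (vec_index (col Zp (j - m))) 0)
    = D n (\<lambda>j. if j < m then phi n Af (- L) (vec_index (col Zm j)) 0 else phi n Af L (vec_index (col Zp (j - m))) 0)"
    by (rule D_cong) (simp add: phi_Ar)
  ultimately show ?thesis by (simp add: right_diff_distrib exp_diff exp_minus field_simps)
qed

end

section \<open>Dependence on the parameter\<close>

lemma continuous_on_D:
  assumes "\<And>i j. i < n \<Longrightarrow> j < n \<Longrightarrow> continuous_on S (\<lambda>z. c z j i)"
  shows "continuous_on S (\<lambda>z. D n (c z))"
  unfolding D_expand
  by (intro continuous_intros assms) (auto dest: permutes_in_image)

lemma holomorphic_on_D:
  assumes "\<And>i j. i < n \<Longrightarrow> j < n \<Longrightarrow> (\<lambda>z. c z j i) holomorphic_on S"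
  shows "(\<lambda>z. D n (c z)) holomorphic_on S"
  unfolding D_expand
  by (intro holomorphic_intros assms) (auto dest: permutes_in_image)

text \<open>A cofactor as a determinant with a unit column, so that continuity of \<open>D\<close>
  applies to it.\<close>

lemma minor_cofactor_D:
  assumes "j < n" "i < n"
  shows "minor_cofactor n c j i = D n (c(j := (\<lambda>k. if k = i then 1 else 0)))"
proof -
  have "(\<Sum>k<n. (if k = i then 1 else 0) * minor_cofactor n c j k) = (\<Sum>k<n. if k = i then minor_cofactor n c j i else 0)"
    by (intro sum.cong) auto
  then show ?thesis using assms by (simp add: D_upd)
qed

lemma continuous_on_cofactor:
  assumes "\<And>i j. i < n \<Longrightarrow> j < n \<Longrightarrow> continuous_on S (\<lambda>z. V z j i)"
    and "\<And>z. z \<in> S \<Longrightarrow> D n (V z) \<noteq> 0" and "j < n" "i < n"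
  shows "continuous_on S (\<lambda>z. minor_cofactor n (V z) j i / D n (V z))"
proof -
  have "continuous_on S (\<lambda>z. D n ((V z)(j := (\<lambda>k. if k = i then 1 else 0))))"
  proof (rule continuous_on_D)
    fix k l assume "k < n" "l < n"
    then show "continuous_on S (\<lambda>z. ((V z)(j := (\<lambda>k. if k = i then 1 else 0))) l k)"
      using assms(1) by (cases "l = j") auto
  qed
  then show ?thesis
    using assms by (intro continuous_intros continuous_on_D) (auto simp: minor_cofactor_D)
qed

lemma continuous_on_crd:
  assumes "\<And>i j. i < n \<Longrightarrow> j < n \<Longrightarrow> continuous_on S (\<lambda>z. V z j i)"
    and "\<And>z. z \<in> S \<Longrightarrow> D n (V z) \<noteq> 0" and "\<And>i. i < n \<Longrightarrow> continuous_on S (\<lambda>z. u z i)" and "k < n"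
  shows "continuous_on S (\<lambda>z. crd n (V z) (u z) k)"
  unfolding crd_def using assms by (intro continuous_on_sum continuous_on_mult continuous_on_cofactor) auto

text \<open>Source of the constant \<open>K\<close>: entrywise decay of the coefficient matrix
  towards its limit becomes decay of the coefficients in the eigenbasis.\<close>

lemma crd_mv_bound:
  assumes c: "\<And>l i. l < n \<Longrightarrow> i < n \<Longrightarrow> cmod (minor_cofactor n V l i / D n V) \<le> b"
    and v: "\<And>i. i < n \<Longrightarrow> cmod (v i) \<le> b"
    and M: "\<And>i a. i < n \<Longrightarrow> a < n \<Longrightarrow> cmod (M i a) \<le> t" and k: "k < n"
  shows "cmod (crd n V (mv n M v) k) \<le> real n * b * (real n * b) * t"
proof -
  have b: "b \<ge> 0" using order_trans[OF norm_ge_zero v[OF k]] .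
  have t: "t \<ge> 0" using order_trans[OF norm_ge_zero M[OF k k]] .
  have mv: "cmod (mv n M v i) \<le> real n * (t * b)" if i: "i < n" for i
  proof -
    have "cmod (M i a * v a) \<le> t * b" if "a < n" for a
      unfolding norm_mult using M[OF i that] v[OF that] t by (intro mult_mono) auto
    then show ?thesis unfolding mv_def using sum_norm_bound[of "{..<n}" "\<lambda>a. M i a * v a" "t * b"] by simp
  qed
  have "cmod (minor_cofactor n V k i / D n V * mv n M v i) \<le> b * (real n * (t * b))" if i: "i < n" for i
    using mult_mono[OF c[OF k i] mv[OF i]] b unfolding norm_mult by simp
  then have "cmod (crd n V (mv n M v) k) \<le> real n * (b * (real n * (t * b)))"
    unfolding crd_def
    using sum_norm_bound[of "{..<n}" "\<lambda>i. minor_cofactor n V k i / D n V * mv n M v i" "b * (real n * (t * b))"] by simp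
  then show ?thesis by (simp add: mult_ac)
qed

text \<open>Applying the coordinate functional at \<open>z\<close> to the eigenvalue equation at \<open>y\<close> turns the
  difference quotient of the eigenvalue into one of the matrix.\<close>
lemma eigenvalue_holomorphic:
  assumes S: "open S"
    and E: "\<And>z. z \<in> S \<Longrightarrow> eigenbasis n (M z) (nu z) (V z) (W z)"
    and M: "\<And>i k. i < n \<Longrightarrow> k < n \<Longrightarrow> (\<lambda>z. mf (M z) i k) holomorphic_on S"
    and V: "\<And>i j. i < n \<Longrightarrow> j < n \<Longrightarrow> continuous_on S (\<lambda>z. vec_index (V z j) i)" and j: "j < n"
  shows "(\<lambda>z. nu z j) holomorphic_on S"
proof -
  have "\<exists>d. ((\<lambda>z. nu z j) has_field_derivative d) (at z)" if z: "z \<in> S" for z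
  proof -
    interpret Z: eigenbasis n "M z" "nu z" "V z" "W z" by (rule E[OF z])
    define c where "c = (\<lambda>u. crd n Z.Vf u j)"
    have "\<exists>d. \<forall>i<n. \<forall>k<n. ((\<lambda>z. mf (M z) i k) has_field_derivative d i k) (at z)"
    proof -
      have "\<forall>i k. \<exists>d. i < n \<and> k < n \<longrightarrow> ((\<lambda>z. mf (M z) i k) has_field_derivative d) (at z)"
        using M S z by (meson field_differentiable_def holomorphic_on_imp_differentiable_at)
      then show ?thesis by metis
    qed
    then obtain d where d: "\<And>i k. i < n \<Longrightarrow> k < n \<Longrightarrow> ((\<lambda>z. mf (M z) i k) has_field_derivative d i k) (at z)"
      by blast
    have Vlim: "((\<lambda>y. vec_index (V y j) i) \<longlongrightarrow> Z.Vf j i) (at z)" if "i < n" for i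
      using V[OF that j] S z by (meson continuous_on_eq_continuous_at isContD)
    \<comment> \<open>Entrywise difference quotient of the matrix. Of the eigenvectors at
      \<open>y\<close> only convergence is used, not differentiability.\<close>
    define Q where "Q = (\<lambda>y i k. (mf (M y) i k - mf (M z) i k) / (y - z))"
    have Qlim: "((\<lambda>y. Q y i k) \<longlongrightarrow> d i k) (at z)" if "i < n" "k < n" for i k
      using d[OF that] unfolding Q_def by (simp add: has_field_derivative_iff)
    have c1: "((\<lambda>y. c (vec_index (V y j))) \<longlongrightarrow> c (Z.Vf j)) (at z)"
      unfolding c_def by (rule tendsto_crd) (rule Vlim)
    have cz: "c (Z.Vf j) = 1" unfolding c_def using crd_basis[OF Z.detV j j] by simp
    have c2: "((\<lambda>y. c (mv n (Q y) (vec_index (V y j)))) \<longlongrightarrow> c (mv n d (Z.Vf j))) (at z)"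
      unfolding c_def by (rule tendsto_crd) (use Qlim Vlim in \<open>auto simp: mv_def intro!: tendsto_intros\<close>)
    have lim: "((\<lambda>y. c (mv n (Q y) (vec_index (V y j))) / c (vec_index (V y j))) \<longlongrightarrow> c (mv n d (Z.Vf j)) / c (Z.Vf j)) (at z)"
      by (intro tendsto_divide c1 c2) (simp add: cz)
    have "\<forall>\<^sub>F y in at z. c (vec_index (V y j)) \<noteq> 0"
      using c1 by (rule tendsto_imp_eventually_ne) (simp add: cz)
    moreover have "\<forall>\<^sub>F y in at z. y \<in> S"
      using S z by (simp add: eventually_at_in_open')
    moreover have "\<forall>\<^sub>F y in at z. y \<noteq> z" by (simp add: eventually_neq_at_within)
    ultimately have "\<forall>\<^sub>F y in at z. c (mv n (Q y) (vec_index (V y j))) / c (vec_index (V y j)) = (nu y j - nu z j) / (y - z)"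
    proof eventually_elim
      case (elim y)
      interpret Y: eigenbasis n "M y" "nu y" "V y" "W y" by (rule E[OF elim(2)])
      have "c (mv n (Q y) (Y.Vf j)) = c (\<lambda>i. (nu y j * Y.Vf j i - mv n (mf (M z)) (Y.Vf j) i) / (y - z))"
        unfolding c_def
      proof (rule crd_cong)
        fix i assume i: "i < n"
        have "mv n (Q y) (Y.Vf j) i = (mv n (mf (M y)) (Y.Vf j) i - mv n (mf (M z)) (Y.Vf j) i) / (y - z)"
          by (simp add: Q_def mv_def diff_divide_distrib sum_subtractf left_diff_distrib sum_divide_distrib)
        then show "mv n (Q y) (Y.Vf j) i = (nu y j * Y.Vf j i - mv n (mf (M z)) (Y.Vf j) i) / (y - z)"
          by (simp add: Y.mv_V[OF j i])
      qed
      also have "\<dots> = c (\<lambda>i. inverse (y - z) * (nu y j * Y.Vf j i - mv n (mf (M z)) (Y.Vf j) i))"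
        by (simp add: divide_inverse mult.commute)
      \<comment> \<open>\<open>c\<close> is a left eigenvector of \<open>M z\<close>: applied after
        \<open>M z\<close> it multiplies by \<open>nu z j\<close>.\<close>
      also have "\<dots> = inverse (y - z) * (nu y j * c (Y.Vf j) - nu z j * c (Y.Vf j))"
        unfolding c_def crd_scale crd_diff by (simp add: Z.crd_mv[OF j] crd_scale)
      finally show ?case using elim by (simp add: field_simps)
    qed
    then have "((\<lambda>y. (nu y j - nu z j) / (y - z)) \<longlongrightarrow> c (mv n d (Z.Vf j)) / c (Z.Vf j)) (at z)"
      by (rule Lim_transform_eventually[OF lim])
    then show ?thesis by (auto simp: has_field_derivative_iff)
  qed
  then show ?thesis
    using S by (auto simp: holomorphic_on_open)
qed

lemma exp_decay_eventually:
  assumes "\<alpha> > 0" "\<epsilon> > 0"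
  shows "\<forall>\<^sub>F L in at_top. Q * exp (- \<alpha> * L) \<le> (\<epsilon>::real)"
proof -
  have "filterlim (\<lambda>L. \<alpha> * L) at_top at_top"
    using assms by (intro filterlim_tendsto_pos_mult_at_top[OF tendsto_const]) (auto simp: filterlim_ident)
  then have "filterlim (\<lambda>L. - \<alpha> * L) at_bot at_top" by (simp add: filterlim_uminus_at_bot)
  then have "((\<lambda>L. exp (- \<alpha> * L)) \<longlongrightarrow> 0) at_top" by (rule filterlim_compose[OF exp_at_bot])
  then have "((\<lambda>L. Q * exp (- \<alpha> * L)) \<longlongrightarrow> Q * 0) at_top" by (intro tendsto_intros)
  then have "\<forall>\<^sub>F L in at_top. Q * exp (- \<alpha> * L) < \<epsilon>" using assms by (intro order_tendstoD) auto
  then show ?thesis by eventually_elim simp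
qed

text \<open>\<open>c - d\<close> equals \<open>c * (1 - p * q)\<close>. Both factors of
  \<open>p * q\<close> have modulus at least 1/2, which bounds \<open>c\<close> by
  \<open>4 * cmod d\<close>; the other factor is at most \<open>2 * (a + b)\<close>.\<close>

lemma quotient_estimate:
  fixes c d p q :: complex
  assumes "c * (p * q) = d" "cmod (p - 1) \<le> a" "cmod (q - 1) \<le> b" "a \<le> 1 / 2" "b \<le> 1 / 2"
  shows "cmod (c - d) \<le> 8 * (a + b) * cmod d"
proof -
  have p: "1 / 2 \<le> cmod p" and q: "1 / 2 \<le> cmod q"
    using norm_triangle_ineq2[of 1 "1 - p"] norm_triangle_ineq2[of 1 "1 - q"] assms
    by (simp_all add: norm_minus_commute)
  have pq: "1 / 4 \<le> cmod (p * q)" using mult_mono[OF p q] by (simp add: norm_mult)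
  have nz: "p * q \<noteq> 0" using pq by auto
  have p2: "cmod p \<le> 2" using norm_triangle_sub[of p 1] assms by simp
  have "1 - p * q = (1 - p) + p * (1 - q)" by (simp add: algebra_simps)
  then have "cmod (1 - p * q) \<le> cmod (1 - p) + cmod p * cmod (1 - q)"
    by (metis norm_mult norm_triangle_ineq)
  also have "\<dots> \<le> a + 2 * b"
    using assms p2 by (intro add_mono mult_mono) (auto simp: norm_minus_commute)
  also have "\<dots> \<le> 2 * (a + b)" using order_trans[OF norm_ge_zero assms(2)] by simp
  finally have 1: "cmod (1 - p * q) \<le> 2 * (a + b)" .
  have ab: "a + b \<ge> 0" using order_trans[OF norm_ge_zero assms(2)] order_trans[OF norm_ge_zero assms(3)] by simp
  have "cmod (c - d) = cmod c * cmod (1 - p * q)"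
    unfolding norm_mult[symmetric] assms(1)[symmetric] by (simp add: algebra_simps)
  also have "\<dots> \<le> (4 * cmod d) * (2 * (a + b))"
  proof (rule mult_mono)
    have "cmod d = cmod c * cmod (p * q)" using assms(1) norm_mult by metis
    then show "cmod c \<le> 4 * cmod d" using mult_left_mono[OF pq norm_ge_zero[of c]] by simp
  qed (use 1 in auto)
  finally show ?thesis by (simp add: mult_ac)
qed

text \<open>Ordering by real part closes the index set of one half-plane downwards; with the number
  of eigenvalues known it is an initial segment.\<close>

lemma downward_closed_eq:
  assumes "S \<subseteq> {..<n}" "\<And>j k. k \<in> S \<Longrightarrow> j \<le> k \<Longrightarrow> j \<in> S" "card S = r"
  shows "S = {..<r::nat}"
proof -
  have fin: "finite S" using assms(1) finite_subset by blast
  have "S \<subseteq> {..<card S}"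
  proof
    fix k assume k: "k \<in> S"
    then have "{..k} \<subseteq> S" using assms(2) by auto
    then have "card {..k} \<le> card S" using fin by (intro card_mono)
    then show "k \<in> {..<card S}" by simp
  qed
  then show ?thesis using assms(3) by (intro card_subset_eq) auto
qed

text \<open>Compactness of the closure supplies the uniform constants of \<open>evans_point\<close>,
  which then applies at every parameter and every large \<open>L\<close>; the rate is that of the
  coefficient matrix.\<close>

theorem theorem1:
  fixes n r :: nat and \<Omega> :: "complex set"
    and A :: "real \<Rightarrow> complex \<Rightarrow> complex mat"
    and Ap Am :: "complex \<Rightarrow> complex mat"
    and nup num :: "complex \<Rightarrow> nat \<Rightarrow> complex"
    and Vp Wp Vm Wm :: "complex \<Rightarrow> nat \<Rightarrow> complex vec"
    and Zp Zm :: "complex \<Rightarrow> complex mat"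
    and Vpx Vmx :: "complex \<Rightarrow> nat \<Rightarrow> real \<Rightarrow> complex vec"
  \<comment> \<open>(H1)\<close>
  assumes Omega: "open \<Omega>" "bounded \<Omega>" "simply_connected \<Omega>"
    and A_dim: "\<And>x \<mu>. \<mu> \<in> closure \<Omega> \<Longrightarrow> A x \<mu> \<in> carrier_mat n n"
    and Apm_dim: "\<And>\<mu>. \<mu> \<in> closure \<Omega> \<Longrightarrow> Ap \<mu> \<in> carrier_mat n n \<and> Am \<mu> \<in> carrier_mat n n"
    and A_cont: "\<And>i j. i < n \<Longrightarrow> j < n \<Longrightarrow>
                   continuous_on (UNIV \<times> closure \<Omega>) (\<lambda>(x,\<mu>). A x \<mu> $$ (i,j))"
    and Apm_cont: "\<And>i j. i < n \<Longrightarrow> j < n \<Longrightarrow>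
                   continuous_on (closure \<Omega>) (\<lambda>\<mu>. Ap \<mu> $$ (i,j)) \<and> continuous_on (closure \<Omega>) (\<lambda>\<mu>. Am \<mu> $$ (i,j))"
    and A_an: "\<And>x i j. i < n \<Longrightarrow> j < n \<Longrightarrow> (\<lambda>\<mu>. A x \<mu> $$ (i,j)) analytic_on \<Omega>"
    and Apm_an: "\<And>i j. i < n \<Longrightarrow> j < n \<Longrightarrow>
                   (\<lambda>\<mu>. Ap \<mu> $$ (i,j)) analytic_on \<Omega> \<and> (\<lambda>\<mu>. Am \<mu> $$ (i,j)) analytic_on \<Omega>"
    and A_exp: "\<exists>K \<alpha>. K > 0 \<and> \<alpha> > 0 \<and> (\<forall>x \<mu> i j. \<mu> \<in> closure \<Omega> \<and> i < n \<and> j < n \<longrightarrow>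
                   (x \<ge> 0 \<longrightarrow> cmod (A x \<mu> $$ (i,j) - Ap \<mu> $$ (i,j)) \<le> K * exp (- \<alpha> * x)) \<and>
                   (x \<le> 0 \<longrightarrow> cmod (A x \<mu> $$ (i,j) - Am \<mu> $$ (i,j)) \<le> K * exp (\<alpha> * x)))"
    and hyp: "\<And>\<mu>. \<mu> \<in> closure \<Omega> \<Longrightarrow> hyperbolic (Ap \<mu>) \<and> hyperbolic (Am \<mu>)"
    and nstab: "\<And>\<mu>. \<mu> \<in> closure \<Omega> \<Longrightarrow> n_stable_eigs (Ap \<mu>) = r \<and> n_stable_eigs (Am \<mu>) = r"
  \<comment> \<open>(H2)\<close>
    and H2: "\<And>\<mu>. \<mu> \<in> closure \<Omega> \<Longrightarrow> simple_eigs (Ap \<mu>) \<and> simple_eigs (Am \<mu>)"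
  \<comment> \<open>eigenvalues and eigenvectors of A_+ (increasing real part) and A_- (decreasing real part)\<close>
    and nup_enum: "\<And>\<mu>. \<mu> \<in> closure \<Omega> \<Longrightarrow>
                     {k. eigenvalue (Ap \<mu>) k} = nup \<mu> ` {..<n} \<and> inj_on (nup \<mu>) {..<n}"
    and nup_ord: "\<And>\<mu> j k. \<mu> \<in> closure \<Omega> \<Longrightarrow> j \<le> k \<Longrightarrow> k < n \<Longrightarrow> Re (nup \<mu> j) \<le> Re (nup \<mu> k)"
    and num_enum: "\<And>\<mu>. \<mu> \<in> closure \<Omega> \<Longrightarrow>
                     {k. eigenvalue (Am \<mu>) k} = num \<mu> ` {..<n} \<and> inj_on (num \<mu>) {..<n}"
    and num_ord: "\<And>\<mu> j k. \<mu> \<in> closure \<Omega> \<Longrightarrow> j \<le> k \<Longrightarrow> k < n \<Longrightarrow> Re (num \<mu> k) \<le> Re (num \<mu> j)"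
    and nu_cont: "\<And>j. j < n \<Longrightarrow> continuous_on (closure \<Omega>) (\<lambda>\<mu>. nup \<mu> j) \<and> continuous_on (closure \<Omega>) (\<lambda>\<mu>. num \<mu> j)"
    and eigvecs: "\<And>\<mu> j. \<mu> \<in> closure \<Omega> \<Longrightarrow> j < n \<Longrightarrow>
                    eigenvector (Ap \<mu>) (Vp \<mu> j) (nup \<mu> j) \<and>
                    eigenvector (mat_adjoint (Ap \<mu>)) (Wp \<mu> j) (cnj (nup \<mu> j)) \<and>
                    eigenvector (Am \<mu>) (Vm \<mu> j) (num \<mu> j) \<and>
                    eigenvector (mat_adjoint (Am \<mu>)) (Wm \<mu> j) (cnj (num \<mu> j))"
    and eigvecs_cont: "\<And>i j. i < n \<Longrightarrow> j < n \<Longrightarrow>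
                    continuous_on (closure \<Omega>) (\<lambda>\<mu>. Vp \<mu> j $ i) \<and> continuous_on (closure \<Omega>) (\<lambda>\<mu>. Wp \<mu> j $ i) \<and>
                    continuous_on (closure \<Omega>) (\<lambda>\<mu>. Vm \<mu> j $ i) \<and> continuous_on (closure \<Omega>) (\<lambda>\<mu>. Wm \<mu> j $ i)"
  \<comment> \<open>analytic bases Z^+ of Rg P^s_+ and Z^- of Rg P^u_-\<close>
    and Zp_basis: "\<And>\<mu>. \<mu> \<in> closure \<Omega> \<Longrightarrow> cols_basis n r (Zp \<mu>) (mrange n (Ps (Ap \<mu>)))"
    and Zm_basis: "\<And>\<mu>. \<mu> \<in> closure \<Omega> \<Longrightarrow> cols_basis n (n - r) (Zm \<mu>) (mrange n (Pu (Am \<mu>)))"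
    and Zp_reg: "\<And>i j. i < n \<Longrightarrow> j < r \<Longrightarrow>
                   (\<lambda>\<mu>. Zp \<mu> $$ (i,j)) analytic_on \<Omega> \<and> continuous_on (closure \<Omega>) (\<lambda>\<mu>. Zp \<mu> $$ (i,j))"
    and Zm_reg: "\<And>i j. i < n \<Longrightarrow> j < n - r \<Longrightarrow>
                   (\<lambda>\<mu>. Zm \<mu> $$ (i,j)) analytic_on \<Omega> \<and> continuous_on (closure \<Omega>) (\<lambda>\<mu>. Zm \<mu> $$ (i,j))"
  \<comment> \<open>the solutions V^+_j(x,\<lambda>), x \<ge> 0, and V^-_j(x,\<lambda>), x \<le> 0\<close>
    and Vpx_sol: "\<And>\<mu> j. \<mu> \<in> closure \<Omega> \<Longrightarrow> j < r \<Longrightarrow>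
                    ode_sol n (\<lambda>x. A x \<mu> - nup \<mu> j \<cdot>\<^sub>m 1\<^sub>m n) {0..} (Vpx \<mu> j) \<and>
                    vec_lim n (Vpx \<mu> j) (Vp \<mu> j) at_top"
    and Vpx_cont: "\<And>j x i. j < r \<Longrightarrow> x \<ge> 0 \<Longrightarrow> i < n \<Longrightarrow>
                    continuous_on (closure \<Omega>) (\<lambda>\<mu>. Vpx \<mu> j x $ i)"
    and Vmx_sol: "\<And>\<mu> j. \<mu> \<in> closure \<Omega> \<Longrightarrow> j < n - r \<Longrightarrow>
                    ode_sol n (\<lambda>x. A x \<mu> - num \<mu> j \<cdot>\<^sub>m 1\<^sub>m n) {..0} (Vmx \<mu> j) \<and>
                    vec_lim n (Vmx \<mu> j) (Vm \<mu> j) at_bot"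
    and Vmx_cont: "\<And>j x i. j < n - r \<Longrightarrow> x \<le> 0 \<Longrightarrow> i < n \<Longrightarrow>
                    continuous_on (closure \<Omega>) (\<lambda>\<mu>. Vmx \<mu> j x $ i)"
  shows "\<exists>\<eta> C L0. \<eta> > 0 \<and> C > 0 \<and> L0 > 0 \<and>
    (\<forall>L\<ge>L0. \<exists>Sp Sm :: complex \<Rightarrow> nat \<Rightarrow> real \<Rightarrow> complex vec.
       (\<forall>\<mu>\<in>closure \<Omega>.
          (\<forall>j<r. bvp_plus n (\<lambda>x. A x \<mu>) (nup \<mu>) (Wp \<mu>) (Vp \<mu>) L (Sp \<mu>) j (Sp \<mu> j) \<and>
                 (\<forall>V. bvp_plus n (\<lambda>x. A x \<mu>) (nup \<mu>) (Wp \<mu>) (Vp \<mu>) L (Sp \<mu>) j V \<longrightarrow>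
                       (\<forall>x\<in>{0..L}. V x = Sp \<mu> j x))) \<and>
          (\<forall>j<n - r. bvp_minus n (\<lambda>x. A x \<mu>) (num \<mu>) (Wm \<mu>) (Vm \<mu>) L (Sm \<mu>) j (Sm \<mu> j) \<and>
                 (\<forall>V. bvp_minus n (\<lambda>x. A x \<mu>) (num \<mu>) (Wm \<mu>) (Vm \<mu>) L (Sm \<mu>) j V \<longrightarrow>
                       (\<forall>x\<in>{-L..0}. V x = Sm \<mu> j x))) \<and>
          (\<exists>!Cp. Cp \<in> carrier_mat r r \<and> mat_of_cols n (map (\<lambda>j. Sp \<mu> j L) [0..<r]) * Cp = Zp \<mu>) \<and>
          (\<exists>!Cm. Cm \<in> carrier_mat (n - r) (n - r) \<and>
                 mat_of_cols n (map (\<lambda>j. Sm \<mu> j (-L)) [0..<n - r]) * Cm = Zm \<mu>) \<and>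
          cmod (det_cols n r (\<lambda>j. Vmx \<mu> j 0) (\<lambda>j. Vpx \<mu> j 0)
                - det_cols n r (\<lambda>j. Sm \<mu> j 0) (\<lambda>j. Sp \<mu> j 0))
          + cmod (calC_L n r (\<lambda>x. A x \<mu>) (Ap \<mu>) (Am \<mu>) (Zp \<mu>) (Zm \<mu>) (Vpx \<mu>) (Vmx \<mu>) L
                - Determinant.det (coef_mat n (n - r) (\<lambda>j. Sm \<mu> j (-L)) (Zm \<mu>))
                  * Determinant.det (coef_mat n r (\<lambda>j. Sp \<mu> j L) (Zp \<mu>)))
            \<le> C * exp (- \<eta> * L) \<and>
          cmod (evans_L n r (\<lambda>x. A x \<mu>) (Ap \<mu>) (Am \<mu>) (Zp \<mu>) (Zm \<mu>) L
                - det_cols n r (\<lambda>j. Sm \<mu> j 0) (\<lambda>j. Sp \<mu> j 0)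
                  * (Determinant.det (coef_mat n (n - r) (\<lambda>j. Sm \<mu> j (-L)) (Zm \<mu>))
                     * Determinant.det (coef_mat n r (\<lambda>j. Sp \<mu> j L) (Zp \<mu>))))
            \<le> C * exp (- \<eta> * L)) \<and>
       (\<lambda>\<mu>. det_cols n r (\<lambda>j. Sm \<mu> j 0) (\<lambda>j. Sp \<mu> j 0)
             * (Determinant.det (coef_mat n (n - r) (\<lambda>j. Sm \<mu> j (-L)) (Zm \<mu>))
                * Determinant.det (coef_mat n r (\<lambda>j. Sp \<mu> j L) (Zp \<mu>)))) analytic_on \<Omega>)"
proof (cases "\<Omega> = {}")
  \<comment> \<open>That \<open>r \<le> n\<close> is obtained by counting eigenvalues at a point of
    the closure, so the empty domain is settled first.\<close>
  case True
  then show ?thesis by (intro exI[of _ 1]) (simp add: analytic_on_def)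
next
  case False
  let ?S = "closure \<Omega>"
  define m where "m = n - r"
  have S: "compact ?S" using Omega(2) by simp
  have \<Omega>S: "\<Omega> \<subseteq> ?S" by (rule closure_subset)
  have EP: "eigenbasis n (Ap \<mu>) (nup \<mu>) (Vp \<mu>) (Wp \<mu>)" if "\<mu> \<in> ?S" for \<mu>
    by unfold_locales (use that Apm_dim eigvecs nup_enum in auto)
  have EM: "eigenbasis n (Am \<mu>) (num \<mu>) (Vm \<mu>) (Wm \<mu>)" if "\<mu> \<in> ?S" for \<mu>
    by unfold_locales (use that Apm_dim eigvecs num_enum in auto)
  have nup_nz: "Re (nup \<mu> l) \<noteq> 0" and num_nz: "Re (num \<mu> l) \<noteq> 0" if "\<mu> \<in> ?S" "l < n" for \<mu> l
    using hyp[OF that(1)] eigvecs[OF that] by (auto simp: hyperbolic_def eigenvalue_def)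
  have Stp: "{l. l < n \<and> Re (nup \<mu> l) < 0} = {..<r}" if \<mu>: "\<mu> \<in> ?S" for \<mu>
  proof -
    interpret E: eigenbasis n "Ap \<mu>" "nup \<mu>" "Vp \<mu>" "Wp \<mu>" by (rule EP[OF \<mu>])
    have "card E.St = r" using E.n_stable_eigs_St nup_enum[OF \<mu>] H2[OF \<mu>] nstab[OF \<mu>] by simp
    then have "card {l. l < n \<and> Re (nup \<mu> l) < 0} = r" by (simp add: E.St_def)
    then show ?thesis
      by (intro downward_closed_eq[of _ n]) (use nup_ord[OF \<mu>] in \<open>auto intro: le_less_trans\<close>)
  qed
  have rn: "r \<le> n"
  proof -
    obtain \<mu> where "\<mu> \<in> ?S" using False \<Omega>S by blast
    have "{l. l < n \<and> Re (nup \<mu> l) < 0} \<subseteq> {..<n}" by blast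
    then show ?thesis unfolding Stp[OF \<open>\<mu> \<in> ?S\<close>] by simp
  qed
  have n: "n = m + r" using rn by (simp add: m_def)
  \<comment> \<open>\<open>num\<close> decreases in real part, so here the unstable indices form the
    initial segment.\<close>
  have Stm: "{l. l < n \<and> Re (num \<mu> l) \<ge> 0} = {..<m}" if \<mu>: "\<mu> \<in> ?S" for \<mu>
  proof -
    interpret E: eigenbasis n "Am \<mu>" "num \<mu>" "Vm \<mu>" "Wm \<mu>" by (rule EM[OF \<mu>])
    have "card E.St = r" using E.n_stable_eigs_St num_enum[OF \<mu>] H2[OF \<mu>] nstab[OF \<mu>] by simp
    moreover have "{l. l < n \<and> Re (num \<mu> l) \<ge> 0} = {..<n} - E.St" by (auto simp: E.St_def)
    ultimately have "card {l. l < n \<and> Re (num \<mu> l) \<ge> 0} = m"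
      using E.St finite_subset[OF E.St] by (simp add: card_Diff_subset m_def)
    then show ?thesis
      by (intro downward_closed_eq[of _ n]) (use num_ord[OF \<mu>] in \<open>auto intro: order_trans\<close>)
  qed
  have bounded: "\<exists>b. \<forall>\<mu>\<in>?S. \<forall>i<N. \<forall>k<N. cmod (f \<mu> i k) \<le> b"
    if "\<And>i k. i < N \<Longrightarrow> k < N \<Longrightarrow> continuous_on ?S (\<lambda>\<mu>. f \<mu> i k)"
    for f :: "complex \<Rightarrow> nat \<Rightarrow> nat \<Rightarrow> complex" and N
  proof (rule matrix_bounded[OF that S])
    fix a
    assume "\<And>\<mu> i k. \<mu> \<in> ?S \<Longrightarrow> i < N \<Longrightarrow> k < N \<Longrightarrow> cmod (f \<mu> i k) \<le> a"
    then show ?thesis by (intro exI[of _ a]) simp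
  qed
  let ?Vp = "\<lambda>\<mu> j. vec_index (Vp \<mu> j)" and ?Vm = "\<lambda>\<mu> j. vec_index (Vm \<mu> j)"
  have cVp: "continuous_on ?S (\<lambda>\<mu>. ?Vp \<mu> j i)" and cVm: "continuous_on ?S (\<lambda>\<mu>. ?Vm \<mu> j i)"
    if "i < n" "j < n" for i j
    using eigvecs_cont[OF that] by auto
  have Dp: "D n (?Vp \<mu>) \<noteq> 0" and Dm: "D n (?Vm \<mu>) \<noteq> 0" if "\<mu> \<in> ?S" for \<mu>
    using eigenbasis.detV[OF EP[OF that]] eigenbasis.detV[OF EM[OF that]] by auto
  have Zpc: "Zp \<mu> \<in> carrier_mat n r" and Zmc: "Zm \<mu> \<in> carrier_mat n m" if "\<mu> \<in> ?S" for \<mu>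
    using Zp_basis[OF that] Zm_basis[OF that] by (auto simp: cols_basis_def m_def)
  have colp: "vec_index (col (Zp \<mu>) j) i = Zp \<mu> $$ (i, j)" if "\<mu> \<in> ?S" "i < n" "j < r" for \<mu> i j
    using Zpc[OF that(1)] that by simp
  have colm: "vec_index (col (Zm \<mu>) j) i = Zm \<mu> $$ (i, j)" if "\<mu> \<in> ?S" "i < n" "j < m" for \<mu> i j
    using Zmc[OF that(1)] that by simp
  have ccp: "continuous_on ?S (\<lambda>\<mu>. vec_index (col (Zp \<mu>) j) i)" if "i < n" "j < r" for i j
    using Zp_reg[OF that] colp that by (simp cong: continuous_on_cong)
  have ccm: "continuous_on ?S (\<lambda>\<mu>. vec_index (col (Zm \<mu>) j) i)" if "i < n" "j < m" for i j
    using Zm_reg[OF that[unfolded m_def]] colm that by (simp cong: continuous_on_cong)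
  obtain b1 where b1: "\<forall>\<mu>\<in>?S. \<forall>l<n. \<forall>i<n. cmod (?Vp \<mu> l i) \<le> b1"
    using bounded[of n "\<lambda>\<mu> l i. ?Vp \<mu> l i"] cVp by blast
  obtain b2 where b2: "\<forall>\<mu>\<in>?S. \<forall>l<n. \<forall>i<n. cmod (?Vm \<mu> l i) \<le> b2"
    using bounded[of n "\<lambda>\<mu> l i. ?Vm \<mu> l i"] cVm by blast
  have "continuous_on ?S (\<lambda>\<mu>. 1 / D n (?Vp \<mu>))" "continuous_on ?S (\<lambda>\<mu>. 1 / D n (?Vm \<mu>))"
    using Dp Dm by (auto intro!: continuous_intros continuous_on_D cVp cVm)
  then obtain b3 b4 where b3: "\<forall>\<mu>\<in>?S. cmod (1 / D n (?Vp \<mu>)) \<le> b3" and b4: "\<forall>\<mu>\<in>?S. cmod (1 / D n (?Vm \<mu>)) \<le> b4"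
    using bounded[of 1 "\<lambda>\<mu> _ _. 1 / D n (?Vp \<mu>)"] bounded[of 1 "\<lambda>\<mu> _ _. 1 / D n (?Vm \<mu>)"] by auto
  have ccrdp: "continuous_on ?S (\<lambda>\<mu>. crd n (?Vp \<mu>) (u \<mu>) k)"
    if "k < n" "\<And>i. i < n \<Longrightarrow> continuous_on ?S (\<lambda>\<mu>. u \<mu> i)" for u k
    by (rule continuous_on_crd[where V = ?Vp, OF cVp Dp that(2) that(1)])
  have ccrdm: "continuous_on ?S (\<lambda>\<mu>. crd n (?Vm \<mu>) (u \<mu>) k)"
    if "k < n" "\<And>i. i < n \<Longrightarrow> continuous_on ?S (\<lambda>\<mu>. u \<mu> i)" for u k
    by (rule continuous_on_crd[where V = ?Vm, OF cVm Dm that(2) that(1)])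
  have cofp: "continuous_on ?S (\<lambda>\<mu>. minor_cofactor n (?Vp \<mu>) l i / D n (?Vp \<mu>))"
    and cofm: "continuous_on ?S (\<lambda>\<mu>. minor_cofactor n (?Vm \<mu>) l i / D n (?Vm \<mu>))" if "l < n" "i < n" for l i
    using continuous_on_cofactor[where V = ?Vp, OF cVp Dp that]
      continuous_on_cofactor[where V = ?Vm, OF cVm Dm that] by blast+
  have crdVm: "continuous_on ?S (\<lambda>\<mu>. crd n (?Vp \<mu>) (?Vm \<mu> l) k)" if "l < n" "k < n" for l k
    by (rule ccrdp[OF that(2) cVm[OF _ that(1)]])
  obtain b5 where b5: "\<forall>\<mu>\<in>?S. \<forall>l<n. \<forall>k<n. cmod (crd n (?Vp \<mu>) (?Vm \<mu> l) k) \<le> b5"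
    using bounded[of n "\<lambda>\<mu> l k. crd n (?Vp \<mu>) (?Vm \<mu> l) k"] crdVm by blast
  \<comment> \<open>Padded by 0 from \<open>m\<close> on, to fit the square index range of
    \<open>bounded\<close>.\<close>
  have "continuous_on ?S (\<lambda>\<mu>. if j < m then crd n (?Vp \<mu>) (vec_index (Vmx \<mu> j 0)) k else 0)" if "k < n" for j k
  proof (cases "j < m")
    case True
    then show ?thesis using ccrdp[OF that Vmx_cont[of j 0]] by (simp add: m_def)
  qed simp
  then obtain b6 where b6: "\<forall>\<mu>\<in>?S. \<forall>j<n. \<forall>k<n. cmod (if j < m then crd n (?Vp \<mu>) (vec_index (Vmx \<mu> j 0)) k else 0) \<le> b6"
    using bounded[of n "\<lambda>\<mu> j k. if j < m then crd n (?Vp \<mu>) (vec_index (Vmx \<mu> j 0)) k else 0"] by blast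
  obtain b7 where b7: "\<forall>\<mu>\<in>?S. \<forall>l<n. \<forall>i<n. cmod (minor_cofactor n (?Vp \<mu>) l i / D n (?Vp \<mu>)) \<le> b7"
    using bounded[of n "\<lambda>\<mu> l i. minor_cofactor n (?Vp \<mu>) l i / D n (?Vp \<mu>)"] cofp by blast
  obtain b8 where b8: "\<forall>\<mu>\<in>?S. \<forall>l<n. \<forall>i<n. cmod (minor_cofactor n (?Vm \<mu>) l i / D n (?Vm \<mu>)) \<le> b8"
    using bounded[of n "\<lambda>\<mu> l i. minor_cofactor n (?Vm \<mu>) l i / D n (?Vm \<mu>)"] cofm by blast
  have "continuous_on ?S (\<lambda>\<mu>. crd n (?Vp \<mu>) (vec_index (col (Zp \<mu>) j)) k)" if "j < r" "k < r" for j k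
    by (rule ccrdp) (use that rn ccp in auto)
  then obtain b9 where b9: "\<forall>\<mu>\<in>?S. \<forall>j<r. \<forall>k<r. cmod (crd n (?Vp \<mu>) (vec_index (col (Zp \<mu>) j)) k) \<le> b9"
    using bounded[of r "\<lambda>\<mu> j k. crd n (?Vp \<mu>) (vec_index (col (Zp \<mu>) j)) k"] by blast
  have "continuous_on ?S (\<lambda>\<mu>. crd n (?Vm \<mu>) (vec_index (col (Zm \<mu>) j)) k)" if "j < m" "k < m" for j k
    by (rule ccrdm) (use that n ccm in auto)
  then obtain b10 where b10: "\<forall>\<mu>\<in>?S. \<forall>j<m. \<forall>k<m. cmod (crd n (?Vm \<mu>) (vec_index (col (Zm \<mu>) j)) k) \<le> b10"
    using bounded[of m "\<lambda>\<mu> j k. crd n (?Vm \<mu>) (vec_index (col (Zm \<mu>) j)) k"] by blast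
  let ?X0 = "\<lambda>\<mu> j. if j < m then vec_index (Vmx \<mu> j 0) else vec_index (Vpx \<mu> (j - m) 0)"
  have "continuous_on ?S (\<lambda>\<mu>. ?X0 \<mu> j i)" if "j < n" "i < n" for j i
  proof (cases "j < m")
    case True
    then show ?thesis using Vmx_cont[of j 0 i] that(2) by (simp add: m_def)
  next
    case False
    then have "j - m < r" using that(1) n by linarith
    then show ?thesis using Vpx_cont[of "j - m" 0 i] that(2) False by simp
  qed
  then obtain b11 where b11: "\<forall>\<mu>\<in>?S. \<forall>j<n. \<forall>i<n. cmod (?X0 \<mu> j i) \<le> b11"
    using bounded[of n ?X0] by blast
  \<comment> \<open>The entry 1 makes the powers of \<open>B\<close> monotone in the
    exponent.\<close>
  define B where "B = Max {1, b1, b2, b3, b4, b5, b6, b7, b8, b9, b10, b11}"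
  have B: "1 \<le> B" "b1 \<le> B" "b2 \<le> B" "b3 \<le> B" "b4 \<le> B" "b5 \<le> B" "b6 \<le> B" "b7 \<le> B" "b8 \<le> B" "b9 \<le> B" "b10 \<le> B" "b11 \<le> B"
    unfolding B_def by (rule Max_ge; simp)+
  \<comment> \<open>The real parts are continuous without zeros on a compact set, so their
    reciprocals are bounded; this yields the gap.\<close>
  have "continuous_on ?S (\<lambda>\<mu>. complex_of_real (1 / Re (nup \<mu> l)))" "continuous_on ?S (\<lambda>\<mu>. complex_of_real (1 / Re (num \<mu> l)))"
    if "l < n" for l
    using nu_cont[OF that] nup_nz num_nz that by (auto intro!: continuous_intros)
  then obtain a1 a2 where a1: "\<forall>\<mu>\<in>?S. \<forall>l<n. \<forall>k<n. cmod (complex_of_real (1 / Re (nup \<mu> l))) \<le> a1"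
    and a2: "\<forall>\<mu>\<in>?S. \<forall>l<n. \<forall>k<n. cmod (complex_of_real (1 / Re (num \<mu> l))) \<le> a2"
    using bounded[of n "\<lambda>\<mu> l _. complex_of_real (1 / Re (nup \<mu> l))"]
      bounded[of n "\<lambda>\<mu> l _. complex_of_real (1 / Re (num \<mu> l))"] by blast
  \<comment> \<open>The 1 and the absolute values keep the denominator positive also for
    \<open>n = 0\<close>, when \<open>a1\<close> and \<open>a2\<close> are arbitrary.\<close>
  define \<delta> where "\<delta> = 1 / (1 + \<bar>a1\<bar> + \<bar>a2\<bar>)"
  have \<delta>: "\<delta> > 0" by (simp add: \<delta>_def add_pos_nonneg)
  have gap: "\<delta> \<le> \<bar>x\<bar>" if "x \<noteq> 0" "cmod (complex_of_real (1 / x)) \<le> a1 \<or> cmod (complex_of_real (1 / x)) \<le> a2" for x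
  proof -
    have "1 / \<bar>x\<bar> \<le> 1 + \<bar>a1\<bar> + \<bar>a2\<bar>" using that(2) by (auto simp: norm_divide)
    then have "1 \<le> (1 + \<bar>a1\<bar> + \<bar>a2\<bar>) * \<bar>x\<bar>" using that(1) by (simp add: pos_divide_le_eq)
    then show ?thesis unfolding \<delta>_def by (simp add: pos_divide_le_eq add_pos_nonneg mult.commute)
  qed
  have gapp: "\<delta> \<le> \<bar>Re (nup \<mu> l)\<bar>" and gapm: "\<delta> \<le> \<bar>Re (num \<mu> l)\<bar>" if "\<mu> \<in> ?S" "l < n" for \<mu> l
    using gap[OF nup_nz[OF that]] gap[OF num_nz[OF that]] a1 a2 that by blast+
  obtain K0 \<alpha> where K0: "K0 > 0" and \<alpha>: "\<alpha> > 0" and exp_p: "\<And>x \<mu> i j. \<mu> \<in> ?S \<Longrightarrow> i < n \<Longrightarrow> j < n \<Longrightarrow> x \<ge> 0 \<Longrightarrow>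
      cmod (A x \<mu> $$ (i,j) - Ap \<mu> $$ (i,j)) \<le> K0 * exp (- \<alpha> * x)"
    and exp_m: "\<And>x \<mu> i j. \<mu> \<in> ?S \<Longrightarrow> i < n \<Longrightarrow> j < n \<Longrightarrow> x \<le> 0 \<Longrightarrow>
      cmod (A x \<mu> $$ (i,j) - Am \<mu> $$ (i,j)) \<le> K0 * exp (\<alpha> * x)"
    using A_exp by blast
  \<comment> \<open>The factor of \<open>crd_mv_bound\<close> with \<open>B\<close> as bound for
    cofactors and eigenvectors.\<close>
  define K where "K = real n * B * (real n * B) * K0"
  have K: "K \<ge> 0" using K0 B(1) by (simp add: K_def)
  define Rm where "Rm = rate_const n m K \<alpha> B"
  define Rr where "Rr = rate_const n r K \<alpha> B"
  have "\<forall>\<^sub>F L in at_top. (real n * K) * exp (- \<alpha> * L) \<le> \<delta> \<and> Rm * exp (- \<alpha> * L) \<le> 1 / 2 \<and> Rr * exp (- \<alpha> * L) \<le> 1 / 2"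
    by (intro eventually_conj exp_decay_eventually \<alpha> \<delta>) simp_all
  then obtain L1 where L1: "\<And>L. L \<ge> L1 \<Longrightarrow> (real n * K) * exp (- \<alpha> * L) \<le> \<delta> \<and> Rm * exp (- \<alpha> * L) \<le> 1 / 2 \<and> Rr * exp (- \<alpha> * L) \<le> 1 / 2"
    unfolding eventually_at_top_linorder by blast
  \<comment> \<open>\<open>L1\<close> collects the smallness conditions of
    \<open>evans_point\<close>, whose constants do not contain the parameter; the 1 makes
    \<open>L0\<close> positive.\<close>
  define L0 where "L0 = max L1 1"
  have A_cont1: "continuous_on UNIV (\<lambda>x. mf (A x \<mu>) i k)" if "\<mu> \<in> ?S" "i < n" "k < n" for \<mu> i k
  proof -
    have c: "continuous_on UNIV (\<lambda>x::real. (x, \<mu>))" by (intro continuous_intros)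
    have s: "range (\<lambda>x::real. (x, \<mu>)) \<subseteq> UNIV \<times> ?S" using that(1) by auto
    show ?thesis
      using continuous_on_compose2[OF A_cont[OF that(2,3)] c s] by (simp add: mf_def)
  qed
  have point: "evans_point n (Ap \<mu>) (Am \<mu>) (nup \<mu>) (num \<mu>) (Vp \<mu>) (Wp \<mu>) (Vm \<mu>) (Wm \<mu>) m r (\<lambda>x. A x \<mu>)
      (Zp \<mu>) (Zm \<mu>) (Vpx \<mu>) (Vmx \<mu>) K \<alpha> \<delta> B L" if \<mu>: "\<mu> \<in> ?S" and L: "L \<ge> L0" for \<mu> L
  proof -
    interpret P: eigenbasis n "Ap \<mu>" "nup \<mu>" "Vp \<mu>" "Wp \<mu>" by (rule EP[OF \<mu>])
    interpret M: eigenbasis n "Am \<mu>" "num \<mu>" "Vm \<mu>" "Wm \<mu>" by (rule EM[OF \<mu>])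
    have L': "L \<ge> L1" "L \<ge> 0" using L by (auto simp: L0_def)
    show ?thesis
    proof
      show "n = m + r" by (rule n)
      show "A x \<mu> \<in> carrier_mat n n" for x by (rule A_dim[OF \<mu>])
      show "continuous_on UNIV (\<lambda>x. mf (A x \<mu>) i k)" if "i < n" "k < n" for i k by (rule A_cont1[OF \<mu> that])
      show "0 \<le> K" "0 < \<alpha>" "0 < \<delta>" "1 \<le> B" "0 \<le> L" by (rule K, rule \<alpha>, rule \<delta>, rule B(1), rule L'(2))
      show "Re (nup \<mu> l) \<le> - \<delta>" if "l < r" for l
      proof -
        have "l \<in> {l. l < n \<and> Re (nup \<mu> l) < 0}" using that unfolding Stp[OF \<mu>] by simp
        then show ?thesis using gapp[OF \<mu>, of l] by simp
      qed
      show "\<delta> \<le> Re (nup \<mu> l)" if "r \<le> l" "l < n" for l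
      proof -
        have "l \<notin> {l. l < n \<and> Re (nup \<mu> l) < 0}" using that unfolding Stp[OF \<mu>] by simp
        then show ?thesis using gapp[OF \<mu> that(2)] that by simp
      qed
      show "\<delta> \<le> Re (num \<mu> l)" if "l < m" for l
      proof -
        have "l \<in> {l. l < n \<and> Re (num \<mu> l) \<ge> 0}" using that unfolding Stm[OF \<mu>] by simp
        then show ?thesis using gapm[OF \<mu>, of l] by simp
      qed
      show "Re (num \<mu> l) \<le> - \<delta>" if "m \<le> l" "l < n" for l
      proof -
        have "l \<notin> {l. l < n \<and> Re (num \<mu> l) \<ge> 0}" using that unfolding Stm[OF \<mu>] by simp
        then show ?thesis using gapm[OF \<mu> that(2)] that by simp
      qed
      fix x :: real and k l assume kl: "k < n" "l < n"
      have b: "cmod (minor_cofactor n P.Vf l i / D n P.Vf) \<le> B" "cmod (minor_cofactor n M.Vf l i / D n M.Vf) \<le> B"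
        "cmod (P.Vf l i) \<le> B" "cmod (M.Vf l i) \<le> B" if "l < n" "i < n" for l i
        using b1 b2 b7 b8 B \<mu> that by (meson order_trans)+
      show "cmod (crd n P.Vf (mv n (\<lambda>i k. mf (A x \<mu>) i k - mf (Ap \<mu>) i k) (P.Vf l)) k) \<le> K * exp (- \<alpha> * x)" if "0 \<le> x"
        using crd_mv_bound[OF b(1) b(3)[OF kl(2)] exp_p[OF \<mu> _ _ that] kl(1)]
        by (simp add: mf_def K_def mult.assoc)
      show "cmod (crd n M.Vf (mv n (\<lambda>i k. mf (A x \<mu>) i k - mf (Am \<mu>) i k) (M.Vf l)) k) \<le> K * exp (\<alpha> * x)" if "x \<le> 0"
        using crd_mv_bound[OF b(2) b(4)[OF kl(2)] exp_m[OF \<mu> _ _ that] kl(1)]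
        by (simp add: mf_def K_def mult.assoc)
    next
      show "cols_basis n r (Zp \<mu>) (mrange n (Ps (Ap \<mu>)))" by (rule Zp_basis[OF \<mu>])
      show "cols_basis n m (Zm \<mu>) (mrange n (Pu (Am \<mu>)))" unfolding m_def by (rule Zm_basis[OF \<mu>])
      show "ode_sol n (\<lambda>x. A x \<mu> - nup \<mu> j \<cdot>\<^sub>m 1\<^sub>m n) {0..} (Vpx \<mu> j) \<and> vec_lim n (Vpx \<mu> j) (Vp \<mu> j) at_top"
        if "j < r" for j by (rule Vpx_sol[OF \<mu> that])
      show "ode_sol n (\<lambda>x. A x \<mu> - num \<mu> j \<cdot>\<^sub>m 1\<^sub>m n) {..0} (Vmx \<mu> j) \<and> vec_lim n (Vmx \<mu> j) (Vm \<mu> j) at_bot"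
        if "j < m" for j by (rule Vmx_sol[OF \<mu> that[unfolded m_def]])
      show "cmod (P.Vf l i) \<le> B" if "l < n" "i < n" for l i using b1 B(2) \<mu> that by (meson order_trans)
      show "cmod (M.Vf l i) \<le> B" if "l < n" "i < n" for l i using b2 B(3) \<mu> that by (meson order_trans)
      show "cmod (1 / D n P.Vf) \<le> B" using b3 B(4) \<mu> by (meson order_trans)
      show "cmod (1 / D n M.Vf) \<le> B" using b4 B(5) \<mu> by (meson order_trans)
      show "cmod (crd n P.Vf (M.Vf l) k) \<le> B" if "l < n" "k < n" for l k using b5 B(6) \<mu> that by (meson order_trans)
      show "cmod (crd n P.Vf (vec_index (Vmx \<mu> j 0)) k) \<le> B" if "j < m" "k < n" for j k
      proof -
        have "j < n" using that n by simp
        then have "cmod (if j < m then crd n P.Vf (vec_index (Vmx \<mu> j 0)) k else 0) \<le> b6" using b6 \<mu> that by blast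
        then show ?thesis using that B(7) by simp
      qed
      show "real n * (K * exp (- \<alpha> * L)) \<le> \<delta>" "rate_const n m K \<alpha> B * exp (- \<alpha> * L) \<le> 1 / 2"
        "rate_const n r K \<alpha> B * exp (- \<alpha> * L) \<le> 1 / 2"
        using L1[OF L'(1)] by (auto simp: Rm_def Rr_def mult.assoc)
    qed
  qed
  define Cd where "Cd = \<bar>diff_const n m r K \<alpha> B\<bar>"
  define b where "b = fact n * B ^ n"
  define CC where "CC = 8 * (\<bar>Rm\<bar> + \<bar>Rr\<bar>) * (b * b)"
  \<comment> \<open>Sum of the constants of all estimates, with 1 for strict positivity.\<close>
  define C where "C = 1 + Cd + CC + b * CC + Cd * (b * b)"
  have b: "b \<ge> 0" using B(1) by (simp add: b_def)
  have CC: "CC \<ge> 0" "Cd \<ge> 0" using b by (auto simp: CC_def Cd_def)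
  have C: "C > 0" "Cd + CC \<le> C" "b * CC + Cd * (b * b) \<le> C"
    using b CC by (auto simp: C_def intro!: add_pos_nonneg)
  have power_le: "fact k * B ^ k \<le> b" if "k \<le> n" for k
    unfolding b_def using that B(1) by (intro mult_mono power_increasing fact_mono) auto
  \<comment> \<open>The witnesses must be functions of the parameter, so they are written outside
    the locale of a fixed one.\<close>
  define Sp where "Sp = (\<lambda>L \<mu> j x. Matrix.vec n (bvp.S n (?Vp \<mu>) (nup \<mu>) (\<lambda>x. mf (A x \<mu>)) L j x))"
  define Sm where "Sm = (\<lambda>L \<mu> j x. Matrix.vec n (bvp.S n (?Vm \<mu>) (\<lambda>l. - num \<mu> l) (\<lambda>x i k. - mf (A (- x) \<mu>) i k) L j (- x)))"
  have main: "(\<forall>j<r. bvp_plus n (\<lambda>x. A x \<mu>) (nup \<mu>) (Wp \<mu>) (Vp \<mu>) L (Sp L \<mu>) j (Sp L \<mu> j) \<and>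
                 (\<forall>V. bvp_plus n (\<lambda>x. A x \<mu>) (nup \<mu>) (Wp \<mu>) (Vp \<mu>) L (Sp L \<mu>) j V \<longrightarrow>
                       (\<forall>x\<in>{0..L}. V x = Sp L \<mu> j x))) \<and>
          (\<forall>j<n - r. bvp_minus n (\<lambda>x. A x \<mu>) (num \<mu>) (Wm \<mu>) (Vm \<mu>) L (Sm L \<mu>) j (Sm L \<mu> j) \<and>
                 (\<forall>V. bvp_minus n (\<lambda>x. A x \<mu>) (num \<mu>) (Wm \<mu>) (Vm \<mu>) L (Sm L \<mu>) j V \<longrightarrow>
                       (\<forall>x\<in>{-L..0}. V x = Sm L \<mu> j x))) \<and>
          (\<exists>!Cp. Cp \<in> carrier_mat r r \<and> mat_of_cols n (map (\<lambda>j. Sp L \<mu> j L) [0..<r]) * Cp = Zp \<mu>) \<and>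
          (\<exists>!Cm. Cm \<in> carrier_mat (n - r) (n - r) \<and>
                 mat_of_cols n (map (\<lambda>j. Sm L \<mu> j (-L)) [0..<n - r]) * Cm = Zm \<mu>) \<and>
          cmod (det_cols n r (\<lambda>j. Vmx \<mu> j 0) (\<lambda>j. Vpx \<mu> j 0)
                - det_cols n r (\<lambda>j. Sm L \<mu> j 0) (\<lambda>j. Sp L \<mu> j 0))
          + cmod (calC_L n r (\<lambda>x. A x \<mu>) (Ap \<mu>) (Am \<mu>) (Zp \<mu>) (Zm \<mu>) (Vpx \<mu>) (Vmx \<mu>) L
                - Determinant.det (coef_mat n (n - r) (\<lambda>j. Sm L \<mu> j (-L)) (Zm \<mu>))
                  * Determinant.det (coef_mat n r (\<lambda>j. Sp L \<mu> j L) (Zp \<mu>)))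
            \<le> C * exp (- \<alpha> * L) \<and>
          cmod (evans_L n r (\<lambda>x. A x \<mu>) (Ap \<mu>) (Am \<mu>) (Zp \<mu>) (Zm \<mu>) L
                - det_cols n r (\<lambda>j. Sm L \<mu> j 0) (\<lambda>j. Sp L \<mu> j 0)
                  * (Determinant.det (coef_mat n (n - r) (\<lambda>j. Sm L \<mu> j (-L)) (Zm \<mu>))
                     * Determinant.det (coef_mat n r (\<lambda>j. Sp L \<mu> j L) (Zp \<mu>))))
            \<le> C * exp (- \<alpha> * L)"
      (is "?estimates \<mu> L")
    and flow: "det_cols n r (\<lambda>j. Sm L \<mu> j 0) (\<lambda>j. Sp L \<mu> j 0)
             * (Determinant.det (coef_mat n (n - r) (\<lambda>j. Sm L \<mu> j (-L)) (Zm \<mu>))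
                * Determinant.det (coef_mat n r (\<lambda>j. Sp L \<mu> j L) (Zp \<mu>)))
        = exp (of_real L * ((\<Sum>k<r. nup \<mu> k) - (\<Sum>k<m. num \<mu> k))) *
          D n (\<lambda>j. if j < m then phi n (\<lambda>x. mf (A x \<mu>)) (- L) (vec_index (col (Zm \<mu>) j)) 0
                    else phi n (\<lambda>x. mf (A x \<mu>)) L (vec_index (col (Zp \<mu>) (j - m))) 0)"
      (is "?Etilde \<mu> L = ?flow \<mu> L")
    if \<mu>: "\<mu> \<in> ?S" and L: "L \<ge> L0" for \<mu> L
  proof -
    interpret E: evans_point n "Ap \<mu>" "Am \<mu>" "nup \<mu>" "num \<mu>" "Vp \<mu>" "Wp \<mu>" "Vm \<mu>" "Wm \<mu>" m r "\<lambda>x. A x \<mu>"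
      "Zp \<mu>" "Zm \<mu>" "Vpx \<mu>" "Vmx \<mu>" K \<alpha> \<delta> B L
      by (rule point[OF \<mu> L])
    have SpE: "Sp L \<mu> = E.Sp" by (intro ext) (simp add: Sp_def E.Sp_def)
    have SmE: "Sm L \<mu> = E.Sm" by (intro ext) (simp add: Sm_def E.Sm_def)
    let ?e = "exp (- \<alpha> * L)"
    have e: "?e \<ge> 0" by simp
    have dzp: "cmod E.dzp \<le> b"
      unfolding E.dzp_def
      by (rule order_trans[OF D_bound power_le[OF rn]]) (use b9 B(10) \<mu> in \<open>meson order_trans\<close>)
    have dzm: "cmod E.dzm \<le> b"
      unfolding E.dzm_def
      by (rule order_trans[OF D_bound power_le[OF E.m_le]]) (use b10 B(11) \<mu> in \<open>meson order_trans\<close>)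
    have dd: "cmod (E.dzm * E.dzp) \<le> b * b"
      unfolding norm_mult using dzp dzm b by (intro mult_mono) auto
    have Ee: "cmod E.Eexact \<le> b"
      unfolding E.Eexact_def det_cols_D[OF rn] m_def[symmetric] b_def
      by (rule D_bound) (use b11 B(12) \<mu> in \<open>meson order_trans\<close>)
    have d1: "cmod (E.Eexact - E.Etilde) \<le> Cd * ?e"
      unfolding Cd_def by (rule order_trans[OF E.Eexact_Etilde mult_right_mono[OF abs_ge_self e]])
    have d2: "cmod (E.calC - E.dzm * E.dzp) \<le> CC * ?e"
    proof -
      have "cmod (E.calC - E.dzp * E.dzm) \<le> 8 * (Rm * ?e + Rr * ?e) * cmod (E.dzp * E.dzm)"
        unfolding Rm_def Rr_def
        by (rule quotient_estimate) (use E.calC_EL E.mp_rate E.mm_rate E.L in auto)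
      also have "\<dots> \<le> (8 * (\<bar>Rm\<bar> + \<bar>Rr\<bar>) * ?e) * (b * b)"
      proof (rule mult_mono)
        have h: "Rm * ?e + Rr * ?e \<le> (\<bar>Rm\<bar> + \<bar>Rr\<bar>) * ?e"
          unfolding distrib_right by (intro add_mono mult_right_mono) auto
        show "8 * (Rm * ?e + Rr * ?e) \<le> 8 * (\<bar>Rm\<bar> + \<bar>Rr\<bar>) * ?e"
          unfolding mult.assoc[of 8] by (rule mult_left_mono[OF h]) simp
        show "cmod (E.dzp * E.dzm) \<le> b * b" using dd by (simp add: mult.commute)
      qed auto
      finally show ?thesis by (simp add: CC_def mult_ac)
    qed
    have d3: "cmod (E.EL - E.Etilde * (E.dzm * E.dzp)) \<le> (b * CC + Cd * (b * b)) * ?e"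
    proof -
      \<comment> \<open>Difference of two products: the exact determinant is bounded by
        \<open>b\<close>, the numerical coefficient by \<open>b * b\<close>.\<close>
      have "E.EL - E.Etilde * (E.dzm * E.dzp)
          = E.Eexact * (E.calC - E.dzm * E.dzp) + (E.Eexact - E.Etilde) * (E.dzm * E.dzp)"
        using E.calC_EL by (simp add: algebra_simps)
      also have "cmod \<dots> \<le> b * (CC * ?e) + (Cd * ?e) * (b * b)"
        using Ee d1 d2 dd b CC
        by (intro order_trans[OF norm_triangle_ineq] add_mono) (auto simp only: norm_mult norm_ge_zero exp_ge_zero intro!: mult_mono mult_nonneg_nonneg)
      finally show ?thesis by (simp add: algebra_simps)
    qed
    have "cmod (E.Eexact - E.Etilde) + cmod (E.calC - E.dzm * E.dzp) \<le> C * ?e"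
      using d1 d2 mult_right_mono[OF C(2) e] unfolding distrib_right by linarith
    moreover have "cmod (E.EL - E.Etilde * (E.dzm * E.dzp)) \<le> C * ?e"
      using d3 mult_right_mono[OF C(3) e] by linarith
    ultimately show "?estimates \<mu> L"
      unfolding SpE SmE m_def[symmetric] E.coefficients_plus(2) E.coefficients_minus(2)
        E.Etilde_def[symmetric] E.Eexact_def[symmetric] E.calC_def[symmetric] E.EL_def[symmetric]
      using E.bvp_plus_Sp E.bvp_minus_Sm E.coefficients_plus(1) E.coefficients_minus(1) by blast
    show "?Etilde \<mu> L = ?flow \<mu> L"
      unfolding SpE SmE m_def[symmetric] E.coefficients_plus(2) E.coefficients_minus(2)
        E.Etilde_def[symmetric] by (rule E.Etilde_flow)
  qed
  \<comment> \<open>The right-hand side of \<open>flow\<close> is holomorphic for every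
    \<open>L\<close>; for \<open>L \<ge> L0\<close> it coincides with the numerical Evans
    function.\<close>
  have holo: "(\<lambda>\<mu>. exp (of_real L * ((\<Sum>k<r. nup \<mu> k) - (\<Sum>k<m. num \<mu> k))) *
          D n (\<lambda>j. if j < m then phi n (\<lambda>x. mf (A x \<mu>)) (- L) (vec_index (col (Zm \<mu>) j)) 0
                    else phi n (\<lambda>x. mf (A x \<mu>)) L (vec_index (col (Zp \<mu>) (j - m))) 0)) holomorphic_on \<Omega>" for L
  proof -
    have nup_h: "(\<lambda>\<mu>. nup \<mu> j) holomorphic_on \<Omega>" if "j < n" for j
    proof (rule eigenvalue_holomorphic[OF Omega(1) EP _ _ that])
      show "(\<lambda>z. mf (Ap z) i k) holomorphic_on \<Omega>" if "i < n" "k < n" for i k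
        using Apm_an[OF that] by (simp add: mf_def analytic_imp_holomorphic)
      show "continuous_on \<Omega> (\<lambda>z. vec_index (Vp z j) i)" if "i < n" "j < n" for i j
        by (rule continuous_on_subset[OF cVp[OF that] \<Omega>S])
    qed (use \<Omega>S in auto)
    have num_h: "(\<lambda>\<mu>. num \<mu> j) holomorphic_on \<Omega>" if "j < n" for j
    proof (rule eigenvalue_holomorphic[OF Omega(1) EM _ _ that])
      show "(\<lambda>z. mf (Am z) i k) holomorphic_on \<Omega>" if "i < n" "k < n" for i k
        using Apm_an[OF that] by (simp add: mf_def analytic_imp_holomorphic)
      show "continuous_on \<Omega> (\<lambda>z. vec_index (Vm z j) i)" if "i < n" "j < n" for i j
        by (rule continuous_on_subset[OF cVm[OF that] \<Omega>S])
    qed (use \<Omega>S in auto)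
    have phi_h: "(\<lambda>\<mu>. phi n (\<lambda>x. mf (A x \<mu>)) s (v \<mu>) 0 i) holomorphic_on \<Omega>"
      if "i < n" "\<And>i. i < n \<Longrightarrow> (\<lambda>\<mu>. v \<mu> i) holomorphic_on \<Omega>" for i s v
    proof (rule phi_holomorphic[OF Omega(1) _ _ that(2) that(1), where A = "\<lambda>\<mu> x. mf (A x \<mu>)"])
      show "continuous_on (UNIV \<times> \<Omega>) (\<lambda>(x, z). mf (A x z) i k)" if "i < n" "k < n" for i k
        unfolding mf_def by (rule continuous_on_subset[OF A_cont[OF that]]) (use \<Omega>S in auto)
      show "(\<lambda>z. mf (A x z) i k) holomorphic_on \<Omega>" if "i < n" "k < n" for i k x
        using A_an[OF that] by (simp add: mf_def analytic_imp_holomorphic)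
    qed auto
    have Zp_h: "(\<lambda>\<mu>. vec_index (col (Zp \<mu>) j) i) holomorphic_on \<Omega>" if "i < n" "j < r" for i j
    proof (rule holomorphic_transform)
      show "(\<lambda>\<mu>. Zp \<mu> $$ (i, j)) holomorphic_on \<Omega>" using Zp_reg[OF that] by (simp add: analytic_imp_holomorphic)
    qed (use colp that \<Omega>S in \<open>simp add: subset_iff\<close>)
    have Zm_h: "(\<lambda>\<mu>. vec_index (col (Zm \<mu>) j) i) holomorphic_on \<Omega>" if "i < n" "j < m" for i j
    proof (rule holomorphic_transform)
      show "(\<lambda>\<mu>. Zm \<mu> $$ (i, j)) holomorphic_on \<Omega>"
        using Zm_reg[OF that[unfolded m_def]] by (simp add: analytic_imp_holomorphic)
    qed (use colm that \<Omega>S in \<open>simp add: subset_iff\<close>)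
    show ?thesis
    proof (intro holomorphic_on_mult holomorphic_on_D)
      show "(\<lambda>\<mu>. exp (of_real L * ((\<Sum>k<r. nup \<mu> k) - (\<Sum>k<m. num \<mu> k)))) holomorphic_on \<Omega>"
        using nup_h num_h n by (intro holomorphic_intros) auto
      fix i j assume ij: "i < n" "j < n"
      show "(\<lambda>\<mu>. (if j < m then phi n (\<lambda>x. mf (A x \<mu>)) (- L) (vec_index (col (Zm \<mu>) j)) 0
          else phi n (\<lambda>x. mf (A x \<mu>)) L (vec_index (col (Zp \<mu>) (j - m))) 0) i) holomorphic_on \<Omega>"
      proof (cases "j < m")
        case True
        then show ?thesis using phi_h[OF ij(1) Zm_h] by simp
      next
        case False
        then have "j - m < r" using ij n by simp
        then show ?thesis using phi_h[OF ij(1) Zp_h] False by simp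
      qed
    qed
  qed
  have analytic: "(\<lambda>\<mu>. det_cols n r (\<lambda>j. Sm L \<mu> j 0) (\<lambda>j. Sp L \<mu> j 0)
             * (Determinant.det (coef_mat n (n - r) (\<lambda>j. Sm L \<mu> j (-L)) (Zm \<mu>))
                * Determinant.det (coef_mat n r (\<lambda>j. Sp L \<mu> j L) (Zp \<mu>)))) analytic_on \<Omega>" if L: "L \<ge> L0" for L
    unfolding analytic_on_open[OF Omega(1)]
    by (rule holomorphic_transform[OF holo[of L]]) (use flow[OF _ L] \<Omega>S in auto)
  show ?thesis
    by (rule exI[of _ \<alpha>], rule exI[of _ C], rule exI[of _ L0], intro conjI allI impI,
        rule \<alpha>, rule C(1), simp add: L0_def,
        rule exI[where x = "Sp L" for L], rule exI[where x = "Sm L" for L],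
        rule conjI, rule ballI, erule main, assumption, erule analytic)
qed

end
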